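(* Fix $\lambda>0$ and start the $\mathrm{ATLAS}_\infty$ evolution at $\underline X(0)$ distributed according to $\mathrm{PPP}_+(\lambda)$. Let $\kappa\in\mathbb R$ be the unique solution of $$g(\kappa):=\frac{\kappa\,(1-\Phi(\kappa))}{\Phi'(\kappa)}=1-\frac{\lambda}{2},$$ where $\Phi$ is the standard normal cumulative distribution function, and set $$c_1:=\frac{2-\lambda\Phi(\kappa)}{1-\Phi(\kappa)},\qquad c_2:=\frac{\lambda-2}{1-\Phi(\kappa)},\qquad y_\star(t):=\kappa\sqrt t\quad (t\ge 0),$$ $$u_\star(t,x):=\big[c_1+c_2\Phi(x/\sqrt t)\big]\mathbf 1_{\{x>y_\star(t)\}}\quad (t>0),\qquad u_\star(0,x):=\lambda\mathbf 1_{\{x>0\}}.$$ Then, as $b\to0$, the $\mathfrak C$-valued measure-valued processes $(Q^b(t,\cdot))_{t\ge0}$ converge in probability, in $(\mathfrak C,\mathfrak d)$, to the non-random limit $Q_\star$ for which, for each $t\ge 0$, the measure $Q_\star(t,\cdot)$ is absolutely continuous with density $u_\star(t,\cdot)$ with respect to Lebesgue measure. Further, the re-scaled left-most particle $Y^b_1(t):=\min_{i\ge1}X^b_i(t)$ converges in probability, as $b\to 0$, to $y_\star(\cdot)$, uniformly over compact subsets of $\mathbb R_+$.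
   Context: $\mathrm{PPP}_+(\lambda)$: the law of the points, listed in increasing order $X_1(0)\le X_2(0)\le\dots$, of a Poisson point process on $\mathbb R_+=[0,\infty)$ of constant intensity $\lambda$ (so the spacings $X_{i+1}(0)-X_i(0)$, $i\ge1$, are i.i.d. exponential of rate $\lambda$). $\mathrm{ATLAS}_\infty$: the infinite particle system $\underline X(t)=(X_i(t))_{i\ge1}$ given by the (unique in law) weak solution of $$dX_i(t)=\mathbf 1_{\{X_i(t)=X_{(1)}(t)\}}\,dt+dW_i(t),\qquad i\in\mathbb N,$$ with $(W_i)_{i\ge1}$ independent standard Brownian motions, independent of $\underline X(0)$; a.s. the configuration can be ranked at all times, $X_{(1)}(t)\le X_{(2)}(t)\le\dots$, with ties broken in lexicographic order (so the unit drift is given only to the currently left-most particle). Weak existence and uniqueness in law hold since a.s. $\sum_i e^{-\alpha X_i(0)^2}<\infty$ for all $\alpha>0$. Scaling: for $b>0$, $X^b_i(t)=bX_i(t/b^2)$ and $Q^b(t,\cdot)=b\sum_{i\ge1}\delta_{X^b_i(t)}$. $M_\star(\mathbb R)$: the space of Borel, locally finite, non-negative measures on $\mathbb R$ assigning finite mass to $(-\infty,0)$, with the $\mathcal C_\star$-topology, under which $\mu\mapsto\mu(f)=\int f\,d\mu$ is continuous for every $f\in\mathcal C_\star$, the set of continuous bounded functions on $\mathbb R$ which are eventually zero (i.e. vanish on some $[r,\infty)$). This topology is metrized by $$d_\star(\mu_1,\mu_2)=\sum_{r\in\mathbb N}2^{-r}\min\Big\{1,\sup_{\|f\|_{\infty}+\|f\|_{\mathrm{Lip}}\le1,\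 \mathrm{supp}(f)\subset(-\infty,r]}|\mu_1(f)-\mu_2(f)|\Big\},$$ with $\|\cdot\|_{\mathrm{Lip}}$ the Lipschitz pseudonorm. $\mathfrak C$ is the space of all continuous maps $t\mapsto\mu(t,\cdot)$ from $\mathbb R_+$ to $(M_\star(\mathbb R),d_\star)$, and $\mathfrak d$ is any metric on $\mathfrak C$ whose topology is that of uniform convergence on compact subsets of $\mathbb R_+$. Almost surely $Q^b\in\mathfrak C$. *)

theory Defs
  imports "HOL-Probability.Probability"
begin

text \<open>
  Particles are indexed from 0, so \<open>X i\<close> is the paper's \<open>X_(i+1)\<close>. Processes have type
  \<open>real \<Rightarrow> 'a \<Rightarrow> real\<close>; only times \<open>t \<ge> 0\<close> matter.
\<close>

section \<open>Poisson initial configuration\<close>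

definition num_points :: "(nat \<Rightarrow> 'a \<Rightarrow> real) \<Rightarrow> real set \<Rightarrow> 'a \<Rightarrow> ennreal" where
  "num_points x A \<omega> = (\<Sum>i. indicator A (x i \<omega>))"

text \<open>
  \<open>x 0 \<le> x 1 \<le> \<dots>\<close> is the increasing list of the points of a Poisson point process of constant
  intensity \<open>lam\<close> on \<open>[0, \<infinity>)\<close>.
\<close>

definition PPP_plus :: "'a measure \<Rightarrow> real \<Rightarrow> (nat \<Rightarrow> 'a \<Rightarrow> real) \<Rightarrow> bool" where
  "PPP_plus M lam x \<longleftrightarrow>
     (\<forall>i. x i \<in> borel_measurable M) \<and>
     (AE \<omega> in M. incseq (\<lambda>i. x i \<omega>) \<and> (\<forall>i. 0 \<le> x i \<omega>)) \<and>
     (\<forall>A \<in> sets borel. A \<subseteq> {0..} \<longrightarrow> emeasure lborel A < \<infinity> \<longrightarrow>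
        (\<forall>k::nat. measure M {\<omega> \<in> space M. num_points x A \<omega> = of_nat k} =
           (lam * measure lborel A) ^ k / fact k * exp (- (lam * measure lborel A)))) \<and>
     (\<forall>A :: nat \<Rightarrow> real set. (\<forall>j. A j \<in> sets borel \<and> A j \<subseteq> {0..}) \<longrightarrow> disjoint_family A \<longrightarrow>
        prob_space.indep_vars M (\<lambda>_. borel) (\<lambda>j. num_points x (A j)) UNIV)"


section \<open>The infinite Atlas model\<close>

definition std_brownian_motion :: "'a measure \<Rightarrow> (real \<Rightarrow> 'a \<Rightarrow> real) \<Rightarrow> bool" where
  "std_brownian_motion M B \<longleftrightarrow>
     (\<forall>t\<ge>0. B t \<in> borel_measurable M) \<and>
     (AE \<omega> in M. B 0 \<omega> = 0) \<and>
     (\<forall>s t. 0 \<le> s \<longrightarrow> s < t \<longrightarrow>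
        distributed M lborel (\<lambda>\<omega>. B t \<omega> - B s \<omega>) (\<lambda>x. ennreal (normal_density 0 (sqrt (t - s)) x))) \<and>
     (\<forall>t :: nat \<Rightarrow> real. 0 \<le> t 0 \<longrightarrow> incseq t \<longrightarrow>
        prob_space.indep_vars M (\<lambda>_. borel) (\<lambda>k \<omega>. B (t (Suc k)) \<omega> - B (t k) \<omega>) UNIV) \<and>
     (AE \<omega> in M. continuous_on {0..} (\<lambda>t. B t \<omega>))"

text \<open>
  \<open>x (p 0) \<le> x (p 1) \<le> \<dots>\<close> is the ranked configuration, ties being broken in lexicographic order.
\<close>

definition ranking :: "(nat \<Rightarrow> real) \<Rightarrow> (nat \<Rightarrow> nat) \<Rightarrow> bool" where
  "ranking x p \<longleftrightarrow> bij p \<and>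
     (\<forall>k l. k < l \<longrightarrow> x (p k) < x (p l) \<or> (x (p k) = x (p l) \<and> p k < p l))"

definition leftmost :: "(nat \<Rightarrow> real) \<Rightarrow> nat \<Rightarrow> bool" where
  "leftmost x i \<longleftrightarrow> (\<exists>p. ranking x p \<and> p 0 = i)"

text \<open>
  Weak solutions of the Atlas stochastic differential equation, on an arbitrary filtered
  probability space. The filtration is indexed by all reals because the library's locale
  requires a total index type; a filtration on \<open>[0, \<infinity>)\<close> extends by \<open>F t = F 0\<close> for \<open>t < 0\<close>.
\<close>

locale atlas_infinity = prob_space M + filtration "space M" F
  for M :: "'a measure" and F :: "real \<Rightarrow> 'a measure" +
  fixes W :: "nat \<Rightarrow> real \<Rightarrow> 'a \<Rightarrow> real"
    and X :: "nat \<Rightarrow> real \<Rightarrow> 'a \<Rightarrow> real"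
  assumes subalgebra_F: "\<And>t. subalgebra M (F t)"
    and W_brownian: "\<And>i. std_brownian_motion M (W i)"
    and W_indep: "indep_vars (\<lambda>_. PiM {0..} (\<lambda>_. borel)) (\<lambda>i \<omega>. \<lambda>t\<in>{0..}. W i t \<omega>) UNIV"
    and W_adapted: "\<And>i t. 0 \<le> t \<Longrightarrow> W i t \<in> borel_measurable (F t)"
    and W_increments: "\<And>s t. 0 \<le> s \<Longrightarrow> s < t \<Longrightarrow>
          indep_set (sets (F s))
            (sets (vimage_algebra (space M) (\<lambda>\<omega> i. W i t \<omega> - W i s \<omega>) (PiM UNIV (\<lambda>_. borel))))"
    and W_indep_X0:
          "indep_set (sets (vimage_algebra (space M) (\<lambda>\<omega> i. X i 0 \<omega>) (PiM UNIV (\<lambda>_. borel))))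
             (sets (vimage_algebra (space M) (\<lambda>\<omega> i. \<lambda>t\<in>{0..}. W i t \<omega>)
                (PiM UNIV (\<lambda>_. PiM {0..} (\<lambda>_. borel)))))"
    and X_adapted: "\<And>i t. 0 \<le> t \<Longrightarrow> X i t \<in> borel_measurable (F t)"
    and X_continuous: "AE \<omega> in M. \<forall>i. continuous_on {0..} (\<lambda>t. X i t \<omega>)"
    and X_ranked: "AE \<omega> in M. \<forall>t\<ge>0. \<exists>p. ranking (\<lambda>i. X i t \<omega>) p"
    and X_equation: "AE \<omega> in M. \<forall>i. \<forall>t\<ge>0.
          X i t \<omega> = X i 0 \<omega> + (LINT s:{0..t}|lborel. of_bool (leftmost (\<lambda>j. X j s \<omega>) i)) + W i t \<omega>"


section \<open>Measures on the line that are finite near minus infinity\<close>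

definition M_star :: "real measure set" where
  "M_star = {\<mu>. sets \<mu> = sets borel \<and> (\<forall>K. compact K \<longrightarrow> emeasure \<mu> K < \<infinity>) \<and> emeasure \<mu> {..<0} < \<infinity>}"

text \<open>
  Here \<open>K\<close> and \<open>L\<close> bound the supremum norm and the Lipschitz pseudonorm. The distance is set to 0
  off \<open>M_star\<close> because the library's \<open>Metric_space\<close> asks for nonnegativity and symmetry on the
  whole type; on \<open>M_star\<close> the supremum is of a bounded set.
\<close>

definition test_fun :: "real \<Rightarrow> (real \<Rightarrow> real) set" where
  "test_fun r = {f. (\<exists>K L. K + L \<le> 1 \<and> (\<forall>x. \<bar>f x\<bar> \<le> K) \<and> L-lipschitz_on UNIV f)
     \<and> closure {x. f x \<noteq> 0} \<subseteq> {..r}}"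

definition d_star :: "real measure \<Rightarrow> real measure \<Rightarrow> real" where
  "d_star \<mu> \<nu> = (if \<mu> \<in> M_star \<and> \<nu> \<in> M_star then
     (\<Sum>n. (1/2) ^ Suc n *
        min 1 (SUP f\<in>test_fun (real (Suc n)). \<bar>(\<integral>x. f x \<partial>\<mu>) - (\<integral>x. f x \<partial>\<nu>)\<bar>)) else 0)"

text \<open>
  The path space. Paths are extensional (\<open>undefined\<close> at negative times), so that equality of
  paths is equality on \<open>[0, \<infinity>)\<close>.
\<close>

definition C_paths :: "(real \<Rightarrow> real measure) set" where
  "C_paths = {q \<in> extensional {0..}.
     continuous_map (top_of_set {0..}) (Metric_space.mtopology M_star d_star) q}"

text \<open>Uniform convergence on compact subsets of \<open>[0, \<infinity>)\<close>.\<close>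

definition uc_open :: "(real \<Rightarrow> real measure) set \<Rightarrow> bool" where
  "uc_open U \<longleftrightarrow> U \<subseteq> C_paths \<and>
     (\<forall>q\<in>U. \<exists>K e. compact K \<and> K \<subseteq> {0..} \<and> e > 0 \<and>
        {q' \<in> C_paths. \<forall>t\<in>K. d_star (q t) (q' t) < e} \<subseteq> U)"

definition uc_topology :: "(real \<Rightarrow> real measure) topology" where
  "uc_topology = topology uc_open"

lemma openin_uc_topology: "openin uc_topology U \<longleftrightarrow> uc_open U"
proof -
  have "istopology uc_open"
    unfolding istopology_def
  proof (intro conjI allI impI)
    fix S T assume S: "uc_open S" and T: "uc_open T"
    show "uc_open (S \<inter> T)"
      unfolding uc_open_def
    proof (intro conjI ballI)
      show "S \<inter> T \<subseteq> C_paths" using S by (auto simp: uc_open_def)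
      fix q assume q: "q \<in> S \<inter> T"
      obtain K e where 1: "compact K" "K \<subseteq> {0..}" "e > 0"
        "{q' \<in> C_paths. \<forall>t\<in>K. d_star (q t) (q' t) < e} \<subseteq> S"
        using S q unfolding uc_open_def by blast
      obtain K' e' where 2: "compact K'" "K' \<subseteq> {0..}" "e' > 0"
        "{q' \<in> C_paths. \<forall>t\<in>K'. d_star (q t) (q' t) < e'} \<subseteq> T"
        using T q unfolding uc_open_def by blast
      have "{q' \<in> C_paths. \<forall>t\<in>K \<union> K'. d_star (q t) (q' t) < min e e'} \<subseteq> S \<inter> T"
        using 1(4) 2(4) by auto
      then show "\<exists>K e. compact K \<and> K \<subseteq> {0..} \<and> e > 0 \<and>
        {q' \<in> C_paths. \<forall>t\<in>K. d_star (q t) (q' t) < e} \<subseteq> S \<inter> T"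
        using 1(1-3) 2(1-3)
        by (intro exI[of _ "K \<union> K'"] exI[of _ "min e e'"] conjI) (simp_all add: compact_Un)
    qed
  next
    fix \<K> assume *: "\<forall>K\<in>\<K>. uc_open K"
    show "uc_open (\<Union>\<K>)"
      unfolding uc_open_def
    proof (intro conjI ballI)
      show "\<Union>\<K> \<subseteq> C_paths" using * by (auto simp: uc_open_def)
      fix q assume "q \<in> \<Union>\<K>"
      then obtain S where S: "S \<in> \<K>" "q \<in> S" by blast
      then have "uc_open S" using * by simp
      then obtain K e where "compact K" "K \<subseteq> {0..}" "e > 0"
        "{q' \<in> C_paths. \<forall>t\<in>K. d_star (q t) (q' t) < e} \<subseteq> S"
        using S(2) unfolding uc_open_def by blast
      then show "\<exists>K e. compact K \<and> K \<subseteq> {0..} \<and> e > 0 \<and>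
        {q' \<in> C_paths. \<forall>t\<in>K. d_star (q t) (q' t) < e} \<subseteq> \<Union>\<K>"
        using S(1) by (meson Union_upper subset_trans)
    qed
  qed
  then show ?thesis by (simp add: uc_topology_def)
qed


section \<open>Rescaled processes\<close>

definition X_scaled :: "(nat \<Rightarrow> real \<Rightarrow> 'a \<Rightarrow> real) \<Rightarrow> real \<Rightarrow> nat \<Rightarrow> real \<Rightarrow> 'a \<Rightarrow> real" where
  "X_scaled X b i t \<omega> = b * X i (t / b\<^sup>2) \<omega>"

text \<open>
  The image of the counting measure on the indices is the sum of the Dirac masses at the particles.
\<close>

definition Q_scaled :: "(nat \<Rightarrow> real \<Rightarrow> 'a \<Rightarrow> real) \<Rightarrow> real \<Rightarrow> 'a \<Rightarrow> real \<Rightarrow> real measure" where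
  "Q_scaled X b \<omega> = (\<lambda>t\<in>{0..}.
     scale_measure (ennreal b) (distr (count_space UNIV) borel (\<lambda>i. X_scaled X b i t \<omega>)))"

text \<open>The infimum is almost surely attained, by rankability of the configuration.\<close>

definition Y_scaled :: "(nat \<Rightarrow> real \<Rightarrow> 'a \<Rightarrow> real) \<Rightarrow> real \<Rightarrow> real \<Rightarrow> 'a \<Rightarrow> real" where
  "Y_scaled X b t \<omega> = (INF i. X_scaled X b i t \<omega>)"


section \<open>The limit\<close>

definition std_normal_cdf :: "real \<Rightarrow> real" where
  "std_normal_cdf = cdf std_normal_distribution"

definition g_fun :: "real \<Rightarrow> real" where
  "g_fun k = k * (1 - std_normal_cdf k) / deriv std_normal_cdf k"

definition c1 :: "real \<Rightarrow> real \<Rightarrow> real" where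
  "c1 lam k = (2 - lam * std_normal_cdf k) / (1 - std_normal_cdf k)"

definition c2 :: "real \<Rightarrow> real \<Rightarrow> real" where
  "c2 lam k = (lam - 2) / (1 - std_normal_cdf k)"

definition y_star :: "real \<Rightarrow> real \<Rightarrow> real" where
  "y_star k t = k * sqrt t"

definition u_star :: "real \<Rightarrow> real \<Rightarrow> real \<Rightarrow> real \<Rightarrow> real" where
  "u_star lam k t x =
     (if t = 0 then lam * indicator {0<..} x
      else (c1 lam k + c2 lam k * std_normal_cdf (x / sqrt t)) * indicator {y_star k t<..} x)"

definition Q_star :: "real \<Rightarrow> real \<Rightarrow> real \<Rightarrow> real measure" where
  "Q_star lam k = (\<lambda>t\<in>{0..}. density lborel (\<lambda>x. ennreal (u_star lam k t x)))"


section \<open>Convergence in probability\<close>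

text \<open>
  Convergence in probability as \<open>b \<rightarrow> 0+\<close> of almost surely \<open>S\<close>-valued maps \<open>Z b\<close> to a point \<open>z\<close>
  of the space \<open>S\<close> with metric \<open>d\<close>. The deviation events are only measurable up to null sets,
  hence the outer measure, which is the probability under the completion of \<open>M\<close>.
\<close>

definition tends_in_probability ::
  "'a measure \<Rightarrow> 'b set \<Rightarrow> ('b \<Rightarrow> 'b \<Rightarrow> real) \<Rightarrow> (real \<Rightarrow> 'a \<Rightarrow> 'b) \<Rightarrow> 'b \<Rightarrow> bool" where
  "tends_in_probability M S d Z z \<longleftrightarrow>
     z \<in> S \<and> (\<forall>b>0. AE \<omega> in M. Z b \<omega> \<in> S) \<and>
     (\<forall>e>0. ((\<lambda>b. outer_measure_of M {\<omega> \<in> space M. Z b \<omega> \<in> S \<and> d (Z b \<omega>) z > e}) \<longlongrightarrow> 0)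
        (at_right 0))"

end

(*
  The rescaled configuration is observed through the integrated count G(t,x) = b * sum_i (x - X_i(t))_+ . Its
  limit Gs(t,x), the integral of (x-z)_+ against u_star(t,z) dz, solves the parabolic obstacle problem
  G_t = G_xx / 2 - 1_{G>0}, for which no regularity of the free boundary is needed. Over a short time step the
  particle system obeys the same equation up to small errors: the noise turns G into its heat evolution, with
  fluctuations of second moment O(b), and the drift of the left-most particle, which in the rescaled system has
  total mass dt, lowers G(t,x) by at most the length of the step, and by exactly that length where G(t,x) > 0.
  A discrete maximum principle with the weight 1 + exp(2x + 2t) then keeps G and Gs uniformly close. The
  left-most particle cannot lie to the right of y_star, where Gs > 0; nor can it stay to the left, because all the
  drift would then be spent in a region where G is too small to absorb it. Second differences of G and Gs in x
  are integrals of tent functions, which gives convergence of the measures.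
*)

theory Submission
  imports Defs "HOL-Real_Asymp.Real_Asymp"
begin

section \<open>The free boundary equation\<close>

text \<open>With the drift switched off during a step, particles move by independent Gaussian
  increments given the past, and the conditional mean of \<open>Ghat\<close> is the heat evolution
  of \<open>G\<close>; the random part of the proof needs little more than this. The errors of about
  \<open>1 / h\<close> steps add up, so each must be far below \<open>h * th\<close>. This dictates
  a noise level \<open>q ^ 40\<close> against \<open>h * th = q ^ 31\<close>, and hence the high
  power \<open>b = q ^ 180\<close>, which pays for Chebyshev's inequality and a union over the time
  and space grids. Integrated counts suit this because \<open>G\<close> is monotone in
  \<open>x\<close>, so control on a space grid extends off it, and because the drift acts on
  \<open>G\<close> with a sign and a known total mass. Deviations below \<open>th\<close> times the
  weight are simply tolerated; where the deviation is larger, either the leader or the free boundary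
  lies at a definite distance to the left of \<open>x\<close>, and no boundary effect is seen. The
  infinity of particles is handled by tolerances that grow with the starting point, so that every
  sum over particles reduces to that of \<open>1 / (1 + X i 0)^2\<close>.\<close>

abbreviation Phi :: "real \<Rightarrow> real" where "Phi \<equiv> std_normal_cdf"
abbreviation phi :: "real \<Rightarrow> real" where "phi \<equiv> std_normal_density"

text \<open>Reflection at the origin turns the left half-line into a right one, where
  \<open>nn_integral_FTC_atLeast\<close> applies.\<close>

lemma nn_integral_FTC_atMost:
  fixes f F :: "real \<Rightarrow> real"
  assumes f_borel: "f \<in> borel_measurable borel"
    and f: "\<And>x. x \<le> a \<Longrightarrow> DERIV F x :> f x"
    and nonneg: "\<And>x. x \<le> a \<Longrightarrow> 0 \<le> f x"
    and lim: "(F \<longlongrightarrow> T) at_bot"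
  shows "(\<integral>\<^sup>+x. ennreal (f x) * indicator {..a} x \<partial>lborel) = ennreal (F a - T)"
proof -
  have "(\<integral>\<^sup>+x. ennreal (f x) * indicator {..a} x \<partial>lborel)
      = (\<integral>\<^sup>+x. ennreal (f (- x)) * indicator {..a} (- x) \<partial>lborel)"
    by (subst nn_integral_real_affine[where c="-1" and t=0]) (use f_borel in auto)
  also have "\<dots> = (\<integral>\<^sup>+x. ennreal (f (- x)) * indicator {-a..} x \<partial>lborel)"
    by (intro nn_integral_cong) (auto split: split_indicator)
  also have "\<dots> = ennreal (- T - (- F (- (- a))))"
  proof (rule nn_integral_FTC_atLeast[where F="\<lambda>x. - F (- x)"])
    show "(\<lambda>x. f (- x)) \<in> borel_measurable borel" using f_borel by measurable
    show "DERIV (\<lambda>x. - F (- x)) x :> f (- x)" if "- a \<le> x" for x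
    proof -
      have "- x \<le> a" using that by simp
      from f[OF this] have "DERIV (\<lambda>x. F (- x)) x :> f (- x) * (- 1)"
        by (intro DERIV_chain'[of uminus "-1"]) (auto intro!: derivative_eq_intros)
      from DERIV_minus[OF this] show ?thesis by simp
    qed
    show "0 \<le> f (- x)" if "- a \<le> x" for x using nonneg[of "-x"] that by simp
    have "((\<lambda>x. F (- x)) \<longlongrightarrow> T) at_top"
      using filterlim_compose[OF lim filterlim_uminus_at_bot_at_top] .
    then show "((\<lambda>x. - F (- x)) \<longlongrightarrow> - T) at_top" by (rule tendsto_minus)
  qed
  finally show ?thesis by simp
qed

section \<open>The standard normal density and distribution function\<close>

interpretation N01: real_distribution std_normal_distribution
  by (rule real_dist_normal_dist)

lemma phi_pos[simp]: "0 < phi x" by (simp add: normal_density_pos)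

lemma phi_minus: "phi (- x) = phi x" by (simp add: std_normal_density_def)

lemma phi_deriv: "(phi has_real_derivative - x * phi x) (at x)"
  unfolding std_normal_density_def[abs_def]
  by (auto intro!: derivative_eq_intros simp: field_simps)

lemma phi_cont: "continuous_on S phi"
  by (meson phi_deriv DERIV_isCont continuous_at_imp_continuous_on)

text \<open>Near \<open>x\<close>, \<open>Phi\<close> is a constant plus the integral of
  \<open>phi\<close> from \<open>x - 1\<close>, since half-open and closed intervals differ by a
  null set; starting at \<open>x - 1\<close> makes \<open>x\<close> an interior point.\<close>

lemma Phi_deriv: "(Phi has_real_derivative phi x) (at x)"
proof -
  have eq: "Phi y = Phi (x - 1) + integral {x - 1..y} phi" if "y > x - 1" for y
  proof -
    have "Phi y - Phi (x - 1) = measure std_normal_distribution {x - 1<..y}"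
      unfolding std_normal_cdf_def using N01.cdf_diff_eq[OF that] .
    also have "\<dots> = (\<integral>z. indicator {x - 1<..y} z \<partial>std_normal_distribution)" by simp
    also have "\<dots> = (\<integral>z. phi z * indicator {x - 1<..y} z \<partial>lborel)"
      by (subst integral_density) (auto simp: normal_density_nonneg)
    also have "\<dots> = (\<integral>z. indicator {x - 1..y} z *\<^sub>R phi z \<partial>lborel)"
    proof (rule integral_cong_AE)
      have "AE z in lborel. z \<noteq> x - 1" by (rule AE_lborel_singleton)
      then show "AE z in lborel. phi z * indicator {x - 1<..y} z = indicator {x - 1..y} z *\<^sub>R phi z"
        by eventually_elim (auto split: split_indicator)
    qed auto
    also have "\<dots> = integral {x - 1..y} phi"
      using set_borel_integral_eq_integral(2)[OF borel_integrable_atLeastAtMost'[OF phi_cont]]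
      by (simp add: set_lebesgue_integral_def)
    finally show ?thesis by simp
  qed
  have "((\<lambda>y. integral {x - 1..y} phi) has_real_derivative phi x) (at x within {x - 1..x + 1})"
    by (rule integral_has_real_derivative[OF phi_cont]) auto
  then have "((\<lambda>y. integral {x - 1..y} phi) has_real_derivative phi x) (at x)"
    by (subst (asm) at_within_interior) auto
  then have "((\<lambda>y. Phi (x - 1) + integral {x - 1..y} phi) has_real_derivative phi x) (at x)"
    by (auto intro!: derivative_eq_intros)
  moreover have "eventually (\<lambda>y. y > x - 1) (nhds x)"
    by (rule order_tendstoD(1)[OF tendsto_ident_at[of x UNIV, THEN tendsto_at_iff_tendsto_nhds[THEN iffD1]]]) simp
  then have "eventually (\<lambda>y. Phi y = Phi (x - 1) + integral {x - 1..y} phi) (nhds x)"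
    by eventually_elim (rule eq)
  ultimately show ?thesis by (subst DERIV_cong_ev[OF refl _ refl])
qed

lemma Phi_cont: "continuous_on S Phi"
  by (meson Phi_deriv DERIV_isCont continuous_at_imp_continuous_on)

lemma Phi_measurable[measurable]: "Phi \<in> borel_measurable borel"
  by (intro borel_measurable_continuous_onI Phi_cont)

lemma Phi_at_bot: "(Phi \<longlongrightarrow> 0) at_bot"
  unfolding std_normal_cdf_def by (rule N01.cdf_lim_at_bot)

lemma Phi_at_top: "(Phi \<longlongrightarrow> 1) at_top"
  unfolding std_normal_cdf_def by (rule N01.cdf_lim_at_top_prob)

lemma Phi_strict_mono: "x < y \<Longrightarrow> Phi x < Phi y"
  by (rule DERIV_pos_imp_increasing[of x y Phi]) (use Phi_deriv phi_pos in blast)+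

lemma Phi_bounds: "0 < Phi x" "Phi x < 1"
proof -
  have "0 \<le> Phi (x - 1)" unfolding std_normal_cdf_def by (rule N01.cdf_nonneg)
  also have "\<dots> < Phi x" by (rule Phi_strict_mono) simp
  finally show "0 < Phi x" .
  have "Phi x < Phi (x + 1)" by (rule Phi_strict_mono) simp
  also have "\<dots> \<le> 1" unfolding std_normal_cdf_def by (rule N01.cdf_bounded_prob)
  finally show "Phi x < 1" .
qed

text \<open>The sum \<open>Phi (- x) + Phi x\<close> has derivative 0 because \<open>phi\<close> is
  even, and its limit at infinity identifies the constant.\<close>

lemma Phi_minus: "Phi (- x) = 1 - Phi x"
proof -
  have "Phi (- x) + Phi x = Phi (- 0) + Phi 0" for x
  proof (rule DERIV_isconst_all[of "\<lambda>x. Phi (- x) + Phi x"], rule allI)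
    show "((\<lambda>x. Phi (- x) + Phi x) has_real_derivative 0) (at x)" for x
    proof -
      have "((\<lambda>x. Phi (- x)) has_real_derivative phi (- x) * (- 1)) (at x)"
        by (rule DERIV_chain'[OF _ Phi_deriv]) (auto intro!: derivative_eq_intros)
      from DERIV_add[OF this Phi_deriv] show ?thesis
        by (simp add: std_normal_density_def)
    qed
  qed
  then have eq: "Phi (- x) + Phi x = Phi 0 + Phi 0" for x by (metis minus_zero)
  have "((\<lambda>x. Phi (- x) + Phi x) \<longlongrightarrow> 0 + 1) at_top"
    by (intro tendsto_add Phi_at_top filterlim_compose[OF Phi_at_bot filterlim_uminus_at_bot_at_top])
  then have "((\<lambda>x::real. Phi 0 + Phi 0) \<longlongrightarrow> 1) at_top" unfolding eq by simp
  then have "Phi 0 + Phi 0 = 1" by (simp add: tendsto_const_iff)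
  with eq[of x] show ?thesis by simp
qed

text \<open>For a standard normal \<open>N\<close>, \<open>q1 x\<close> is the mean of
  \<open>(x - N)_+\<close> and \<open>q2 x\<close> the mean of half its square; they are the first
  and second antiderivatives of \<open>Phi\<close> that vanish at minus infinity.\<close>

definition q1 :: "real \<Rightarrow> real" where "q1 x = x * Phi x + phi x"
definition q2 :: "real \<Rightarrow> real" where "q2 x = ((x\<^sup>2 + 1) * Phi x + x * phi x) / 2"

lemma q1_deriv: "(q1 has_real_derivative Phi x) (at x)"
  unfolding q1_def[abs_def] by (auto intro!: derivative_eq_intros Phi_deriv phi_deriv)

lemma q2_deriv: "(q2 has_real_derivative q1 x) (at x)"
  unfolding q2_def[abs_def] q1_def
  by (auto intro!: derivative_eq_intros Phi_deriv phi_deriv simp: field_simps power2_eq_square)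

lemma phi_lims: "(phi \<longlongrightarrow> 0) at_bot" "((\<lambda>w. w * phi w) \<longlongrightarrow> 0) at_bot"
  unfolding std_normal_density_def[abs_def] by real_asymp+

lemma nn_integral_N01:
  "f \<in> borel_measurable borel \<Longrightarrow>
    (\<integral>\<^sup>+w. f w \<partial>std_normal_distribution) = (\<integral>\<^sup>+w. ennreal (phi w) * f w \<partial>lborel)"
  by (subst nn_integral_density) auto

lemma nn_integral_pos_part_N01:
  "(\<integral>\<^sup>+w. ennreal (max 0 (x - w)) \<partial>std_normal_distribution) = ennreal (q1 x)"
proof -
  have "(\<integral>\<^sup>+w. ennreal (max 0 (x - w)) \<partial>std_normal_distribution) =
      (\<integral>\<^sup>+w. ennreal ((x - w) * phi w) * indicator {..x} w \<partial>lborel)"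
    by (subst nn_integral_N01)
       (auto intro!: nn_integral_cong simp: ennreal_mult'[symmetric] max_def mult.commute split: split_indicator)
  also have "\<dots> = ennreal ((x * Phi x + phi x) - (x * 0 + 0))"
  proof (rule nn_integral_FTC_atMost[where F="\<lambda>w. x * Phi w + phi w"])
    show "((\<lambda>w. x * Phi w + phi w) \<longlongrightarrow> x * 0 + 0) at_bot"
      by (intro tendsto_intros Phi_at_bot phi_lims)
  qed (auto intro!: derivative_eq_intros Phi_deriv phi_deriv simp: algebra_simps mult_right_mono)
  finally show ?thesis by (simp add: q1_def)
qed

lemma nn_integral_pos_part_sq_N01:
  "(\<integral>\<^sup>+w. ennreal ((max 0 (x - w))\<^sup>2 / 2) \<partial>std_normal_distribution) = ennreal (q2 x)"
proof -
  have "(\<integral>\<^sup>+w. ennreal ((max 0 (x - w))\<^sup>2 / 2) \<partial>std_normal_distribution) =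
      (\<integral>\<^sup>+w. ennreal ((x - w)\<^sup>2 / 2 * phi w) * indicator {..x} w \<partial>lborel)"
    by (subst nn_integral_N01)
       (auto intro!: nn_integral_cong simp: ennreal_mult'[symmetric] max_def mult.commute split: split_indicator)
  also have "\<dots> = ennreal (((x\<^sup>2 + 1) * Phi x + 2 * x * phi x - x * phi x) / 2
      - ((x\<^sup>2 + 1) * 0 + 2 * x * 0 - 0) / 2)"
  proof (rule nn_integral_FTC_atMost[where F="\<lambda>w. ((x\<^sup>2 + 1) * Phi w + 2 * x * phi w - w * phi w) / 2"])
    show "((\<lambda>w. ((x\<^sup>2 + 1) * Phi w + 2 * x * phi w - w * phi w) / 2)
      \<longlongrightarrow> ((x\<^sup>2 + 1) * 0 + 2 * x * 0 - 0) / 2) at_bot"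
      by (intro tendsto_intros Phi_at_bot phi_lims) auto
    show "0 \<le> (x - w)\<^sup>2 / 2 * phi w" for w by simp
  qed (auto intro!: derivative_eq_intros Phi_deriv phi_deriv simp: field_simps power2_eq_square)
  finally show ?thesis by (simp add: q2_def algebra_simps)
qed

text \<open>A Mills ratio bound. Strict monotonicity reduces it to
  \<open>0 \<le> q1 (x - 1)\<close>. There, \<open>(x - 1) * Phi w + phi w\<close> starts from 0 at
  minus infinity, increases in \<open>w\<close> up to \<open>x - 1\<close>, and ends at the required
  value.\<close>

lemma q1_pos: "0 < q1 x"
proof -
  have "q1 (x - 1) < q1 x"
    by (rule DERIV_pos_imp_increasing[of "x - 1" x q1]) (use q1_deriv Phi_bounds in force)+
  moreover have "ennreal (q1 y) = (\<integral>\<^sup>+w. ennreal (max 0 (y - w)) \<partial>std_normal_distribution)" for y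
    by (rule nn_integral_pos_part_N01[symmetric])
  have "0 \<le> q1 (x - 1)"
  proof (rule tendsto_upperbound)
    show "((\<lambda>w. (x-1) * Phi w + phi w) \<longlongrightarrow> 0) at_bot"
      by (rule tendsto_eq_intros Phi_at_bot phi_lims refl | simp)+
    show "\<forall>\<^sub>F w in at_bot. (x-1) * Phi w + phi w \<le> q1 (x-1)"
      unfolding q1_def
    proof (rule eventually_at_bot_linorderI)
      fix w assume w: "w \<le> x - 1"
      show "(x-1) * Phi w + phi w \<le> (x-1) * Phi (x-1) + phi (x-1)"
      proof (rule DERIV_nonneg_imp_nondecreasing[OF w], intro exI conjI)
        fix v assume v: "v \<le> x - 1"
        show "((\<lambda>w. (x-1) * Phi w + phi w) has_real_derivative (x - 1 - v) * phi v) (at v)"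
          by (auto intro!: derivative_eq_intros Phi_deriv phi_deriv simp: algebra_simps)
        show "0 \<le> (x - 1 - v) * phi v" using v by (intro mult_nonneg_nonneg) auto
      qed
    qed
  qed simp
  ultimately show ?thesis by linarith
qed

text \<open>The next Mills ratio bound, by the same scheme with a primitive of
  \<open>(x - 1 - w)^2 / 2 * phi w\<close>. Evaluated at \<open>- k\<close> it makes
  \<open>g_fun\<close> strictly increasing.\<close>

lemma q2_pos: "0 < q2 x"
proof -
  have "q2 (x - 1) < q2 x"
    by (rule DERIV_pos_imp_increasing[of "x - 1" x q2]) (use q2_deriv q1_pos in force)+
  moreover have "0 \<le> q2 (x - 1)"
  proof (rule tendsto_upperbound)
    show "((\<lambda>w. (((x-1)\<^sup>2 + 1) * Phi w + 2 * (x-1) * phi w - w * phi w) / 2) \<longlongrightarrow> 0) at_bot"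
      by (rule tendsto_eq_intros Phi_at_bot phi_lims refl | simp)+
    show "\<forall>\<^sub>F w in at_bot. (((x-1)\<^sup>2 + 1) * Phi w + 2 * (x-1) * phi w - w * phi w) / 2 \<le> q2 (x-1)"
    proof (rule eventually_at_bot_linorderI)
      fix w assume w: "w \<le> x - 1"
      have "(((x-1)\<^sup>2 + 1) * Phi w + 2 * (x-1) * phi w - w * phi w) / 2
        \<le> (((x-1)\<^sup>2 + 1) * Phi (x-1) + 2 * (x-1) * phi (x-1) - (x-1) * phi (x-1)) / 2"
      proof (rule DERIV_nonneg_imp_nondecreasing[OF w], intro exI conjI)
        fix v show "((\<lambda>w. (((x-1)\<^sup>2 + 1) * Phi w + 2 * (x-1) * phi w - w * phi w) / 2)
           has_real_derivative (x - 1 - v)\<^sup>2 / 2 * phi v) (at v)"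
          by (auto intro!: derivative_eq_intros Phi_deriv phi_deriv simp: field_simps power2_eq_square)
      qed auto
      also have "\<dots> = q2 (x-1)" unfolding q2_def by (simp add: algebra_simps)
      finally show "(((x-1)\<^sup>2 + 1) * Phi w + 2 * (x-1) * phi w - w * phi w) / 2 \<le> q2 (x-1)" .
    qed
  qed simp
  ultimately show ?thesis by linarith
qed

section \<open>The equation for the free boundary constant\<close>

lemma g_fun_eq: "g_fun k = k * (1 - Phi k) / phi k"
  unfolding g_fun_def using DERIV_imp_deriv[OF Phi_deriv] by simp

text \<open>The quotient rule yields \<open>((k^2 + 1) * (1 - Phi k) - k * phi k) / phi k\<close>,
  and the numerator is \<open>2 * q2 (- k)\<close>; uniqueness of \<open>k\<close> thus rests on
  \<open>q2_pos\<close>.\<close>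

lemma g_fun_deriv: "(g_fun has_real_derivative 2 * q2 (- k) / phi k) (at k)"
proof -
  have "((\<lambda>k. k * (1 - Phi k) / phi k) has_real_derivative 2 * q2 (- k) / phi k) (at k)"
    using phi_pos[of k]
    by (auto intro!: derivative_eq_intros Phi_deriv phi_deriv
        simp: field_simps power2_eq_square q2_def Phi_minus phi_minus simp del: phi_pos)
  then show ?thesis by (simp add: g_fun_eq[abs_def])
qed

lemma g_fun_strict_mono: "x < y \<Longrightarrow> g_fun x < g_fun y"
  by (rule DERIV_pos_imp_increasing[of x y g_fun]) (use g_fun_deriv q2_pos phi_pos in \<open>blast intro: divide_pos_pos mult_pos_pos zero_less_numeral\<close>)+

lemma ex1_kappa:
  assumes "lam > 0"
  shows "\<exists>!k. g_fun k = 1 - lam / 2"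
proof -
  have cont: "continuous_on S g_fun" for S
    by (meson g_fun_deriv DERIV_isCont continuous_at_imp_continuous_on)
  \<comment> \<open>Since \<open>phi k1 \<le> 1\<close>, \<open>1 - Phi k1 \<ge> 1 / 2\<close> and
    \<open>k1 \<le> 0\<close>, the value \<open>g_fun k1\<close> is at most \<open>k1 / 2\<close>,
    which lies below \<open>1 - lam / 2\<close> whatever the sign of \<open>2 - lam\<close>.\<close>
  define k1 where "k1 = - \<bar>2 - lam\<bar>"
  have phi_le: "phi k1 \<le> 1"
  proof -
    have "sqrt (2 * pi) \<ge> 1" using pi_ge_two by simp
    then have "1 / sqrt (2 * pi) \<le> 1" by simp
    moreover have "exp (- k1\<^sup>2 / 2) \<le> 1" by simp
    ultimately show ?thesis unfolding std_normal_density_def by (intro mult_le_one) auto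
  qed
  have half: "1 - Phi k1 \<ge> 1 / 2"
  proof -
    have "Phi k1 \<le> Phi 0" using Phi_strict_mono[of k1 0] by (cases "k1 = 0") (auto simp: k1_def)
    moreover have "Phi 0 = 1 / 2" using Phi_minus[of 0] by simp
    ultimately show ?thesis by simp
  qed
  have "(1 - Phi k1) / phi k1 \<ge> 1 / 2"
    using phi_le half phi_pos[of k1] by (simp add: field_simps)
  then have "k1 * ((1 - Phi k1) / phi k1) \<le> k1 * (1 / 2)"
    by (intro mult_left_mono_neg) (auto simp: k1_def)
  then have g1: "g_fun k1 \<le> 1 - lam / 2" unfolding g_fun_eq k1_def by simp
  \<comment> \<open>Positivity of \<open>q2 (- k2)\<close> says
    \<open>g_fun k2 > k2^2 / (k2^2 + 1)\<close>; with \<open>k2^2 = 2 / lam\<close> the right side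
    is \<open>1 - lam / (lam + 2)\<close>, which is at least \<open>1 - lam / 2\<close>.\<close>
  define k2 where "k2 = sqrt (2 / lam)"
  have k2: "k2 > 0" "k2\<^sup>2 = 2 / lam" using assms by (auto simp: k2_def)
  have "0 < q2 (- k2)" by (rule q2_pos)
  then have "(k2\<^sup>2 + 1) * (1 - Phi k2) > k2 * phi k2"
    by (simp add: q2_def Phi_minus std_normal_density_def)
  then have "k2 * ((k2\<^sup>2 + 1) * (1 - Phi k2)) > k2 * (k2 * phi k2)" using k2 by simp
  then have "(k2\<^sup>2 + 1) * g_fun k2 > k2\<^sup>2"
    using phi_pos[of k2] by (simp add: g_fun_eq field_simps power2_eq_square del: phi_pos)
  then have "g_fun k2 > k2\<^sup>2 / (k2\<^sup>2 + 1)"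
    by (simp add: field_simps add_pos_nonneg power2_eq_square sum_squares_gt_zero_iff)
  also have "k2\<^sup>2 / (k2\<^sup>2 + 1) = 1 - lam / (lam + 2)" using assms unfolding k2(2) by (simp add: field_simps)
  finally have "1 - lam / (lam + 2) < g_fun k2" .
  moreover have "1 - lam / 2 \<le> 1 - lam / (lam + 2)" using assms by (simp add: field_simps)
  ultimately have g2: "1 - lam / 2 \<le> g_fun k2" by linarith
  have "k1 \<le> k2" using k2 by (simp add: k1_def)
  from IVT'[of g_fun k1 _ k2, OF g1 g2 this cont] obtain k where "g_fun k = 1 - lam / 2" by blast
  then show ?thesis
    by (metis g_fun_strict_mono less_irrefl linorder_neqE_linordered_idom)
qed

lemma q1_minus: "q1 (- k) = phi k - k * (1 - Phi k)"
  by (simp add: q1_def Phi_minus std_normal_density_def)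

locale stefan =
  fixes lam k :: real
  assumes lam_pos: "lam > 0" and g_k: "g_fun k = 1 - lam / 2"
begin

lemma lam_eq: "lam * phi k = 2 * q1 (- k)"
  using g_k phi_pos[of k] unfolding g_fun_eq q1_minus by (simp add: field_simps del: phi_pos)

text \<open>\<open>c1\<close> is the limit of the profile \<open>c1 + c2 * Phi\<close> at minus
  infinity, so its positivity keeps the profile away from 0. For \<open>k \<ge> 0\<close> the
  equation forces \<open>lam \<le> 2\<close>; for \<open>k < 0\<close>, inserting
  \<open>lam * phi k = 2 * q1 (- k)\<close> reduces the claim to \<open>q1 k > 0\<close>.\<close>

lemma c1_pos: "0 < c1 lam k"
proof -
  have "lam * Phi k < 2"
  proof (cases "k \<ge> 0")
    case True
    have "g_fun k \<ge> 0" unfolding g_fun_eq using True Phi_bounds[of k]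
      by (intro divide_nonneg_pos mult_nonneg_nonneg) auto
    then have "lam \<le> 2" using g_k by simp
    then have "lam * Phi k \<le> 2 * Phi k" using Phi_bounds[of k] by (simp add: mult_right_mono)
    then show ?thesis using Phi_bounds[of k] by linarith
  next
    case False
    have "phi k > - k * Phi k" using q1_pos[of k] by (simp add: q1_def)
    then have "(1 - Phi k) * phi k > (1 - Phi k) * (- k * Phi k)"
      using Phi_bounds[of k] by (intro mult_strict_left_mono) auto
    then have "2 * q1 (- k) * Phi k < 2 * phi k" unfolding q1_minus by (simp add: algebra_simps)
    moreover have "lam * Phi k * phi k = 2 * q1 (- k) * Phi k" by (simp add: lam_eq[symmetric])
    ultimately have "lam * Phi k * phi k < 2 * phi k" by (simp only:)
    then show ?thesis using mult_less_cancel_right_pos[OF phi_pos] by blast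
  qed
  then show ?thesis unfolding c1_def using Phi_bounds[of k] by (intro divide_pos_pos) auto
qed

end

section \<open>The heat semigroup\<close>

text \<open>An image of the standard normal law rather than a density, so that \<open>t = 0\<close>
  is included and gives the point mass at 0.\<close>

definition gauss :: "real \<Rightarrow> real measure" where
  "gauss t = distr std_normal_distribution borel (\<lambda>n. sqrt t * n)"

lemma space_gauss[simp]: "space (gauss t) = UNIV" and sets_gauss[simp, measurable_cong]: "sets (gauss t) = sets borel"
  by (simp_all add: gauss_def)

lemma prob_space_gauss: "prob_space (gauss t)"
  unfolding gauss_def by (rule N01.prob_space_distr) simp

lemma sigma_finite_gauss: "sigma_finite_measure (gauss t)"
  using prob_space_gauss[of t] by (simp add: prob_space_imp_sigma_finite)

lemma nn_integral_gauss:
  "f \<in> borel_measurable borel \<Longrightarrow>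
    (\<integral>\<^sup>+w. f w \<partial>gauss t) = (\<integral>\<^sup>+n. f (sqrt t * n) \<partial>std_normal_distribution)"
  unfolding gauss_def by (subst nn_integral_distr) auto

lemma integral_gauss:
  fixes f :: "real \<Rightarrow> real"
  shows "f \<in> borel_measurable borel \<Longrightarrow>
    (\<integral>w. f w \<partial>gauss t) = (\<integral>n. f (sqrt t * n) \<partial>std_normal_distribution)"
  unfolding gauss_def by (subst integral_distr) auto

lemma integrable_gauss:
  fixes f :: "real \<Rightarrow> real"
  shows "f \<in> borel_measurable borel \<Longrightarrow>
    integrable (gauss t) f \<longleftrightarrow> integrable std_normal_distribution (\<lambda>n. f (sqrt t * n))"
  unfolding gauss_def by (subst integrable_distr_eq) auto

lemma integral_gauss_0:
  fixes f :: "real \<Rightarrow> real"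
  shows "f \<in> borel_measurable borel \<Longrightarrow> (\<integral>w. f w \<partial>gauss 0) = f 0"
  using N01.prob_space by (subst integral_gauss) auto

lemma nn_integral_gauss_0:
  "f \<in> borel_measurable borel \<Longrightarrow> (\<integral>\<^sup>+w. f w \<partial>gauss 0) = f 0"
  using N01.emeasure_space_1 by (subst nn_integral_gauss) auto

lemma gauss_density:
  assumes "t > 0"
  shows "gauss t = density lborel (\<lambda>x. ennreal (normal_density 0 (sqrt t) x))"
proof -
  have "distributed std_normal_distribution lborel (\<lambda>x. x) std_normal_density"
    unfolding distributed_def by (auto intro: distr_cong simp: distr_id2)
  from N01.normal_density_affine[OF this, of "sqrt t" 0] assms
  have "distr std_normal_distribution lborel (\<lambda>x. sqrt t * x) = density lborel (\<lambda>x. ennreal (normal_density 0 (sqrt t) x))"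
    by (simp add: distributed_def)
  then show ?thesis unfolding gauss_def by (metis distr_cong sets_lborel)
qed

lemma distributed_gauss:
  assumes "distributed M lborel X (\<lambda>x. ennreal (normal_density 0 (sqrt t) x))" "t > 0"
  shows "distr M borel X = gauss t"
  using assms unfolding gauss_density[OF assms(2)] distributed_def by (metis distr_cong sets_lborel)

text \<open>Convolution of centred normal laws, for nonnegative integrals, where Tonelli asks for
  measurability alone. The degenerate times have no density and are split off.\<close>

lemma gauss_semigroup:
  assumes [measurable]: "f \<in> borel_measurable borel" and "s \<ge> 0" "t \<ge> 0"
  shows "(\<integral>\<^sup>+x. (\<integral>\<^sup>+y. f (x + y) \<partial>gauss t) \<partial>gauss s) = (\<integral>\<^sup>+z. f z \<partial>gauss (s + t))"
proof -
  interpret t: sigma_finite_measure "gauss t" by (rule sigma_finite_gauss)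
  consider "s = 0" | "t = 0" | "s > 0" "t > 0" using assms by linarith
  then show ?thesis
  proof cases
    case 1 then show ?thesis by (simp add: nn_integral_gauss_0)
  next
    case 2 then show ?thesis by (simp add: nn_integral_gauss_0)
  next
    case 3
    let ?s = "normal_density 0 (sqrt s)" and ?t = "normal_density 0 (sqrt t)"
    have "(\<integral>\<^sup>+x. (\<integral>\<^sup>+y. f (x + y) \<partial>gauss t) \<partial>gauss s)
        = (\<integral>\<^sup>+x. ?s x * (\<integral>\<^sup>+y. ?t y * f (x + y) \<partial>lborel) \<partial>lborel)"
    proof -
      have "(\<integral>\<^sup>+x. (\<integral>\<^sup>+y. f (x + y) \<partial>gauss t) \<partial>gauss s) = (\<integral>\<^sup>+x. ?s x * (\<integral>\<^sup>+y. f (x + y) \<partial>gauss t) \<partial>lborel)"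
        unfolding gauss_density[OF 3(1)] by (rule nn_integral_density) measurable
      also have "\<dots> = (\<integral>\<^sup>+x. ?s x * (\<integral>\<^sup>+y. ?t y * f (x + y) \<partial>lborel) \<partial>lborel)"
        unfolding gauss_density[OF 3(2)] by (simp add: nn_integral_density)
      finally show ?thesis .
    qed
    also have "\<dots> = (\<integral>\<^sup>+x. ?s x * (\<integral>\<^sup>+z. ?t (z - x) * f z \<partial>lborel) \<partial>lborel)"
    proof (rule nn_integral_cong, rule arg_cong2[where f="(*)", OF refl])
      fix x :: real
      show "(\<integral>\<^sup>+y. ?t y * f (x + y) \<partial>lborel) = (\<integral>\<^sup>+z. ?t (z - x) * f z \<partial>lborel)"
        by (subst nn_integral_real_affine[where c=1 and t="-x"]) auto
    qed
    also have "\<dots> = (\<integral>\<^sup>+x. (\<integral>\<^sup>+z. f z * ennreal (?t (z - x) * ?s x) \<partial>lborel) \<partial>lborel)"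
      by (subst nn_integral_cmult[symmetric])
         (auto intro!: nn_integral_cong simp: ennreal_mult'' mult_ac)
    also have "\<dots> = (\<integral>\<^sup>+z. (\<integral>\<^sup>+x. f z * ennreal (?t (z - x) * ?s x) \<partial>lborel) \<partial>lborel)"
      by (rule lborel_pair.Fubini') measurable
    also have "\<dots> = (\<integral>\<^sup>+z. f z * ennreal (normal_density 0 (sqrt (s + t)) z) \<partial>lborel)"
    proof (intro nn_integral_cong)
      fix z
      have "(\<integral>\<^sup>+x. ennreal (?t (z - x) * ?s x) \<partial>lborel) = ennreal (normal_density 0 (sqrt (s + t)) z)"
        using fun_cong[OF conv_normal_density_zero_mean[of "sqrt t" "sqrt s"], of z] 3
        by (simp add: add.commute)
      then show "(\<integral>\<^sup>+x. f z * ennreal (?t (z - x) * ?s x) \<partial>lborel) = f z * ennreal (normal_density 0 (sqrt (s + t)) z)"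
        by (subst nn_integral_cmult) auto
    qed
    also have "\<dots> = (\<integral>\<^sup>+z. f z \<partial>gauss (s + t))"
      using 3 by (subst gauss_density) (auto simp: nn_integral_density mult.commute)
    finally show ?thesis .
  qed
qed

section \<open>Gaussian moments\<close>

lemma N01_exp: "integrable std_normal_distribution (\<lambda>n. exp (c * n))"
  and integral_N01_exp: "(\<integral>n. exp (c * n) \<partial>std_normal_distribution) = exp (c\<^sup>2 / 2)"
proof -
  \<comment> \<open>Completing the square moves the centre of the density to
    \<open>c\<close>.\<close>
  have *: "phi n * exp (c * n) = exp (c\<^sup>2 / 2) * normal_density c 1 n" for n
    by (simp add: normal_density_def mult_exp_exp power2_eq_square field_simps)
  show "integrable std_normal_distribution (\<lambda>n. exp (c * n))"
    by (subst integrable_density) (auto simp: *)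
  show "(\<integral>n. exp (c * n) \<partial>std_normal_distribution) = exp (c\<^sup>2 / 2)"
    by (subst integral_density) (auto simp: *)
qed

lemma gauss_exp: "integrable (gauss t) (\<lambda>w. exp (c * w))"
  using N01_exp[of "c * sqrt t"] by (simp add: integrable_gauss mult.assoc)

lemma integral_gauss_exp: "t \<ge> 0 \<Longrightarrow> (\<integral>w. exp (c * w) \<partial>gauss t) = exp (c\<^sup>2 * t / 2)"
  using integral_N01_exp[of "c * sqrt t"] by (simp add: integral_gauss mult.assoc power_mult_distrib)

definition moment :: "nat \<Rightarrow> real" where
  "moment p = (\<integral>n. n ^ (2 * p) \<partial>std_normal_distribution)"

lemma N01_moment: "integrable std_normal_distribution (\<lambda>n. n ^ p)"
  by (subst integrable_density) (auto simp: integrable_std_normal_moment)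

lemma moment_eq: "moment p = fact (2 * p) / (2 ^ p * fact p)"
  unfolding moment_def by (subst integral_density) (auto simp: integral_std_normal_moment_even)

lemma moment_nonneg: "0 \<le> moment p" by (simp add: moment_eq)

lemma gauss_moment: "integrable (gauss t) (\<lambda>w. w ^ p)"
  using N01_moment by (simp add: integrable_gauss power_mult_distrib)

lemma integral_gauss_moment: "t \<ge> 0 \<Longrightarrow> (\<integral>w. w ^ (2 * p) \<partial>gauss t) = moment p * t ^ p"
  by (subst integral_gauss) (auto simp: power_mult_distrib moment_def power_mult[of "sqrt t"])

lemma integral_gauss_2: "t \<ge> 0 \<Longrightarrow> (\<integral>w. w\<^sup>2 \<partial>gauss t) = t"
  using integral_gauss_moment[of t 1] by (simp add: moment_eq)

lemma integral_gauss_4: "t \<ge> 0 \<Longrightarrow> (\<integral>w. w ^ 4 \<partial>gauss t) = 3 * t\<^sup>2"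
  using integral_gauss_moment[of t 2] by (simp add: moment_eq fact_numeral)

lemma integral_gauss_1: "(\<integral>w. w \<partial>gauss t) = 0"
proof -
  have "(\<integral>n. n \<partial>std_normal_distribution) = 0"
    by (subst integral_density) (use integral_std_normal_moment_odd[of 0] in auto)
  then show ?thesis by (subst integral_gauss) auto
qed

section \<open>The heat semigroup on functions of exponential growth\<close>

definition heat :: "real \<Rightarrow> (real \<Rightarrow> real) \<Rightarrow> real \<Rightarrow> real" where
  "heat t f x = (\<integral>w. f (x - w) \<partial>gauss t)"

text \<open>The rate 2 is that of the weight \<open>exp (2 * x + 2 * t)\<close> in the maximum
  principle; the class contains this weight as well as \<open>G\<close> and the limit, which grow
  polynomially.\<close>

definition exp_bounded :: "(real \<Rightarrow> real) \<Rightarrow> bool" where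
  "exp_bounded f \<longleftrightarrow> f \<in> borel_measurable borel \<and> (\<exists>C. \<forall>x. \<bar>f x\<bar> \<le> C * exp (2 * \<bar>x\<bar>))"

lemma exp_boundedI: "f \<in> borel_measurable borel \<Longrightarrow> (\<And>x. \<bar>f x\<bar> \<le> C * exp (2 * \<bar>x\<bar>)) \<Longrightarrow> exp_bounded f"
  unfolding exp_bounded_def by blast

lemma exp_bounded_measurable[measurable_dest]: "exp_bounded f \<Longrightarrow> f \<in> borel_measurable borel"
  unfolding exp_bounded_def by blast

lemma exp_bounded_integrable:
  assumes "exp_bounded f" shows "integrable (gauss t) (\<lambda>w. f (x - w))"
proof -
  obtain C where C: "\<And>x. \<bar>f x\<bar> \<le> C * exp (2 * \<bar>x\<bar>)" using assms unfolding exp_bounded_def by blast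
  note [measurable] = exp_bounded_measurable[OF assms]
  have C0: "C \<ge> 0" using C[of 0] by simp
  show ?thesis
  proof (rule Bochner_Integration.integrable_bound)
    show "integrable (gauss t) (\<lambda>w. C * exp (2 * \<bar>x\<bar>) * (exp (2 * w) + exp ((-2) * w)))"
      using gauss_exp[of t 2] gauss_exp[of t "-2"] by simp
    show "AE w in gauss t. norm (f (x - w)) \<le> norm (C * exp (2 * \<bar>x\<bar>) * (exp (2 * w) + exp (- 2 * w)))"
    proof (rule AE_I2)
      fix w
      have "\<bar>f (x - w)\<bar> \<le> C * exp (2 * \<bar>x - w\<bar>)" by (rule C)
      also have "\<dots> \<le> C * (exp (2 * \<bar>x\<bar>) * (exp (2 * w) + exp (- 2 * w)))"
      proof (rule mult_left_mono[OF _ C0])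
        have "exp (2 * \<bar>x - w\<bar>) \<le> exp (2 * \<bar>x\<bar> + 2 * \<bar>w\<bar>)"
          using abs_triangle_ineq4[of x w] by simp
        also have "\<dots> = exp (2 * \<bar>x\<bar>) * exp (2 * \<bar>w\<bar>)" by (rule exp_add)
        also have "exp (2 * \<bar>w\<bar>) \<le> exp (2 * w) + exp (- 2 * w)" by (cases "w \<ge> 0") auto
        finally show "exp (2 * \<bar>x - w\<bar>) \<le> exp (2 * \<bar>x\<bar>) * (exp (2 * w) + exp (- 2 * w))" by simp
      qed
      finally show "norm (f (x - w)) \<le> norm (C * exp (2 * \<bar>x\<bar>) * (exp (2 * w) + exp (- 2 * w)))"
        using C0 by (simp add: mult.assoc)
    qed
  qed measurable
qed

lemma exp_bounded_poly:
  assumes "f \<in> borel_measurable borel" "\<And>x. \<bar>f x\<bar> \<le> C * (1 + x\<^sup>2)"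
  shows "exp_bounded f"
proof (rule exp_boundedI[OF assms(1)])
  fix x :: real
  have C: "C \<ge> 0" using assms(2)[of 0] by simp
  have "1 + x\<^sup>2 \<le> exp (2 * \<bar>x\<bar>)"
  proof -
    have "1 + 2 * \<bar>x\<bar> + (2 * \<bar>x\<bar>)\<^sup>2 / 2 \<le> exp (2 * \<bar>x\<bar>)"
      by (rule exp_lower_Taylor_quadratic) simp
    then have "1 + 2 * \<bar>x\<bar> + 2 * x\<^sup>2 \<le> exp (2 * \<bar>x\<bar>)" by (simp add: power_mult_distrib)
    then show ?thesis using zero_le_power2[of x] abs_ge_zero[of x] by linarith
  qed
  then show "\<bar>f x\<bar> \<le> C * exp (2 * \<bar>x\<bar>)" using assms(2)[of x] C
    by (meson mult_left_mono order_trans)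
qed

lemma exp_bounded_add: "exp_bounded f \<Longrightarrow> exp_bounded g \<Longrightarrow> exp_bounded (\<lambda>x. f x + g x)"
proof -
  assume f: "exp_bounded f" and g: "exp_bounded g"
  obtain C where C: "\<And>x. \<bar>f x\<bar> \<le> C * exp (2 * \<bar>x\<bar>)" using f unfolding exp_bounded_def by blast
  obtain D where D: "\<And>x. \<bar>g x\<bar> \<le> D * exp (2 * \<bar>x\<bar>)" using g unfolding exp_bounded_def by blast
  note [measurable] = exp_bounded_measurable[OF f] exp_bounded_measurable[OF g]
  show ?thesis
  proof (rule exp_boundedI[where C="C + D"])
    show "\<bar>f x + g x\<bar> \<le> (C + D) * exp (2 * \<bar>x\<bar>)" for x
      using C[of x] D[of x] by (simp add: ring_distribs)
  qed measurable
qed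

lemma exp_bounded_cmult: "exp_bounded f \<Longrightarrow> exp_bounded (\<lambda>x. c * f x)"
proof -
  assume f: "exp_bounded f"
  obtain C where C: "\<And>x. \<bar>f x\<bar> \<le> C * exp (2 * \<bar>x\<bar>)" using f unfolding exp_bounded_def by blast
  note [measurable] = exp_bounded_measurable[OF f]
  show ?thesis
  proof (rule exp_boundedI[where C="\<bar>c\<bar> * C"])
    show "\<bar>c * f x\<bar> \<le> (\<bar>c\<bar> * C) * exp (2 * \<bar>x\<bar>)" for x
      using mult_left_mono[OF C[of x], of "\<bar>c\<bar>"] by (simp add: abs_mult mult.assoc)
  qed measurable
qed

lemma exp_bounded_diff: "exp_bounded f \<Longrightarrow> exp_bounded g \<Longrightarrow> exp_bounded (\<lambda>x. f x - g x)"
  using exp_bounded_add[of f "\<lambda>x. (-1) * g x"] exp_bounded_cmult[of g "-1"] by simp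

lemma exp_bounded_const: "exp_bounded (\<lambda>x. c)"
proof (rule exp_bounded_poly[where C="\<bar>c\<bar>"])
  show "\<bar>c\<bar> \<le> \<bar>c\<bar> * (1 + x\<^sup>2)" for x by (simp add: algebra_simps)
qed simp

lemma exp_bounded_mono:
  assumes "exp_bounded g" "f \<in> borel_measurable borel" "\<And>x. \<bar>f x\<bar> \<le> g x"
  shows "exp_bounded f"
proof -
  obtain C where C: "\<And>x. \<bar>g x\<bar> \<le> C * exp (2 * \<bar>x\<bar>)" using assms(1) unfolding exp_bounded_def by blast
  show ?thesis
  proof (rule exp_boundedI[OF assms(2)])
    show "\<bar>f x\<bar> \<le> C * exp (2 * \<bar>x\<bar>)" for x using C[of x] assms(3)[of x] by linarith
  qed
qed

lemma heat_add: "exp_bounded f \<Longrightarrow> exp_bounded g \<Longrightarrow> heat t (\<lambda>x. f x + g x) x = heat t f x + heat t g x"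
  unfolding heat_def by (intro Bochner_Integration.integral_add exp_bounded_integrable)

lemma heat_diff: "exp_bounded f \<Longrightarrow> exp_bounded g \<Longrightarrow> heat t (\<lambda>x. f x - g x) x = heat t f x - heat t g x"
  unfolding heat_def by (intro Bochner_Integration.integral_diff exp_bounded_integrable)

lemma heat_cmult: "heat t (\<lambda>x. c * f x) x = c * heat t f x"
  unfolding heat_def by simp

lemma heat_const: "heat t (\<lambda>x. c) x = c"
proof -
  interpret prob_space "gauss t" by (rule prob_space_gauss)
  show ?thesis unfolding heat_def using prob_space by simp
qed

lemma heat_mono: "exp_bounded f \<Longrightarrow> exp_bounded g \<Longrightarrow> (\<And>y. f y \<le> g y) \<Longrightarrow> heat t f x \<le> heat t g x"
  unfolding heat_def by (intro integral_mono exp_bounded_integrable)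

lemma exp_bounded_exp: "exp_bounded (\<lambda>x. exp (2 * x))"
  by (rule exp_boundedI[where C=1]) auto

lemma heat_exp: "t \<ge> 0 \<Longrightarrow> heat t (\<lambda>x. exp (2 * x)) x = exp (2 * x + 2 * t)"
proof -
  assume t: "t \<ge> 0"
  have "heat t (\<lambda>x. exp (2 * x)) x = (\<integral>w. exp (2 * x) * exp ((-2) * w) \<partial>gauss t)"
    unfolding heat_def by (simp add: exp_add[symmetric] algebra_simps)
  also have "\<dots> = exp (2 * x) * exp ((-2)\<^sup>2 * t / 2)" using integral_gauss_exp[OF t, of "-2"] by simp
  finally show ?thesis by (simp add: exp_add)
qed

lemma exp_bounded_sq: "exp_bounded (\<lambda>x. x\<^sup>2)"
  by (rule exp_bounded_poly[where C=1]) auto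

lemma heat_sq: "t \<ge> 0 \<Longrightarrow> heat t (\<lambda>x. x\<^sup>2) x = x\<^sup>2 + t"
proof -
  assume t: "t \<ge> 0"
  have 1: "(\<lambda>w. (x - w)\<^sup>2) = (\<lambda>w. x\<^sup>2 - 2 * x * w + w\<^sup>2)" by (simp add: power2_diff algebra_simps)
  interpret prob_space "gauss t" by (rule prob_space_gauss)
  show ?thesis unfolding heat_def 1
    using t gauss_moment[of t 1] gauss_moment[of t 2]
    using prob_space by (simp add: integral_gauss_1 integral_gauss_2)
qed

text \<open>For \<open>t > 0\<close> this is \<open>t * q2 (x / sqrt t)\<close>. The continued limit
  \<open>G0\<close> is a combination of \<open>Q2\<close>, \<open>x^2\<close> and a constant in
  \<open>x\<close>, so the semigroup property yields its evolution exactly.\<close>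

definition Q2 :: "real \<Rightarrow> real \<Rightarrow> real" where
  "Q2 t = heat t (\<lambda>y. (max 0 y)\<^sup>2 / 2)"

lemma exp_bounded_possq: "exp_bounded (\<lambda>y. (max 0 y)\<^sup>2 / 2)"
  by (rule exp_bounded_poly[where C=1]) (auto simp: max_def)

lemma Q2_nn: "ennreal (Q2 t x) = (\<integral>\<^sup>+w. ennreal ((max 0 (x - w))\<^sup>2 / 2) \<partial>gauss t)"
  unfolding Q2_def heat_def
  by (rule nn_integral_eq_integral[symmetric]) (auto intro: exp_bounded_integrable[OF exp_bounded_possq])

lemma Q2_nonneg: "0 \<le> Q2 t x"
  unfolding Q2_def heat_def by (intro integral_nonneg_AE) auto

lemma Q2_le: "t \<ge> 0 \<Longrightarrow> Q2 t x \<le> x\<^sup>2 + t"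
proof -
  assume t: "t \<ge> 0"
  have "Q2 t x \<le> heat t (\<lambda>x. x\<^sup>2) x"
    unfolding Q2_def by (rule heat_mono[OF exp_bounded_possq exp_bounded_sq]) (auto simp: max_def)
  with heat_sq[OF t] show ?thesis by simp
qed

lemma Q2_0: "Q2 0 x = (max 0 x)\<^sup>2 / 2"
  unfolding Q2_def heat_def by (subst integral_gauss_0) auto

lemma Q2_pos_time: "t > 0 \<Longrightarrow> Q2 t x = t * q2 (x / sqrt t)"
proof -
  assume t: "t > 0"
  have "ennreal (Q2 t x) = (\<integral>\<^sup>+n. ennreal (t * ((max 0 (x / sqrt t - n))\<^sup>2 / 2)) \<partial>std_normal_distribution)"
    unfolding Q2_nn
  proof (subst nn_integral_gauss, simp, intro nn_integral_cong arg_cong[where f=ennreal])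
    fix n
    have "x - sqrt t * n = sqrt t * (x / sqrt t - n)" using t by (simp add: algebra_simps)
    then have "max 0 (x - sqrt t * n) = sqrt t * max 0 (x / sqrt t - n)"
      using t by (simp only:) (auto simp: max_def zero_le_mult_iff)
    then show "(max 0 (x - sqrt t * n))\<^sup>2 / 2 = t * ((max 0 (x / sqrt t - n))\<^sup>2 / 2)"
      using t by (simp add: power_mult_distrib)
  qed
  also have "\<dots> = ennreal t * ennreal (q2 (x / sqrt t))"
    by (subst nn_integral_pos_part_sq_N01[symmetric], subst nn_integral_cmult[symmetric])
       (use t in \<open>auto intro!: nn_integral_cong simp: ennreal_mult'[symmetric]\<close>)
  also have "\<dots> = ennreal (t * q2 (x / sqrt t))" using t by (simp add: ennreal_mult')
  finally show ?thesis using Q2_nonneg t q2_pos[of "x / sqrt t"] by (subst (asm) ennreal_inj) auto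
qed

lemma Q2_measurable[measurable]: "Q2 t \<in> borel_measurable borel"
proof -
  have "(\<lambda>x. \<integral>\<^sup>+w. ennreal ((max 0 (x - w))\<^sup>2 / 2) \<partial>gauss t) \<in> borel_measurable borel"
  proof -
    interpret sigma_finite_measure "gauss t" by (rule sigma_finite_gauss)
    show ?thesis by measurable
  qed
  then have "(\<lambda>x. enn2real (ennreal (Q2 t x))) \<in> borel_measurable borel" unfolding Q2_nn by measurable
  then show ?thesis by (simp add: Q2_nonneg)
qed

lemma exp_bounded_Q2: "t \<ge> 0 \<Longrightarrow> exp_bounded (Q2 t)"
proof (rule exp_bounded_poly[where C="1 + t"])
  fix x :: real assume t: "t \<ge> 0"
  have "\<bar>Q2 t x\<bar> \<le> x\<^sup>2 + t" using Q2_nonneg[of t x] Q2_le[OF t, of x] by simp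
  also have "\<dots> \<le> (1 + t) * (1 + x\<^sup>2)" using t by (simp add: algebra_simps)
  finally show "\<bar>Q2 t x\<bar> \<le> (1 + t) * (1 + x\<^sup>2)" .
qed simp

lemma heat_Q2: "s \<ge> 0 \<Longrightarrow> t \<ge> 0 \<Longrightarrow> heat s (Q2 t) x = Q2 (s + t) x"
proof -
  assume s: "s \<ge> 0" and t: "t \<ge> 0"
  interpret sigma_finite_measure "gauss t" by (rule sigma_finite_gauss)
  have "ennreal (heat s (Q2 t) x) = (\<integral>\<^sup>+w. ennreal (Q2 t (x - w)) \<partial>gauss s)"
    unfolding heat_def
    by (rule nn_integral_eq_integral[symmetric])
       (auto intro: exp_bounded_integrable[OF exp_bounded_Q2[OF t]] simp: Q2_nonneg)
  also have "\<dots> = (\<integral>\<^sup>+w. (\<integral>\<^sup>+v. ennreal ((max 0 (x - (w + v)))\<^sup>2 / 2) \<partial>gauss t) \<partial>gauss s)"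
    unfolding Q2_nn by (simp add: diff_diff_add)
  also have "\<dots> = ennreal (Q2 (s + t) x)"
    unfolding Q2_nn by (rule gauss_semigroup[OF _ s t, where f="\<lambda>w. ennreal ((max 0 (x - w))\<^sup>2 / 2)"]) measurable
  finally show ?thesis
    by (subst (asm) ennreal_inj) (auto simp: Q2_nonneg heat_def intro!: integral_nonneg_AE)
qed

text \<open>Writing the Gaussian variable as \<open>sqrt t\<close> times a fixed standard normal
  moves both parameters into the integrand; dominated convergence then gives joint continuity down
  to \<open>t = 0\<close>.\<close>

lemma tendsto_Q2:
  assumes x: "(\<lambda>n::nat. xs n) \<longlonglongrightarrow> x" and t: "(\<lambda>n. ts n) \<longlonglongrightarrow> t"
  shows "(\<lambda>n. Q2 (ts n) (xs n)) \<longlonglongrightarrow> Q2 t x"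
proof -
  obtain Bx where Bx: "\<And>n. \<bar>xs n\<bar> \<le> Bx"
    using convergent_imp_Bseq[OF convergentI[OF x]] by (auto simp: Bseq_def)
  obtain Bt where Bt: "\<And>n. \<bar>sqrt (ts n)\<bar> \<le> Bt"
    using convergent_imp_Bseq[OF convergentI[OF tendsto_real_sqrt[OF t]]] by (auto simp: Bseq_def)
  have Q2_eq: "Q2 t x = (\<integral>n. (max 0 (x - sqrt t * n))\<^sup>2 / 2 \<partial>std_normal_distribution)" for t x
    unfolding Q2_def heat_def by (subst integral_gauss) auto
  show ?thesis unfolding Q2_eq
  proof (rule integral_dominated_convergence)
    show "integrable std_normal_distribution (\<lambda>n. Bx\<^sup>2 + Bt\<^sup>2 * n\<^sup>2)"
      using N01_moment[of 2] N01.prob_space by simp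
    show "AE n in std_normal_distribution. (\<lambda>i. (max 0 (xs i - sqrt (ts i) * n))\<^sup>2 / 2)
        \<longlonglongrightarrow> (max 0 (x - sqrt t * n))\<^sup>2 / 2"
      by (intro AE_I2 tendsto_intros x t) simp
    show "AE n in std_normal_distribution. norm ((max 0 (xs i - sqrt (ts i) * n))\<^sup>2 / 2) \<le> Bx\<^sup>2 + Bt\<^sup>2 * n\<^sup>2" for i
    proof (rule AE_I2)
      fix n
      have "(max 0 (xs i - sqrt (ts i) * n))\<^sup>2 \<le> (xs i - sqrt (ts i) * n)\<^sup>2" by (simp add: max_def)
      also have "\<dots> \<le> 2 * (xs i)\<^sup>2 + 2 * (sqrt (ts i) * n)\<^sup>2"
        using sum_squares_bound[of "xs i" "- (sqrt (ts i) * n)"] by (simp add: power2_eq_square algebra_simps)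
      also have "\<dots> \<le> 2 * Bx\<^sup>2 + 2 * (Bt\<^sup>2 * n\<^sup>2)"
      proof -
        have "(xs i)\<^sup>2 \<le> Bx\<^sup>2" using Bx[of i] by (metis abs_ge_zero power2_abs power_mono)
        moreover have "(sqrt (ts i))\<^sup>2 \<le> Bt\<^sup>2" using Bt[of i] by (metis abs_ge_zero power2_abs power_mono)
        ultimately show ?thesis unfolding power_mult_distrib
          by (intro add_mono mult_left_mono mult_right_mono) auto
      qed
      finally show "norm ((max 0 (xs i - sqrt (ts i) * n))\<^sup>2 / 2) \<le> Bx\<^sup>2 + Bt\<^sup>2 * n\<^sup>2" by simp
    qed
  qed auto
qed

section \<open>The obstacle problem\<close>

text \<open>A convex function with a double zero at \<open>a\<close> decreases before
  \<open>a\<close> and increases after it.\<close>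

lemma second_deriv_nonneg_imp_nonneg:
  fixes f f' f'' :: "real \<Rightarrow> real"
  assumes f: "\<And>x. (f has_real_derivative f' x) (at x)"
    and f': "\<And>x. (f' has_real_derivative f'' x) (at x)"
    and "\<And>x. 0 \<le> f'' x" "f a = 0" "f' a = 0"
  shows "0 \<le> f x"
proof (cases "a \<le> x")
  case True
  have "f' a \<le> f' y" if "a \<le> y" for y
    by (rule DERIV_nonneg_imp_nondecreasing[OF that]) (use f' assms(3) in blast)
  then have "f a \<le> f x" using assms(5)
    by (intro DERIV_nonneg_imp_nondecreasing[OF True]) (use f in fastforce)
  then show ?thesis using assms by simp
next
  case False
  have "f' y \<le> f' a" if "y \<le> a" for y
    by (rule DERIV_nonneg_imp_nondecreasing[OF that]) (use f' assms(3) in blast)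
  then have "f a \<le> f x" using assms(5) False
    by (intro DERIV_nonpos_imp_nonincreasing[of x a f]) (use f in fastforce)+
  then show ?thesis using assms by simp
qed

section \<open>The self-similar profile and the limit function\<close>

context stefan begin

abbreviation ys :: "real \<Rightarrow> real" where "ys \<equiv> y_star k"

text \<open>\<open>Gam\<close> is the self-similar profile of the limit: \<open>Gam'' = prof\<close>, and the equation for \<open>k\<close> says precisely
  that \<open>Gam\<close> and \<open>Gam'\<close> vanish at \<open>k\<close>.\<close>

definition prof :: "real \<Rightarrow> real" where "prof x = c1 lam k + c2 lam k * Phi x"
definition m0 :: real where "m0 = min (c1 lam k) lam"
definition m1 :: real where "m1 = max (c1 lam k) lam"
definition Gam :: "real \<Rightarrow> real" where
  "Gam x = c1 lam k * (x\<^sup>2 + 1) / 2 + c2 lam k * q2 x - 1"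
definition Gam' :: "real \<Rightarrow> real" where "Gam' x = c1 lam k * x + c2 lam k * q1 x"

lemma c1_c2: "c1 lam k + c2 lam k = lam"
  using Phi_bounds[of k] by (simp add: c1_def c2_def divide_simps) (simp add: algebra_simps)

lemma m0_pos: "0 < m0" and m1_pos: "0 < m1"
  using c1_pos lam_pos by (auto simp: m0_def m1_def)

text \<open>The profile is a convex combination of its two limits, \<open>c1\<close> at minus
  infinity and \<open>lam = c1 + c2\<close> at infinity, with weight \<open>Phi x\<close> on the
  latter.\<close>

lemma prof_bounds: "m0 \<le> prof x" "prof x \<le> m1"
proof -
  have *: "prof x = (1 - Phi x) * c1 lam k + Phi x * lam"
    using arg_cong[OF c1_c2, of "\<lambda>u. Phi x * u"] by (simp add: prof_def algebra_simps)
  have P: "0 \<le> Phi x" "0 \<le> 1 - Phi x" using Phi_bounds[of x] by auto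
  have "(1 - Phi x) * m0 + Phi x * m0 \<le> (1 - Phi x) * c1 lam k + Phi x * lam"
    using P by (intro add_mono mult_left_mono) (auto simp: m0_def)
  then show "m0 \<le> prof x" unfolding * by (simp add: algebra_simps)
  have "(1 - Phi x) * c1 lam k + Phi x * lam \<le> (1 - Phi x) * m1 + Phi x * m1"
    using P by (intro add_mono mult_left_mono) (auto simp: m1_def)
  then show "prof x \<le> m1" unfolding * by (simp add: algebra_simps)
qed

lemma Gam_deriv: "(Gam has_real_derivative Gam' x) (at x)"
  unfolding Gam_def[abs_def] Gam'_def
  by (auto intro!: derivative_eq_intros q2_deriv simp: algebra_simps)

lemma Gam'_deriv: "(Gam' has_real_derivative prof x) (at x)"
  unfolding Gam'_def[abs_def] prof_def
  by (auto intro!: derivative_eq_intros q1_deriv simp: algebra_simps)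

text \<open>The limit density takes the value 2 at the free boundary, where half the second
  derivative of the integrated count balances the unit sink.\<close>

lemma prof_k: "prof k = 2"
  using Phi_bounds[of k] by (simp add: prof_def c1_def c2_def divide_simps) (simp add: algebra_simps)

text \<open>The Stefan condition \<open>2 * y' = - u_x / 2\<close> at \<open>y = k * sqrt t\<close>,
  in self-similar variables. It is here that the equation for \<open>k\<close> enters the
  construction of the limit.\<close>

lemma c2_phi: "c2 lam k * phi k = - 2 * k"
proof -
  have "(lam - 2) * phi k = - 2 * k * (1 - Phi k)"
    using lam_eq unfolding q1_minus by (simp add: algebra_simps)
  then show ?thesis using Phi_bounds[of k] unfolding c2_def by (simp add: divide_simps mult_ac)
qed

lemma Gam'_k: "Gam' k = 0"
proof -
  have "Gam' k = k * prof k + c2 lam k * phi k"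
    by (simp add: Gam'_def prof_def q1_def algebra_simps)
  then show ?thesis unfolding prof_k c2_phi by simp
qed

lemma Gam_k: "Gam k = 0"
proof -
  have "Gam k = (k\<^sup>2 + 1) * prof k / 2 + k * (c2 lam k * phi k) / 2 - 1"
    by (simp add: Gam_def prof_def q2_def field_simps)
  then show ?thesis unfolding prof_k c2_phi by (simp add: power2_eq_square add_divide_distrib)
qed

text \<open>\<open>Gam\<close> and the parabola share the double zero at \<open>k\<close>, and
  \<open>prof_bounds\<close> orders their second derivatives. With the companion upper bound, the
  size of the limit and the squared distance from the boundary control each other.\<close>

lemma Gam_lower: "m0 * (x - k)\<^sup>2 / 2 \<le> Gam x"
proof -
  have "0 \<le> Gam x - m0 * (x - k)\<^sup>2 / 2"
  proof (rule second_deriv_nonneg_imp_nonneg[of "\<lambda>x. Gam x - m0 * (x - k)\<^sup>2 / 2" "\<lambda>x. Gam' x - m0 * (x - k)" "\<lambda>x. prof x - m0" k])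
    show "((\<lambda>x. Gam x - m0 * (x - k)\<^sup>2 / 2) has_real_derivative Gam' x - m0 * (x - k)) (at x)" for x
      by (auto intro!: derivative_eq_intros Gam_deriv)
    show "((\<lambda>x. Gam' x - m0 * (x - k)) has_real_derivative prof x - m0) (at x)" for x
      by (auto intro!: derivative_eq_intros Gam'_deriv)
  qed (use prof_bounds in \<open>auto simp: Gam_k Gam'_k\<close>)
  then show ?thesis by simp
qed

lemma Gam_upper: "Gam x \<le> m1 * (x - k)\<^sup>2 / 2"
proof -
  have "0 \<le> m1 * (x - k)\<^sup>2 / 2 - Gam x"
  proof (rule second_deriv_nonneg_imp_nonneg[of "\<lambda>x. m1 * (x - k)\<^sup>2 / 2 - Gam x" "\<lambda>x. m1 * (x - k) - Gam' x" "\<lambda>x. m1 - prof x" k])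
    show "((\<lambda>x. m1 * (x - k)\<^sup>2 / 2 - Gam x) has_real_derivative m1 * (x - k) - Gam' x) (at x)" for x
      by (auto intro!: derivative_eq_intros Gam_deriv)
    show "((\<lambda>x. m1 * (x - k) - Gam' x) has_real_derivative m1 - prof x) (at x)" for x
      by (auto intro!: derivative_eq_intros Gam'_deriv)
  qed (use prof_bounds in \<open>auto simp: Gam_k Gam'_k\<close>)
  then show ?thesis by simp
qed

lemma Gam_mono: "k \<le> x \<Longrightarrow> x \<le> y \<Longrightarrow> Gam x \<le> Gam y"
proof -
  assume x: "k \<le> x" "x \<le> y"
  have "Gam' k \<le> Gam' z" if "k \<le> z" for z
  proof (rule DERIV_nonneg_imp_nondecreasing[OF that])
    show "\<exists>y. (Gam' has_real_derivative y) (at z) \<and> 0 \<le> y" for z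
      using Gam'_deriv[of z] prof_bounds(1)[of z] m0_pos by (intro exI[of _ "prof z"]) auto
  qed
  then show ?thesis using x
    by (intro DERIV_nonneg_imp_nondecreasing[of x y Gam]) (use Gam_deriv Gam'_k in fastforce)+
qed

text \<open>\<open>Gs t x\<close> is the integral of \<open>max 0 (x - z)\<close> against the limit density; \<open>G0\<close> is its continuation
  across the free boundary, for which the heat semigroup is explicit.\<close>

definition G0 :: "real \<Rightarrow> real \<Rightarrow> real" where
  "G0 t x = c1 lam k * (x\<^sup>2 + t) / 2 + c2 lam k * Q2 t x - t"

definition Gs :: "real \<Rightarrow> real \<Rightarrow> real" where
  "Gs t x = (if x > ys t then G0 t x else 0)"

lemma G0_alt: "G0 t = (\<lambda>x. c1 lam k / 2 * x\<^sup>2 + c2 lam k * Q2 t x + (c1 lam k * t / 2 - t))"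
  by (intro ext) (simp add: G0_def algebra_simps add_divide_distrib)

lemma G0_pos_time: "t > 0 \<Longrightarrow> G0 t x = t * Gam (x / sqrt t)"
  by (simp add: G0_def Gam_def Q2_pos_time field_simps)

lemma G0_0: "G0 0 x = (if x \<ge> 0 then lam else c1 lam k) * x\<^sup>2 / 2"
proof (cases "x \<ge> 0")
  case True
  then have "G0 0 x = (c1 lam k + c2 lam k) * x\<^sup>2 / 2" by (simp add: G0_def Q2_0 algebra_simps)
  then show ?thesis using True by (simp add: c1_c2)
qed (simp add: G0_def Q2_0)

lemma G0_bounds:
  assumes "t \<ge> 0"
  shows "m0 * (x - ys t)\<^sup>2 / 2 \<le> G0 t x" "G0 t x \<le> m1 * (x - ys t)\<^sup>2 / 2"
proof -
  have "m0 * (x - ys t)\<^sup>2 / 2 \<le> G0 t x \<and> G0 t x \<le> m1 * (x - ys t)\<^sup>2 / 2"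
  proof (cases "t = 0")
    case True
    then show ?thesis by (simp add: G0_0 y_star_def m0_def m1_def mult_right_mono)
  next
    case False
    then have t: "t > 0" using assms by simp
    have eq: "(x - ys t)\<^sup>2 = t * (x / sqrt t - k)\<^sup>2"
    proof -
      have "x - ys t = sqrt t * (x / sqrt t - k)" using t by (simp add: y_star_def algebra_simps)
      then show ?thesis using t by (simp only: power_mult_distrib) simp
    qed
    have "t * (m0 * (x / sqrt t - k)\<^sup>2 / 2) \<le> t * Gam (x / sqrt t)"
      "t * Gam (x / sqrt t) \<le> t * (m1 * (x / sqrt t - k)\<^sup>2 / 2)"
      using t Gam_lower Gam_upper by (auto intro!: mult_left_mono)
    then show ?thesis unfolding eq G0_pos_time[OF t] by (simp add: mult_ac)
  qed
  then show "m0 * (x - ys t)\<^sup>2 / 2 \<le> G0 t x" "G0 t x \<le> m1 * (x - ys t)\<^sup>2 / 2" by auto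
qed

lemma G0_nonneg: "t \<ge> 0 \<Longrightarrow> 0 \<le> G0 t x"
  by (rule order_trans[OF _ G0_bounds(1)]) (use m0_pos in auto)

lemma G0_ys: "t \<ge> 0 \<Longrightarrow> G0 t (ys t) = 0"
  using G0_bounds[of t "ys t"] by simp

lemma G0_mono: "t \<ge> 0 \<Longrightarrow> ys t \<le> x \<Longrightarrow> x \<le> y \<Longrightarrow> G0 t x \<le> G0 t y"
proof (cases "t = 0")
  case True
  assume "ys t \<le> x" "x \<le> y"
  then show ?thesis using True lam_pos by (simp add: G0_0 y_star_def power_mono)
next
  case False
  assume "t \<ge> 0" "ys t \<le> x" "x \<le> y"
  with False have t: "t > 0" by simp
  have "k \<le> x / sqrt t" "x / sqrt t \<le> y / sqrt t"
    using \<open>ys t \<le> x\<close> \<open>x \<le> y\<close> t by (auto simp: y_star_def field_simps)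
  from Gam_mono[OF this] show ?thesis using t by (simp add: G0_pos_time)
qed

lemma G0_measurable[measurable]: "G0 t \<in> borel_measurable borel"
  unfolding G0_def[abs_def] by measurable

lemma Gs_measurable[measurable]: "Gs t \<in> borel_measurable borel"
  unfolding Gs_def[abs_def] by measurable

lemma Gs_nonneg: "t \<ge> 0 \<Longrightarrow> 0 \<le> Gs t x" by (simp add: Gs_def G0_nonneg)

lemma Gs_le_G0: "t \<ge> 0 \<Longrightarrow> Gs t x \<le> G0 t x" by (simp add: Gs_def G0_nonneg)

lemma Gs_mono: "t \<ge> 0 \<Longrightarrow> x \<le> y \<Longrightarrow> Gs t x \<le> Gs t y"
  using G0_mono[of t x y] G0_nonneg[of t y] by (auto simp: Gs_def)

lemma Gs_upper: "t \<ge> 0 \<Longrightarrow> Gs t x \<le> m1 * (max 0 (x - ys t))\<^sup>2 / 2"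
  using G0_bounds(2)[of t x] m1_pos by (auto simp: Gs_def)

lemma Gs_lower: "t \<ge> 0 \<Longrightarrow> m0 * (max 0 (x - ys t))\<^sup>2 / 2 \<le> Gs t x"
  using G0_bounds(1)[of t x] m0_pos by (auto simp: Gs_def)

lemma exp_bounded_G0: "t \<ge> 0 \<Longrightarrow> exp_bounded (G0 t)"
proof -
  assume t: "t \<ge> 0"
  have "exp_bounded (\<lambda>x. c1 lam k / 2 * x\<^sup>2 + c2 lam k * Q2 t x + (c1 lam k * t / 2 - t))"
    by (intro exp_bounded_add exp_bounded_cmult exp_bounded_sq exp_bounded_Q2[OF t] exp_bounded_const)
  then show ?thesis unfolding G0_alt .
qed

lemma exp_bounded_Gs: "t \<ge> 0 \<Longrightarrow> exp_bounded (Gs t)"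
  by (rule exp_bounded_mono[OF exp_bounded_G0]) (auto simp: Gs_nonneg Gs_le_G0)

lemma heat_G0: "s \<ge> 0 \<Longrightarrow> t \<ge> 0 \<Longrightarrow> heat s (G0 t) x = G0 (t + s) x + s"
proof -
  assume s: "s \<ge> 0" and t: "t \<ge> 0"
  have "heat s (G0 t) x = heat s (\<lambda>x. c1 lam k / 2 * x\<^sup>2 + c2 lam k * Q2 t x + (c1 lam k * t / 2 - t)) x"
    by (simp add: G0_alt)
  also have "\<dots> = heat s (\<lambda>x. c1 lam k / 2 * x\<^sup>2 + c2 lam k * Q2 t x) x + (c1 lam k * t / 2 - t)"
    by (subst heat_add)
       (intro exp_bounded_add exp_bounded_cmult exp_bounded_sq exp_bounded_Q2[OF t] exp_bounded_const,
        intro exp_bounded_const, simp add: heat_const)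
  finally have 1: "heat s (G0 t) x = heat s (\<lambda>x. c1 lam k / 2 * x\<^sup>2 + c2 lam k * Q2 t x) x + (c1 lam k * t / 2 - t)" .
  have 2: "heat s (\<lambda>x. c1 lam k / 2 * x\<^sup>2 + c2 lam k * Q2 t x) x
      = c1 lam k / 2 * (x\<^sup>2 + s) + c2 lam k * Q2 (s + t) x"
    by (subst heat_add)
       (intro exp_bounded_cmult exp_bounded_sq, intro exp_bounded_cmult exp_bounded_Q2[OF t],
        simp only: heat_cmult heat_sq[OF s] heat_Q2[OF s t])
  show ?thesis unfolding 1 2 by (simp add: G0_def algebra_simps add_divide_distrib)
qed

text \<open>\<open>Gs\<close> is a solution of the parabolic obstacle problem \<open>G\<^sub>t = G\<^sub>x\<^sub>x / 2 - 1\<^bsub>G > 0\<^esub>\<close>; the next two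
  lemmas are its one-step discretisation.\<close>

lemma Gs_step_lower:
  assumes s: "s \<ge> 0" and t: "t \<ge> 0"
  shows "heat s (Gs t) x - s \<le> Gs (t + s) x"
proof -
  have le: "heat s (Gs t) y \<le> G0 (t + s) y + s" for y
    using heat_mono[OF exp_bounded_Gs[OF t] exp_bounded_G0[OF t] Gs_le_G0[OF t], of s y] heat_G0[OF s t] by simp
  show ?thesis
  proof (cases "x > ys (t + s)")
    case True then show ?thesis using le[of x] by (simp add: Gs_def)
  next
    case False
    \<comment> \<open>Heat flow preserves monotonicity, so to the left of the new boundary the value
      on the boundary dominates, and \<open>G0\<close> vanishes there.\<close>
    have "heat s (Gs t) x \<le> heat s (Gs t) (ys (t + s))"
      unfolding heat_def using False Gs_mono[OF t]
      by (intro integral_mono exp_bounded_integrable exp_bounded_Gs t) auto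
    also have "\<dots> \<le> s" using le[of "ys (t + s)"] G0_ys[of "t + s"] s t by simp
    finally show ?thesis using False by (simp add: Gs_def)
  qed
qed

lemma integral_tail:
  assumes "g > 0" "s \<ge> 0"
  shows "integrable (gauss s) (\<lambda>w. m1 / (2 * g\<^sup>2) * w ^ 4)"
    "(\<integral>w. m1 / (2 * g\<^sup>2) * w ^ 4 \<partial>gauss s) = 3 * m1 * s\<^sup>2 / (2 * g\<^sup>2)"
  using assms gauss_moment[of s 4] integral_gauss_4[of s] by auto

lemma sq_le_fourth: "0 < g \<Longrightarrow> g \<le> \<bar>w\<bar> \<Longrightarrow> w\<^sup>2 \<le> w ^ 4 / (g::real)\<^sup>2"
proof -
  assume "0 < g" "g \<le> \<bar>w\<bar>"
  then have "g\<^sup>2 \<le> w\<^sup>2" using power_mono[of g "\<bar>w\<bar>" 2] by simp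
  then have "g\<^sup>2 * w\<^sup>2 \<le> w\<^sup>2 * w\<^sup>2" by (intro mult_right_mono) auto
  then show ?thesis using \<open>0 < g\<close> by (simp add: field_simps power4_eq_xxxx power2_eq_square)
qed

lemma Gs_step_upper:
  assumes s: "s \<ge> 0" and t: "t \<ge> 0" and g: "g > 0" and x: "ys t + g \<le> x"
  shows "G0 (t + s) x \<le> heat s (Gs t) x - s + 3 * m1 * s\<^sup>2 / (2 * g\<^sup>2)"
proof -
  \<comment> \<open>\<open>G0\<close> evolves exactly, so only its excess over \<open>Gs\<close>,
    carried by points left of the boundary, is estimated. Reaching them from \<open>x\<close> takes
    a displacement of at least \<open>g\<close>, where \<open>w^2 \<le> w^4 / g^2\<close>; the
    fourth moment then makes the excess of second order in \<open>s\<close>.\<close>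
  have "heat s (\<lambda>z. G0 t z - Gs t z) x \<le> (\<integral>w. m1 / (2 * g\<^sup>2) * w ^ 4 \<partial>gauss s)"
    unfolding heat_def
  proof (rule integral_mono[OF exp_bounded_integrable[OF exp_bounded_diff[OF exp_bounded_G0[OF t] exp_bounded_Gs[OF t]]] integral_tail(1)[OF g s]])
    fix w
    show "G0 t (x - w) - Gs t (x - w) \<le> m1 / (2 * g\<^sup>2) * w ^ 4"
    proof (cases "x - w > ys t")
      case True then show ?thesis using m1_pos by (simp add: Gs_def)
    next
      case False
      have "G0 t (x - w) - Gs t (x - w) \<le> m1 * (x - w - ys t)\<^sup>2 / 2"
        using G0_bounds(2)[OF t, of "x - w"] False by (simp add: Gs_def)
      also have "\<dots> \<le> m1 * w\<^sup>2 / 2"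
      proof -
        have "\<bar>x - w - ys t\<bar> \<le> \<bar>w\<bar>" using False x g by linarith
        then have "(x - w - ys t)\<^sup>2 \<le> w\<^sup>2" by (simp add: abs_le_square_iff)
        then show ?thesis using m1_pos by (simp add: mult_left_mono)
      qed
      also have "\<dots> \<le> m1 * (w ^ 4 / g\<^sup>2) / 2"
        using sq_le_fourth[OF g, of w] False x g m1_pos by (intro divide_right_mono mult_left_mono) auto
      finally show ?thesis by (simp add: field_simps)
    qed
  qed
  then show ?thesis
    unfolding integral_tail(2)[OF g s] heat_diff[OF exp_bounded_G0[OF t] exp_bounded_Gs[OF t]] heat_G0[OF s t]
    by simp
qed

text \<open>From distance \<open>g\<close> left of the boundary, the support of \<open>Gs t\<close>
  is reached only by displacements larger than \<open>g\<close>; quadratic growth and the fourth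
  Gaussian moment leave a term of order \<open>s^2\<close>. Drift of total size \<open>s\<close>
  spent there cannot be compensated.\<close>

lemma Gs_heat_left:
  assumes s: "s \<ge> 0" and t: "t \<ge> 0" and g: "g > 0" and x: "x \<le> ys t - g"
  shows "heat s (Gs t) x \<le> 3 * m1 * s\<^sup>2 / (2 * g\<^sup>2)"
proof -
  have "heat s (Gs t) x \<le> (\<integral>w. m1 / (2 * g\<^sup>2) * w ^ 4 \<partial>gauss s)"
    unfolding heat_def
  proof (rule integral_mono[OF exp_bounded_integrable[OF exp_bounded_Gs[OF t]] integral_tail(1)[OF g s]])
    fix w
    show "Gs t (x - w) \<le> m1 / (2 * g\<^sup>2) * w ^ 4"
    proof (cases "x - w > ys t")
      case False then show ?thesis using m1_pos by (simp add: Gs_def)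
    next
      case True
      have "Gs t (x - w) \<le> m1 * (x - w - ys t)\<^sup>2 / 2"
        using G0_bounds(2)[OF t, of "x - w"] True by (simp add: Gs_def)
      also have "\<dots> \<le> m1 * w\<^sup>2 / 2"
      proof -
        have "\<bar>x - w - ys t\<bar> \<le> \<bar>w\<bar>" using True x g by linarith
        then have "(x - w - ys t)\<^sup>2 \<le> w\<^sup>2" by (simp add: abs_le_square_iff)
        then show ?thesis using m1_pos by (simp add: mult_left_mono)
      qed
      also have "\<dots> \<le> m1 * (w ^ 4 / g\<^sup>2) / 2"
        using sq_le_fourth[OF g, of w] True x g m1_pos by (intro divide_right_mono mult_left_mono) auto
      finally show ?thesis by (simp add: field_simps)
    qed
  qed
  then show ?thesis unfolding integral_tail(2)[OF g s] .
qed

lemma Gs_eq_max: "t \<ge> 0 \<Longrightarrow> Gs t x = G0 t (max x (ys t))"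
  by (auto simp: Gs_def max_def G0_ys)

text \<open>Evaluating \<open>G0\<close> at \<open>max x (ys t)\<close> removes the case distinction
  at the free boundary, and \<open>tendsto_Q2\<close> covers \<open>t = 0\<close>.\<close>

lemma continuous_on_Gs: "continuous_on ({0..} \<times> UNIV) (\<lambda>(t, x). Gs t x)"
proof -
  have "continuous_on ({0..} \<times> UNIV) (\<lambda>p. G0 (fst p) (max (snd p) (ys (fst p))))"
    unfolding continuous_on_sequentially
  proof safe
    fix u :: "nat \<Rightarrow> real \<times> real" and t x :: real
    assume "u \<longlonglongrightarrow> (t, x)"
    then have 1: "(\<lambda>n. fst (u n)) \<longlonglongrightarrow> t" "(\<lambda>n. snd (u n)) \<longlonglongrightarrow> x"
      using tendsto_fst[of u "(t,x)"] tendsto_snd[of u "(t,x)"] by auto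
    show "((\<lambda>p. G0 (fst p) (max (snd p) (ys (fst p)))) \<circ> u)
         \<longlonglongrightarrow> G0 (fst (t, x)) (max (snd (t, x)) (ys (fst (t, x))))"
      unfolding G0_def comp_def fst_conv snd_conv y_star_def
      by (intro tendsto_intros tendsto_Q2 1) simp_all
  qed
  then show ?thesis
    by (rule continuous_on_eq) (auto simp: Gs_eq_max)
qed

end

section \<open>Comparison along one path\<close>

text \<open>\<open>A i t\<close> is the drift accumulated by particle \<open>i\<close>. Assumption \<open>A_sums\<close> says that the leader is pushed at rate \<open>1 / b\<close>,
  and \<open>A_last\<close> that a particle that has moved by drift was the leader at the last moment of the push.\<close>

locale particle_path =
  fixes b :: real and X W A :: "nat \<Rightarrow> real \<Rightarrow> real"
  assumes b_pos: "b > 0"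
    and X_eq: "\<And>i t. 0 \<le> t \<Longrightarrow> X i t = X i 0 + A i t + W i t"
    and A_0: "\<And>i. A i 0 = 0"
    and A_mono: "\<And>i s t. 0 \<le> s \<Longrightarrow> s \<le> t \<Longrightarrow> A i s \<le> A i t"
    and A_sums: "\<And>s t. 0 \<le> s \<Longrightarrow> s \<le> t \<Longrightarrow> (\<lambda>i. b * (A i t - A i s)) sums (t - s)"
    and A_last: "\<And>i s t. 0 \<le> s \<Longrightarrow> s \<le> t \<Longrightarrow> A i s < A i t \<Longrightarrow>
      \<exists>u\<in>{s..t}. (\<forall>j. X i u \<le> X j u) \<and> A i t = A i u"
    and leader: "\<And>t. 0 \<le> t \<Longrightarrow> \<exists>i. \<forall>j. X i t \<le> X j t"
    and X0_nonneg: "\<And>i. 0 \<le> X i 0"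
begin

definition G :: "real \<Rightarrow> real \<Rightarrow> real" where
  "G t x = (\<Sum>i. b * max 0 (x - X i t))"

text \<open>\<open>Ghat s t\<close> belongs to the configuration at time \<open>t\<close> if the drift were switched off after time \<open>s\<close>.\<close>

definition Ghat :: "real \<Rightarrow> real \<Rightarrow> real \<Rightarrow> real" where
  "Ghat s t x = (\<Sum>i. b * max 0 (x - (X i s + W i t - W i s)))"

lemma X_diff: "0 \<le> s \<Longrightarrow> 0 \<le> t \<Longrightarrow> X i t - X i s = (A i t - A i s) + (W i t - W i s)"
  using X_eq[of s i] X_eq[of t i] by simp

end

text \<open>\<open>range\<close> lets the noise of a particle grow with its starting point, but only
  at half the rate: a particle starting far out stays beyond \<open>(X i 0 - L) / 2\<close> until
  \<open>T + 1\<close>. Sums over particles are then controlled by the single number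
  \<open>S\<close>.\<close>

locale ranged_path = particle_path +
  fixes T L S :: real
  assumes T_pos: "0 < T" and L_ge: "2 \<le> L"
    and range: "\<And>i u. 0 \<le> u \<Longrightarrow> u \<le> T + 1 \<Longrightarrow> \<bar>W i u\<bar> \<le> (L + X i 0) / 2"
    and S0_summable: "summable (\<lambda>i. 1 / (1 + X i 0)\<^sup>2)"
    and S0_le: "b * (\<Sum>i. 1 / (1 + X i 0)\<^sup>2) \<le> S"
begin

lemma X_lower:
  assumes "0 \<le> t" "t \<le> T + 1" shows "(X i 0 - L) / 2 \<le> X i t"
proof -
  have "0 \<le> A i t" using A_mono[of 0 t i] A_0[of i] assms by simp
  then show ?thesis using range[OF assms, of i] X_eq[OF assms(1), of i] by (simp add: abs_le_iff field_simps)
qed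

lemma hat_lower:
  assumes "0 \<le> s" "0 \<le> t" "t \<le> T + 1" shows "(X i 0 - L) / 2 \<le> X i s + W i t - W i s"
proof -
  have "0 \<le> A i s" using A_mono[of 0 s i] A_0[of i] assms by simp
  then show ?thesis using range[OF assms(2,3), of i] X_eq[OF assms(1), of i] by (simp add: abs_le_iff field_simps)
qed

text \<open>A particle that contributes at \<open>x\<close> started below
  \<open>r = 2 * x + L\<close> and contributes at most \<open>r\<close>, and for such a particle
  \<open>1 \<le> (1 + r)^2 / (1 + X i 0)^2\<close>.\<close>

definition Gbound :: "real \<Rightarrow> real" where
  "Gbound x = max 0 (2 * x + L) * (1 + max 0 (2 * x + L))\<^sup>2"

lemma term_bound:
  assumes "(X i 0 - L) / 2 \<le> y"
  shows "max 0 (x - y) \<le> Gbound x * (1 / (1 + X i 0)\<^sup>2)"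
proof -
  define r where "r = max 0 (2 * x + L)"
  have r: "0 \<le> r" "2 * x + L \<le> r" by (auto simp: r_def)
  show ?thesis
  proof (cases "x - y \<le> 0")
    case True then show ?thesis by (simp add: Gbound_def r_def[symmetric] r)
  next
    case False
    have *: "X i 0 \<le> r" using False assms r by (simp add: field_simps)
    have "(1 + X i 0)\<^sup>2 \<le> (1 + r)\<^sup>2" using * X0_nonneg[of i] by (intro power_mono) auto
    then have "1 \<le> (1 + r)\<^sup>2 * (1 / (1 + X i 0)\<^sup>2)"
      using X0_nonneg[of i] by (simp add: field_simps)
    then have "r * 1 \<le> r * ((1 + r)\<^sup>2 * (1 / (1 + X i 0)\<^sup>2))" using r by (intro mult_left_mono) auto
    moreover have "x - y \<le> r" using assms r X0_nonneg[of i] by (simp add: field_simps)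
    ultimately show ?thesis using r(1) by (simp add: Gbound_def r_def[symmetric])
  qed
qed

lemma sum_bound:
  assumes "\<And>i. (X i 0 - L) / 2 \<le> y i"
  shows "summable (\<lambda>i. b * max 0 (x - y i))" "(\<Sum>i. b * max 0 (x - y i)) \<le> Gbound x * S"
    "0 \<le> (\<Sum>i. b * max 0 (x - y i))"
proof -
  have le: "b * max 0 (x - y i) \<le> Gbound x * (b * (1 / (1 + X i 0)\<^sup>2))" for i
    using mult_left_mono[OF term_bound[OF assms, of x i], of b] b_pos by (simp add: mult_ac)
  have sm: "summable (\<lambda>i. Gbound x * (b * (1 / (1 + X i 0)\<^sup>2)))"
    by (intro summable_mult S0_summable)
  show s: "summable (\<lambda>i. b * max 0 (x - y i))"
    using le b_pos by (intro summable_comparison_test'[OF sm]) auto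
  have "(\<Sum>i. b * max 0 (x - y i)) \<le> (\<Sum>i. Gbound x * (b * (1 / (1 + X i 0)\<^sup>2)))"
    by (intro suminf_le le s sm)
  also have "\<dots> = Gbound x * (b * (\<Sum>i. 1 / (1 + X i 0)\<^sup>2))"
    by (subst suminf_mult[OF summable_mult[OF S0_summable]], subst suminf_mult[OF S0_summable]) (rule refl)
  also have "\<dots> \<le> Gbound x * S" by (intro mult_left_mono S0_le) (simp add: Gbound_def)
  finally show "(\<Sum>i. b * max 0 (x - y i)) \<le> Gbound x * S" .
  show "0 \<le> (\<Sum>i. b * max 0 (x - y i))" using b_pos by (intro suminf_nonneg s) auto
qed

lemma S_nonneg: "0 \<le> S"
proof -
  have "0 \<le> b * (\<Sum>i. 1 / (1 + X i 0)\<^sup>2)"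
    using b_pos by (intro mult_nonneg_nonneg suminf_nonneg S0_summable) auto
  then show ?thesis using S0_le by simp
qed

section \<open>The integrated count at a fixed time\<close>

context
  fixes t assumes t: "0 \<le> t" "t \<le> T + 1"
begin

lemmas G_summable = sum_bound(1)[OF X_lower[OF t]]

lemma G_le_bound: "G t x \<le> Gbound x * S" unfolding G_def by (rule sum_bound[OF X_lower[OF t]])

lemma G_nonneg: "0 \<le> G t x" unfolding G_def by (rule sum_bound[OF X_lower[OF t]])

lemma G_mono: "x \<le> y \<Longrightarrow> G t x \<le> G t y"
  unfolding G_def using b_pos by (intro suminf_le G_summable mult_left_mono) auto

lemma G_measurable[measurable]: "G t \<in> borel_measurable borel"
  by (rule borel_measurable_mono) (auto simp: mono_def G_mono)

lemma exp_bounded_G: "exp_bounded (G t)"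
proof (rule exp_boundedI[where C="27 * 8 * exp (2 * L) * S"])
  fix x :: real
  have "Gbound x \<le> 27 * 8 * exp (2 * L) * exp (2 * \<bar>x\<bar>)"
  proof -
    define r where "r = 2 * \<bar>x\<bar> + L"
    have r: "r \<ge> 0" using L_ge by (simp add: r_def)
    have "Gbound x \<le> r * (1 + r)\<^sup>2"
      unfolding Gbound_def using r L_ge by (intro mult_mono power_mono) (auto simp: r_def)
    also have "\<dots> \<le> (1 + r) * (1 + r)\<^sup>2" using r by (intro mult_right_mono) auto
    also have "\<dots> = 27 * ((1 + r) / 3) ^ 3" by (simp add: power3_eq_cube power2_eq_square)
    also have "\<dots> \<le> 27 * exp ((1 + r) / 3) ^ 3"
    proof (intro mult_left_mono power_mono)
      show "(1 + r) / 3 \<le> exp ((1 + r) / 3)" using exp_ge_add_one_self[of "(1 + r) / 3"] by linarith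
    qed (use r in auto)
    also have "\<dots> = 27 * (exp 1 * exp r)" by (simp add: exp_of_nat_mult[symmetric] exp_add[symmetric])
    also have "\<dots> \<le> 27 * (8 * exp r)" using exp_le by (intro mult_left_mono mult_right_mono) auto
    also have "exp r \<le> exp (2 * L) * exp (2 * \<bar>x\<bar>)" using L_ge by (simp add: r_def exp_add[symmetric])
    finally show ?thesis by simp
  qed
  then have "Gbound x * S \<le> 27 * 8 * exp (2 * L) * exp (2 * \<bar>x\<bar>) * S" using S_nonneg by (rule mult_right_mono)
  then show "\<bar>G t x\<bar> \<le> 27 * 8 * exp (2 * L) * S * exp (2 * \<bar>x\<bar>)"
    using G_le_bound[of x] G_nonneg[of x] by (simp add: mult_ac)
qed simp

text \<open>Shifting the argument by \<open>r\<close> costs at most \<open>r\<close> for each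
  particle left of \<open>x + r\<close>, and such a particle is at distance at least 1 from
  \<open>x + 2\<close>. The local number of particles is thereby bounded by \<open>G\<close>
  itself.\<close>

lemma G_shift_le:
  assumes "0 \<le> r" "r \<le> 1" shows "G t (x + r) \<le> G t x + r * G t (x + 2)"
proof -
  have "G t (x + r) \<le> (\<Sum>i. b * max 0 (x - X i t) + r * (b * max 0 (x + 2 - X i t)))"
    unfolding G_def
  proof (intro suminf_le)
    show "summable (\<lambda>i. b * max 0 (x + r - X i t))" by (rule G_summable)
    show "summable (\<lambda>i. b * max 0 (x - X i t) + r * (b * max 0 (x + 2 - X i t)))"
      by (rule summable_add[OF G_summable summable_mult[OF G_summable]])
    fix i
    have "max 0 (x + r - X i t) \<le> max 0 (x - X i t) + r * max 0 (x + 2 - X i t)"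
    proof (cases "x + r - X i t \<le> 0")
      case True then show ?thesis using assms by simp
    next
      case False
      have "r * 1 \<le> r * max 0 (x + 2 - X i t)" using False assms by (intro mult_left_mono) auto
      then show ?thesis using False by auto
    qed
    from mult_left_mono[OF this, of b]
    show "b * max 0 (x + r - X i t) \<le> b * max 0 (x - X i t) + r * (b * max 0 (x + 2 - X i t))"
      using b_pos by (simp add: algebra_simps)
  qed
  also have "\<dots> = G t x + r * G t (x + 2)"
    unfolding G_def
    by (subst suminf_add[OF G_summable summable_mult[OF G_summable], symmetric], subst suminf_mult[OF G_summable]) (rule refl)
  finally show ?thesis .
qed

text \<open>Read in contrapositive form: if \<open>G t x\<close> is not small while
  \<open>G t (x + 1)\<close> is bounded, the leader is well to the left of \<open>x\<close>. Every
  particle left of \<open>x\<close> counts at least 1 in \<open>G t (x + 1)\<close>.\<close>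

lemma G_le_gap:
  assumes "\<And>i. y \<le> X i t" "y \<le> x" shows "G t x \<le> (x - y) * G t (x + 1)"
proof -
  have "G t x \<le> (\<Sum>i. (x - y) * (b * max 0 (x + 1 - X i t)))"
    unfolding G_def
  proof (intro suminf_le)
    show "summable (\<lambda>i. b * max 0 (x - X i t))" by (rule G_summable)
    show "summable (\<lambda>i. (x - y) * (b * max 0 (x + 1 - X i t)))" by (rule summable_mult[OF G_summable])
    fix i
    have "max 0 (x - X i t) \<le> (x - y) * max 0 (x + 1 - X i t)"
    proof (cases "x - X i t \<le> 0")
      case True then show ?thesis using assms(2) by simp
    next
      case False
      have "x - X i t \<le> (x - y) * 1" using assms(1)[of i] by simp
      also have "\<dots> \<le> (x - y) * max 0 (x + 1 - X i t)" using False assms by (intro mult_left_mono) auto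
      finally show ?thesis using False by auto
    qed
    from mult_left_mono[OF this, of b]
    show "b * max 0 (x - X i t) \<le> (x - y) * (b * max 0 (x + 1 - X i t))"
      using b_pos by (simp add: algebra_simps)
  qed
  also have "\<dots> = (x - y) * G t (x + 1)"
    unfolding G_def by (rule suminf_mult[OF G_summable])
  finally show ?thesis .
qed

lemma G_pos_imp: "G t x > 0 \<Longrightarrow> \<exists>i. X i t < x"
proof (rule ccontr)
  assume "G t x > 0" "\<nexists>i. X i t < x"
  then have "max 0 (x - X i t) = 0" for i by (simp add: not_less)
  then show False using \<open>G t x > 0\<close> unfolding G_def by simp
qed

end

section \<open>One time step with and without drift\<close>

context
  fixes s t assumes st: "0 \<le> s" "s \<le> t" "t \<le> T + 1"
begin

lemma s_t: "0 \<le> t" "s \<le> T + 1" using st by auto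

lemmas Ghat_summable = sum_bound(1)[OF hat_lower[OF st(1) s_t(1) st(3)]]

lemma Ghat_mono: "x \<le> y \<Longrightarrow> Ghat s t x \<le> Ghat s t y"
  unfolding Ghat_def using b_pos by (intro suminf_le Ghat_summable mult_left_mono) auto

lemma hat_eq: "X i s + W i t - W i s = X i t - (A i t - A i s)"
  using X_diff[OF st(1) s_t(1), of i] by simp

lemma G_le_Ghat: "G t x \<le> Ghat s t x"
  unfolding Ghat_def G_def
proof (intro suminf_le G_summable Ghat_summable s_t st mult_left_mono)
  fix i
  have "x - X i t \<le> x - (X i s + W i t - W i s)"
    unfolding hat_eq using A_mono[OF st(1,2), of i] by simp
  then show "max 0 (x - X i t) \<le> max 0 (x - (X i s + W i t - W i s))" by (rule max.mono[OF order_refl])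
qed (use b_pos in simp)

lemma Ghat_le_G: "Ghat s t x - (t - s) \<le> G t x"
proof -
  have "Ghat s t x \<le> (\<Sum>i. b * max 0 (x - X i t) + b * (A i t - A i s))"
    unfolding Ghat_def
  proof (intro suminf_le Ghat_summable summable_add G_summable s_t st sums_summable[OF A_sums])
    show "b * max 0 (x - (X i s + W i t - W i s)) \<le> b * max 0 (x - X i t) + b * (A i t - A i s)" for i
      using A_mono[OF st(1,2), of i] b_pos unfolding hat_eq distrib_left[symmetric]
      by (intro mult_left_mono) auto
  qed
  also have "\<dots> = G t x + (t - s)"
    unfolding G_def
    by (subst suminf_add[OF G_summable[OF s_t(1) st(3)] sums_summable[OF A_sums[OF st(1,2)]], symmetric])
       (simp add: sums_unique[OF A_sums[OF st(1,2)], symmetric])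
  finally show ?thesis by simp
qed

text \<open>If the leader stays well to the left of \<open>x\<close>, no particle is pushed across \<open>x\<close>, so the drift lowers \<open>G t x\<close> by
  the full elapsed time.\<close>

lemma drift_full:
  assumes lead: "\<And>u. s \<le> u \<Longrightarrow> u \<le> t \<Longrightarrow> \<exists>j. X j u \<le> x - g"
    and osc: "\<And>i u. s \<le> u \<Longrightarrow> u \<le> t \<Longrightarrow> X i u \<le> x \<Longrightarrow> W i t - W i u \<le> g" and "g \<ge> 0"
  shows "G t x = Ghat s t x - (t - s)"
proof -
  \<comment> \<open>An unpushed particle contributes equally to both sides; a pushed one ends at or
    left of \<open>x\<close>, where the positive part is linear and records its whole drift.\<close>
  have *: "b * max 0 (x - (X i s + W i t - W i s)) = b * max 0 (x - X i t) + b * (A i t - A i s)" for i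
  proof (cases "A i s < A i t")
    case False
    then have "A i s = A i t" using A_mono[OF st(1,2), of i] by simp
    then show ?thesis unfolding hat_eq by simp
  next
    case True
    \<comment> \<open>At the last push the particle is the leader, hence at most
      \<open>x - g\<close>; from then on it moves by noise alone, which gains at most
      \<open>g\<close>.\<close>
    from A_last[OF st(1,2) this] obtain u where u: "s \<le> u" "u \<le> t" "\<And>j. X i u \<le> X j u" "A i t = A i u" by auto
    obtain j where "X j u \<le> x - g" using lead[OF u(1,2)] by auto
    with u(3)[of j] have 1: "X i u \<le> x - g" by simp
    have "X i t = X i u + (W i t - W i u)" using X_diff[of u t i] u st by simp
    also have "\<dots> \<le> x" using osc[OF u(1,2), of i] 1 \<open>g \<ge> 0\<close> by simp
    finally have "X i t \<le> x" .
    then have "max 0 (x - (X i s + W i t - W i s)) = max 0 (x - X i t) + (A i t - A i s)"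
      unfolding hat_eq using True by simp
    then show ?thesis by (simp add: distrib_left)
  qed
  have "Ghat s t x = G t x + (t - s)"
    unfolding Ghat_def G_def *
    by (subst suminf_add[OF G_summable[OF s_t(1) st(3)] sums_summable[OF A_sums[OF st(1,2)]], symmetric])
       (simp add: sums_unique[OF A_sums[OF st(1,2)], symmetric])
  then show ?thesis by simp
qed

lemma heat_G_mono: "x \<le> y \<Longrightarrow> heat r (G s) x \<le> heat r (G s) y"
  unfolding heat_def by (intro integral_mono exp_bounded_integrable exp_bounded_G G_mono st s_t) auto

lemma heat_G_shift:
  assumes "0 \<le> r" "r \<le> 1" shows "heat q (G s) (x + r) \<le> heat q (G s) x + r * heat q (G s) (x + 2)"
proof -
  have i: "integrable (gauss q) (\<lambda>w. G s (y - w))" for y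
    by (intro exp_bounded_integrable exp_bounded_G st s_t)
  have "heat q (G s) (x + r) \<le> (\<integral>w. G s (x - w) + r * G s (x + 2 - w) \<partial>gauss q)"
    unfolding heat_def
  proof (intro integral_mono Bochner_Integration.integrable_add integrable_mult_right i)
    fix w show "G s (x + r - w) \<le> G s (x - w) + r * G s (x + 2 - w)"
      using G_shift_le[OF st(1) s_t(2) assms, of "x - w"] by (simp add: algebra_simps)
  qed
  also have "\<dots> = heat q (G s) x + r * heat q (G s) (x + 2)"
    unfolding heat_def using i by (simp add: Bochner_Integration.integral_add)
  finally show ?thesis .
qed

text \<open>\<open>Ghat\<close> and the heat evolution of \<open>G\<close> are both nondecreasing in
  \<open>x\<close>, so \<open>x\<close> is sandwiched between its grid neighbours at a cost of
  \<open>rho\<close> times the local count. The neighbours may leave the interval by up to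
  \<open>rho \<le> 1\<close>, hence \<open>M + 1\<close> in the grid hypothesis.\<close>

lemma noise_off_grid:
  fixes nu rho M :: real
  assumes rho: "0 < rho" "rho \<le> 1"
    and grid: "\<And>j::int. \<bar>rho * j\<bar> \<le> M + 1 \<Longrightarrow> \<bar>Ghat s t (rho * j) - heat (t - s) (G s) (rho * j)\<bar> \<le> nu"
    and x: "\<bar>x\<bar> \<le> M"
  shows "\<bar>Ghat s t x - heat (t - s) (G s) x\<bar> \<le> nu + rho * heat (t - s) (G s) (x + 2)"
proof -
  define j where "j = \<lfloor>x / rho\<rfloor>"
  have j: "rho * j \<le> x" "x \<le> rho * (j + 1)"
  proof -
    have "of_int j \<le> x / rho" "x / rho \<le> of_int j + 1" unfolding j_def by linarith+
    then show "rho * j \<le> x" "x \<le> rho * (j + 1)"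
      using rho by (simp_all add: pos_le_divide_eq pos_divide_le_eq mult.commute)
  qed
  have r: "0 \<le> x - rho * j" "x - rho * j \<le> rho" "0 \<le> rho * (j + 1) - x" "rho * (j + 1) - x \<le> rho"
    using j by (auto simp: algebra_simps)
  have P2: "heat (t - s) (G s) (rho * j + 2) \<le> heat (t - s) (G s) (x + 2)"
    using j by (intro heat_G_mono) auto
  have P0: "0 \<le> heat (t - s) (G s) y" for y
    unfolding heat_def by (intro integral_nonneg_AE AE_I2 G_nonneg st s_t)
  have "Ghat s t x \<le> Ghat s t (rho * (j + 1))" by (rule Ghat_mono[OF j(2)])
  also have "\<dots> \<le> heat (t - s) (G s) (rho * (j + 1)) + nu"
    using grid[of "j + 1"] x r rho by (simp add: abs_le_iff)
  also have "heat (t - s) (G s) (rho * (j + 1)) \<le> heat (t - s) (G s) x + (rho * (j + 1) - x) * heat (t - s) (G s) (x + 2)"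
    using heat_G_shift[OF r(3), of "t - s" x] r rho by simp
  also have "(rho * (j + 1) - x) * heat (t - s) (G s) (x + 2) \<le> rho * heat (t - s) (G s) (x + 2)"
    by (intro mult_right_mono r P0)
  finally have 1: "Ghat s t x \<le> heat (t - s) (G s) x + nu + rho * heat (t - s) (G s) (x + 2)" by simp
  have "heat (t - s) (G s) x \<le> heat (t - s) (G s) (rho * j) + (x - rho * j) * heat (t - s) (G s) (rho * j + 2)"
    using heat_G_shift[OF r(1), of "t - s" "rho * j"] r rho by simp
  also have "(x - rho * j) * heat (t - s) (G s) (rho * j + 2) \<le> rho * heat (t - s) (G s) (x + 2)"
    using rho by (intro mult_mono r P0 P2) auto
  also have "heat (t - s) (G s) (rho * j) \<le> Ghat s t (rho * j) + nu"
    using grid[of j] x r rho by (simp add: abs_le_iff)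
  also have "Ghat s t (rho * j) \<le> Ghat s t x" by (rule Ghat_mono[OF j(1)])
  finally show ?thesis using 1 by (simp add: abs_le_iff)
qed

end

end

text \<open>The weight of the maximum principle; it is preserved by the heat flow.\<close>

definition wt :: "real \<Rightarrow> real \<Rightarrow> real" where "wt t x = 1 + exp (2 * x + 2 * t)"

lemma wt_ge_1: "1 \<le> wt t x" by (simp add: wt_def)

lemma wt_pos[simp]: "0 < wt t x" using wt_ge_1[of t x] by linarith

lemma wt_mono: "s \<le> t \<Longrightarrow> x \<le> y \<Longrightarrow> wt s x \<le> wt t y" by (simp add: wt_def)

lemma wt_shift: "wt t (x + 2) \<le> exp 4 * wt t x"
proof -
  have "wt t (x + 2) = 1 + exp 4 * exp (2 * x + 2 * t)" by (simp add: wt_def exp_add[symmetric] algebra_simps)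
  then show ?thesis by (simp add: wt_def algebra_simps)
qed

lemma exp_bounded_wt: "exp_bounded (wt t)"
proof -
  have "wt t = (\<lambda>x. 1 + exp (2 * t) * exp (2 * x))" by (simp add: wt_def fun_eq_iff exp_add[symmetric] add.commute)
  then show ?thesis by (simp add: exp_bounded_add exp_bounded_const exp_bounded_cmult exp_bounded_exp)
qed

lemma heat_wt: "s \<ge> 0 \<Longrightarrow> heat s (wt t) x = wt (t + s) x"
proof -
  assume s: "s \<ge> 0"
  have "wt t = (\<lambda>x. 1 + exp (2 * t) * exp (2 * x))" by (simp add: wt_def fun_eq_iff exp_add[symmetric] add.commute)
  then have "heat s (wt t) x = 1 + exp (2 * t) * exp (2 * x + 2 * s)"
    by (simp only: heat_add[OF exp_bounded_const exp_bounded_cmult[OF exp_bounded_exp]] heat_cmult heat_const heat_exp[OF s])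
  then show ?thesis by (simp add: wt_def exp_add[symmetric] algebra_simps)
qed

lemma sqrt_diff_le:
  assumes "0 \<le> s" "s \<le> t" shows "\<bar>sqrt t - sqrt s\<bar> \<le> sqrt (t - s)"
proof -
  have "(sqrt t - sqrt s)\<^sup>2 \<le> t - s"
  proof -
    have "sqrt s * sqrt s \<le> sqrt t * sqrt s" using assms by (intro mult_right_mono) auto
    then show ?thesis using assms by (simp add: power2_diff)
  qed
  then show ?thesis by (metis abs_le_square_iff abs_of_nonneg assms diff_ge_0_iff_ge real_sqrt_ge_zero real_sqrt_pow2)
qed

section \<open>The limit function against the weight\<close>

context stefan begin

lemma ys_diff:
  assumes "0 \<le> s" "s \<le> t" "t - s \<le> d" shows "\<bar>ys t - ys s\<bar> \<le> \<bar>k\<bar> * sqrt d"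
proof -
  have "\<bar>ys t - ys s\<bar> = \<bar>k\<bar> * \<bar>sqrt t - sqrt s\<bar>"
    by (simp add: y_star_def abs_mult[symmetric] right_diff_distrib)
  also have "\<dots> \<le> \<bar>k\<bar> * sqrt (t - s)" by (intro mult_left_mono sqrt_diff_le assms) auto
  also have "\<dots> \<le> \<bar>k\<bar> * sqrt d" using assms by (intro mult_left_mono) auto
  finally show ?thesis .
qed

definition yb :: "real \<Rightarrow> real" where "yb T = \<bar>k\<bar> * sqrt (T + 1)"

lemma ys_le_yb: "0 \<le> t \<Longrightarrow> t \<le> T + 1 \<Longrightarrow> \<bar>ys t\<bar> \<le> yb T"
  using ys_diff[of 0 t "T + 1"] by (simp add: yb_def y_star_def)

text \<open>\<open>C1\<close> is the constant that bounds \<open>Gs\<close> by the weight. In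
  \<open>C3\<close> the added 2 leaves room for one weight of accumulated error and one of one-step
  error, and \<open>exp 4\<close> is the price of evaluating the weight at
  \<open>x + 2\<close>.\<close>

definition C1 :: "real \<Rightarrow> real" where "C1 T = m1 * (1 + (yb T)\<^sup>2)"
definition C3 :: "real \<Rightarrow> real" where "C3 T = (C1 T + 2) * exp 4"

lemma C1_pos: "0 < C1 T"
  unfolding C1_def using m1_pos by (intro mult_pos_pos) (auto simp: add_pos_nonneg)

lemma Gs_le_wt: "0 \<le> t \<Longrightarrow> t \<le> T + 1 \<Longrightarrow> Gs t x \<le> C1 T * wt t x"
proof -
  assume t: "0 \<le> t" "t \<le> T + 1"
  define p where "p = max 0 x"
  have p: "0 \<le> p" "p \<le> exp p" using exp_ge_add_one_self[of p] by (auto simp: p_def intro: order_trans[OF _ exp_ge_add_one_self])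
  have "max 0 (x - ys t) \<le> p + yb T" using ys_le_yb[OF t] by (auto simp: p_def max_def)
  then have "(max 0 (x - ys t))\<^sup>2 \<le> (p + yb T)\<^sup>2" by (intro power_mono) auto
  also have "\<dots> \<le> 2 * p\<^sup>2 + 2 * (yb T)\<^sup>2"
    using sum_squares_bound[of p "yb T"] by (simp add: power2_sum)
  also have "p\<^sup>2 \<le> wt t x"
  proof (cases "x \<le> 0")
    case True then show ?thesis by (simp add: p_def less_imp_le)
  next
    case False
    then have "p\<^sup>2 \<le> (exp x)\<^sup>2" using p by (intro power_mono) (auto simp: p_def)
    also have "\<dots> = exp (2 * x)" by (simp add: exp_double)
    also have "\<dots> \<le> wt t x" using t by (simp add: wt_def add_increasing)
    finally show ?thesis .
  qed
  also have "2 * wt t x + 2 * (yb T)\<^sup>2 \<le> 2 * (1 + (yb T)\<^sup>2) * wt t x"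
    using mult_left_mono[OF wt_ge_1[of t x], of "2 * (yb T)\<^sup>2"] by (simp add: algebra_simps)
  finally have "(max 0 (x - ys t))\<^sup>2 \<le> 2 * (1 + (yb T)\<^sup>2) * wt t x" by simp
  from mult_left_mono[OF this, of m1] have "m1 * (max 0 (x - ys t))\<^sup>2 / 2 \<le> C1 T * wt t x"
    using m1_pos by (simp add: C1_def algebra_simps)
  with Gs_upper[OF t(1), of x] show ?thesis by simp
qed

end

text \<open>\<open>h\<close> is the time step and \<open>th\<close> the accuracy of the comparison; \<open>de\<close> is the longer time over which the leader
  is watched. Oscillations over these two times are at most \<open>o1\<close> and \<open>o2\<close>, and the noise is at most \<open>nu\<close> on a
  grid of mesh \<open>rho\<close>. Everything is controlled on \<open>{- L..L}\<close>; beyond it the weight dominates.\<close>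

locale good_path = ranged_path b X W A T L S + stefan lam k
  for b :: real and X W A :: "nat \<Rightarrow> real \<Rightarrow> real" and T L S lam k :: real +
  fixes h th de nu rho o1 o2 :: real
  assumes h: "0 < h" "h \<le> 1" "h \<le> de" and de: "3 * de \<le> 1"
    and th: "0 < th" "2 * th \<le> 1" and rho: "0 < rho" "rho \<le> 1" and nu: "0 \<le> nu" and o1: "0 \<le> o1"
    and osc1: "\<And>n i u v. real n * h \<le> T \<Longrightarrow> X i 0 \<le> 4 * L \<Longrightarrow> n * h \<le> u \<Longrightarrow> u \<le> n * h + h \<Longrightarrow>
      n * h \<le> v \<Longrightarrow> v \<le> n * h + h \<Longrightarrow> \<bar>W i u - W i v\<bar> \<le> o1"
    and osc2: "\<And>n i u v. real n * h \<le> T \<Longrightarrow> X i 0 \<le> 4 * L \<Longrightarrow> n * h \<le> u \<Longrightarrow> u \<le> n * h + 3 * de \<Longrightarrow>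
      n * h \<le> v \<Longrightarrow> v \<le> n * h + 3 * de \<Longrightarrow> \<bar>W i u - W i v\<bar> \<le> o2"
    and noise1: "\<And>n (j::int). real n * h \<le> T \<Longrightarrow> \<bar>rho * j\<bar> \<le> L + 2 \<Longrightarrow>
      \<bar>Ghat (n * h) (n * h + h) (rho * j) - heat h (G (n * h)) (rho * j)\<bar> \<le> nu"
    and noise2: "\<And>n (j::int). real n * h \<le> T \<Longrightarrow> \<bar>rho * j\<bar> \<le> L + 2 \<Longrightarrow>
      \<bar>Ghat (n * h) (n * h + de) (rho * j) - heat de (G (n * h)) (rho * j)\<bar> \<le> nu"
    and init: "\<And>j::int. \<bar>rho * j\<bar> \<le> L + 2 \<Longrightarrow> \<bar>G 0 (rho * j) - lam * (max 0 (rho * j))\<^sup>2 / 2\<bar> \<le> nu"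
    and out1: "\<And>x. L < x \<Longrightarrow> 3 * x * (1 + 3 * x)\<^sup>2 * S \<le> th * exp (2 * x)"
    and out2: "\<And>x. L < x \<Longrightarrow> m1 * (x + yb T)\<^sup>2 / 2 \<le> th * exp (2 * x)"
    and yb_L: "yb T + 1 \<le> L"
    and mu: "(T + 1) * (nu + rho * C3 T + 3 * m1\<^sup>2 * h\<^sup>2 / th) \<le> th * h"
    and o1_le: "2 * C3 T * o1 \<le> th"
    and kh_le: "\<bar>k\<bar> * sqrt h \<le> sqrt (th / (2 * m1))"
    and init_le: "nu + rho * (lam * 2) \<le> th"
begin

lemma C1_C3_pos: "0 < C1 T" "0 < C3 T" "C1 T + 2 \<le> C3 T"
proof -
  show 1: "0 < C1 T" by (rule C1_pos)
  have "1 \<le> exp (4::real)" by simp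
  then have "(C1 T + 2) * 1 \<le> C3 T" unfolding C3_def using 1 by (intro mult_left_mono) auto
  then show "C1 T + 2 \<le> C3 T" "0 < C3 T" using 1 by auto
qed

text \<open>On the far right the cubic bound for \<open>G\<close> and the quadratic one for
  \<open>Gs\<close> lose against the exponential weight (\<open>out1\<close>, \<open>out2\<close>);
  on the far left both functions vanish.\<close>

lemma G_out:
  assumes t: "0 \<le> t" "t \<le> T + 1" and x: "L < \<bar>x\<bar>"
  shows "G t x \<le> th * wt t x" "Gs t x \<le> th * wt t x"
proof -
  have *: "G t x \<le> th * wt t x \<and> Gs t x \<le> th * wt t x"
  proof (cases "x > L")
    case True
    have le: "th * exp (2 * x) \<le> th * wt t x" using th t by (intro mult_left_mono) (auto simp: wt_def add_increasing)
    have "Gbound x * S \<le> 3 * x * (1 + 3 * x)\<^sup>2 * S"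
      unfolding Gbound_def using True L_ge S_nonneg by (intro mult_right_mono mult_mono power_mono) auto
    with G_le_bound[OF t, of x] out1[OF True] le have 1: "G t x \<le> th * wt t x" by linarith
    have "(max 0 (x - ys t))\<^sup>2 \<le> (x + yb T)\<^sup>2"
      using ys_le_yb[OF t] True L_ge by (intro power_mono) (auto simp: abs_le_iff)
    then have "m1 * (max 0 (x - ys t))\<^sup>2 / 2 \<le> m1 * (x + yb T)\<^sup>2 / 2"
      using m1_pos by (intro divide_right_mono mult_left_mono) auto
    with Gs_upper[OF t(1), of x] out2[OF True] le have "Gs t x \<le> th * wt t x" by linarith
    with 1 show ?thesis by simp
  next
    case False
    with x have x: "x < - L" by linarith
    then have "Gbound x = 0" unfolding Gbound_def using L_ge by (simp add: max_def)
    moreover have "\<not> x > ys t" using x yb_L ys_le_yb[OF t] by (auto simp: abs_le_iff)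
    then have "Gs t x = 0" by (simp add: Gs_def)
    moreover have "0 \<le> th * wt t x" using th by (intro mult_nonneg_nonneg) (auto simp: less_imp_le)
    ultimately show ?thesis using G_le_bound[OF t, of x] by simp
  qed
  then show "G t x \<le> th * wt t x" "Gs t x \<le> th * wt t x" by auto
qed

section \<open>The discrete maximum principle\<close>

definition near :: "real \<Rightarrow> real \<Rightarrow> bool" where
  "near m t \<longleftrightarrow> (\<forall>x. \<bar>G t x - Gs t x\<bar> \<le> m * wt t x)"

text \<open>The heat semigroup preserves order and carries \<open>wt t\<close> exactly to
  \<open>wt (t + s)\<close>, so the comparison constant \<open>m\<close> does not grow.\<close>

lemma near_heat:
  assumes "near m t" "0 \<le> t" "t \<le> T + 1" "0 \<le> s"
  shows "heat s (G t) x \<le> heat s (Gs t) x + m * wt (t + s) x"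
    "heat s (Gs t) x - m * wt (t + s) x \<le> heat s (G t) x"
proof -
  have "heat s (G t) x \<le> heat s (\<lambda>x. Gs t x + m * wt t x) x"
    using assms unfolding near_def
    by (intro heat_mono exp_bounded_G exp_bounded_add exp_bounded_Gs exp_bounded_cmult exp_bounded_wt)
       (auto simp: abs_le_iff algebra_simps)
  also have "\<dots> = heat s (Gs t) x + m * wt (t + s) x"
    using assms by (subst heat_add) (auto simp: heat_cmult heat_wt intro: exp_bounded_Gs exp_bounded_cmult exp_bounded_wt)
  finally show "heat s (G t) x \<le> heat s (Gs t) x + m * wt (t + s) x" .
  have "heat s (\<lambda>x. Gs t x - m * wt t x) x \<le> heat s (G t) x"
    using assms unfolding near_def
    by (intro heat_mono exp_bounded_G exp_bounded_diff exp_bounded_Gs exp_bounded_cmult exp_bounded_wt)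
       (auto simp: abs_le_iff algebra_simps)
  also have "heat s (\<lambda>x. Gs t x - m * wt t x) x = heat s (Gs t) x - m * wt (t + s) x"
    using assms by (subst heat_diff) (auto simp: heat_cmult heat_wt intro: exp_bounded_Gs exp_bounded_cmult exp_bounded_wt)
  finally show "heat s (Gs t) x - m * wt (t + s) x \<le> heat s (G t) x" .
qed

lemma heat_G_le:
  assumes "near m t" "m \<le> 1" "0 \<le> t" "t \<le> T + 1" "0 \<le> s"
  shows "heat s (G t) x \<le> (C1 T + 1) * wt (t + s) x"
proof -
  have "heat s (Gs t) x \<le> heat s (\<lambda>x. C1 T * wt t x) x"
    using assms by (intro heat_mono exp_bounded_Gs exp_bounded_cmult exp_bounded_wt Gs_le_wt) auto
  also have "\<dots> = C1 T * wt (t + s) x" using assms by (simp add: heat_cmult heat_wt)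
  finally have "heat s (G t) x \<le> C1 T * wt (t + s) x + m * wt (t + s) x"
    using near_heat(1)[OF assms(1,3,4,5), of x] by linarith
  also have "m * wt (t + s) x \<le> 1 * wt (t + s) x" using assms by (intro mult_right_mono) (auto simp: less_imp_le)
  finally show ?thesis by (simp add: algebra_simps)
qed

lemma noise_near:
  assumes nr: "near m t" "m \<le> 1" and t: "0 \<le> t" "0 \<le> s" "t + s \<le> T + 1"
    and grid: "\<And>j::int. \<bar>rho * j\<bar> \<le> L + 2 \<Longrightarrow> \<bar>Ghat t (t + s) (rho * j) - heat s (G t) (rho * j)\<bar> \<le> nu"
    and x: "\<bar>x\<bar> \<le> L + 1"
  shows "\<bar>Ghat t (t + s) x - heat s (G t) x\<bar> \<le> (nu + rho * C3 T) * wt (t + s) x"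
proof -
  have t2: "t \<le> t + s" "t \<le> T + 1" using t by auto
  have "\<bar>Ghat t (t + s) x - heat s (G t) x\<bar> \<le> nu + rho * heat s (G t) (x + 2)"
    using noise_off_grid[OF t(1) t2(1) t(3) rho, of "L + 1" nu x] grid x by (simp add: add.commute)
  also have "heat s (G t) (x + 2) \<le> (C1 T + 1) * wt (t + s) (x + 2)"
    by (rule heat_G_le[OF nr t(1) t2(2) t(2)])
  also have "\<dots> \<le> (C1 T + 1) * (exp 4 * wt (t + s) x)"
    using C1_C3_pos by (intro mult_left_mono wt_shift) auto
  also have "\<dots> \<le> C3 T * wt (t + s) x"
    unfolding C3_def mult.assoc[symmetric] by (intro mult_right_mono) (auto simp: less_imp_le)
  finally have "\<bar>Ghat t (t + s) x - heat s (G t) x\<bar> \<le> nu + rho * (C3 T * wt (t + s) x)"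
    using rho by (simp add: mult_left_mono)
  also have "nu \<le> nu * wt (t + s) x" using mult_left_mono[OF wt_ge_1 nu, of "t + s" x] by simp
  finally show ?thesis by (simp add: algebra_simps)
qed

lemma X0_le_4L: "0 \<le> t \<Longrightarrow> t \<le> T + 1 \<Longrightarrow> X i t \<le> L + 1 \<Longrightarrow> X i 0 \<le> 4 * L"
  using X_lower[of t i] L_ge by simp

text \<open>The summands are the noise on the grid, the passage off the grid, and the boundary term
  of \<open>Gs_step_upper\<close> for \<open>g^2 = th / (2 * m1)\<close>. Assumption
  \<open>mu\<close> makes \<open>(T + 1) / h\<close> such errors at most \<open>th\<close>.\<close>

definition step_error :: real where "step_error = nu + rho * C3 T + 3 * m1\<^sup>2 * h\<^sup>2 / th"

lemma noise_error_bounds: "0 \<le> nu + rho * C3 T" "nu + rho * C3 T \<le> step_error" "0 \<le> step_error" "step_error \<le> 1"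
proof -
  show 1: "0 \<le> nu + rho * C3 T" using nu rho C1_C3_pos by simp
  have 2: "0 \<le> 3 * m1\<^sup>2 * h\<^sup>2 / th" using th by simp
  show "nu + rho * C3 T \<le> step_error" using 2 by (simp add: step_error_def)
  show 3: "0 \<le> step_error" using 1 2 by (simp add: step_error_def)
  have "step_error \<le> (T + 1) * step_error" using mult_right_mono[of 1 "T + 1" step_error] T_pos 3 by simp
  also have "\<dots> \<le> th * h" using mu by (simp add: step_error_def)
  also have "\<dots> \<le> 1 * 1" using th h by (intro mult_mono) auto
  finally show "step_error \<le> 1" by simp
qed

text \<open>Deviations up to \<open>th * wt\<close> are covered by \<open>m \<ge> th\<close>. If
  \<open>G\<close> exceeds \<open>Gs\<close> by more, the leader is well left of \<open>x\<close>
  during the whole step, so \<open>G\<close> loses exactly \<open>h\<close> while \<open>Gs\<close>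
  loses at most \<open>h\<close>. If \<open>Gs\<close> exceeds \<open>G\<close> by more,
  \<open>x\<close> is well right of the boundary, so \<open>Gs\<close> loses \<open>h\<close> up to
  second order while \<open>G\<close> loses at most \<open>h\<close>. Either way the losses cancel
  in the favourable direction.\<close>

lemma near_step:
  assumes n: "real n * h \<le> T" and nr: "near m (n * h)" and m: "th \<le> m" "m \<le> 1"
  shows "near (m + step_error) (n * h + h)"
  unfolding near_def
proof
  fix x
  define t t' where "t = real n * h" and "t' = t + h"
  have t: "0 \<le> t" "t \<le> t'" "t' \<le> T + 1" "t \<le> T + 1" "0 \<le> t'" "t \<le> T" using n h by (auto simp: t_def t'_def)
  note nr' = nr[folded t_def]
  let ?w = "wt t' x"
  have w: "0 \<le> ?w" "1 \<le> ?w" using wt_ge_1[of t' x] by auto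
  have noise: "\<bar>Ghat t t' y - heat h (G t) y\<bar> \<le> (nu + rho * C3 T) * wt t' y" if "\<bar>y\<bar> \<le> L + 1" for y
    unfolding t'_def using t(3) h noise1[OF n] that
    by (intro noise_near[OF nr' m(2) t(1)]) (auto simp: t_def t'_def)
  have mm: "m * ?w \<le> (m + step_error) * ?w" "th * ?w \<le> (m + step_error) * ?w"
    using noise_error_bounds m w by (auto intro!: mult_right_mono)
  have "\<bar>G t' x - Gs t' x\<bar> \<le> (m + step_error) * ?w"
  proof (cases "\<bar>x\<bar> \<le> L")
    case False
    then have "L < \<bar>x\<bar>" by simp
    from G_out[OF t(5,3) this] G_nonneg[OF t(5,3), of x] Gs_nonneg[OF t(5), of x] mm
    show ?thesis by (intro abs_leI) linarith+
  next
    case x: True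
    have noise_x: "\<bar>Ghat t t' x - heat h (G t) x\<bar> \<le> (nu + rho * C3 T) * ?w" by (rule noise) (use x in simp)
    have "G t' x - Gs t' x \<le> (m + step_error) * ?w"
    proof (cases "G t' x - Gs t' x \<le> th * ?w")
      case True then show ?thesis using mm by linarith
    next
      case False
      then have Gx: "G t' x > th * ?w" using Gs_nonneg[OF t(5), of x] by linarith
      \<comment> \<open>\<open>G_le_gap\<close> will place the leader at least \<open>2 * g\<close>
        to the left of \<open>x\<close>; one \<open>g\<close> is reserved for the oscillation
        \<open>o1\<close>.\<close>
      define g where "g = th / (2 * C3 T)"
      have g: "o1 \<le> g" "0 \<le> g" using o1_le C1_C3_pos th by (auto simp: g_def field_simps)
      obtain j where j: "\<And>i. X j t' \<le> X i t'" using leader[OF t(5)] by auto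
      have jx: "X j t' \<le> x - 2 * g"
      proof -
        have "0 < th * ?w" using th w by simp
        then have "0 < G t' x" using Gx by simp
        then obtain i where "X i t' < x" using G_pos_imp[OF t(5,3)] by blast
        with j[of i] have jx: "X j t' \<le> x" by simp
        \<comment> \<open>An a priori bound at the new time, obtained by ignoring the drift, because
          closeness to \<open>Gs\<close> at that time is still to be shown.\<close>
        have "G t' (x + 1) \<le> Ghat t t' (x + 1)" by (rule G_le_Ghat[OF t(1,2,3)])
        also have "\<dots> \<le> heat h (G t) (x + 1) + (nu + rho * C3 T) * wt t' (x + 1)"
          using noise[of "x + 1"] x by (simp add: abs_le_iff)
        also have "heat h (G t) (x + 1) \<le> (C1 T + 1) * wt t' (x + 1)"
          unfolding t'_def by (rule heat_G_le[OF nr' m(2) t(1,4)]) (use h in simp)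
        also have "(nu + rho * C3 T) * wt t' (x + 1) \<le> 1 * wt t' (x + 1)"
          using noise_error_bounds by (intro mult_right_mono) (auto simp: less_imp_le)
        also have "(C1 T + 1) * wt t' (x + 1) + 1 * wt t' (x + 1) = (C1 T + 2) * wt t' (x + 1)"
          by (simp add: algebra_simps)
        also have "\<dots> \<le> (C1 T + 2) * (exp 4 * ?w)"
          using C1_C3_pos wt_mono[of t' t' "x + 1" "x + 2"] wt_shift[of t' x] by (intro mult_left_mono) auto
        also have "\<dots> = C3 T * ?w" by (simp add: C3_def)
        finally have F: "G t' (x + 1) \<le> C3 T * ?w" by simp
        have "th * ?w < (x - X j t') * G t' (x + 1)"
          using Gx G_le_gap[OF t(5,3) j jx] by linarith
        also have "\<dots> \<le> (x - X j t') * (C3 T * ?w)" using F jx by (intro mult_left_mono) auto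
        finally have "th * ?w < ((x - X j t') * C3 T) * ?w" by (simp add: mult_ac)
        then have "th < (x - X j t') * C3 T" using mult_less_cancel_right_pos[OF wt_pos] by blast
        then have "2 * g < x - X j t'" using C1_C3_pos by (simp add: g_def field_simps)
        then show ?thesis by simp
      qed
      have j4: "X j 0 \<le> 4 * L" using X0_le_4L[OF t(5,3), of j] jx x g by simp
      have osc: "\<bar>W i u - W i v\<bar> \<le> g" if "X i 0 \<le> 4 * L" "t \<le> u" "u \<le> t'" "t \<le> v" "v \<le> t'" for i u v
        using osc1[OF n that(1), of u v] that g by (auto simp: t_def t'_def)
      have full: "G t' x = Ghat t t' x - (t' - t)"
      proof (rule drift_full[OF t(1,2,3), of x g])
        fix u assume u: "t \<le> u" "u \<le> t'"
        \<comment> \<open>Going back from \<open>t'\<close>, the drift only puts particle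
          \<open>j\<close> further left, so noise alone can bring it nearer to
          \<open>x\<close>.\<close>
        have "X j t' - X j u = (A j t' - A j u) + (W j t' - W j u)" using u t by (intro X_diff) auto
        moreover have "0 \<le> A j t' - A j u" using A_mono[of u t' j] u t by simp
        moreover have "\<bar>W j t' - W j u\<bar> \<le> g" using osc[OF j4, of t' u] u t by simp
        ultimately have "X j u \<le> x - g" using jx by linarith
        then show "\<exists>j. X j u \<le> x - g" by blast
      next
        fix i u assume u: "t \<le> u" "u \<le> t'" and xi: "X i u \<le> x"
        have "X i 0 \<le> 4 * L" using X0_le_4L[of u i] u t xi x by simp
        from osc[OF this, of t' u] u t show "W i t' - W i u \<le> g" by simp
      qed (use g in simp)
      then have "G t' x = Ghat t t' x - h" by (simp add: t'_def)
      also have "\<dots> \<le> heat h (G t) x + (nu + rho * C3 T) * ?w - h" using noise_x by (simp add: abs_le_iff)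
      also have "heat h (G t) x \<le> heat h (Gs t) x + m * ?w"
        unfolding t'_def using h by (intro near_heat(1)[OF nr' t(1,4)]) auto
      also have "heat h (Gs t) x \<le> Gs t' x + h"
        using Gs_step_lower[of h t x] h t by (simp add: t'_def)
      finally have "G t' x - Gs t' x \<le> m * ?w + (nu + rho * C3 T) * ?w" by simp
      also have "\<dots> = (m + (nu + rho * C3 T)) * ?w" by (simp add: algebra_simps)
      also have "\<dots> \<le> (m + step_error) * ?w" using noise_error_bounds w by (intro mult_right_mono) auto
      finally show ?thesis .
    qed
    moreover have "- ((m + step_error) * ?w) \<le> G t' x - Gs t' x"
    proof (cases "- (th * ?w) \<le> G t' x - Gs t' x")
      case True then show ?thesis using mm by linarith
    next
      case False
      then have "Gs t' x > th * ?w" using G_nonneg[OF t(5,3), of x] by linarith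
      moreover have "th * 1 \<le> th * ?w" using th w by (intro mult_left_mono) auto
      ultimately have Gx: "Gs t' x > th" by linarith
      then have xy: "x > ys t'" using th by (auto simp: Gs_def split: if_splits)
      \<comment> \<open>\<open>Gs > th\<close> and the quadratic upper bound put \<open>x\<close> at
        least \<open>2 * g\<close> to the right of the new boundary; one \<open>g\<close> is spent
        on the motion of the boundary during the step, by \<open>kh_le\<close>.\<close>
      define g where "g = sqrt (th / (2 * m1))"
      have g: "0 < g" "g\<^sup>2 = th / (2 * m1)" using th m1_pos by (auto simp: g_def)
      have "(2 * g)\<^sup>2 \<le> (x - ys t')\<^sup>2"
      proof -
        have "th < m1 * (x - ys t')\<^sup>2 / 2" using Gx Gs_upper[OF t(5), of x] xy by simp
        then show ?thesis using m1_pos unfolding power_mult_distrib g by (simp add: field_simps)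
      qed
      then have "2 * g \<le> x - ys t'" by (rule power2_le_imp_le) (use xy in simp)
      moreover have "\<bar>ys t' - ys t\<bar> \<le> g"
        using ys_diff[OF t(1,2), of h] kh_le by (simp add: t'_def g_def)
      ultimately have xg: "ys t + g \<le> x" by (simp add: abs_le_iff)
      have "Gs t' x \<le> heat h (Gs t) x - h + 3 * m1 * h\<^sup>2 / (2 * g\<^sup>2)"
        using Gs_step_upper[OF _ t(1) g(1) xg, of h] h xy by (simp add: Gs_def t'_def)
      also have "3 * m1 * h\<^sup>2 / (2 * g\<^sup>2) = 3 * m1\<^sup>2 * h\<^sup>2 / th"
        unfolding g(2) using m1_pos by (simp add: power2_eq_square)
      also have "heat h (Gs t) x \<le> heat h (G t) x + m * ?w"
        using near_heat(2)[OF nr' t(1,4), of h x] h by (simp add: t'_def)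
      also have "heat h (G t) x \<le> Ghat t t' x + (nu + rho * C3 T) * ?w" using noise_x by (simp add: abs_le_iff)
      also have "Ghat t t' x \<le> G t' x + h" using Ghat_le_G[OF t(1,2,3), of x] by (simp add: t'_def)
      finally have "Gs t' x - G t' x \<le> m * ?w + (nu + rho * C3 T) * ?w + 3 * m1\<^sup>2 * h\<^sup>2 / th * 1" by simp
      also have "3 * m1\<^sup>2 * h\<^sup>2 / th * 1 \<le> 3 * m1\<^sup>2 * h\<^sup>2 / th * ?w"
        using w th by (intro mult_left_mono) auto
      finally have "Gs t' x - G t' x \<le> (m + step_error) * ?w" by (simp add: step_error_def algebra_simps)
      then show ?thesis by simp
    qed
    ultimately show ?thesis by (simp add: abs_le_iff)
  qed
  then show "\<bar>G (n * h + h) x - Gs (n * h + h) x\<bar> \<le> (m + step_error) * wt (n * h + h) x"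
    by (simp add: t_def t'_def)
qed

text \<open>The initial count is known on the grid only. Both it and the limiting parabola are
  nondecreasing, so grid neighbours sandwich \<open>x\<close> as in
  \<open>noise_off_grid\<close>.\<close>

lemma near_init: "near th 0"
  unfolding near_def
proof
  fix x
  have Gs0: "Gs 0 y = lam * (max 0 y)\<^sup>2 / 2" for y
    by (auto simp: Gs_def G0_0 y_star_def max_def)
  have T1: "0 \<le> (0::real)" "0 \<le> T + 1" using T_pos by auto
  show "\<bar>G 0 x - Gs 0 x\<bar> \<le> th * wt 0 x"
  proof (cases "\<bar>x\<bar> \<le> L")
    case False
    then have "L < \<bar>x\<bar>" by simp
    from G_out[OF T1 this] G_nonneg[OF T1, of x] Gs_nonneg[of 0 x] show ?thesis by (simp add: abs_le_iff)
  next
    case x: True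
    define j where "j = \<lfloor>x / rho\<rfloor>"
    have "of_int j \<le> x / rho" "x / rho \<le> of_int j + 1" unfolding j_def by linarith+
    then have j: "rho * j \<le> x" "x \<le> rho * (j + 1)"
      using rho by (simp_all add: pos_le_divide_eq pos_divide_le_eq mult.commute)
    have shift: "lam * (max 0 (y + r))\<^sup>2 / 2 \<le> lam * (max 0 y)\<^sup>2 / 2 + r * (lam * (max 0 y + 1))"
      if "0 \<le> r" "r \<le> 1" for y r
    proof -
      have "(max 0 (y + r))\<^sup>2 \<le> (max 0 y + r)\<^sup>2" using that by (intro power_mono) auto
      also have "\<dots> \<le> (max 0 y)\<^sup>2 + 2 * r * (max 0 y + 1)"
      proof -
        have "r\<^sup>2 \<le> 2 * r" using that by (auto simp: power2_eq_square intro: mult_right_mono order_trans[of _ "1 * r"])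
        then show ?thesis by (simp add: power2_sum algebra_simps)
      qed
      finally have "lam * (max 0 (y + r))\<^sup>2 \<le> lam * ((max 0 y)\<^sup>2 + 2 * r * (max 0 y + 1))"
        using lam_pos by (intro mult_left_mono) auto
      then show ?thesis by (simp add: algebra_simps)
    qed
    have r: "0 \<le> x - rho * j" "x - rho * j \<le> rho" "0 \<le> rho * (j + 1) - x" "rho * (j + 1) - x \<le> rho"
      using j by (auto simp: algebra_simps)
    have lw: "lam * (max 0 x + 1) \<le> lam * 2 * wt 0 x"
    proof -
      have "max 0 x + 1 \<le> 2 * wt 0 x"
      proof -
        have "max 0 x + 1 \<le> 1 + (1 + exp (2 * x))"
          using exp_ge_add_one_self[of "2 * x"] exp_gt_zero[of "2 * x"] by linarith
        also have "\<dots> \<le> 2 * wt 0 x" by (simp add: wt_def)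
        finally show ?thesis .
      qed
      from mult_left_mono[OF this, of lam] lam_pos show ?thesis by simp
    qed
    have fin: "nu + rho * (lam * 2 * wt 0 x) \<le> th * wt 0 x"
    proof -
      have "nu * 1 + rho * (lam * 2 * wt 0 x) \<le> nu * wt 0 x + rho * (lam * 2 * wt 0 x)"
        using mult_left_mono[OF wt_ge_1[of 0 x] nu] by simp
      also have "\<dots> = (nu + rho * (lam * 2)) * wt 0 x" by (simp add: algebra_simps)
      also have "\<dots> \<le> th * wt 0 x" using init_le by (intro mult_right_mono) (auto simp: less_imp_le)
      finally show ?thesis by simp
    qed
    have "G 0 x \<le> G 0 (rho * (j + 1))" by (rule G_mono[OF T1 j(2)])
    also have "\<dots> \<le> lam * (max 0 (rho * (j + 1)))\<^sup>2 / 2 + nu"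
      using init[of "j + 1"] x r rho by (simp add: abs_le_iff)
    also have "lam * (max 0 (rho * (j + 1)))\<^sup>2 / 2 \<le> lam * (max 0 x)\<^sup>2 / 2 + (rho * (j + 1) - x) * (lam * (max 0 x + 1))"
      using shift[OF r(3), of x] r rho by simp
    also have "(rho * (j + 1) - x) * (lam * (max 0 x + 1)) \<le> rho * (lam * 2 * wt 0 x)"
      using rho lam_pos by (intro mult_mono r lw) (auto intro!: mult_nonneg_nonneg)
    finally have 1: "G 0 x - Gs 0 x \<le> nu + rho * (lam * 2 * wt 0 x)" unfolding Gs0 by simp
    have "lam * (max 0 x)\<^sup>2 / 2 \<le> lam * (max 0 (rho * j))\<^sup>2 / 2 + (x - rho * j) * (lam * (max 0 (rho * j) + 1))"
      using shift[OF r(1), of "rho * j"] r rho by simp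
    also have "(x - rho * j) * (lam * (max 0 (rho * j) + 1)) \<le> rho * (lam * 2 * wt 0 x)"
    proof (rule mult_mono[OF r(2)])
      have "lam * (max 0 (rho * j) + 1) \<le> lam * (max 0 x + 1)" using j lam_pos by (intro mult_left_mono) auto
      with lw show "lam * (max 0 (rho * j) + 1) \<le> lam * 2 * wt 0 x" by linarith
    qed (use rho lam_pos in auto)
    also have "lam * (max 0 (rho * j))\<^sup>2 / 2 \<le> G 0 (rho * j) + nu"
      using init[of j] x r rho by (simp add: abs_le_iff)
    also have "G 0 (rho * j) \<le> G 0 x" by (rule G_mono[OF T1 j(1)])
    finally have "Gs 0 x - G 0 x \<le> nu + rho * (lam * 2 * wt 0 x)" unfolding Gs0 by simp
    with 1 fin show ?thesis by (simp add: abs_le_iff)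
  qed
qed

text \<open>The error is carried as \<open>th + n * step_error\<close>: the offset \<open>th\<close>
  is what \<open>near_step\<close> needs to tolerate small deviations, and \<open>mu\<close> bounds
  the accumulated part by another \<open>th\<close>. The range reaches \<open>T + h\<close> so that
  every time up to \<open>T\<close> has a grid time at or after it.\<close>

lemma near_grid: "real n * h \<le> T + h \<Longrightarrow> near (2 * th) (n * h)"
proof -
  have *: "near (th + n * step_error) (n * h)" if "real n * h \<le> T + h" for n
    using that
  proof (induction n)
    case 0 then show ?case using near_init by simp
  next
    case (Suc n)
    have n: "real n * h \<le> T" using Suc.prems by (simp add: algebra_simps)
    have nm: "n * step_error \<le> th"
    proof -
      have "(n * h) * step_error \<le> (T + 1) * step_error" using n noise_error_bounds by (intro mult_right_mono) auto
      also have "\<dots> \<le> th * h" using mu by (simp add: step_error_def)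
      finally have "(n * step_error) * h \<le> th * h" by (simp add: mult_ac)
      then show ?thesis using h by simp
    qed
    have "near (th + n * step_error) (n * h)" using Suc n h by (intro Suc.IH) simp
    from near_step[OF n this] nm noise_error_bounds th have "near (th + n * step_error + step_error) (n * h + h)" by simp
    then show ?case by (simp add: algebra_simps)
  qed
  assume n: "real n * h \<le> T + h"
  have "(n * h) * step_error \<le> (T + 1) * step_error" using n h noise_error_bounds by (intro mult_right_mono) auto
  also have "\<dots> \<le> th * h" using mu by (simp add: step_error_def)
  finally have "(n * step_error) * h \<le> th * h" by (simp add: mult_ac)
  then have "n * step_error \<le> th" using h by simp
  then have le: "th + n * step_error \<le> 2 * th" by simp
  show "near (2 * th) (n * h)"
    unfolding near_def
  proof
    fix x
    have "\<bar>G (n * h) x - Gs (n * h) x\<bar> \<le> (th + n * step_error) * wt (n * h) x" using *[OF n] by (simp add: near_def)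
    also have "\<dots> \<le> 2 * th * wt (n * h) x" using le by (intro mult_right_mono) (auto simp: less_imp_le)
    finally show "\<bar>G (n * h) x - Gs (n * h) x\<bar> \<le> 2 * th * wt (n * h) x" .
  qed
qed

end

text \<open>What it takes to pass from \<open>2 * th * wt\<close> at grid times to
  \<open>eps\<close> at all times. \<open>C4\<close> bounds the weight near the boundary and on the
  window \<open>R\<close>; \<open>p5\<close> contradicts a leader too far left, the first part of
  \<open>p6\<close> makes \<open>Gs\<close> visible above the error just right of the boundary, and
  \<open>p7\<close> is a modulus of continuity of \<open>Gs\<close> in time.\<close>

locale good_path_eps = good_path +
  fixes eps R C4 :: real
  assumes eps: "0 < eps" "eps \<le> 1" and R: "0 \<le> R" "R \<le> L"
    and C4_1: "1 + exp (2 * (yb T + 1) + 2 * (T + 1)) \<le> C4"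
    and C4_2: "1 + exp (2 * R + 2 * (T + 1)) \<le> C4"
    and p5: "24 * m1 * de\<^sup>2 / eps\<^sup>2 + (2 * th + nu + rho * C3 T) * C4 < de"
    and o2_le: "o2 \<le> eps / 4" and o1_le': "o1 \<le> eps / 4" "o1 * (C3 T * C4) \<le> eps / 4" and h_le: "h \<le> eps / 4"
    and kde: "\<bar>k\<bar> * sqrt (2 * de) \<le> eps / 4"
    and p6: "2 * th * C4 < m0 * eps\<^sup>2 / 32" "2 * th * C4 \<le> eps / 4"
    and p7: "\<And>s t x. 0 \<le> s \<Longrightarrow> s \<le> t \<Longrightarrow> t \<le> T + 1 \<Longrightarrow> t - s \<le> h \<Longrightarrow> \<bar>x\<bar> \<le> R \<Longrightarrow> \<bar>Gs s x - Gs t x\<bar> \<le> eps / 4"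
begin

lemma wt_le_C4: "t \<le> T + 1 \<Longrightarrow> x \<le> yb T + 1 \<Longrightarrow> wt t x \<le> C4"
  by (rule order_trans[OF _ C4_1]) (simp add: wt_def)

lemma wt_le_C4': "t \<le> T + 1 \<Longrightarrow> x \<le> R \<Longrightarrow> wt t x \<le> C4"
  by (rule order_trans[OF _ C4_2]) (simp add: wt_def)

lemma near_grid': "real n * h \<le> T + h \<Longrightarrow> \<bar>G (n * h) x - Gs (n * h) x\<bar> \<le> 2 * th * wt (n * h) x"
  using near_grid[of n] unfolding near_def by blast

text \<open>A leader at distance \<open>eps\<close> to the left of the free boundary would spend a drift of size \<open>de\<close> there, while the
  heat flow supplies only \<open>O(de\<^sup>2)\<close>.\<close>

lemma leader_lower:
  assumes t: "0 \<le> t" "t \<le> T" shows "ys t - eps \<le> X i t"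
proof (rule ccontr)
  assume "\<not> ys t - eps \<le> X i t"
  then have i: "X i t < ys t - eps" by simp
  have yt: "\<bar>ys t\<bar> \<le> yb T" using ys_le_yb[of t T] t by simp
  have tT: "t \<le> T + 1" using t by simp
  have i4: "X i 0 \<le> 4 * L" using X0_le_4L[OF t(1) tT, of i] i yt yb_L eps by (simp add: abs_le_iff)
  have de0: "0 < de" using h by simp
  \<comment> \<open>Drift never moves a particle left, so a particle too far left at time
    \<open>t\<close> was, up to noise, too far left during the whole preceding window.\<close>
  have bck: "X i u \<le> X i t + eps / 4"
    if n: "real n * h \<le> T" "n * h \<le> u" "u \<le> t" "t \<le> n * h + 3 * de" for n u
  proof -
    have u: "0 \<le> u" using n h by (smt (verit) mult_nonneg_nonneg of_nat_0_le_iff)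
    have "\<bar>W i t - W i u\<bar> \<le> o2" using n by (intro osc2[OF n(1) i4]) auto
    moreover have "X i t - X i u = (A i t - A i u) + (W i t - W i u)" using X_diff[OF u t(1)] .
    moreover have "A i u \<le> A i t" using A_mono[OF u n(3)] .
    ultimately show ?thesis using o2_le by linarith
  qed
  show False
  proof (cases "t \<le> 2 * de")
    \<comment> \<open>For early times one goes back to time 0, where all positions are nonnegative
      while the boundary at time \<open>t\<close> is at most \<open>eps / 4\<close>.\<close>
    case True
    have "X i 0 \<le> X i t + eps / 4" using bck[of 0 0] t True de0 T_pos by simp
    moreover have "ys t \<le> eps / 4"
      using ys_diff[of 0 t "2 * de"] t True kde by (simp add: y_star_def abs_le_iff)
    ultimately show False using i X0_nonneg[of i] eps by linarith
  next
    case False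
    \<comment> \<open>The last grid time with \<open>s + de \<le> t\<close>; as
      \<open>h \<le> de\<close>, the window \<open>t - s\<close> is at most \<open>2 * de\<close>,
      within reach of \<open>osc2\<close>.\<close>
    define n where "n = nat \<lfloor>(t - de) / h\<rfloor>"
    define s where "s = real n * h"
    have n: "s \<le> t - de" "t - de < s + h"
    proof -
      have "0 \<le> (t - de) / h" using False de0 h by simp
      then have "real n \<le> (t - de) / h" "(t - de) / h < real n + 1" unfolding n_def by linarith+
      then show "s \<le> t - de" "t - de < s + h" using h unfolding s_def by (simp_all add: field_simps)
    qed
    have s: "0 \<le> s" "s \<le> T" "s \<le> s + de" "s + de \<le> T + 1" "s \<le> t" "t - s \<le> 2 * de" "s \<le> T + 1" "s + de \<le> t"
      using n t de0 h by (auto simp: s_def)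
    \<comment> \<open>Placed with margin \<open>eps / 4\<close> on either side: particle
      \<open>i\<close> stays left of \<open>x - eps / 4\<close> during the window, and the boundary
      at time \<open>s\<close> is right of \<open>x + eps / 4\<close>.\<close>
    define x where "x = ys t - eps / 2"
    have x: "\<bar>x\<bar> \<le> L" using yt yb_L eps by (simp add: x_def abs_le_iff)
    have full: "G (s + de) x = Ghat s (s + de) x - (s + de - s)"
    proof (rule drift_full[OF s(1,3,4), of x "eps / 4"])
      fix u assume u: "s \<le> u" "u \<le> s + de"
      have "X i u \<le> X i t + eps / 4"
        using bck[of n u] u s n by (simp add: s_def)
      then have "X i u \<le> x - eps / 4" using i by (simp add: x_def)
      then show "\<exists>j. X j u \<le> x - eps / 4" by blast
    next
      fix j u assume u: "s \<le> u" "u \<le> s + de" and "X j u \<le> x"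
      then have j4: "X j 0 \<le> 4 * L" using X0_le_4L[of u j] s x by simp
      have "\<bar>W j (s + de) - W j u\<bar> \<le> o2"
        using s(2) u de0 unfolding s_def by (intro osc2[OF _ j4]) auto
      then show "W j (s + de) - W j u \<le> eps / 4" using o2_le by simp
    qed (use eps in simp)
    have nr: "near (2 * th) s" unfolding s_def using near_grid[of n] s(2) h by (simp add: s_def)
    have noise: "\<bar>Ghat s (s + de) x - heat de (G s) x\<bar> \<le> (nu + rho * C3 T) * wt (s + de) x"
      using s x de0 th noise2[OF s(2)[unfolded s_def]]
      by (intro noise_near[OF nr]) (auto simp: s_def)
    have C4: "wt (s + de) x \<le> C4" using s yt eps by (intro wt_le_C4) (auto simp: x_def abs_le_iff)
    \<comment> \<open>\<open>G\<close> is nonnegative after a loss of the full \<open>de\<close>, so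
      the heat flow alone must have produced at least \<open>de\<close> at \<open>x\<close>.\<close>
    have "de \<le> Ghat s (s + de) x" using full G_nonneg[of "s + de" x] s de0 by simp
    also have "\<dots> \<le> heat de (G s) x + (nu + rho * C3 T) * wt (s + de) x"
      using noise by (simp add: abs_le_iff)
    also have "heat de (G s) x \<le> heat de (Gs s) x + 2 * th * wt (s + de) x"
      using near_heat(1)[OF nr s(1,7)] de0 by simp
    also have "heat de (Gs s) x \<le> 3 * m1 * de\<^sup>2 / (2 * (eps / 4)\<^sup>2)"
    proof (rule Gs_heat_left)
      show "x \<le> ys s - eps / 4" using ys_diff[OF s(1,5,6)] kde by (simp add: x_def abs_le_iff)
    qed (use s de0 eps in auto)
    also have "3 * m1 * de\<^sup>2 / (2 * (eps / 4)\<^sup>2) = 24 * m1 * de\<^sup>2 / eps\<^sup>2"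
      by (simp add: power_divide)
    finally have "de \<le> 24 * m1 * de\<^sup>2 / eps\<^sup>2 + (2 * th + nu + rho * C3 T) * wt (s + de) x"
      by (simp add: algebra_simps)
    also have "(2 * th + nu + rho * C3 T) * wt (s + de) x \<le> (2 * th + nu + rho * C3 T) * C4"
      using noise_error_bounds(1) th by (intro mult_left_mono C4) auto
    finally show False using p5 by simp
  qed
qed

text \<open>At a grid time \<open>s\<close> at or after \<open>t\<close>, the limit is visibly
  positive at distance \<open>eps / 4\<close> right of the boundary, hence so is \<open>G\<close>,
  and some particle lies to the left of that point. Back at time \<open>t\<close> it can be further
  right by noise only.\<close>

lemma leader_upper:
  assumes t: "0 \<le> t" "t \<le> T" shows "\<exists>i. X i t \<le> ys t + eps"
proof -
  define n where "n = nat \<lceil>t / h\<rceil>"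
  define s where "s = real n * h"
  have n: "t \<le> s" "s < t + h"
  proof -
    have "0 \<le> t / h" using t h by simp
    then have "t / h \<le> real n" "real n < t / h + 1" unfolding n_def by linarith+
    then show "t \<le> s" "s < t + h" using h unfolding s_def by (simp_all add: field_simps)
  qed
  have s: "0 \<le> s" "s \<le> T + 1" using n t h by auto
  define x where "x = ys s + eps / 4"
  have ysb: "\<bar>ys s\<bar> \<le> yb T" by (rule ys_le_yb[OF s])
  have "m0 * eps\<^sup>2 / 32 \<le> Gs s x"
    using Gs_lower[OF s(1), of x] eps by (simp add: x_def power_divide)
  moreover have "wt s x \<le> C4" using s ysb eps by (intro wt_le_C4) (auto simp: x_def abs_le_iff)
  then have "2 * th * wt s x \<le> 2 * th * C4" using th by (intro mult_left_mono) auto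
  moreover have "\<bar>G s x - Gs s x\<bar> \<le> 2 * th * wt s x"
    unfolding s_def using n t by (intro near_grid') (simp add: s_def)
  ultimately have "0 < G s x" using p6(1) by linarith
  then obtain i where i: "X i s < x" using G_pos_imp[OF s] by blast
  have kh: "\<bar>k\<bar> * sqrt h \<le> eps / 4"
    by (rule order_trans[OF _ kde]) (use h in \<open>intro mult_left_mono, auto\<close>)
  have yst: "ys s \<le> ys t + eps / 4" using ys_diff[OF t(1) n(1), of h] n kh by (simp add: abs_le_iff)
  have "X i t \<le> X i s + eps / 4"
  proof (cases "n = 0")
    case True then show ?thesis using n t eps by (simp add: s_def)
  next
    case False
    \<comment> \<open>\<open>t\<close> lies in the step that ends at \<open>s\<close>, so the
      oscillation bound is that of index \<open>n - 1\<close>; \<open>n = 0\<close> occurs only for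
      \<open>t = 0\<close>.\<close>
    have s': "s = real (n - 1) * h + h" using False by (simp add: s_def of_nat_diff algebra_simps)
    have i4: "X i 0 \<le> 4 * L" using X0_le_4L[OF s, of i] i ysb yb_L eps by (simp add: x_def abs_le_iff)
    have "\<bar>W i s - W i t\<bar> \<le> o1"
      using n t h by (intro osc1[where n="n - 1", OF _ i4]) (auto simp: s')
    moreover have "X i s - X i t = (A i s - A i t) + (W i s - W i t)" using X_diff[OF t(1) s(1)] .
    moreover have "A i t \<le> A i s" using A_mono[OF t(1) n(1)] .
    ultimately show ?thesis using o1_le' by linarith
  qed
  then have "X i t \<le> ys t + eps" using i yst eps unfolding x_def by linarith
  then show ?thesis by blast
qed

text \<open>Between grid times \<open>G\<close> is compared particle by particle with the preceding
  grid time. A relevant particle moves by at most \<open>o1\<close> plus its own drift; the number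
  of relevant ones is bounded by \<open>G s (x + 2)\<close>, and the drifts add up to
  \<open>t - s\<close>.\<close>

lemma G_close:
  assumes t: "0 \<le> t" "t \<le> T" and x: "\<bar>x\<bar> \<le> R"
  shows "\<bar>G t x - Gs t x\<bar> \<le> eps"
proof -
  define n where "n = nat \<lfloor>t / h\<rfloor>"
  define s where "s = real n * h"
  have n: "s \<le> t" "t < s + h"
  proof -
    have "0 \<le> t / h" using t h by simp
    then have "real n \<le> t / h" "t / h < real n + 1" unfolding n_def by linarith+
    then show "s \<le> t" "t < s + h" using h unfolding s_def by (simp_all add: field_simps)
  qed
  have s: "0 \<le> s" "s \<le> T + 1" "s \<le> T" "t \<le> T + 1" using n t h by (auto simp: s_def)
  have nr: "near (2 * th) s" unfolding s_def using near_grid[of n] s(3) h by (simp add: s_def)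
  have sm: "summable (\<lambda>i. b * max 0 (y - X i s))" for y by (rule G_summable[OF s(1,2)])
  have smt: "summable (\<lambda>i. b * max 0 (y - X i t))" for y by (rule G_summable[OF t(1) s(4)])
  have smA: "(\<lambda>i. b * (A i t - A i s)) sums (t - s)" by (rule A_sums[OF s(1) n(1)])
  have part: "\<bar>max 0 (x - X i t) - max 0 (x - X i s)\<bar> \<le> o1 * max 0 (x + 2 - X i s) + (A i t - A i s)" for i
  proof (cases "X i t \<le> x \<or> X i s \<le> x")
    case False
    then show ?thesis using A_mono[OF s(1) n(1), of i] o1 by simp
  next
    case True
    then have i4: "X i 0 \<le> 4 * L"
      using X0_le_4L[OF s(1,2), of i] X0_le_4L[OF t(1) s(4), of i] x R by linarith
    have W: "\<bar>W i t - W i s\<bar> \<le> o1"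
      using n s(3) h unfolding s_def by (intro osc1[OF _ i4]) auto
    have X: "X i t - X i s = (A i t - A i s) + (W i t - W i s)" using X_diff[OF s(1) t(1)] .
    have Am: "A i s \<le> A i t" using A_mono[OF s(1) n(1)] .
    have "X i s \<le> x + 1" using True W X Am o1_le' eps by linarith
    then have "o1 * 1 \<le> o1 * max 0 (x + 2 - X i s)" using o1 by (intro mult_left_mono) auto
    moreover have "\<bar>max 0 (x - X i t) - max 0 (x - X i s)\<bar> \<le> \<bar>X i t - X i s\<bar>"
      by (simp add: max_def abs_minus_commute)
    ultimately show ?thesis using W X Am by linarith
  qed
  have part': "\<bar>b * max 0 (x - X i t) - b * max 0 (x - X i s)\<bar> \<le> o1 * (b * max 0 (x + 2 - X i s)) + b * (A i t - A i s)" for i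
  proof -
    have "\<bar>b * max 0 (x - X i t) - b * max 0 (x - X i s)\<bar> = b * \<bar>max 0 (x - X i t) - max 0 (x - X i s)\<bar>"
      unfolding right_diff_distrib[symmetric] abs_mult using b_pos by simp
    also have "\<dots> \<le> b * (o1 * max 0 (x + 2 - X i s) + (A i t - A i s))"
      using b_pos by (intro mult_left_mono part) auto
    finally show ?thesis by (simp add: distrib_left mult.left_commute)
  qed
  have sum_r: "(\<lambda>i. o1 * (b * max 0 (x + 2 - X i s)) + b * (A i t - A i s)) sums (o1 * G s (x + 2) + (t - s))"
    unfolding G_def by (intro sums_add smA sums_mult summable_sums sm)
  have smd: "summable (\<lambda>i. \<bar>b * max 0 (x - X i t) - b * max 0 (x - X i s)\<bar>)"
    by (rule summable_comparison_test'[OF sums_summable[OF sum_r]]) (use part' in simp)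
  have "\<bar>G t x - G s x\<bar> = \<bar>\<Sum>i. b * max 0 (x - X i t) - b * max 0 (x - X i s)\<bar>"
    unfolding G_def by (subst suminf_diff[OF smt sm]) simp
  also have "\<dots> \<le> (\<Sum>i. \<bar>b * max 0 (x - X i t) - b * max 0 (x - X i s)\<bar>)" by (rule summable_rabs[OF smd])
  also have "\<dots> \<le> o1 * G s (x + 2) + (t - s)"
    unfolding sums_unique[OF sum_r] by (intro suminf_le part' smd sums_summable[OF sum_r])
  also have "G s (x + 2) \<le> C3 T * C4"
  proof -
    have "G s (x + 2) = heat 0 (G s) (x + 2)"
      unfolding heat_def using G_measurable[OF s(1,2)] by (subst integral_gauss_0) auto
    also have "\<dots> \<le> (C1 T + 1) * wt (s + 0) (x + 2)"
      by (rule heat_G_le[OF nr _ s(1,2)]) (use th in auto)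
    also have "\<dots> \<le> (C1 T + 1) * (exp 4 * wt s x)" using C1_C3_pos wt_shift[of s x] by (intro mult_left_mono) auto
    also have "\<dots> \<le> (C1 T + 1) * (exp 4 * C4)" using C1_C3_pos wt_le_C4'[OF s(2), of x] x by (intro mult_left_mono) auto
    also have "\<dots> \<le> C3 T * C4"
    proof -
      have "0 \<le> C4" using C4_1 exp_gt_zero[of "2 * (yb T + 1) + 2 * (T + 1)"] by linarith
      then show ?thesis unfolding C3_def mult.assoc[symmetric] by (intro mult_right_mono) auto
    qed
    finally show ?thesis .
  qed
  finally have "\<bar>G t x - G s x\<bar> \<le> o1 * (C3 T * C4) + h" using o1 n by (simp add: mult_left_mono)
  moreover have "\<bar>G s x - Gs s x\<bar> \<le> 2 * th * wt s x"
    unfolding s_def using s(3) h by (intro near_grid') (simp add: s_def)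
  moreover have "2 * th * wt s x \<le> 2 * th * C4" using th x wt_le_C4'[OF s(2), of x] by (intro mult_left_mono) auto
  moreover have "\<bar>Gs s x - Gs t x\<bar> \<le> eps / 4" using p7[OF s(1) n(1) s(4) _ x] n by simp
  ultimately show ?thesis using o1_le' h_le p6 by linarith
qed

end

section \<open>Probability of the exceptional events\<close>

context prob_space begin

lemma indep_var_of_indep_set:
  assumes ind: "indep_set (sets A) (sets B)" and sp: "space A = space M" "space B = space M"
    and U: "U \<in> A \<rightarrow>\<^sub>M S" and V: "V \<in> B \<rightarrow>\<^sub>M T"
  shows "indep_var S U T V"
proof -
  have A: "sets A \<subseteq> events" and B: "sets B \<subseteq> events"
    using indep_setD_ev1[OF ind] indep_setD_ev2[OF ind] by auto
  have U': "random_variable S U" and V': "random_variable T V"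
    using U V A B sp unfolding measurable_def by auto
  have 1: "sigma_sets (space M) {U -` C \<inter> space M |C. C \<in> sets S} \<subseteq> sets A"
    unfolding sp(1)[symmetric] by (rule sets.sigma_sets_subset) (use measurable_sets[OF U] in auto)
  have 2: "sigma_sets (space M) {V -` C \<inter> space M |C. C \<in> sets T} \<subseteq> sets B"
    unfolding sp(2)[symmetric] by (rule sets.sigma_sets_subset) (use measurable_sets[OF V] in auto)
  have "indep_set (sigma_sets (space M) {U -` C \<inter> space M |C. C \<in> sets S})
      (sigma_sets (space M) {V -` C \<inter> space M |C. C \<in> sets T})"
    using ind 1 2 unfolding indep_set_def
    by (elim indep_sets_mono_sets) (auto split: bool.split)
  then show ?thesis unfolding indep_var_eq using U' V' by simp
qed

text \<open>This takes the place of conditioning: \<open>U\<close> stands for the past and is frozen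
  while the independent \<open>V\<close> is integrated out.\<close>

lemma nn_integral_indep_var:
  assumes ind: "indep_var S U T V" and [measurable]: "f \<in> borel_measurable (S \<Otimes>\<^sub>M T)"
  shows "(\<integral>\<^sup>+\<omega>. f (U \<omega>, V \<omega>) \<partial>M) = (\<integral>\<^sup>+\<omega>. (\<integral>\<^sup>+v. f (U \<omega>, v) \<partial>distr M T V) \<partial>M)"
proof -
  have eq: "distr M S U \<Otimes>\<^sub>M distr M T V = distr M (S \<Otimes>\<^sub>M T) (\<lambda>x. (U x, V x))"
    and [measurable]: "random_variable S U" "random_variable T V"
    using ind unfolding indep_var_distribution_eq by auto
  interpret T: prob_space "distr M T V" by (rule prob_space_distr) measurable
  have "(\<integral>\<^sup>+\<omega>. f (U \<omega>, V \<omega>) \<partial>M) = (\<integral>\<^sup>+p. f p \<partial>distr M (S \<Otimes>\<^sub>M T) (\<lambda>x. (U x, V x)))"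
    by (subst nn_integral_distr) auto
  also have "\<dots> = (\<integral>\<^sup>+u. (\<integral>\<^sup>+v. f (u, v) \<partial>distr M T V) \<partial>distr M S U)"
    unfolding eq[symmetric] by (rule T.nn_integral_fst[symmetric]) simp
  also have "\<dots> = (\<integral>\<^sup>+\<omega>. (\<integral>\<^sup>+v. f (U \<omega>, v) \<partial>distr M T V) \<partial>M)"
    by (subst nn_integral_distr) auto
  finally show ?thesis .
qed

lemma integral_indep_var:
  fixes f :: "_ \<Rightarrow> real"
  assumes ind: "indep_var S U T V" and [measurable]: "f \<in> borel_measurable (S \<Otimes>\<^sub>M T)"
    and int: "integrable M (\<lambda>\<omega>. f (U \<omega>, V \<omega>))"
  shows "(\<integral>\<omega>. f (U \<omega>, V \<omega>) \<partial>M) = (\<integral>\<omega>. (\<integral>v. f (U \<omega>, v) \<partial>distr M T V) \<partial>M)"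
proof -
  have eq: "distr M S U \<Otimes>\<^sub>M distr M T V = distr M (S \<Otimes>\<^sub>M T) (\<lambda>x. (U x, V x))"
    and [measurable]: "random_variable S U" "random_variable T V"
    using ind unfolding indep_var_distribution_eq by auto
  interpret S: prob_space "distr M S U" by (rule prob_space_distr) measurable
  interpret T: prob_space "distr M T V" by (rule prob_space_distr) measurable
  interpret ST: pair_sigma_finite "distr M S U" "distr M T V" ..
  have "integrable (distr M S U \<Otimes>\<^sub>M distr M T V) f"
    unfolding eq using int by (subst integrable_distr_eq) auto
  from ST.integral_fst'[OF this]
  have "(\<integral>\<omega>. f (U \<omega>, V \<omega>) \<partial>M) = (\<integral>u. (\<integral>v. f (u, v) \<partial>distr M T V) \<partial>distr M S U)"
    unfolding eq by (subst (asm) (2) integral_distr) auto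
  also have "\<dots> = (\<integral>\<omega>. (\<integral>v. f (U \<omega>, v) \<partial>distr M T V) \<partial>M)"
    by (subst integral_distr) auto
  finally show ?thesis .
qed

end

lemma ennreal_suminf_swap: "(\<Sum>i. \<Sum>n. f i n) = (\<Sum>n. \<Sum>i. f i (n::nat) :: ennreal)" for f :: "nat \<Rightarrow> nat \<Rightarrow> ennreal"
  unfolding nn_integral_count_space_nat[symmetric, of "\<lambda>i. \<Sum>n. f i n"]
  by (subst nn_integral_suminf) (auto simp: nn_integral_count_space_nat)

text \<open>The interface between the rescaled system and the probability estimates.
  \<open>intensity\<close> and \<open>fluct\<close> are the mean and the mean absolute deviation of
  the Poisson counts; independence of the driving motions enters in pairs, through second
  moments.\<close>

locale scaled_atlas = prob_space M for M :: "'a measure" +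
  fixes b lam :: real and X W :: "nat \<Rightarrow> real \<Rightarrow> 'a \<Rightarrow> real" and F :: "real \<Rightarrow> 'a measure"
  assumes b_pos: "b > 0" and lam_pos': "lam > 0"
    and F_sub: "\<And>t. 0 \<le> t \<Longrightarrow> subalgebra M (F t)"
    and X_adapted: "\<And>i t. 0 \<le> t \<Longrightarrow> X i t \<in> borel_measurable (F t)"
    and X0_adapted: "\<And>i t. 0 \<le> t \<Longrightarrow> X i 0 \<in> borel_measurable (F t)"
    and W_meas: "\<And>i t. 0 \<le> t \<Longrightarrow> W i t \<in> borel_measurable M"
    and W_normal: "\<And>i s t. 0 \<le> s \<Longrightarrow> s < t \<Longrightarrow>
      distributed M lborel (\<lambda>\<omega>. W i t \<omega> - W i s \<omega>) (\<lambda>x. ennreal (normal_density 0 (sqrt (t - s)) x))"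
    and W_indep_F: "\<And>s t. 0 \<le> s \<Longrightarrow> s < t \<Longrightarrow> indep_set (sets (F s))
      (sets (vimage_algebra (space M) (\<lambda>\<omega> i. W i t \<omega> - W i s \<omega>) (PiM UNIV (\<lambda>_. borel))))"
    and W_pair: "\<And>i j s t. i \<noteq> j \<Longrightarrow> 0 \<le> s \<Longrightarrow> s < t \<Longrightarrow>
      indep_var borel (\<lambda>\<omega>. W i t \<omega> - W i s \<omega>) borel (\<lambda>\<omega>. W j t \<omega> - W j s \<omega>)"
    and lower: "AE \<omega> in M. \<forall>i. \<forall>t\<ge>0. X i 0 \<omega> + W i t \<omega> \<le> X i t \<omega>"
    and W0: "AE \<omega> in M. \<forall>i. W i 0 \<omega> = 0"
    and W_cont: "AE \<omega> in M. \<forall>i. continuous_on {0..} (\<lambda>t. W i t \<omega>)"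
    and X0_nonneg: "AE \<omega> in M. \<forall>i. 0 \<le> X i 0 \<omega>"
    and intensity: "\<And>u v. 0 \<le> u \<Longrightarrow> u \<le> v \<Longrightarrow>
      (\<Sum>i. emeasure M {\<omega> \<in> space M. X i 0 \<omega> \<in> {u..<v}}) \<le> ennreal (lam * (v - u) / b)"
    and fluct: "\<And>y. 0 \<le> y \<Longrightarrow>
      (\<integral>\<^sup>+\<omega>. ennreal \<bar>b * enn2real (\<Sum>i. indicator {..y} (X i 0 \<omega>)) - lam * y\<bar> \<partial>M) \<le> ennreal (sqrt (b * lam * y))"
    and finite_below: "AE \<omega> in M. \<forall>y. finite {i. X i 0 \<omega> \<le> y}"
begin

lemma X_meas[measurable]: "0 \<le> t \<Longrightarrow> X i t \<in> borel_measurable M"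
  using measurable_from_subalg[OF F_sub X_adapted] .

lemma X0_meas[measurable]: "X i 0 \<in> borel_measurable M"
  by (rule X_meas) simp

lemma space_F: "0 \<le> t \<Longrightarrow> space (F t) = space M"
  using F_sub[of t] unfolding subalgebra_def by simp

lemma W_distr: "0 \<le> s \<Longrightarrow> s < t \<Longrightarrow> distr M borel (\<lambda>\<omega>. W i t \<omega> - W i s \<omega>) = gauss (t - s)"
  using distributed_gauss[OF W_normal] by simp

lemma space_incr_algebra: "space (vimage_algebra (space M) (\<lambda>\<omega> i. W i t \<omega> - W i s \<omega>) (PiM UNIV (\<lambda>_. borel))) = space M"
  by simp

lemma measurable_incr:
  "(\<lambda>\<omega>. W i t \<omega> - W i s \<omega>) \<in> borel_measurable (vimage_algebra (space M) (\<lambda>\<omega> i. W i t \<omega> - W i s \<omega>) (PiM UNIV (\<lambda>_. borel)))"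
proof -
  have "(\<lambda>\<omega> i. W i t \<omega> - W i s \<omega>) \<in> measurable (vimage_algebra (space M) (\<lambda>\<omega> i. W i t \<omega> - W i s \<omega>) (PiM UNIV (\<lambda>_. borel))) (PiM UNIV (\<lambda>_. borel))"
    by (rule measurable_vimage_algebra1) (auto simp: space_PiM)
  from measurable_compose[OF this measurable_component_singleton[of i UNIV]] show ?thesis by simp
qed

lemma indep_incr:
  assumes "0 \<le> s" "s < t" "U \<in> F s \<rightarrow>\<^sub>M N"
  shows "indep_var N U borel (\<lambda>\<omega>. W i t \<omega> - W i s \<omega>)"
  by (rule indep_var_of_indep_set[OF W_indep_F[OF assms(1,2)] space_F[OF assms(1)] space_incr_algebra assms(3) measurable_incr])

lemma indep_incr2:
  assumes "0 \<le> s" "s < t" "U \<in> F s \<rightarrow>\<^sub>M N"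
  shows "indep_var N U (borel \<Otimes>\<^sub>M borel) (\<lambda>\<omega>. (W i t \<omega> - W i s \<omega>, W j t \<omega> - W j s \<omega>))"
  by (rule indep_var_of_indep_set[OF W_indep_F[OF assms(1,2)] space_F[OF assms(1)] space_incr_algebra assms(3)])
     (intro measurable_Pair measurable_incr)

lemma nn_integral_incr:
  fixes U :: "'a \<Rightarrow> real"
  assumes "0 \<le> s" "s < t" "U \<in> F s \<rightarrow>\<^sub>M N" "f \<in> borel_measurable (N \<Otimes>\<^sub>M borel)"
  shows "(\<integral>\<^sup>+\<omega>. f (U \<omega>, W i t \<omega> - W i s \<omega>) \<partial>M) = (\<integral>\<^sup>+\<omega>. (\<integral>\<^sup>+w. f (U \<omega>, w) \<partial>gauss (t - s)) \<partial>M)"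
  using nn_integral_indep_var[OF indep_incr[OF assms(1-3), of i] assms(4)] unfolding W_distr[OF assms(1,2)] .

lemma nn_integral_incr_prod:
  assumes st: "0 \<le> s" "s < t" and [measurable]: "f \<in> borel_measurable borel" "g \<in> borel_measurable borel"
  shows "(\<integral>\<^sup>+\<omega>. f (X i 0 \<omega>) * g (W i t \<omega> - W i s \<omega>) \<partial>M) = (\<integral>\<^sup>+\<omega>. f (X i 0 \<omega>) \<partial>M) * (\<integral>\<^sup>+w. g w \<partial>gauss (t - s))"
proof -
  have "(\<integral>\<^sup>+\<omega>. f (X i 0 \<omega>) * g (W i t \<omega> - W i s \<omega>) \<partial>M)
      = (\<integral>\<^sup>+\<omega>. (\<integral>\<^sup>+w. f (X i 0 \<omega>) * g w \<partial>gauss (t - s)) \<partial>M)"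
    using nn_integral_incr[OF st X0_adapted[OF st(1)], of "\<lambda>p. f (fst p) * g (snd p)" i i] by simp
  also have "\<dots> = (\<integral>\<^sup>+\<omega>. f (X i 0 \<omega>) * (\<integral>\<^sup>+w. g w \<partial>gauss (t - s)) \<partial>M)"
    by (subst nn_integral_cmult) auto
  also have "\<dots> = (\<integral>\<^sup>+\<omega>. f (X i 0 \<omega>) \<partial>M) * (\<integral>\<^sup>+w. g w \<partial>gauss (t - s))"
    by (subst nn_integral_multc) auto
  finally show ?thesis .
qed

text \<open>An inequality form of Campbell's formula: a nonincreasing \<open>f\<close> is replaced
  by its value at the left end of the unit cell containing the point, and each cell has mean count
  at most \<open>lam / b\<close>.\<close>

lemma campbell_le:
  assumes [measurable]: "f \<in> borel_measurable borel" and anti: "\<And>x y. 0 \<le> x \<Longrightarrow> x \<le> y \<Longrightarrow> f y \<le> (f x :: ennreal)"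
  shows "(\<Sum>i. \<integral>\<^sup>+\<omega>. f (X i 0 \<omega>) \<partial>M) \<le> ennreal (lam / b) * (\<Sum>n. f (real n))"
proof -
  let ?e = "\<lambda>i n. emeasure M {\<omega> \<in> space M. X i 0 \<omega> \<in> {real n..<real n + 1}}"
  have "(\<integral>\<^sup>+\<omega>. f (X i 0 \<omega>) \<partial>M) \<le> (\<Sum>n. f (real n) * ?e i n)" for i
  proof -
    have "(\<integral>\<^sup>+\<omega>. f (X i 0 \<omega>) \<partial>M)
        \<le> (\<integral>\<^sup>+\<omega>. (\<Sum>n. f (real n) * indicator {\<omega> \<in> space M. X i 0 \<omega> \<in> {real n..<real n + 1}} \<omega>) \<partial>M)"
    proof (rule nn_integral_mono_AE)
      show "AE \<omega> in M. f (X i 0 \<omega>)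
        \<le> (\<Sum>n. f (real n) * indicator {\<omega> \<in> space M. X i 0 \<omega> \<in> {real n..<real n + 1}} \<omega>)"
        using X0_nonneg AE_space
      proof (eventually_elim, goal_cases)
        case (1 \<omega>)
        define n where "n = nat \<lfloor>X i 0 \<omega>\<rfloor>"
        have n: "real n \<le> X i 0 \<omega>" "X i 0 \<omega> < real n + 1"
          using 1 unfolding n_def by (simp_all add: floor_le_iff less_floor_iff)
        have "f (X i 0 \<omega>) \<le> f (real n)" using n by (intro anti) auto
        also have "\<dots> = (\<Sum>m\<in>{n}. f (real m) * indicator {\<omega> \<in> space M. X i 0 \<omega> \<in> {real m..<real m + 1}} \<omega>)"
          using n 1 by simp
        also have "\<dots> \<le> (\<Sum>m. f (real m) * indicator {\<omega> \<in> space M. X i 0 \<omega> \<in> {real m..<real m + 1}} \<omega>)"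
          by (intro sum_le_suminf) auto
        finally show ?case .
      qed
    qed
    also have "\<dots> = (\<Sum>n. f (real n) * ?e i n)"
      by (subst nn_integral_suminf) (auto simp: nn_integral_cmult)
    finally show ?thesis .
  qed
  then have "(\<Sum>i. \<integral>\<^sup>+\<omega>. f (X i 0 \<omega>) \<partial>M) \<le> (\<Sum>i. \<Sum>n. f (real n) * ?e i n)"
    by (intro suminf_le) auto
  also have "\<dots> = (\<Sum>n. \<Sum>i. f (real n) * ?e i n)" by (rule ennreal_suminf_swap)
  also have "\<dots> = (\<Sum>n. f (real n) * (\<Sum>i. ?e i n))" by simp
  also have "\<dots> \<le> (\<Sum>n. f (real n) * ennreal (lam / b))"
    using intensity[of "real n" "real n + 1" for n] by (intro suminf_le mult_left_mono) auto
  also have "\<dots> = ennreal (lam / b) * (\<Sum>n. f (real n))" by (simp add: mult.commute)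
  finally show ?thesis .
qed

definition zeta2 :: real where "zeta2 = (\<Sum>n. 1 / (1 + real n)\<^sup>2)"

lemma zeta2: "summable (\<lambda>n. 1 / (1 + real n)\<^sup>2)" "0 \<le> zeta2"
  "(\<Sum>n. ennreal (1 / (1 + real n)\<^sup>2)) = ennreal zeta2"
proof -
  have "summable (\<lambda>n. inverse ((real (Suc n))\<^sup>2))"
    using inverse_power_summable[of 2] by (subst summable_Suc_iff) auto
  then show s: "summable (\<lambda>n. 1 / (1 + real n)\<^sup>2)" by (simp add: inverse_eq_divide add.commute)
  show "0 \<le> zeta2" unfolding zeta2_def by (intro suminf_nonneg s) simp
  show "(\<Sum>n. ennreal (1 / (1 + real n)\<^sup>2)) = ennreal zeta2"
    unfolding zeta2_def by (intro suminf_ennreal2 s) auto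
qed

text \<open>The summability that underlies all estimates over infinitely many particles. The
  \<open>max 0\<close> makes the integrand bounded and nonincreasing in the starting point on the
  whole line.\<close>

lemma inv_sq_sum: "(\<Sum>i. \<integral>\<^sup>+\<omega>. ennreal (1 / (1 + max 0 (X i 0 \<omega>))\<^sup>2) \<partial>M) \<le> ennreal (lam / b * zeta2)"
proof -
  have "(\<Sum>i. \<integral>\<^sup>+\<omega>. ennreal (1 / (1 + max 0 (X i 0 \<omega>))\<^sup>2) \<partial>M)
      \<le> ennreal (lam / b) * (\<Sum>n. ennreal (1 / (1 + max 0 (real n))\<^sup>2))"
    by (rule campbell_le[where f="\<lambda>x. ennreal (1 / (1 + max 0 x)\<^sup>2)"])
       (auto intro!: ennreal_leI frac_le power_mono)
  also have "\<dots> = ennreal (lam / b * zeta2)"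
    using zeta2 b_pos lam_pos' by (simp add: ennreal_mult[symmetric])
  finally show ?thesis .
qed

end

text \<open>Levy's dyadic chaining: a dyadic point is reached from \<open>s\<close> through one
  increment per level, and continuity carries the bound to all \<open>u\<close>.\<close>

lemma chaining:
  fixes f :: "real \<Rightarrow> real" and a :: "nat \<Rightarrow> real"
  assumes cont: "continuous_on {s..s + tau} f" and tau: "tau > 0"
    and incr: "\<And>n j. j < 2 ^ n \<Longrightarrow> \<bar>f (s + real (Suc j) * tau / 2 ^ n) - f (s + real j * tau / 2 ^ n)\<bar> \<le> a n"
    and B: "\<And>n. (\<Sum>m\<le>n. a m) \<le> B" and u: "s \<le> u" "u \<le> s + tau"
  shows "\<bar>f u - f s\<bar> \<le> B"
proof -
  have dyadic: "j \<le> 2 ^ n \<Longrightarrow> \<bar>f (s + real j * tau / 2 ^ n) - f s\<bar> \<le> (\<Sum>m\<le>n. a m)" for n j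
  proof (induction n arbitrary: j)
    case 0
    then have "j = 0 \<or> j = 1" by auto
    moreover have "0 \<le> a 0" by (rule order_trans[OF abs_ge_zero incr[of 0 0]]) simp
    ultimately show ?case using incr[of 0 0] by auto
  next
    case (Suc n)
    have a: "0 \<le> a (Suc n)" by (rule order_trans[OF abs_ge_zero incr[of 0 "Suc n"]]) simp
    \<comment> \<open>An even \<open>j\<close> already occurs on level \<open>n\<close>; an odd one
      is a single step of level \<open>Suc n\<close> away from its left neighbour, which
      does.\<close>
    define i where "i = j div 2"
    have i: "i \<le> 2 ^ n" using Suc.prems by (simp add: i_def)
    have eq: "s + real (2 * i) * tau / 2 ^ Suc n = s + real i * tau / 2 ^ n" by simp
    show ?case
    proof (cases "even j")
      case True
      then have "j = 2 * i" by (simp add: i_def)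
      then show ?thesis using Suc.IH[OF i] a eq by simp
    next
      case False
      then have j: "j = Suc (2 * i)" by (simp add: i_def)
      then have "2 * i < 2 ^ Suc n" using Suc.prems by simp
      from incr[OF this] Suc.IH[OF i] show ?thesis unfolding eq j by (simp add: abs_le_iff)
    qed
  qed
  \<comment> \<open>Dyadic approximation of \<open>u\<close> from the left.\<close>
  define v where "v n = s + real (nat \<lfloor>(u - s) * 2 ^ n / tau\<rfloor>) * tau / 2 ^ n" for n
  have v: "s \<le> v n" "v n \<le> u" "u - v n \<le> tau / 2 ^ n" "\<bar>f (v n) - f s\<bar> \<le> B" for n
  proof -
    let ?j = "nat \<lfloor>(u - s) * 2 ^ n / tau\<rfloor>"
    have 0: "0 \<le> (u - s) * 2 ^ n / tau" using u tau by simp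
    then have j: "real ?j \<le> (u - s) * 2 ^ n / tau" "(u - s) * 2 ^ n / tau < real ?j + 1" by linarith+
    have j1: "real ?j * tau / 2 ^ n \<le> u - s" using j(1) tau by (simp add: field_simps)
    have j2: "u - s \<le> (real ?j + 1) * tau / 2 ^ n" using j(2) tau by (simp add: field_simps)
    show "s \<le> v n" using tau by (simp add: v_def)
    show "v n \<le> u" using j1 by (simp add: v_def)
    show "u - v n \<le> tau / 2 ^ n" using j2 by (simp add: v_def distrib_right add_divide_distrib)
    have "(u - s) * 2 ^ n \<le> tau * 2 ^ n" using u by (intro mult_right_mono) auto
    then have "(u - s) * 2 ^ n / tau \<le> 2 ^ n" using tau by (simp add: pos_divide_le_eq mult.commute)
    then have "?j \<le> 2 ^ n" using j(1) by (metis of_nat_le_iff of_nat_numeral of_nat_power order_trans)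
    from order_trans[OF dyadic[OF this] B] show "\<bar>f (v n) - f s\<bar> \<le> B" by (simp add: v_def)
  qed
  have "v \<longlonglongrightarrow> u"
  proof (rule tendsto_sandwich[of "\<lambda>n. u - tau / 2 ^ n" _ _ "\<lambda>n. u"])
    have "(\<lambda>n. tau * (1 / 2) ^ n) \<longlonglongrightarrow> tau * 0" by (intro tendsto_mult_left LIMSEQ_power_zero) simp
    then have "(\<lambda>n. u - tau * (1 / 2) ^ n) \<longlonglongrightarrow> u - 0" by (intro tendsto_diff tendsto_const) simp
    then show "(\<lambda>n. u - tau / 2 ^ n) \<longlonglongrightarrow> u" by (simp add: power_one_over field_simps)
    show "\<forall>\<^sub>F n in sequentially. u - tau / 2 ^ n \<le> v n" using v(3) by (intro always_eventually) (simp add: algebra_simps)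
  qed (use v in auto)
  moreover have "\<forall>n. v n \<in> {s..s + tau}" using v(1,2) u by (auto intro: order_trans)
  ultimately have "(\<lambda>n. f (v n)) \<longlonglongrightarrow> f u"
    using cont u unfolding continuous_on_sequentially comp_def by fastforce
  then have "(\<lambda>n. \<bar>f (v n) - f s\<bar>) \<longlonglongrightarrow> \<bar>f u - f s\<bar>" by (intro tendsto_intros)
  then show ?thesis by (rule tendsto_upperbound) (use v(4) in auto)
qed

section \<open>Oscillation of the driving motions\<close>

context scaled_atlas begin

text \<open>The thresholds \<open>c / 10 * (9 / 10) ^ n\<close> of the dyadic levels add up to \<open>c\<close>.\<close>

definition osc_bad :: "real \<Rightarrow> real \<Rightarrow> real \<Rightarrow> real \<Rightarrow> 'a set" where
  "osc_bad s tau c R = (\<Union>i n. \<Union>j<2 ^ n. {\<omega> \<in> space M.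
     c / 10 * (9 / 10) ^ n * (R + max 0 (X i 0 \<omega>)) < \<bar>W i (s + real (Suc j) * tau / 2 ^ n) \<omega> - W i (s + real j * tau / 2 ^ n) \<omega>\<bar>})"

lemma osc_bad_sets: "0 \<le> s \<Longrightarrow> 0 < tau \<Longrightarrow> osc_bad s tau c R \<in> sets M"
  unfolding osc_bad_def
proof (intro sets.countable_UN sets.finite_UN image_subsetI)
  fix i n j assume "0 \<le> s" "0 < tau"
  then have [measurable]: "W i (s + real j * tau / 2 ^ n) \<in> borel_measurable M" for j
    by (intro W_meas) simp
  show "{\<omega> \<in> space M. c / 10 * (9 / 10) ^ n * (R + max 0 (X i 0 \<omega>))
     < \<bar>W i (s + real (Suc j) * tau / 2 ^ n) \<omega> - W i (s + real j * tau / 2 ^ n) \<omega>\<bar>} \<in> sets M"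
    by measurable
qed

text \<open>Markov's inequality for the \<open>2 * p\<close>-th moment. Splitting
  \<open>(R + y) ^ (2 * p)\<close> as at least \<open>R ^ (2 * p - 2) * (1 + y)^2\<close> leaves a
  factor summable over particles and a power of \<open>R\<close> as gain; the starting point and the
  increment are independent.\<close>

lemma osc_term:
  assumes st: "0 \<le> s" "s < t" and a: "0 < a" and R: "1 \<le> R" and p: "1 \<le> p"
  shows "emeasure M {\<omega> \<in> space M. a * (R + max 0 (X i 0 \<omega>)) < \<bar>W i t \<omega> - W i s \<omega>\<bar>}
    \<le> ennreal (moment p * ((t - s) / a\<^sup>2) ^ p / R ^ (2 * p - 2)) * (\<integral>\<^sup>+\<omega>. ennreal (1 / (1 + max 0 (X i 0 \<omega>))\<^sup>2) \<partial>M)"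
proof -
  note [measurable] = W_meas[of t i] W_meas[of s i]
  have [measurable]: "W i t \<in> borel_measurable M" "W i s \<in> borel_measurable M" using W_meas st by auto
  let ?f = "\<lambda>y. ennreal (1 / R ^ (2 * p - 2) * (1 / (1 + max 0 y)\<^sup>2))"
  let ?g = "\<lambda>w. ennreal (w ^ (2 * p) / a ^ (2 * p))"
  have "emeasure M {\<omega> \<in> space M. a * (R + max 0 (X i 0 \<omega>)) < \<bar>W i t \<omega> - W i s \<omega>\<bar>}
      = (\<integral>\<^sup>+\<omega>. indicator {\<omega> \<in> space M. a * (R + max 0 (X i 0 \<omega>)) < \<bar>W i t \<omega> - W i s \<omega>\<bar>} \<omega> \<partial>M)"
    by (rule nn_integral_indicator[symmetric]) measurable
  also have "\<dots> \<le> (\<integral>\<^sup>+\<omega>. ?f (X i 0 \<omega>) * ?g (W i t \<omega> - W i s \<omega>) \<partial>M)"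
  proof (intro nn_integral_mono)
    fix \<omega>
    show "indicator {\<omega> \<in> space M. a * (R + max 0 (X i 0 \<omega>)) < \<bar>W i t \<omega> - W i s \<omega>\<bar>} \<omega>
        \<le> ?f (X i 0 \<omega>) * ?g (W i t \<omega> - W i s \<omega>)"
    proof (cases "a * (R + max 0 (X i 0 \<omega>)) < \<bar>W i t \<omega> - W i s \<omega>\<bar>")
      case True
      define y where "y = max 0 (X i 0 \<omega>)"
      define w where "w = W i t \<omega> - W i s \<omega>"
      have y: "0 \<le> y" by (simp add: y_def)
      have "(a * (R + y)) ^ (2 * p) \<le> \<bar>w\<bar> ^ (2 * p)"
        using True a R y unfolding y_def w_def by (intro power_mono) auto
      also have "\<dots> = w ^ (2 * p)" by (simp add: power_mult)
      finally have 1: "(R + y) ^ (2 * p) \<le> w ^ (2 * p) / a ^ (2 * p)"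
        using a by (simp add: power_mult_distrib[of a] pos_le_divide_eq mult.commute)
      have "R ^ (2 * p - 2) * (1 + y)\<^sup>2 \<le> (R + y) ^ (2 * p - 2) * (R + y)\<^sup>2"
        using R y by (intro mult_mono power_mono) auto
      also have "\<dots> = (R + y) ^ ((2 * p - 2) + 2)" by (simp only: power_add)
      also have "(2 * p - 2) + 2 = 2 * p" using p by simp
      finally have "R ^ (2 * p - 2) * (1 + y)\<^sup>2 \<le> w ^ (2 * p) / a ^ (2 * p)" using 1 by simp
      then have "1 \<le> 1 / R ^ (2 * p - 2) * (1 / (1 + y)\<^sup>2) * (w ^ (2 * p) / a ^ (2 * p))"
      proof -
        define Z where "Z = R ^ (2 * p - 2) * (1 + y)\<^sup>2"
        have Z: "0 < Z" using R y unfolding Z_def by (intro mult_pos_pos zero_less_power) auto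
        have "1 / R ^ (2 * p - 2) * (1 / (1 + y)\<^sup>2) = 1 / Z" by (simp add: Z_def)
        moreover have "1 \<le> (w ^ (2 * p) / a ^ (2 * p)) / Z"
          using \<open>R ^ (2 * p - 2) * (1 + y)\<^sup>2 \<le> w ^ (2 * p) / a ^ (2 * p)\<close> Z
          unfolding Z_def[symmetric] by (simp only: pos_le_divide_eq[OF Z] mult_1)
        ultimately show ?thesis by (simp add: mult.commute)
      qed
      then have "ennreal 1 \<le> ennreal (1 / R ^ (2 * p - 2) * (1 / (1 + y)\<^sup>2) * (w ^ (2 * p) / a ^ (2 * p)))"
        by (rule ennreal_leI)
      also have "\<dots> = ennreal (1 / R ^ (2 * p - 2) * (1 / (1 + y)\<^sup>2)) * ennreal (w ^ (2 * p) / a ^ (2 * p))"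
        using R y a by (intro ennreal_mult) (auto simp: power_mult)
      finally show ?thesis by (auto simp: y_def w_def indicator_def)
    qed (simp add: indicator_def)
  qed
  also have "\<dots> = (\<integral>\<^sup>+\<omega>. ?f (X i 0 \<omega>) \<partial>M) * (\<integral>\<^sup>+w. ?g w \<partial>gauss (t - s))"
    by (rule nn_integral_incr_prod[OF st]) auto
  also have "(\<integral>\<^sup>+w. ?g w \<partial>gauss (t - s)) = ennreal (moment p * ((t - s) / a\<^sup>2) ^ p)"
  proof -
    have "(\<integral>\<^sup>+w. ?g w \<partial>gauss (t - s)) = ennreal (\<integral>w. w ^ (2 * p) / a ^ (2 * p) \<partial>gauss (t - s))"
      using a gauss_moment[of "t - s" "2 * p"]
      by (intro nn_integral_eq_integral) (auto simp: power_mult)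
    also have "(\<integral>w. w ^ (2 * p) / a ^ (2 * p) \<partial>gauss (t - s)) = moment p * ((t - s) / a\<^sup>2) ^ p"
    proof -
      have "(\<integral>w. w ^ (2 * p) / a ^ (2 * p) \<partial>gauss (t - s)) = moment p * (t - s) ^ p / a ^ (2 * p)"
        using st integral_gauss_moment[of "t - s" p] by simp
      then show ?thesis by (simp add: power_divide power_mult)
    qed
    finally show ?thesis .
  qed
  also have "(\<integral>\<^sup>+\<omega>. ?f (X i 0 \<omega>) \<partial>M) = ennreal (1 / R ^ (2 * p - 2)) * (\<integral>\<^sup>+\<omega>. ennreal (1 / (1 + max 0 (X i 0 \<omega>))\<^sup>2) \<partial>M)"
  proof -
    have "?f y = ennreal (1 / R ^ (2 * p - 2)) * ennreal (1 / (1 + max 0 y)\<^sup>2)" for y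
      using R by (intro ennreal_mult) auto
    then show ?thesis by (simp add: nn_integral_cmult)
  qed
  also have "ennreal (1 / R ^ (2 * p - 2)) * (\<integral>\<^sup>+\<omega>. ennreal (1 / (1 + max 0 (X i 0 \<omega>))\<^sup>2) \<partial>M)
      * ennreal (moment p * ((t - s) / a\<^sup>2) ^ p)
    = (ennreal (moment p * ((t - s) / a\<^sup>2) ^ p) * ennreal (1 / R ^ (2 * p - 2)))
      * (\<integral>\<^sup>+\<omega>. ennreal (1 / (1 + max 0 (X i 0 \<omega>))\<^sup>2) \<partial>M)"
    by (simp add: mult_ac)
  also have "ennreal (moment p * ((t - s) / a\<^sup>2) ^ p) * ennreal (1 / R ^ (2 * p - 2))
      = ennreal (moment p * ((t - s) / a\<^sup>2) ^ p / R ^ (2 * p - 2))"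
    using R st a by (subst ennreal_mult[symmetric]) (auto intro!: mult_nonneg_nonneg moment_nonneg)
  finally show ?thesis .
qed

text \<open>On level \<open>n\<close> there are \<open>2 ^ n\<close> increments of variance
  \<open>tau / 2 ^ n\<close> against a squared threshold \<open>c^2 / 100 * (81 / 100) ^ n\<close>,
  so the ratio decays like \<open>(50 / 81) ^ n\<close>; its \<open>p\<close>-th power has to beat
  the number of increments.\<close>

lemma emeasure_osc_bad:
  assumes s: "0 \<le> s" and tau: "0 < tau" and c: "0 < c" and R: "1 \<le> R" and p: "3 \<le> p"
  shows "emeasure M (osc_bad s tau c R)
    \<le> ennreal (2 * moment p * zeta2 * lam / b * (100 * tau / c\<^sup>2) ^ p / R ^ (2 * p - 2))"
proof -
  let ?K = "moment p * (100 * tau / c\<^sup>2) ^ p / R ^ (2 * p - 2)"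
  let ?I = "\<lambda>i. \<integral>\<^sup>+\<omega>. ennreal (1 / (1 + max 0 (X i 0 \<omega>))\<^sup>2) \<partial>M"
  define E where "E i n j = {\<omega> \<in> space M.
     c / 10 * (9 / 10) ^ n * (R + max 0 (X i 0 \<omega>)) < \<bar>W i (s + real (Suc j) * tau / 2 ^ n) \<omega> - W i (s + real j * tau / 2 ^ n) \<omega>\<bar>}" for i n j
  have K0: "0 \<le> ?K" using R tau by (intro divide_nonneg_nonneg mult_nonneg_nonneg moment_nonneg) auto
  have E_sets[measurable]: "E i n j \<in> sets M" for i n j
  proof -
    have [measurable]: "W i (s + real j * tau / 2 ^ n) \<in> borel_measurable M" for j
      using s tau by (intro W_meas) simp
    show ?thesis unfolding E_def by measurable
  qed
  have Eb: "emeasure M (E i n j) \<le> ennreal (?K * (50 / 81) ^ (n * p)) * ?I i" for i n j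
  proof -
    have 1: "0 \<le> s + real j * tau / 2 ^ n" using s tau by simp
    have 2: "s + real j * tau / 2 ^ n < s + real (Suc j) * tau / 2 ^ n" using tau by (simp add: divide_strict_right_mono)
    have d: "s + real (Suc j) * tau / 2 ^ n - (s + real j * tau / 2 ^ n) = tau / 2 ^ n" by (simp add: field_simps)
    have r: "(tau / 2 ^ n / (c / 10 * (9 / 10) ^ n)\<^sup>2) = 100 * tau / c\<^sup>2 * (50 / 81) ^ n"
    proof -
      define P where "P = (81 / 100 :: real) ^ n"
      have P: "0 < P" by (simp add: P_def)
      have "((9 / 10) ^ n)\<^sup>2 = P" by (simp only: P_def power2_eq_square power_mult_distrib[symmetric]) simp
      then have 1: "(c / 10 * (9 / 10) ^ n)\<^sup>2 = c\<^sup>2 / 100 * P"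
        by (simp only: power_mult_distrib[of "c / 10"]) (simp add: power_divide)
      have "(50 / 81 :: real) ^ n * (2 ^ n * P) = 1"
        by (simp only: P_def power_mult_distrib[symmetric]) simp
      then have "(50 / 81 :: real) ^ n = 1 / (2 ^ n * P)" using P by (simp add: divide_eq_eq eq_divide_eq)
      then show ?thesis unfolding 1 by (simp add: ac_simps)
    qed
    have "emeasure M (E i n j) \<le> ennreal (moment p * (tau / 2 ^ n / (c / 10 * (9 / 10) ^ n)\<^sup>2) ^ p / R ^ (2 * p - 2)) * ?I i"
      unfolding E_def using osc_term[OF 1 2 _ R, of "c / 10 * (9 / 10) ^ n" p i, unfolded d] c p by simp
    also have "moment p * (tau / 2 ^ n / (c / 10 * (9 / 10) ^ n)\<^sup>2) ^ p / R ^ (2 * p - 2) = ?K * (50 / 81) ^ (n * p)"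
      unfolding r power_mult_distrib[of "100 * tau / c\<^sup>2"] power_mult by simp
    finally show ?thesis .
  qed
  have En: "emeasure M (\<Union>j<2 ^ n. E i n j) \<le> ennreal (?K * (1 / 2) ^ n) * ?I i" for i n
  proof -
    have "emeasure M (\<Union>j<2 ^ n. E i n j) \<le> (\<Sum>j<2 ^ n. emeasure M (E i n j))"
      by (intro emeasure_subadditive_finite) auto
    also have "\<dots> \<le> (\<Sum>j<(2::nat) ^ n. ennreal (?K * (50 / 81) ^ (n * p)) * ?I i)" by (intro sum_mono Eb)
    also have "\<dots> = ennreal (2 ^ n * (?K * (50 / 81) ^ (n * p))) * ?I i"
    proof -
      define K' where "K' = ?K * (50 / 81) ^ (n * p)"
      have "0 \<le> K'" unfolding K'_def using K0 by (intro mult_nonneg_nonneg) auto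
      then have "ennreal (2 ^ n * K') = of_nat (2 ^ n) * ennreal K'"
        by (simp add: ennreal_mult ennreal_power[symmetric])
      then show ?thesis unfolding K'_def[symmetric] by (simp add: mult.assoc)
    qed
    also have "\<dots> \<le> ennreal (?K * (1 / 2) ^ n) * ?I i"
    proof (intro mult_right_mono ennreal_leI)
      have "(2 * (50 / 81) ^ p) ^ n \<le> (1 / 2 :: real) ^ n"
      proof (intro power_mono)
        \<comment> \<open>This is where \<open>p \<ge> 3\<close> is used: it yields
          \<open>2 * (50 / 81) ^ p \<le> 1 / 2\<close>, so the levels form a geometric
          series.\<close>
        have "(50 / 81 :: real) ^ p \<le> (50 / 81) ^ 3" using p by (intro power_decreasing) auto
        also have "\<dots> \<le> 1 / 4" by (simp add: power3_eq_cube)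
        finally show "2 * (50 / 81) ^ p \<le> (1 / 2 :: real)" by simp
      qed simp
      then have "?K * (2 * (50 / 81) ^ p) ^ n \<le> ?K * (1 / 2) ^ n" using K0 by (rule mult_left_mono)
      moreover have "(2 * (50 / 81) ^ p) ^ n = 2 ^ n * (50 / 81 :: real) ^ (n * p)"
        unfolding power_mult_distrib mult.commute[of n p] power_mult ..
      ultimately show "2 ^ n * (?K * (50 / 81) ^ (n * p)) \<le> ?K * (1 / 2) ^ n"
        by (simp only: mult.left_commute)
    qed simp
    finally show ?thesis .
  qed
  have "emeasure M (\<Union>n. \<Union>j<2 ^ n. E i n j) \<le> ennreal (2 * ?K) * ?I i" for i
  proof -
    have "emeasure M (\<Union>n. \<Union>j<2 ^ n. E i n j) \<le> (\<Sum>n. emeasure M (\<Union>j<2 ^ n. E i n j))"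
      by (intro emeasure_subadditive_countably) auto
    also have "\<dots> \<le> (\<Sum>n. ennreal (?K * (1 / 2) ^ n) * ?I i)" by (intro suminf_le En) auto
    also have "\<dots> = (\<Sum>n. ennreal (?K * (1 / 2) ^ n)) * ?I i" by simp
    also have "(\<Sum>n. ennreal (?K * (1 / 2) ^ n)) = ennreal (\<Sum>n. ?K * (1 / 2) ^ n)"
      by (rule suminf_ennreal2, rule mult_nonneg_nonneg[OF K0], simp, rule summable_mult, rule summable_geometric, simp)
    also have "(\<Sum>n. ?K * (1 / 2) ^ n) = 2 * ?K"
      by (subst suminf_mult[OF summable_geometric]) (auto simp: suminf_geometric)
    finally show ?thesis .
  qed
  then have B: "(\<Sum>i. emeasure M (\<Union>n. \<Union>j<2 ^ n. E i n j)) \<le> (\<Sum>i. ennreal (2 * ?K) * ?I i)"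
    by (intro suminf_le) auto
  have A: "emeasure M (osc_bad s tau c R) \<le> (\<Sum>i. emeasure M (\<Union>n. \<Union>j<2 ^ n. E i n j))"
    unfolding osc_bad_def E_def[symmetric] by (intro emeasure_subadditive_countably) auto
  have C: "(\<Sum>i. ennreal (2 * ?K) * ?I i) \<le> ennreal (2 * ?K) * ennreal (lam / b * zeta2)"
    using inv_sq_sum by (simp add: mult_left_mono)
  have D: "ennreal (2 * ?K) * ennreal (lam / b * zeta2) = ennreal (2 * moment p * zeta2 * lam / b * (100 * tau / c\<^sup>2) ^ p / R ^ (2 * p - 2))"
  proof -
    have 1: "0 \<le> 2 * ?K" using K0 by linarith
    have 2: "0 \<le> lam / b * zeta2" using b_pos lam_pos' zeta2(2) by simp
    have "2 * (m * q / r) * (l / b * z) = 2 * m * z * l / b * q / r" for m q r l z :: real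
      by (simp add: field_simps)
    then show ?thesis unfolding ennreal_mult[OF 1 2, symmetric] by (rule arg_cong[where f=ennreal])
  qed
  show ?thesis using order_trans[OF order_trans[OF A B] C] unfolding D .
qed

lemma osc_good:
  assumes \<omega>: "\<omega> \<in> space M" "\<omega> \<notin> osc_bad s tau c R"
    and cont: "continuous_on {0..} (\<lambda>t. W i t \<omega>)" and X0: "0 \<le> X i 0 \<omega>"
    and s: "0 \<le> s" "0 < tau" "0 \<le> c" "0 \<le> R" and u: "s \<le> u" "u \<le> s + tau"
  shows "\<bar>W i u \<omega> - W i s \<omega>\<bar> \<le> c * (R + X i 0 \<omega>)"
proof (rule chaining[where f="\<lambda>u. W i u \<omega>" and s=s and tau=tau and a="\<lambda>n. c / 10 * (9 / 10) ^ n * (R + X i 0 \<omega>)"])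
  show "continuous_on {s..s + tau} (\<lambda>u. W i u \<omega>)" by (rule continuous_on_subset[OF cont]) (use s in auto)
  show "\<bar>W i (s + real (Suc j) * tau / 2 ^ n) \<omega> - W i (s + real j * tau / 2 ^ n) \<omega>\<bar> \<le> c / 10 * (9 / 10) ^ n * (R + X i 0 \<omega>)"
    if "j < 2 ^ n" for n j
  proof (rule ccontr)
    assume "\<not> ?thesis"
    then have "\<omega> \<in> osc_bad s tau c R" unfolding osc_bad_def using \<omega>(1) X0 that
      by (intro UN_I[of i] UN_I[of n] UN_I[of j] CollectI conjI) (auto simp: not_le max_def)
    then show False using \<omega>(2) by simp
  qed
  show "(\<Sum>m\<le>n. c / 10 * (9 / 10) ^ m * (R + X i 0 \<omega>)) \<le> c * (R + X i 0 \<omega>)" for n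
  proof -
    have "(\<Sum>m\<le>n. (9 / 10 :: real) ^ m) \<le> (\<Sum>m. (9 / 10) ^ m)" by (intro sum_le_suminf) auto
    also have "\<dots> = 10" by (simp add: suminf_geometric)
    finally have 1: "(\<Sum>m\<le>n. (9 / 10 :: real) ^ m) \<le> 10" .
    have "(\<Sum>m\<le>n. c / 10 * (9 / 10) ^ m * (R + X i 0 \<omega>)) = c / 10 * (R + X i 0 \<omega>) * (\<Sum>m\<le>n. (9 / 10) ^ m)"
      unfolding sum_distrib_left by (intro sum.cong refl) (simp only: ac_simps)
    also have "\<dots> \<le> c / 10 * (R + X i 0 \<omega>) * 10"
      using s X0 by (intro mult_left_mono 1) auto
    finally show ?thesis by simp
  qed
qed (use s u in auto)

end

section \<open>The noise of one time step\<close>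

abbreviation pos :: "real \<Rightarrow> real" where "pos \<equiv> max 0"

lemma exp_bounded_pos: "exp_bounded pos"
proof (rule exp_bounded_poly[where C=1])
  show "\<bar>pos x\<bar> \<le> 1 * (1 + x\<^sup>2)" for x :: real
    using sum_squares_bound[of x 1] by (auto simp: max_def)
qed simp

lemma heat_pos_measurable[measurable]: "heat t pos \<in> borel_measurable borel"
proof -
  interpret sigma_finite_measure "gauss t" by (rule sigma_finite_gauss)
  have "(\<lambda>y. \<integral>w. pos (y - w) \<partial>gauss t) \<in> borel_measurable borel"
    by (rule borel_measurable_lebesgue_integral) measurable
  then show ?thesis unfolding heat_def[abs_def] .
qed

text \<open>Interchanges the sum over particles with the Gaussian integral, so that the difference
  of \<open>Ghat\<close> and the heat evolution of \<open>G\<close> becomes a series of the terms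
  \<open>b * xi\<close>.\<close>

lemma (in ranged_path) heat_G_sums:
  assumes t: "0 \<le> t" "t \<le> T + 1"
  shows "(\<lambda>i. b * heat r pos (x - X i t)) sums heat r (G t) x"
proof -
  have e: "x - w - X i t = x - X i t - w" for w i by simp
  have int: "integrable (gauss r) (\<lambda>w. b * pos (x - w - X i t))" for i
    unfolding e using exp_bounded_integrable[OF exp_bounded_pos, of r "x - X i t"] by simp
  have intG: "integrable (gauss r) (\<lambda>w. G t (x - w))"
    by (rule exp_bounded_integrable[OF exp_bounded_G[OF t]])
  have nn: "0 \<le> b * pos (x - w - X i t)" for w i using b_pos by simp
  have eq: "(\<integral>w. b * pos (x - w - X i t) \<partial>gauss r) = b * heat r pos (x - X i t)" for i
    unfolding heat_def e by simp
  have sm: "summable (\<lambda>i. \<integral>w. norm (b * pos (x - w - X i t)) \<partial>gauss r)"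
  proof (rule summableI_nonneg_bounded)
    fix n
    have "(\<Sum>i<n. \<integral>w. norm (b * pos (x - w - X i t)) \<partial>gauss r) = (\<integral>w. (\<Sum>i<n. b * pos (x - w - X i t)) \<partial>gauss r)"
      using nn int by (subst Bochner_Integration.integral_sum) auto
    also have "\<dots> \<le> (\<integral>w. G t (x - w) \<partial>gauss r)"
      unfolding G_def using int intG nn G_summable[OF t]
      by (intro integral_mono Bochner_Integration.integrable_sum) (auto simp: G_def intro!: sum_le_suminf)
    finally show "(\<Sum>i<n. \<integral>w. norm (b * pos (x - w - X i t)) \<partial>gauss r) \<le> (\<integral>w. G t (x - w) \<partial>gauss r)" .
  qed simp
  have "(\<lambda>i. \<integral>w. b * pos (x - w - X i t) \<partial>gauss r) sums (\<integral>w. (\<Sum>i. b * pos (x - w - X i t)) \<partial>gauss r)"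
    using G_summable[OF t] nn by (intro sums_integral int AE_I2 sm) auto
  then show ?thesis unfolding eq heat_def G_def .
qed

context scaled_atlas begin

text \<open>Given the past at time \<open>s\<close>, the subtracted term is the conditional mean of
  the first one, so \<open>xi\<close> is conditionally centred.\<close>

definition xi :: "real \<Rightarrow> real \<Rightarrow> real \<Rightarrow> nat \<Rightarrow> 'a \<Rightarrow> real" where
  "xi s t x i \<omega> = pos (x - (X i s \<omega> + (W i t \<omega> - W i s \<omega>))) - heat (t - s) pos (x - X i s \<omega>)"

text \<open>The lower limit makes Fatou's lemma applicable before the sum of the \<open>xi\<close> is known to converge.\<close>

definition noise_bad :: "real \<Rightarrow> real \<Rightarrow> real \<Rightarrow> real \<Rightarrow> 'a set" where
  "noise_bad s t x nu = {\<omega> \<in> space M. ennreal (nu\<^sup>2) < liminf (\<lambda>n. ennreal ((b * (\<Sum>i<n. xi s t x i \<omega>))\<^sup>2))}"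

context
  fixes s t :: real assumes st: "0 \<le> s" "s < t"
begin

lemma W_meas_st[measurable]: "W i t \<in> borel_measurable M" "W i s \<in> borel_measurable M" "X i s \<in> borel_measurable M"
  "W i 0 \<in> borel_measurable M"
  using st W_meas X_meas by auto

lemma xi_meas[measurable]: "xi s t x i \<in> borel_measurable M"
  unfolding xi_def[abs_def] by measurable

definition noise_const :: "real \<Rightarrow> real" where "noise_const x = 8 * ((1 + \<bar>x\<bar>) ^ 4 + 3 * t\<^sup>2)"

lemma K4_nonneg: "0 \<le> noise_const x" by (simp add: noise_const_def)

text \<open>With \<open>r = \<bar>x\<bar> + \<bar>w\<bar>\<close>, the product
  \<open>(r - y)_+ * (1 + y)\<close> is at most \<open>(1 + r)^2\<close>. Squaring separates a
  factor in the start \<open>y\<close>, summable over particles, from one in the noise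
  \<open>w\<close>; the 8 comes from \<open>(u + v)^4 \<le> 8 * (u^4 + v^4)\<close>.\<close>

lemma pos_sq_bound:
  assumes "0 \<le> y" "y + w \<le> z"
  shows "(pos (x - z))\<^sup>2 \<le> 1 / (1 + y)\<^sup>2 * (8 * ((1 + \<bar>x\<bar>) ^ 4 + w ^ 4))"
proof -
  define r where "r = \<bar>x\<bar> + \<bar>w\<bar>"
  have "pos (x - z) \<le> pos (r - y)" using assms unfolding r_def by linarith
  then have "pos (x - z) * (1 + y) \<le> pos (r - y) * (1 + y)" using assms by (intro mult_right_mono) auto
  also have "\<dots> \<le> (1 + r)\<^sup>2"
  proof (cases "y \<le> r")
    case True
    then have "(r - y) * (1 + y) \<le> (1 + r) * (1 + r)" using assms by (intro mult_mono) auto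
    then show ?thesis using True by (simp add: power2_eq_square)
  qed simp
  finally have "(pos (x - z) * (1 + y))\<^sup>2 \<le> ((1 + r)\<^sup>2)\<^sup>2" using assms by (intro power_mono) auto
  also have "\<dots> = (1 + r) ^ 4" by (simp add: power_mult[symmetric])
  also have "\<dots> \<le> 8 * ((1 + \<bar>x\<bar>) ^ 4 + \<bar>w\<bar> ^ 4)"
  proof -
    have sq: "(u + v)\<^sup>2 \<le> 2 * (u\<^sup>2 + v\<^sup>2)" for u v :: real using sum_squares_bound[of u v] by (simp add: power2_sum)
    define u v where "u = 1 + \<bar>x\<bar>" and "v = \<bar>w\<bar>"
    have "(u + v) ^ 4 = ((u + v)\<^sup>2)\<^sup>2" by (simp add: power_mult[symmetric])
    also have "\<dots> \<le> (2 * (u\<^sup>2 + v\<^sup>2))\<^sup>2" by (intro power_mono sq) auto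
    also have "\<dots> = 4 * (u\<^sup>2 + v\<^sup>2)\<^sup>2" by (simp only: power_mult_distrib) simp
    also have "\<dots> \<le> 4 * (2 * ((u\<^sup>2)\<^sup>2 + (v\<^sup>2)\<^sup>2))" by (intro mult_left_mono sq) auto
    finally show ?thesis by (simp add: u_def v_def r_def power_mult[symmetric] add.assoc)
  qed
  finally have "(pos (x - z))\<^sup>2 * (1 + y)\<^sup>2 \<le> 8 * ((1 + \<bar>x\<bar>) ^ 4 + w ^ 4)" by (simp only: power_mult_distrib power_even_abs even_numeral)
  moreover have "0 < (1 + y)\<^sup>2" using assms by simp
  ultimately show ?thesis by (simp add: pos_le_divide_eq)
qed

lemma gauss_var_le:
  "(\<integral>\<^sup>+w. ennreal ((pos (y - w) - heat r pos y)\<^sup>2) \<partial>gauss r) \<le> (\<integral>\<^sup>+w. ennreal ((pos (y - w))\<^sup>2) \<partial>gauss r)"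
proof -
  interpret g: prob_space "gauss r" by (rule prob_space_gauss)
  define c where "c = heat r pos y"
  have i1: "integrable (gauss r) (\<lambda>w. pos (y - w))" by (rule exp_bounded_integrable[OF exp_bounded_pos])
  have i2: "integrable (gauss r) (\<lambda>w. (pos (y - w))\<^sup>2)"
    using integrable_mult_right[OF exp_bounded_integrable[OF exp_bounded_possq, of r y], of 2] by simp
  have c: "c = (\<integral>w. pos (y - w) \<partial>gauss r)" by (simp add: c_def heat_def)
  have e: "(\<lambda>w. (pos (y - w) - c)\<^sup>2) = (\<lambda>w. (pos (y - w))\<^sup>2 - 2 * c * pos (y - w) + c\<^sup>2)"
    by (simp add: power2_diff algebra_simps)
  have i3: "integrable (gauss r) (\<lambda>w. (pos (y - w) - c)\<^sup>2)" unfolding e using i1 i2 by auto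
  have "(\<integral>w. (pos (y - w) - c)\<^sup>2 \<partial>gauss r) = (\<integral>w. (pos (y - w))\<^sup>2 \<partial>gauss r) - 2 * c * c + c\<^sup>2"
    unfolding e using i1 i2 g.prob_space by (simp add: c)
  also have "\<dots> \<le> (\<integral>w. (pos (y - w))\<^sup>2 \<partial>gauss r)" by (simp add: power2_eq_square)
  finally have "(\<integral>w. (pos (y - w) - c)\<^sup>2 \<partial>gauss r) \<le> (\<integral>w. (pos (y - w))\<^sup>2 \<partial>gauss r)" .
  then show ?thesis unfolding c_def[symmetric]
    using i2 i3 by (simp add: nn_integral_eq_integral ennreal_leI)
qed

text \<open>Freezing the past allows the variance to be replaced by the second moment; unfreezing
  returns to the actual increment. The position is then bounded below by
  \<open>X i 0 + W i t\<close>, whose two terms are independent, and \<open>noise_const\<close>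
  collects the resulting moments.\<close>

lemma xi_sq:
  "(\<integral>\<^sup>+\<omega>. ennreal ((xi s t x i \<omega>)\<^sup>2) \<partial>M)
    \<le> ennreal (noise_const x) * (\<integral>\<^sup>+\<omega>. ennreal (1 / (1 + pos (X i 0 \<omega>))\<^sup>2) \<partial>M)"
proof -
  let ?r = "t - s"
  have "(\<integral>\<^sup>+\<omega>. ennreal ((xi s t x i \<omega>)\<^sup>2) \<partial>M)
      = (\<integral>\<^sup>+\<omega>. (\<integral>\<^sup>+w. ennreal ((pos (x - X i s \<omega> - w) - heat ?r pos (x - X i s \<omega>))\<^sup>2) \<partial>gauss ?r) \<partial>M)"
    using nn_integral_incr[OF st X_adapted[OF st(1)], of "\<lambda>p. ennreal ((pos (x - fst p - snd p) - heat ?r pos (x - fst p))\<^sup>2)" i i]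
    by (simp add: xi_def diff_diff_add)
  also have "\<dots> \<le> (\<integral>\<^sup>+\<omega>. (\<integral>\<^sup>+w. ennreal ((pos (x - X i s \<omega> - w))\<^sup>2) \<partial>gauss ?r) \<partial>M)"
    by (intro nn_integral_mono gauss_var_le)
  also have "\<dots> = (\<integral>\<^sup>+\<omega>. ennreal ((pos (x - (X i s \<omega> + (W i t \<omega> - W i s \<omega>))))\<^sup>2) \<partial>M)"
    using nn_integral_incr[OF st X_adapted[OF st(1)], of "\<lambda>p. ennreal ((pos (x - fst p - snd p))\<^sup>2)" i i]
    by (simp add: diff_diff_add)
  also have "\<dots> \<le> (\<integral>\<^sup>+\<omega>. ennreal (1 / (1 + pos (X i 0 \<omega>))\<^sup>2) * ennreal (8 * ((1 + \<bar>x\<bar>) ^ 4 + (W i t \<omega> - W i 0 \<omega>) ^ 4)) \<partial>M)"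
  proof (rule nn_integral_mono_AE)
    show "AE \<omega> in M. ennreal ((pos (x - (X i s \<omega> + (W i t \<omega> - W i s \<omega>))))\<^sup>2)
      \<le> ennreal (1 / (1 + pos (X i 0 \<omega>))\<^sup>2) * ennreal (8 * ((1 + \<bar>x\<bar>) ^ 4 + (W i t \<omega> - W i 0 \<omega>) ^ 4))"
      using lower W0 X0_nonneg
    proof eventually_elim
      case (elim \<omega>)
      have "X i 0 \<omega> + W i s \<omega> \<le> X i s \<omega>" "W i 0 \<omega> = 0" "0 \<le> X i 0 \<omega>" using elim st by auto
      then have "(pos (x - (X i s \<omega> + (W i t \<omega> - W i s \<omega>))))\<^sup>2
          \<le> 1 / (1 + pos (X i 0 \<omega>))\<^sup>2 * (8 * ((1 + \<bar>x\<bar>) ^ 4 + (W i t \<omega> - W i 0 \<omega>) ^ 4))"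
        by (intro pos_sq_bound) auto
      then show ?case by (subst ennreal_mult[symmetric]) (auto intro!: ennreal_leI)
    qed
  qed
  also have "\<dots> = (\<integral>\<^sup>+\<omega>. ennreal (1 / (1 + pos (X i 0 \<omega>))\<^sup>2) \<partial>M) * (\<integral>\<^sup>+w. ennreal (8 * ((1 + \<bar>x\<bar>) ^ 4 + w ^ 4)) \<partial>gauss (t - 0))"
    using st by (intro nn_integral_incr_prod[of 0 t "\<lambda>y. ennreal (1 / (1 + pos y)\<^sup>2)" "\<lambda>w. ennreal (8 * ((1 + \<bar>x\<bar>) ^ 4 + w ^ 4))"]) auto
  also have "(\<integral>\<^sup>+w. ennreal (8 * ((1 + \<bar>x\<bar>) ^ 4 + w ^ 4)) \<partial>gauss (t - 0)) = ennreal (noise_const x)"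
  proof -
    interpret g: prob_space "gauss t" by (rule prob_space_gauss)
    show ?thesis using st gauss_moment[of t 4] g.prob_space
      by (subst nn_integral_eq_integral) (auto simp: noise_const_def integral_gauss_4 distrib_left)
  qed
  finally show ?thesis by (simp add: mult.commute)
qed

lemma xi_sq_integrable: "integrable M (\<lambda>\<omega>. (xi s t x i \<omega>)\<^sup>2)"
proof (rule integrableI_nonneg)
  have "(\<integral>\<^sup>+\<omega>. ennreal (1 / (1 + pos (X i 0 \<omega>))\<^sup>2) \<partial>M) \<le> (\<integral>\<^sup>+\<omega>. 1 \<partial>M)"
    by (intro nn_integral_mono) (auto simp: ennreal_le_1 divide_le_eq_1)
  then have "(\<integral>\<^sup>+\<omega>. ennreal (1 / (1 + pos (X i 0 \<omega>))\<^sup>2) \<partial>M) < \<infinity>"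
    using emeasure_space_1 by (auto intro: le_less_trans)
  then show "(\<integral>\<^sup>+\<omega>. ennreal ((xi s t x i \<omega>)\<^sup>2) \<partial>M) < \<infinity>"
    using le_less_trans[OF xi_sq] by (simp add: ennreal_mult_less_top)
qed auto

lemma xi_prod_integrable: "integrable M (\<lambda>\<omega>. xi s t x i \<omega> * xi s t x j \<omega>)"
proof (rule Bochner_Integration.integrable_bound)
  show "integrable M (\<lambda>\<omega>. (xi s t x i \<omega>)\<^sup>2 + (xi s t x j \<omega>)\<^sup>2)" using xi_sq_integrable by auto
  show "AE \<omega> in M. norm (xi s t x i \<omega> * xi s t x j \<omega>) \<le> norm ((xi s t x i \<omega>)\<^sup>2 + (xi s t x j \<omega>)\<^sup>2)"
  proof (rule AE_I2)
    fix \<omega>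
    have "2 * \<bar>xi s t x i \<omega>\<bar> * \<bar>xi s t x j \<omega>\<bar> \<le> (xi s t x i \<omega>)\<^sup>2 + (xi s t x j \<omega>)\<^sup>2"
      using sum_squares_bound[of "\<bar>xi s t x i \<omega>\<bar>" "\<bar>xi s t x j \<omega>\<bar>"] by simp
    moreover have "0 \<le> \<bar>xi s t x i \<omega>\<bar> * \<bar>xi s t x j \<omega>\<bar>" by simp
    ultimately have "\<bar>xi s t x i \<omega> * xi s t x j \<omega>\<bar> \<le> (xi s t x i \<omega>)\<^sup>2 + (xi s t x j \<omega>)\<^sup>2"
      unfolding abs_mult by linarith
    then show "norm (xi s t x i \<omega> * xi s t x j \<omega>) \<le> norm ((xi s t x i \<omega>)\<^sup>2 + (xi s t x j \<omega>)\<^sup>2)"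
      by simp
  qed
qed measurable

text \<open>With both positions at time \<open>s\<close> frozen, the two increments are independent
  and each factor has mean 0.\<close>

lemma xi_orthogonal:
  assumes "i \<noteq> j" shows "(\<integral>\<omega>. xi s t x i \<omega> * xi s t x j \<omega> \<partial>M) = 0"
proof -
  let ?r = "t - s"
  let ?f = "\<lambda>v w. pos (x - (v + w)) - heat ?r pos (x - v)"
  let ?D = "\<lambda>i \<omega>. W i t \<omega> - W i s \<omega>"
  let ?F = "\<lambda>p. ?f (fst (fst p)) (fst (snd p)) * ?f (snd (fst p)) (snd (snd p))"
  have U: "(\<lambda>\<omega>. (X i s \<omega>, X j s \<omega>)) \<in> F s \<rightarrow>\<^sub>M borel \<Otimes>\<^sub>M borel"
    using X_adapted[OF st(1)] by (intro measurable_Pair) auto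
  have Fm: "?F \<in> borel_measurable ((borel \<Otimes>\<^sub>M borel) \<Otimes>\<^sub>M (borel \<Otimes>\<^sub>M borel))" by measurable
  have "(\<integral>\<omega>. xi s t x i \<omega> * xi s t x j \<omega> \<partial>M)
      = (\<integral>\<omega>. (\<integral>d. ?F ((X i s \<omega>, X j s \<omega>), d) \<partial>distr M (borel \<Otimes>\<^sub>M borel) (\<lambda>\<omega>. (?D i \<omega>, ?D j \<omega>))) \<partial>M)"
    using integral_indep_var[OF indep_incr2[OF st U, of i j] Fm] xi_prod_integrable[of x i j]
    by (simp add: xi_def)
  also have "\<dots> = (\<integral>\<omega>. 0 \<partial>M)"
  proof (intro Bochner_Integration.integral_cong refl)
    fix \<omega>
    let ?u = "X i s \<omega>" and ?v = "X j s \<omega>"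
    have zero: "(\<integral>\<omega>. ?f u (?D i \<omega>) \<partial>M) = 0" and int: "integrable M (\<lambda>\<omega>. ?f u (?D i \<omega>))" for u i
    proof -
      interpret g: prob_space "gauss ?r" by (rule prob_space_gauss)
      have D: "?D i \<in> borel_measurable M" by measurable
      have ig: "integrable (gauss ?r) (\<lambda>w. pos (x - (u + w)))"
        using exp_bounded_integrable[OF exp_bounded_pos, of ?r "x - u"] by (simp add: diff_diff_add)
      have "integrable (gauss ?r) (\<lambda>w. ?f u w)" using ig by simp
      then show "integrable M (\<lambda>\<omega>. ?f u (?D i \<omega>))"
        unfolding W_distr[OF st, of i, symmetric] by (subst (asm) integrable_distr_eq) (auto intro: D)
      have "(\<integral>\<omega>. ?f u (?D i \<omega>) \<partial>M) = (\<integral>w. ?f u w \<partial>gauss ?r)"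
        unfolding W_distr[OF st, of i, symmetric] by (subst integral_distr) (auto intro: D)
      also have "\<dots> = 0" using ig g.prob_space by (simp add: heat_def diff_diff_add)
      finally show "(\<integral>\<omega>. ?f u (?D i \<omega>) \<partial>M) = 0" .
    qed
    have ind: "indep_var borel (\<lambda>\<omega>. ?f ?u (?D i \<omega>)) borel (\<lambda>\<omega>. ?f ?v (?D j \<omega>))"
      using indep_var_compose[OF W_pair[OF assms st], of "?f ?u" borel "?f ?v" borel] by (simp add: comp_def)
    have "(\<integral>d. ?F ((?u, ?v), d) \<partial>distr M (borel \<Otimes>\<^sub>M borel) (\<lambda>\<omega>. (?D i \<omega>, ?D j \<omega>)))
        = (\<integral>\<omega>. ?f ?u (?D i \<omega>) * ?f ?v (?D j \<omega>) \<partial>M)"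
      by (subst integral_distr) auto
    also have "\<dots> = 0"
      using indep_var_lebesgue_integral[OF ind int int] zero by simp
    finally show "(\<integral>d. ?F ((?u, ?v), d) \<partial>distr M (borel \<Otimes>\<^sub>M borel) (\<lambda>\<omega>. (?D i \<omega>, ?D j \<omega>))) = 0" .
  qed
  finally show ?thesis by simp
qed

text \<open>Orthogonality leaves the diagonal: the factor \<open>b^2\<close> meets a sum over
  particles of order \<open>lam / b\<close>. The result is of order \<open>b\<close>, uniformly in
  the number of terms.\<close>

lemma xi_sum_sq:
  "(\<integral>\<^sup>+\<omega>. ennreal ((b * (\<Sum>i<n. xi s t x i \<omega>))\<^sup>2) \<partial>M) \<le> ennreal (b * lam * zeta2 * noise_const x)"
proof -
  have e: "(b * (\<Sum>i<n. xi s t x i \<omega>))\<^sup>2 = (\<Sum>i<n. \<Sum>j<n. b\<^sup>2 * (xi s t x i \<omega> * xi s t x j \<omega>))" for \<omega>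
    by (simp add: power_mult_distrib power2_eq_square sum_product sum_distrib_left mult_ac)
  have "(\<integral>\<^sup>+\<omega>. ennreal ((b * (\<Sum>i<n. xi s t x i \<omega>))\<^sup>2) \<partial>M) = ennreal (\<integral>\<omega>. (b * (\<Sum>i<n. xi s t x i \<omega>))\<^sup>2 \<partial>M)"
    unfolding e
    by (intro nn_integral_eq_integral Bochner_Integration.integrable_sum integrable_mult_right xi_prod_integrable AE_I2)
       (auto simp: e[symmetric])
  also have "(\<integral>\<omega>. (b * (\<Sum>i<n. xi s t x i \<omega>))\<^sup>2 \<partial>M) = (\<Sum>i<n. \<Sum>j<n. b\<^sup>2 * (\<integral>\<omega>. xi s t x i \<omega> * xi s t x j \<omega> \<partial>M))"
    unfolding e by (simp add: Bochner_Integration.integral_sum xi_prod_integrable)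
  also have "\<dots> = (\<Sum>i<n. \<Sum>j<n. if j = i then b\<^sup>2 * (\<integral>\<omega>. xi s t x i \<omega> * xi s t x i \<omega> \<partial>M) else 0)"
    by (intro sum.cong refl) (auto simp: xi_orthogonal)
  also have "\<dots> = (\<Sum>i<n. b\<^sup>2 * (\<integral>\<omega>. (xi s t x i \<omega>)\<^sup>2 \<partial>M))"
    by (simp add: power2_eq_square)
  also have "ennreal \<dots> = (\<Sum>i<n. ennreal (b\<^sup>2) * (\<integral>\<^sup>+\<omega>. ennreal ((xi s t x i \<omega>)\<^sup>2) \<partial>M))"
    by (subst sum_ennreal[symmetric])
       (auto simp: nn_integral_eq_integral[OF xi_sq_integrable] ennreal_mult intro!: sum.cong)
  also have "\<dots> \<le> (\<Sum>i<n. ennreal (b\<^sup>2) * (ennreal (noise_const x) * (\<integral>\<^sup>+\<omega>. ennreal (1 / (1 + pos (X i 0 \<omega>))\<^sup>2) \<partial>M)))"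
    by (intro sum_mono mult_left_mono xi_sq) auto
  also have "\<dots> = ennreal (b\<^sup>2) * ennreal (noise_const x) * (\<Sum>i<n. \<integral>\<^sup>+\<omega>. ennreal (1 / (1 + pos (X i 0 \<omega>))\<^sup>2) \<partial>M)"
    by (simp add: sum_distrib_left mult.assoc)
  also have "\<dots> \<le> ennreal (b\<^sup>2) * ennreal (noise_const x) * ennreal (lam / b * zeta2)"
    by (intro mult_left_mono order_trans[OF sum_le_suminf inv_sq_sum]) auto
  also have "\<dots> = ennreal (b\<^sup>2 * noise_const x * (lam / b * zeta2))"
  proof -
    have 1: "0 \<le> lam / b * zeta2" using b_pos lam_pos' zeta2(2) by simp
    have 2: "0 \<le> b\<^sup>2" by simp
    show ?thesis
      unfolding ennreal_mult[OF mult_nonneg_nonneg[OF 2 K4_nonneg] 1] ennreal_mult[OF 2 K4_nonneg] ..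
  qed
  also have "b\<^sup>2 * noise_const x * (lam / b * zeta2) = b * lam * zeta2 * noise_const x"
    using b_pos by (simp add: power2_eq_square)
  finally show ?thesis .
qed

lemma noise_bad_sets: "noise_bad s t x nu \<in> sets M"
  unfolding noise_bad_def by measurable

text \<open>Chebyshev's inequality for the lower limit, whose mean Fatou's lemma bounds by the
  uniform second moment of the partial sums.\<close>

lemma emeasure_noise_bad:
  assumes nu: "0 < nu"
  shows "emeasure M (noise_bad s t x nu) \<le> ennreal (b * lam * zeta2 * noise_const x / nu\<^sup>2)"
proof -
  let ?l = "\<lambda>\<omega>. liminf (\<lambda>n. ennreal ((b * (\<Sum>i<n. xi s t x i \<omega>))\<^sup>2))"
  have "(\<integral>\<^sup>+\<omega>. ?l \<omega> \<partial>M) \<le> liminf (\<lambda>n. \<integral>\<^sup>+\<omega>. ennreal ((b * (\<Sum>i<n. xi s t x i \<omega>))\<^sup>2) \<partial>M)"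
    by (rule nn_integral_liminf) measurable
  also have "\<dots> \<le> liminf (\<lambda>n::nat. ennreal (b * lam * zeta2 * noise_const x))"
    by (intro Liminf_mono always_eventually allI xi_sum_sq)
  also have "\<dots> = ennreal (b * lam * zeta2 * noise_const x)" by (simp add: Liminf_const)
  finally have I: "(\<integral>\<^sup>+\<omega>. ?l \<omega> \<partial>M) \<le> ennreal (b * lam * zeta2 * noise_const x)" .
  have "emeasure M (noise_bad s t x nu) = emeasure M (noise_bad s t x nu \<inter> space M)"
    unfolding noise_bad_def by (intro arg_cong2[where f=emeasure]) auto
  also have "\<dots> \<le> emeasure M ({\<omega> \<in> space M. 1 \<le> ennreal (1 / nu\<^sup>2) * ?l \<omega>} \<inter> space M)"
  proof (rule emeasure_mono)
    show "noise_bad s t x nu \<inter> space M \<subseteq> {\<omega> \<in> space M. 1 \<le> ennreal (1 / nu\<^sup>2) * ?l \<omega>} \<inter> space M"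
    proof safe
      fix \<omega> assume "\<omega> \<in> noise_bad s t x nu"
      then have "ennreal (nu\<^sup>2) \<le> ?l \<omega>" by (simp add: noise_bad_def less_imp_le)
      then have "ennreal (1 / nu\<^sup>2) * ennreal (nu\<^sup>2) \<le> ennreal (1 / nu\<^sup>2) * ?l \<omega>" by (rule mult_left_mono) simp
      moreover have "ennreal (1 / nu\<^sup>2) * ennreal (nu\<^sup>2) = 1" using nu by (simp add: ennreal_mult[symmetric])
      ultimately show "1 \<le> ennreal (1 / nu\<^sup>2) * ?l \<omega>" by simp
    qed
  qed measurable
  also have "\<dots> \<le> ennreal (1 / nu\<^sup>2) * (\<integral>\<^sup>+\<omega>. ?l \<omega> * indicator (space M) \<omega> \<partial>M)"
    using nn_integral_Markov_inequality[of ?l "space M" M "ennreal (1 / nu\<^sup>2)"] by (simp add: Int_def conj_commute)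
  also have "(\<integral>\<^sup>+\<omega>. ?l \<omega> * indicator (space M) \<omega> \<partial>M) = (\<integral>\<^sup>+\<omega>. ?l \<omega> \<partial>M)"
    by (intro nn_integral_cong) simp
  also have "ennreal (1 / nu\<^sup>2) * (\<integral>\<^sup>+\<omega>. ?l \<omega> \<partial>M) \<le> ennreal (1 / nu\<^sup>2) * ennreal (b * lam * zeta2 * noise_const x)"
    by (intro mult_left_mono I) simp
  also have "\<dots> = ennreal (b * lam * zeta2 * noise_const x / nu\<^sup>2)" by (simp add: ennreal_mult'[symmetric])
  finally show ?thesis .
qed

lemma noise_good:
  assumes \<omega>: "\<omega> \<in> space M" "\<omega> \<notin> noise_bad s t x nu" and nu: "0 \<le> nu"
    and lim: "(\<lambda>i. b * xi s t x i \<omega>) sums l"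
  shows "\<bar>l\<bar> \<le> nu"
proof -
  have "(\<lambda>n. b * (\<Sum>i<n. xi s t x i \<omega>)) \<longlonglongrightarrow> l" using lim by (simp add: sums_def sum_distrib_left)
  then have "(\<lambda>n. ennreal ((b * (\<Sum>i<n. xi s t x i \<omega>))\<^sup>2)) \<longlonglongrightarrow> ennreal (l\<^sup>2)" by (intro tendsto_intros tendsto_ennrealI)
  then have "liminf (\<lambda>n. ennreal ((b * (\<Sum>i<n. xi s t x i \<omega>))\<^sup>2)) = ennreal (l\<^sup>2)"
    by (rule lim_imp_Liminf[OF sequentially_bot])
  then have "ennreal (l\<^sup>2) \<le> ennreal (nu\<^sup>2)" using \<omega> by (simp add: noise_bad_def not_less)
  then have "l\<^sup>2 \<le> nu\<^sup>2" by (subst (asm) ennreal_le_iff) auto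
  then show ?thesis using nu by (metis abs_le_square_iff abs_of_nonneg)
qed

end

section \<open>The initial configuration\<close>

definition S_bad :: "real \<Rightarrow> 'a set" where
  "S_bad S = {\<omega> \<in> space M. ennreal S < (\<Sum>i. ennreal (b * (1 / (1 + pos (X i 0 \<omega>))\<^sup>2)))}"

lemma S_bad_sets: "S_bad S \<in> sets M"
  unfolding S_bad_def by measurable

lemma emeasure_less_le_markov:
  assumes [measurable]: "f \<in> borel_measurable M" and a: "0 < a" and I: "(\<integral>\<^sup>+\<omega>. f \<omega> \<partial>M) \<le> ennreal B"
    and B: "0 \<le> B"
  shows "emeasure M {\<omega> \<in> space M. ennreal a < f \<omega>} \<le> ennreal (B / a)"
proof -
  have "emeasure M {\<omega> \<in> space M. ennreal a < f \<omega>} \<le> emeasure M ({\<omega> \<in> space M. 1 \<le> ennreal (1 / a) * f \<omega>})"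
  proof (rule emeasure_mono)
    show "{\<omega> \<in> space M. ennreal a < f \<omega>} \<subseteq> {\<omega> \<in> space M. 1 \<le> ennreal (1 / a) * f \<omega>}"
    proof safe
      fix \<omega> assume "ennreal a < f \<omega>"
      then have "ennreal (1 / a) * ennreal a \<le> ennreal (1 / a) * f \<omega>" by (intro mult_left_mono) (auto simp: less_imp_le)
      moreover have "ennreal (1 / a) * ennreal a = 1" using a by (simp add: ennreal_mult[symmetric])
      ultimately show "1 \<le> ennreal (1 / a) * f \<omega>" by simp
    qed
  qed measurable
  also have "\<dots> = emeasure M ({\<omega> \<in> space M. 1 \<le> ennreal (1 / a) * f \<omega>} \<inter> space M)"
    by (intro arg_cong2[where f=emeasure]) auto
  also have "\<dots> \<le> ennreal (1 / a) * (\<integral>\<^sup>+\<omega>. f \<omega> * indicator (space M) \<omega> \<partial>M)"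
    using nn_integral_Markov_inequality[of f "space M" M "ennreal (1 / a)"] by (simp add: Int_def conj_commute)
  also have "(\<integral>\<^sup>+\<omega>. f \<omega> * indicator (space M) \<omega> \<partial>M) = (\<integral>\<^sup>+\<omega>. f \<omega> \<partial>M)"
    by (intro nn_integral_cong) simp
  also have "ennreal (1 / a) * (\<integral>\<^sup>+\<omega>. f \<omega> \<partial>M) \<le> ennreal (1 / a) * ennreal B"
    by (intro mult_left_mono I) simp
  also have "\<dots> = ennreal (B / a)" using a by (simp add: ennreal_mult'[symmetric])
  finally show ?thesis .
qed

lemma emeasure_S_bad: "0 < S \<Longrightarrow> emeasure M (S_bad S) \<le> ennreal (lam * zeta2 / S)"
  unfolding S_bad_def
proof (rule emeasure_less_le_markov)
  have "(\<integral>\<^sup>+\<omega>. (\<Sum>i. ennreal (b * (1 / (1 + pos (X i 0 \<omega>))\<^sup>2))) \<partial>M)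
      = (\<Sum>i. \<integral>\<^sup>+\<omega>. ennreal (b * (1 / (1 + pos (X i 0 \<omega>))\<^sup>2)) \<partial>M)"
    by (rule nn_integral_suminf) measurable
  also have "\<dots> = (\<Sum>i. ennreal b * (\<integral>\<^sup>+\<omega>. ennreal (1 / (1 + pos (X i 0 \<omega>))\<^sup>2) \<partial>M))"
    using b_pos by (intro suminf_cong) (simp only: ennreal_mult' nn_integral_cmult[symmetric] less_imp_le, subst nn_integral_cmult[symmetric], auto simp: ennreal_mult')
  also have "\<dots> \<le> ennreal b * ennreal (lam / b * zeta2)"
    using inv_sq_sum by (simp add: mult_left_mono)
  also have "\<dots> = ennreal (lam * zeta2)" using b_pos by (simp add: ennreal_mult'[symmetric])
  finally show "(\<integral>\<^sup>+\<omega>. (\<Sum>i. ennreal (b * (1 / (1 + pos (X i 0 \<omega>))\<^sup>2))) \<partial>M) \<le> ennreal (lam * zeta2)" .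
qed (use lam_pos' zeta2(2) in auto)

lemma S_good:
  assumes \<omega>: "\<omega> \<in> space M" "\<omega> \<notin> S_bad S" and X0: "\<And>i. 0 \<le> X i 0 \<omega>" and S: "0 \<le> S"
  shows "summable (\<lambda>i. 1 / (1 + X i 0 \<omega>)\<^sup>2)" "b * (\<Sum>i. 1 / (1 + X i 0 \<omega>)\<^sup>2) \<le> S"
proof -
  have eq: "pos (X i 0 \<omega>) = X i 0 \<omega>" for i using X0[of i] by simp
  have le: "(\<Sum>i. ennreal (b * (1 / (1 + X i 0 \<omega>)\<^sup>2))) \<le> ennreal S"
    using \<omega> unfolding S_bad_def by (simp add: not_less eq)
  have nn: "0 \<le> b * (1 / (1 + X i 0 \<omega>)\<^sup>2)" for i using b_pos by simp
  have sm: "summable (\<lambda>i. b * (1 / (1 + X i 0 \<omega>)\<^sup>2))"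
  proof (rule summable_suminf_not_top[OF nn])
    show "(\<Sum>i. ennreal (b * (1 / (1 + X i 0 \<omega>)\<^sup>2))) \<noteq> top" using le by (metis ennreal_less_top leD top.not_eq_extremum)
  qed
  have "summable (\<lambda>i. 1 / b * (b * (1 / (1 + X i 0 \<omega>)\<^sup>2)))" by (rule summable_mult[OF sm])
  then show sm': "summable (\<lambda>i. 1 / (1 + X i 0 \<omega>)\<^sup>2)" using b_pos by simp
  have "ennreal (\<Sum>i. b * (1 / (1 + X i 0 \<omega>)\<^sup>2)) \<le> ennreal S"
    using le suminf_ennreal2[OF nn sm] by simp
  then have "(\<Sum>i. b * (1 / (1 + X i 0 \<omega>)\<^sup>2)) \<le> S" by (simp only: ennreal_le_iff[OF S])
  then show "b * (\<Sum>i. 1 / (1 + X i 0 \<omega>)\<^sup>2) \<le> S" by (simp only: suminf_mult[OF sm'])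
qed

text \<open>The integrated count at time 0 is the integral over \<open>[0, x]\<close> of the
  rescaled counting function, so an integrated absolute deviation of that function from
  \<open>lam * y\<close> controls its distance to \<open>lam * x^2 / 2\<close>, and the mean
  deviation can be taken under the integral.\<close>

definition init_bad :: "real \<Rightarrow> real \<Rightarrow> 'a set" where
  "init_bad x nu = {\<omega> \<in> space M. ennreal nu < (\<integral>\<^sup>+y. ennreal \<bar>b * enn2real (\<Sum>i. indicator {..y} (X i 0 \<omega>)) - lam * y\<bar> * indicator {0..x} y \<partial>lborel)}"

lemma count_measurable[measurable]:
  "(\<lambda>p. \<Sum>i. indicator {..snd p} (X i 0 (fst p)) :: ennreal) \<in> borel_measurable (M \<Otimes>\<^sub>M lborel)"
proof -
  have "(\<lambda>p. indicator {..snd p} (X i 0 (fst p)) :: ennreal) = indicator {p. X i 0 (fst p) \<le> snd p}" for i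
    by (auto simp: indicator_def fun_eq_iff)
  moreover have "{p \<in> space (M \<Otimes>\<^sub>M lborel). X i 0 (fst p) \<le> snd p} \<in> sets (M \<Otimes>\<^sub>M lborel)" for i by measurable
  ultimately have "(\<lambda>p. indicator {..snd p} (X i 0 (fst p)) :: ennreal) \<in> borel_measurable (M \<Otimes>\<^sub>M lborel)" for i
    by (simp add: borel_measurable_indicator_iff Int_def conj_commute)
  then show ?thesis by measurable
qed

lemma init_meas[measurable]:
  "(\<lambda>\<omega>. \<integral>\<^sup>+y. ennreal \<bar>b * enn2real (\<Sum>i. indicator {..y} (X i 0 \<omega>)) - lam * y\<bar> * indicator {0..x} y \<partial>lborel) \<in> borel_measurable M"
  by measurable

lemma init_bad_sets: "init_bad x nu \<in> sets M"
  unfolding init_bad_def by measurable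

lemma emeasure_init_bad:
  assumes "0 < nu" "0 \<le> x"
  shows "emeasure M (init_bad x nu) \<le> ennreal (x * sqrt (b * lam * x) / nu)"
  unfolding init_bad_def
proof (rule emeasure_less_le_markov)
  have "(\<integral>\<^sup>+\<omega>. (\<integral>\<^sup>+y. ennreal \<bar>b * enn2real (\<Sum>i. indicator {..y} (X i 0 \<omega>)) - lam * y\<bar> * indicator {0..x} y \<partial>lborel) \<partial>M)
      = (\<integral>\<^sup>+y. (\<integral>\<^sup>+\<omega>. ennreal \<bar>b * enn2real (\<Sum>i. indicator {..y} (X i 0 \<omega>)) - lam * y\<bar> * indicator {0..x} y \<partial>M) \<partial>lborel)"
  proof -
    interpret pair_sigma_finite M lborel ..
    show ?thesis by (rule Fubini'[symmetric]) measurable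
  qed
  also have "\<dots> \<le> (\<integral>\<^sup>+y. ennreal (sqrt (b * lam * x)) * indicator {0..x} y \<partial>lborel)"
  proof (intro nn_integral_mono)
    fix y :: real
    have [measurable]: "(\<lambda>\<omega>. \<Sum>i. indicator {..y} (X i 0 \<omega>) :: ennreal) \<in> borel_measurable M" by measurable
    show "(\<integral>\<^sup>+\<omega>. ennreal \<bar>b * enn2real (\<Sum>i. indicator {..y} (X i 0 \<omega>)) - lam * y\<bar> * indicator {0..x} y \<partial>M)
        \<le> ennreal (sqrt (b * lam * x)) * indicator {0..x} y"
    proof (cases "y \<in> {0..x}")
      case True
      have "(\<integral>\<^sup>+\<omega>. ennreal \<bar>b * enn2real (\<Sum>i. indicator {..y} (X i 0 \<omega>)) - lam * y\<bar> \<partial>M) \<le> ennreal (sqrt (b * lam * y))"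
        using True by (intro fluct) simp
      also have "\<dots> \<le> ennreal (sqrt (b * lam * x))"
        using True b_pos lam_pos' by (intro ennreal_leI real_sqrt_le_mono mult_left_mono) auto
      finally show ?thesis using True by simp
    qed simp
  qed
  also have "\<dots> = ennreal (sqrt (b * lam * x)) * ennreal x" using assms by (simp add: nn_integral_cmult_indicator)
  also have "\<dots> = ennreal (x * sqrt (b * lam * x))" using assms b_pos lam_pos' by (simp add: ennreal_mult'[symmetric] mult.commute)
  finally show "(\<integral>\<^sup>+\<omega>. (\<integral>\<^sup>+y. ennreal \<bar>b * enn2real (\<Sum>i. indicator {..y} (X i 0 \<omega>)) - lam * y\<bar> * indicator {0..x} y \<partial>lborel) \<partial>M)
    \<le> ennreal (x * sqrt (b * lam * x))" .
qed (use assms b_pos lam_pos' in auto)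

lemma init_good:
  assumes \<omega>: "\<omega> \<in> space M" "\<omega> \<notin> init_bad x nu" and X0: "\<And>i. 0 \<le> X i 0 \<omega>" and nu: "0 \<le> nu" and x: "0 \<le> x"
    and fin: "\<And>y. finite {i. X i 0 \<omega> \<le> y}"
  shows "\<bar>(\<Sum>i. b * pos (x - X i 0 \<omega>)) - lam * x\<^sup>2 / 2\<bar> \<le> nu"
proof -
  define I where "I = {i. X i 0 \<omega> \<le> x}"
  have finI: "finite I" unfolding I_def by (rule fin)
  define N where "N y = (\<Sum>i\<in>I. indicator {..y} (X i 0 \<omega>) :: real)" for y
  have cnt: "enn2real (\<Sum>i. indicator {..y} (X i 0 \<omega>)) = N y" if "y \<le> x" for y
  proof -
    have "(\<Sum>i. indicator {..y} (X i 0 \<omega>) :: ennreal) = (\<Sum>i\<in>I. indicator {..y} (X i 0 \<omega>))"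
      using that by (intro suminf_finite finI) (auto simp: I_def indicator_def)
    also have "\<dots> = ennreal (N y)" unfolding N_def by (subst sum_ennreal[symmetric]) (auto simp: ennreal_indicator intro!: sum.cong)
    finally show ?thesis by (simp add: N_def sum_nonneg)
  qed
  have [measurable]: "N \<in> borel_measurable borel"
  proof -
    have "N = (\<lambda>y. \<Sum>i\<in>I. indicator {X i 0 \<omega>..} y)" by (auto simp: N_def fun_eq_iff indicator_def)
    then show ?thesis by simp
  qed
  have Nint: "((\<lambda>y. b * N y) has_integral (\<Sum>i\<in>I. b * (x - X i 0 \<omega>))) {0..x}"
  proof -
    \<comment> \<open>Layer-cake formula: \<open>x - X i 0\<close> is the length of the set of
      levels \<open>y\<close> in \<open>[0, x]\<close> that lie at or above the particle.\<close>
    have "((\<lambda>y. indicator {..y} (X i 0 \<omega>) :: real) has_integral (x - X i 0 \<omega>)) {0..x}" if "i \<in> I" for i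
    proof -
      have "((\<lambda>y. 1::real) has_integral (x - X i 0 \<omega>)) {X i 0 \<omega>..x}"
        using has_integral_const_real[of "1::real" "X i 0 \<omega>" x] that by (simp add: I_def)
      then have "((\<lambda>y. if y \<in> {X i 0 \<omega>..x} then 1::real else 0) has_integral (x - X i 0 \<omega>)) {0..x}"
        using X0[of i] by (subst has_integral_restrict) auto
      then show ?thesis by (rule has_integral_eq[rotated]) (auto simp: indicator_def)
    qed
    then have "((\<lambda>y. \<Sum>i\<in>I. b * (indicator {..y} (X i 0 \<omega>) :: real)) has_integral (\<Sum>i\<in>I. b * (x - X i 0 \<omega>))) {0..x}"
      by (intro has_integral_sum finI has_integral_mult_right) auto
    then show ?thesis unfolding N_def by (simp add: sum_distrib_left)
  qed
  have lin: "((\<lambda>y. lam * y) has_integral (lam * ((x\<^sup>2 - 0\<^sup>2) / 2))) {0..x}"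
    using x by (intro has_integral_mult_right ident_has_integral)
  have diff: "((\<lambda>y. b * N y - lam * y) has_integral ((\<Sum>i\<in>I. b * (x - X i 0 \<omega>)) - lam * x\<^sup>2 / 2)) {0..x}"
    using has_integral_diff[OF Nint lin] by simp
  have Nb: "0 \<le> N y" "N y \<le> real (card I)" for y
  proof -
    show "0 \<le> N y" unfolding N_def by (intro sum_nonneg) auto
    have "N y \<le> (\<Sum>i\<in>I. 1)" unfolding N_def by (intro sum_mono) (simp add: indicator_def)
    then show "N y \<le> real (card I)" by simp
  qed
  have set_int: "integrable lborel (\<lambda>y. indicator {0..x} y *\<^sub>R (b * N y - lam * y))"
  proof (rule Bochner_Integration.integrable_bound)
    show "integrable lborel (\<lambda>y. indicator {0..x} y *\<^sub>R (b * real (card I) + lam * x))"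
      using x by (intro integrable_scaleR_left) (auto simp: integrable_indicator_iff emeasure_lborel_Icc)
    show "AE y in lborel. norm (indicator {0..x} y *\<^sub>R (b * N y - lam * y)) \<le> norm (indicator {0..x} y *\<^sub>R (b * real (card I) + lam * x))"
    proof (rule AE_I2)
      fix y
      show "norm (indicator {0..x} y *\<^sub>R (b * N y - lam * y)) \<le> norm (indicator {0..x} y *\<^sub>R (b * real (card I) + lam * x))"
      proof (cases "y \<in> {0..x}")
        case True
        have "b * N y \<le> b * real (card I)" "lam * y \<le> lam * x" "0 \<le> b * N y" "0 \<le> lam * y"
          using True b_pos lam_pos' Nb[of y] by (auto intro!: mult_left_mono)
        then show ?thesis using True by simp
      qed simp
    qed
  qed measurable
  let ?J = "\<integral>y. indicator {0..x} y *\<^sub>R (b * N y - lam * y) \<partial>lborel"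
  have J: "?J = (\<Sum>i\<in>I. b * (x - X i 0 \<omega>)) - lam * x\<^sup>2 / 2"
    using set_borel_integral_eq_integral(2)[of "{0..x}" "\<lambda>y. b * N y - lam * y"] set_int diff
    by (simp add: set_integrable_def set_lebesgue_integral_def integral_unique)
  have "ennreal \<bar>?J\<bar> \<le> (\<integral>\<^sup>+y. ennreal \<bar>indicator {0..x} y *\<^sub>R (b * N y - lam * y)\<bar> \<partial>lborel)"
    using integral_norm_bound_ennreal[OF set_int] by simp
  also have "\<dots> = (\<integral>\<^sup>+y. ennreal \<bar>b * enn2real (\<Sum>i. indicator {..y} (X i 0 \<omega>)) - lam * y\<bar> * indicator {0..x} y \<partial>lborel)"
  proof (rule nn_integral_cong)
    fix y
    show "ennreal \<bar>indicator {0..x} y *\<^sub>R (b * N y - lam * y)\<bar>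
      = ennreal \<bar>b * enn2real (\<Sum>i. indicator {..y} (X i 0 \<omega>)) - lam * y\<bar> * indicator {0..x} y"
      by (cases "y \<in> {0..x}") (use cnt[of y] in simp_all)
  qed
  also have "\<dots> \<le> ennreal nu" using \<omega> by (simp add: init_bad_def not_less)
  finally have "\<bar>?J\<bar> \<le> nu" by (simp only: ennreal_le_iff[OF nu])
  moreover have "(\<Sum>i. b * pos (x - X i 0 \<omega>)) = (\<Sum>i\<in>I. b * (x - X i 0 \<omega>))"
  proof -
    have "(\<Sum>i. b * pos (x - X i 0 \<omega>)) = (\<Sum>i\<in>I. b * pos (x - X i 0 \<omega>))"
      by (intro suminf_finite finI) (auto simp: I_def)
    also have "\<dots> = (\<Sum>i\<in>I. b * (x - X i 0 \<omega>))" by (intro sum.cong refl) (auto simp: I_def)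
    finally show ?thesis .
  qed
  ultimately show ?thesis unfolding J by simp
qed

end

section \<open>The exceptional event and its probability\<close>

lemma (in finite_measure) emeasure_UN_le_card_mult:
  assumes "finite I" and A: "\<And>i. i \<in> I \<Longrightarrow> A i \<in> sets M" "\<And>i. i \<in> I \<Longrightarrow> emeasure M (A i) \<le> ennreal B"
    and "0 \<le> B" "real (card I) \<le> c"
  shows "emeasure M (\<Union>i\<in>I. A i) \<le> ennreal (c * B)"
proof -
  have "emeasure M (\<Union>i\<in>I. A i) \<le> (\<Sum>i\<in>I. emeasure M (A i))"
    using A assms(1) by (intro emeasure_subadditive_finite) auto
  also have "\<dots> \<le> (\<Sum>i\<in>I. ennreal B)" by (intro sum_mono A)
  also have "\<dots> = ennreal (real (card I) * B)"
    using assms(4) by (simp add: ennreal_of_nat_eq_real_of_nat ennreal_mult)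
  also have "\<dots> \<le> ennreal (c * B)" using assms by (intro ennreal_leI mult_right_mono) auto
  finally show ?thesis .
qed

lemma sqrt_le_add_one: "0 \<le> y \<Longrightarrow> sqrt y \<le> y + 1"
  by (rule real_le_lsqrt) (auto simp: power2_eq_square algebra_simps)

text \<open>A constant that the simplifier does not expand: 250 is the order of the moments used for the oscillations.\<close>

definition pw :: "real \<Rightarrow> real" where "pw x = x ^ 250"

lemma pw_nonneg: "0 \<le> pw x" unfolding pw_def by (rule zero_le_even_power) simp

lemma frac_rearrange: "a / x * (c / y * (K * z)) = a * c * K * (z / (x * y))" for a x c y K z :: real
  by simp

text \<open>All parameters are powers of \<open>q\<close>: step \<open>q ^ 23\<close>, accuracy \<open>q ^ 8\<close>, watching time \<open>q ^ 6\<close>, noise \<open>q ^ 40\<close> on a grid of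
  mesh \<open>q ^ 42\<close>, oscillations \<open>q ^ 11\<close> and \<open>q\<^sup>2\<close>. Only the order of these scales matters.\<close>

locale scaled_q = scaled_atlas M b lam X W F
  for M :: "'a measure" and b lam :: real and X W :: "nat \<Rightarrow> real \<Rightarrow> 'a \<Rightarrow> real" and F :: "real \<Rightarrow> 'a measure" +
  fixes q T :: real
  assumes q: "0 < q" "q \<le> 1" and b_q: "b = q ^ 180" and T: "0 < T"
begin

definition Nh :: nat where "Nh = nat \<lfloor>T / q ^ 23\<rfloor>"
definition J0 :: int where "J0 = \<lfloor>(1 / q + 2) / q ^ 42\<rfloor>"

definition bad :: "'a set" where
  "bad = osc_bad 0 (T + 1) (1 / 2) (1 / q)
    \<union> (\<Union>n\<in>{..Nh}. osc_bad (n * q ^ 23) (q ^ 23) (q ^ 11) 1)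
    \<union> (\<Union>n\<in>{..Nh}. osc_bad (n * q ^ 23) (3 * q ^ 6) (q\<^sup>2) 1)
    \<union> (\<Union>(n, j)\<in>{..Nh} \<times> {-J0..J0}. noise_bad (n * q ^ 23) (n * q ^ 23 + q ^ 23) (q ^ 42 * j) (q ^ 40))
    \<union> (\<Union>(n, j)\<in>{..Nh} \<times> {-J0..J0}. noise_bad (n * q ^ 23) (n * q ^ 23 + q ^ 6) (q ^ 42 * j) (q ^ 40))
    \<union> S_bad (1 / q)
    \<union> (\<Union>j\<in>{0..J0}. init_bad (q ^ 42 * j) (q ^ 40))"

lemma Nh: "real n * q ^ 23 \<le> T \<longleftrightarrow> n \<le> Nh"
proof -
  have "real n * q ^ 23 \<le> T \<longleftrightarrow> real n \<le> T / q ^ 23" using q by (simp add: pos_le_divide_eq)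
  also have "\<dots> \<longleftrightarrow> n \<le> Nh" unfolding Nh_def using q T by (simp add: le_nat_iff le_floor_iff)
  finally show ?thesis .
qed

lemma J0: "\<bar>q ^ 42 * real_of_int j\<bar> \<le> 1 / q + 2 \<longleftrightarrow> j \<in> {-J0..J0}"
proof -
  have "\<bar>q ^ 42 * real_of_int j\<bar> \<le> 1 / q + 2 \<longleftrightarrow> real_of_int \<bar>j\<bar> \<le> (1 / q + 2) / q ^ 42"
    using q by (simp add: pos_le_divide_eq abs_mult mult.commute)
  also have "\<dots> \<longleftrightarrow> \<bar>j\<bar> \<le> J0" unfolding J0_def by (simp only: le_floor_iff)
  finally show ?thesis by (auto simp: abs_le_iff)
qed

lemma card_bounds:
  shows "real (card {..Nh}) \<le> (T + 1) / q ^ 23"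
    "real (card ({..Nh} \<times> {-J0..J0})) \<le> 7 * (T + 1) / q ^ 66" "real (card {0..J0}) \<le> 4 / q ^ 43"
proof -
  have q1: "q ^ n \<le> 1" "0 < q ^ n" for n using q by (auto intro: power_le_one)
  have "real Nh \<le> T / q ^ 23" unfolding Nh_def using T q by simp
  moreover have "1 \<le> 1 / q ^ 23" using q1[of 23] by simp
  ultimately show N: "real (card {..Nh}) \<le> (T + 1) / q ^ 23" by (simp add: add_divide_distrib)
  have J0p: "0 \<le> J0" unfolding J0_def using q by simp
  have "1 / q + 2 \<le> 3 / q" using q by (simp add: field_simps)
  then have "(1 / q + 2) / q ^ 42 \<le> (3 / q) / q ^ 42" by (rule divide_right_mono) (use q in simp)
  also have "(3 / q) / q ^ 42 = 3 / q ^ 43" by (simp add: power_Suc[symmetric] del: power_Suc)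
  finally have J: "real_of_int J0 \<le> 3 / q ^ 43" unfolding J0_def using of_int_floor_le order_trans by blast
  have J1: "1 \<le> 1 / q ^ 43" using q1[of 43] by simp
  have "real (card {0..J0}) = real_of_int J0 + 1" using J0p by simp
  also have "\<dots> \<le> 3 / q ^ 43 + 1 / q ^ 43" using J J1 by linarith
  finally show "real (card {0..J0}) \<le> 4 / q ^ 43" by simp
  have "real (card {-J0..J0}) = 2 * real_of_int J0 + 1" using J0p by simp
  also have "\<dots> \<le> 2 * (3 / q ^ 43) + 1 / q ^ 43" using J J1 by linarith
  finally have J2: "real (card {-J0..J0}) \<le> 7 / q ^ 43" by simp
  have "real (card ({..Nh} \<times> {-J0..J0})) = real (card {..Nh}) * real (card {-J0..J0})"
    by (simp only: card_cartesian_product of_nat_mult)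
  also have "\<dots> \<le> (T + 1) / q ^ 23 * (7 / q ^ 43)" by (intro mult_mono N J2) (use T q in auto)
  also have "\<dots> = 7 * (T + 1) / q ^ 66" by (simp add: power_add[symmetric])
  finally show "real (card ({..Nh} \<times> {-J0..J0})) \<le> 7 * (T + 1) / q ^ 66" .
qed

definition Co :: real where "Co = 2 * moment 250 * zeta2 * lam"

lemma Co_nonneg: "0 \<le> Co"
  unfolding Co_def using zeta2(2) lam_pos' moment_nonneg[of 250] by (intro mult_nonneg_nonneg) auto

text \<open>The gain comes from the range \<open>R = 1 / q\<close>: order 250 gives
  \<open>q ^ 498\<close>, of which \<open>1 / b\<close> costs \<open>q ^ 180\<close>.\<close>

lemma emeasure_bad_range: "emeasure M (osc_bad 0 (T + 1) (1 / 2) (1 / q)) \<le> ennreal (Co * pw (400 * (T + 1)) * q)" (is "?E \<le> _")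
proof -
  have "1 \<le> 1 / q" using q by simp
  then have "emeasure M (osc_bad 0 (T + 1) (1 / 2) (1 / q))
      \<le> ennreal (Co / b * (100 * (T + 1) / (1 / 2)\<^sup>2) ^ 250 / (1 / q) ^ (2 * 250 - 2))"
    unfolding Co_def using T by (intro emeasure_osc_bad) auto
  also have "Co / b * (100 * (T + 1) / (1 / 2)\<^sup>2) ^ 250 / (1 / q) ^ (2 * 250 - 2) = Co * pw (400 * (T + 1)) * (q ^ 498 / q ^ 180)"
    unfolding b_q power_divide[of 1] by (simp add: pw_def)
  also have "q ^ 498 / q ^ 180 = q ^ 318" using q by (simp add: power_diff[symmetric])
  finally have 1: "?E \<le> ennreal (Co * pw (400 * (T + 1)) * q ^ 318)" .
  have "Co * pw (400 * (T + 1)) * q ^ 318 \<le> Co * pw (400 * (T + 1)) * q ^ 1"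
    using q T Co_nonneg by (intro mult_left_mono power_decreasing mult_nonneg_nonneg) (auto simp: pw_nonneg)
  then have "Co * pw (400 * (T + 1)) * q ^ 318 \<le> Co * pw (400 * (T + 1)) * q" by (simp only: power_one_right)
  from order_trans[OF 1 ennreal_leI[OF this]] show ?thesis  .
qed

text \<open>This event dictates the order 250. The ratio \<open>100 * tau / c^2\<close> is only
  \<open>100 * q\<close>, and its power must beat \<open>q ^ 23\<close> for the number of steps and
  \<open>q ^ 180\<close> for \<open>1 / b\<close>.\<close>

lemma emeasure_bad_step_osc: "emeasure M (\<Union>n\<in>{..Nh}. osc_bad (n * q ^ 23) (q ^ 23) (q ^ 11) 1) \<le> ennreal ((T + 1) * Co * pw 100 * q)" (is "?E \<le> _")
proof -
  have q0: "0 < q ^ n" for n using q by simp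
  have "emeasure M (\<Union>n\<in>{..Nh}. osc_bad (n * q ^ 23) (q ^ 23) (q ^ 11) 1)
      \<le> ennreal ((T + 1) / q ^ 23 * (Co / b * (100 * q ^ 23 / (q ^ 11)\<^sup>2) ^ 250 / 1 ^ (2 * 250 - 2)))"
  proof (rule emeasure_UN_le_card_mult[OF _ _ _ _ card_bounds(1)])
    show "osc_bad (n * q ^ 23) (q ^ 23) (q ^ 11) 1 \<in> sets M" for n :: nat
      using q by (intro osc_bad_sets) auto
    show "emeasure M (osc_bad (n * q ^ 23) (q ^ 23) (q ^ 11) 1)
      \<le> ennreal (Co / b * (100 * q ^ 23 / (q ^ 11)\<^sup>2) ^ 250 / 1 ^ (2 * 250 - 2))" for n :: nat
      unfolding Co_def using q by (intro emeasure_osc_bad) auto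
    show "0 \<le> Co / b * (100 * q ^ 23 / (q ^ 11)\<^sup>2) ^ 250 / 1 ^ (2 * 250 - 2)"
      using Co_nonneg b_pos q by simp
  qed simp
  also have "100 * q ^ 23 / (q ^ 11)\<^sup>2 = 100 * q"
    using q by (simp add: power_mult[symmetric] field_simps power_add[symmetric] flip: power_Suc)
  also have "(T + 1) / q ^ 23 * (Co / b * (100 * q) ^ 250 / 1 ^ (2 * 250 - 2)) = (T + 1) * Co * pw 100 * (q ^ 250 / (q ^ 23 * q ^ 180))"
    unfolding b_q power_mult_distrib power_one div_by_1 pw_def by (rule frac_rearrange)
  also have "q ^ 23 * q ^ 180 = q ^ 203" by (simp flip: power_add)
  also have "q ^ 250 / q ^ 203 = q ^ 47" using q by (simp add: power_diff[symmetric])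
  finally have 1: "?E \<le> ennreal ((T + 1) * Co * pw 100 * q ^ 47)" .
  have "(T + 1) * Co * pw 100 * q ^ 47 \<le> (T + 1) * Co * pw 100 * q ^ 1"
    using q T Co_nonneg by (intro mult_left_mono power_decreasing mult_nonneg_nonneg) (auto simp: pw_nonneg)
  then have "(T + 1) * Co * pw 100 * q ^ 47 \<le> (T + 1) * Co * pw 100 * q" by (simp only: power_one_right)
  from order_trans[OF 1 ennreal_leI[OF this]] show ?thesis  .
qed

text \<open>Here \<open>100 * tau / c^2\<close> is \<open>300 * q^2\<close>, so the same order
  leaves an ample margin.\<close>

lemma emeasure_bad_watch_osc: "emeasure M (\<Union>n\<in>{..Nh}. osc_bad (n * q ^ 23) (3 * q ^ 6) (q\<^sup>2) 1) \<le> ennreal ((T + 1) * Co * pw 300 * q)" (is "?E \<le> _")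
proof -
  have q0: "0 < q ^ n" for n using q by simp
  have "emeasure M (\<Union>n\<in>{..Nh}. osc_bad (n * q ^ 23) (3 * q ^ 6) (q\<^sup>2) 1)
      \<le> ennreal ((T + 1) / q ^ 23 * (Co / b * (100 * (3 * q ^ 6) / (q\<^sup>2)\<^sup>2) ^ 250 / 1 ^ (2 * 250 - 2)))"
  proof (rule emeasure_UN_le_card_mult[OF _ _ _ _ card_bounds(1)])
    show "osc_bad (n * q ^ 23) (3 * q ^ 6) (q\<^sup>2) 1 \<in> sets M" for n :: nat
      using q by (intro osc_bad_sets) auto
    show "emeasure M (osc_bad (n * q ^ 23) (3 * q ^ 6) (q\<^sup>2) 1)
      \<le> ennreal (Co / b * (100 * (3 * q ^ 6) / (q\<^sup>2)\<^sup>2) ^ 250 / 1 ^ (2 * 250 - 2))" for n :: nat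
      unfolding Co_def using q by (intro emeasure_osc_bad) auto
    show "0 \<le> Co / b * (100 * (3 * q ^ 6) / (q\<^sup>2)\<^sup>2) ^ 250 / 1 ^ (2 * 250 - 2)"
      using Co_nonneg b_pos q by simp
  qed simp
  also have "100 * (3 * q ^ 6) / (q\<^sup>2)\<^sup>2 = 300 * q\<^sup>2"
    using q by (simp add: power_mult[symmetric] field_simps power_add[symmetric])
  also have "(T + 1) / q ^ 23 * (Co / b * (300 * q\<^sup>2) ^ 250 / 1 ^ (2 * 250 - 2)) = (T + 1) * Co * pw 300 * ((q\<^sup>2) ^ 250 / (q ^ 23 * q ^ 180))"
    unfolding b_q power_mult_distrib power_one div_by_1 pw_def by (rule frac_rearrange)
  also have "q ^ 23 * q ^ 180 = q ^ 203" by (simp flip: power_add)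
  also have "(q\<^sup>2) ^ 250 = q ^ 500" by (simp flip: power_mult)
  also have "q ^ 500 / q ^ 203 = q ^ 297" using q by (simp add: power_diff[symmetric])
  finally have 1: "?E \<le> ennreal ((T + 1) * Co * pw 300 * q ^ 297)" .
  have "(T + 1) * Co * pw 300 * q ^ 297 \<le> (T + 1) * Co * pw 300 * q ^ 1"
    using q T Co_nonneg by (intro mult_left_mono power_decreasing mult_nonneg_nonneg) (auto simp: pw_nonneg)
  then have "(T + 1) * Co * pw 300 * q ^ 297 \<le> (T + 1) * Co * pw 300 * q" by (simp only: power_one_right)
  from order_trans[OF 1 ennreal_leI[OF this]] show ?thesis  .
qed

definition Cn :: real where "Cn = 7 * (T + 1) * (lam * zeta2 * (8 * (256 + 3 * (T + 2)\<^sup>2)))"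

text \<open>The balance behind \<open>b = q ^ 180\<close>: the costs are \<open>q ^ 66\<close> for
  the space-time grid, \<open>q ^ 4\<close> for the fourth power of the largest \<open>x\<close>,
  and \<open>q ^ 80\<close> for the squared threshold.\<close>

lemma emeasure_bad_noise:
  assumes d: "0 < d" "d \<le> 1"
  shows "emeasure M (\<Union>(n, j)\<in>{..Nh} \<times> {-J0..J0}. noise_bad (n * q ^ 23) (n * q ^ 23 + d) (q ^ 42 * j) (q ^ 40)) \<le> ennreal (Cn * q)" (is "?E \<le> _")
proof -
  have q0: "0 < q ^ n" for n using q by simp
  let ?B = "b * lam * zeta2 * (8 * (256 + 3 * (T + 2)\<^sup>2) / q ^ 4) / (q ^ 40)\<^sup>2"
  have B0: "0 \<le> ?B" using b_pos lam_pos' zeta2(2) q by (intro divide_nonneg_nonneg mult_nonneg_nonneg) auto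
  have "?E \<le> ennreal (7 * (T + 1) / q ^ 66 * ?B)"
    unfolding case_prod_beta
  proof (rule emeasure_UN_le_card_mult[OF _ _ _ B0 card_bounds(2)])
    fix p assume p: "p \<in> {..Nh} \<times> {-J0..J0}"
    have n: "real (fst p) * q ^ 23 \<le> T" using p unfolding Nh by auto
    have j: "\<bar>q ^ 42 * real_of_int (snd p)\<bar> \<le> 1 / q + 2" using p unfolding J0 by auto
    let ?s = "real (fst p) * q ^ 23" and ?x = "q ^ 42 * real_of_int (snd p)"
    have st: "0 \<le> ?s" "?s < ?s + d" using q d by auto
    show "noise_bad ?s (?s + d) ?x (q ^ 40) \<in> sets M" by (rule noise_bad_sets[OF st])
    have "emeasure M (noise_bad ?s (?s + d) ?x (q ^ 40)) \<le> ennreal (b * lam * zeta2 * noise_const (?s + d) ?x / (q ^ 40)\<^sup>2)"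
      by (rule emeasure_noise_bad[OF st]) (use q in simp)
    also have "\<dots> \<le> ennreal ?B"
    proof (intro ennreal_leI divide_right_mono mult_left_mono)
      have "1 + \<bar>?x\<bar> \<le> 4 / q" using j q by (simp add: field_simps)
      then have "(1 + \<bar>?x\<bar>) ^ 4 \<le> (4 / q) ^ 4" by (intro power_mono) auto
      also have "\<dots> = 256 / q ^ 4" by (simp add: power_divide)
      finally have 1: "(1 + \<bar>?x\<bar>) ^ 4 \<le> 256 / q ^ 4" .
      have "(?s + d)\<^sup>2 \<le> (T + 2)\<^sup>2" using n d st by (intro power_mono) auto
      also have "\<dots> \<le> (T + 2)\<^sup>2 / q ^ 4"
        using q power_le_one[of q 4] by (simp add: pos_le_divide_eq mult_left_le)
      finally have "8 * ((1 + \<bar>?x\<bar>) ^ 4 + 3 * (?s + d)\<^sup>2) \<le> 8 * (256 / q ^ 4 + 3 * ((T + 2)\<^sup>2 / q ^ 4))"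
        using 1 by simp
      then show "noise_const (?s + d) ?x \<le> 8 * (256 + 3 * (T + 2)\<^sup>2) / q ^ 4"
        unfolding noise_const_def[OF st] by (simp add: add_divide_distrib distrib_left)
    qed (use b_pos lam_pos' zeta2(2) in auto)
    finally show "emeasure M (noise_bad ?s (?s + d) ?x (q ^ 40)) \<le> ennreal ?B" .
  qed simp
  also have "7 * (T + 1) / q ^ 66 * ?B = Cn * (q ^ 180 / q ^ 150)"
    unfolding b_q Cn_def using q by (simp add: field_simps power_add[symmetric] power_mult[symmetric])
  also have "q ^ 180 / q ^ 150 = q ^ 30" using q by (simp add: power_diff[symmetric])
  finally have 1: "?E \<le> ennreal (Cn * q ^ 30)" .
  have "Cn * q ^ 30 \<le> Cn * q ^ 1"
    using q T lam_pos' zeta2(2) unfolding Cn_def by (intro mult_left_mono power_decreasing mult_nonneg_nonneg) (auto simp: pw_nonneg)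
  then have "Cn * q ^ 30 \<le> Cn * q" by (simp only: power_one_right)
  from order_trans[OF 1 ennreal_leI[OF this]] show ?thesis .
qed

lemma emeasure_bad_tail: "emeasure M (S_bad (1 / q)) \<le> ennreal (lam * zeta2 * q)"
  using emeasure_S_bad[of "1 / q"] q by simp

text \<open>The fluctuation of the counts contributes \<open>sqrt b = q ^ 90\<close>, against
  \<open>q ^ 43\<close> for the grid, \<open>q ^ 40\<close> for the threshold and
  \<open>q ^ 2\<close> for two factors of the size of \<open>x\<close>.\<close>

lemma emeasure_bad_init: "emeasure M (\<Union>j\<in>{0..J0}. init_bad (q ^ 42 * j) (q ^ 40)) \<le> ennreal (12 * (3 * lam + 1) * q)" (is "?E \<le> _")
proof -
  have q0: "0 < q ^ n" for n using q by simp
  let ?B = "3 / q * (q ^ 90 * ((3 * lam + 1) / q)) / q ^ 40"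
  have "emeasure M (\<Union>j\<in>{0..J0}. init_bad (q ^ 42 * j) (q ^ 40)) \<le> ennreal (4 / q ^ 43 * ?B)"
  proof (rule emeasure_UN_le_card_mult[OF _ _ _ _ card_bounds(3)])
    fix j assume j: "j \<in> {0..J0}"
    let ?x = "q ^ 42 * real_of_int j"
    have x0: "0 \<le> ?x" using j q by simp
    have "\<bar>?x\<bar> \<le> 1 / q + 2" using j unfolding J0 by auto
    moreover have "1 / q + 2 \<le> 3 / q" using q by (simp add: field_simps)
    ultimately have x1: "?x \<le> 3 / q" using abs_ge_self[of ?x] by linarith
    show "init_bad ?x (q ^ 40) \<in> sets M" by (rule init_bad_sets)
    have "emeasure M (init_bad ?x (q ^ 40)) \<le> ennreal (?x * sqrt (b * lam * ?x) / q ^ 40)"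
      by (rule emeasure_init_bad[OF _ x0]) (use q in simp)
    also have "\<dots> \<le> ennreal ?B"
    proof (intro ennreal_leI divide_right_mono mult_mono x1)
      have "sqrt (b * lam * ?x) = q ^ 90 * sqrt (lam * ?x)"
      proof -
        have b2: "b = (q ^ 90)\<^sup>2" unfolding b_q by (simp flip: power_mult)
        have "sqrt (b * lam * ?x) = sqrt ((q ^ 90)\<^sup>2) * sqrt (lam * ?x)"
          unfolding b2 mult.assoc by (rule real_sqrt_mult)
        also have "sqrt ((q ^ 90)\<^sup>2) = q ^ 90" by (rule real_sqrt_unique) (use q in auto)
        finally show ?thesis .
      qed
      also have "sqrt (lam * ?x) \<le> lam * ?x + 1"
      proof -
        have "0 \<le> lam * ?x" using lam_pos' x0 by simp
        then show ?thesis by (rule sqrt_le_add_one)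
      qed
      also have "lam * ?x + 1 \<le> (3 * lam + 1) / q"
      proof -
        have "lam * ?x \<le> lam * (3 / q)" using x1 lam_pos' by (intro mult_left_mono) auto
        moreover have "1 \<le> 1 / q" using q by simp
        ultimately show ?thesis by (simp add: add_divide_distrib mult.commute)
      qed
      finally show "sqrt (b * lam * ?x) \<le> q ^ 90 * ((3 * lam + 1) / q)" using q by simp
    qed (use q x0 b_pos lam_pos' in auto)
    finally show "emeasure M (init_bad ?x (q ^ 40)) \<le> ennreal ?B" .
  next
    show "0 \<le> ?B" using q lam_pos' by simp
  qed simp
  also have "4 / q ^ 43 * ?B = 12 * (3 * lam + 1) * (q ^ 90 / q ^ 85)"
    using q by (simp add: field_simps power_add[symmetric] flip: power_Suc)
  also have "q ^ 90 / q ^ 85 = q ^ 5" using q by (simp add: power_diff[symmetric])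
  finally have 1: "?E \<le> ennreal (12 * (3 * lam + 1) * q ^ 5)" .
  have "12 * (3 * lam + 1) * q ^ 5 \<le> 12 * (3 * lam + 1) * q ^ 1"
    using q lam_pos' by (intro mult_left_mono power_decreasing mult_nonneg_nonneg) (auto simp: pw_nonneg)
  then have "12 * (3 * lam + 1) * q ^ 5 \<le> 12 * (3 * lam + 1) * q" by (simp only: power_one_right)
  from order_trans[OF 1 ennreal_leI[OF this]] show ?thesis  .
qed

definition Cbad :: real where
  "Cbad = Co * pw (400 * (T + 1)) + (T + 1) * Co * pw 100 + (T + 1) * Co * pw 300 + Cn + Cn
    + lam * zeta2 + 12 * (3 * lam + 1)"

lemma bad_sets: "bad \<in> sets M"
  unfolding bad_def using q T
  by (intro sets.Un sets.finite_UN osc_bad_sets S_bad_sets init_bad_sets)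
     (auto intro!: noise_bad_sets osc_bad_sets)

lemma emeasure_bad: "emeasure M bad \<le> ennreal (Cbad * q)"
proof -
  have d: "q ^ n \<le> 1" "0 < q ^ n" for n using q by (auto intro: power_le_one)
  have T': "0 \<le> T" using T by simp
  note s = osc_bad_sets S_bad_sets init_bad_sets
  have Cn: "0 \<le> Cn" unfolding Cn_def using T lam_pos' zeta2(2) by (intro mult_nonneg_nonneg) auto
  have add: "A \<in> sets M \<Longrightarrow> B \<in> sets M \<Longrightarrow> emeasure M A \<le> ennreal x \<Longrightarrow> emeasure M B \<le> ennreal y \<Longrightarrow> 0 \<le> x \<Longrightarrow> 0 \<le> y
      \<Longrightarrow> emeasure M (A \<union> B) \<le> ennreal (x + y)" for A B x y
    by (rule order_trans[OF emeasure_subadditive]) (auto simp: ennreal_plus intro: add_mono)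
  have "emeasure M bad \<le> ennreal (Co * pw (400 * (T + 1)) * q + (T + 1) * Co * pw 100 * q + (T + 1) * Co * pw 300 * q + Cn * q + Cn * q
    + lam * zeta2 * q + 12 * (3 * lam + 1) * q)"
    unfolding bad_def
    by (intro add emeasure_bad_range emeasure_bad_step_osc emeasure_bad_watch_osc emeasure_bad_noise emeasure_bad_tail emeasure_bad_init d sets.Un)
       (use q T Co_nonneg Cn lam_pos' zeta2(2) in
         \<open>auto intro!: noise_bad_sets sets.finite_UN s mult_nonneg_nonneg add_nonneg_nonneg pw_nonneg\<close>)
  then show ?thesis by (simp add: Cbad_def algebra_simps)
qed

end

section \<open>Choice of the scales\<close>

context stefan begin

text \<open>The factor 2 arises because both times are compared with the start of the window;
  \<open>1 + 4 / q\<close> is the largest value of \<open>1 + X i 0\<close> for a particle with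
  \<open>X i 0 \<le> 4 * L\<close> and \<open>L = 1 / q\<close>.\<close>

definition o1q :: "real \<Rightarrow> real" where "o1q q = 2 * q ^ 11 * (1 + 4 / q)"
definition o2q :: "real \<Rightarrow> real" where "o2q q = 2 * q\<^sup>2 * (1 + 4 / q)"
definition C4 :: "real \<Rightarrow> real \<Rightarrow> real" where
  "C4 T R = (1 + exp (2 * (yb T + 1) + 2 * (T + 1))) + (1 + exp (2 * R + 2 * (T + 1)))"

text \<open>The numerical assumptions of \<open>good_path\<close> and \<open>good_path_eps\<close>,
  with all scales replaced by powers of \<open>q\<close>, gathered into one predicate that can be
  shown to hold eventually. The bound \<open>q \<le> 1 / 2\<close> is
  \<open>2 \<le> L\<close>.\<close>

definition params :: "real \<Rightarrow> real \<Rightarrow> real \<Rightarrow> real \<Rightarrow> bool" where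
  "params T eps R q \<longleftrightarrow> 0 < q \<and> q \<le> 1 / 2 \<and> 3 * q ^ 6 \<le> 1 \<and> 2 * q ^ 8 \<le> 1 \<and>
    (\<forall>x>1 / q. 3 * x * (1 + 3 * x)\<^sup>2 * (1 / q) \<le> q ^ 8 * exp (2 * x)) \<and>
    (\<forall>x>1 / q. m1 * (x + yb T)\<^sup>2 / 2 \<le> q ^ 8 * exp (2 * x)) \<and>
    yb T + 1 \<le> 1 / q \<and>
    (T + 1) * (q ^ 40 + q ^ 42 * C3 T + 3 * m1\<^sup>2 * (q ^ 23)\<^sup>2 / q ^ 8) \<le> q ^ 8 * q ^ 23 \<and>
    2 * C3 T * o1q q \<le> q ^ 8 \<and>
    \<bar>k\<bar> * sqrt (q ^ 23) \<le> sqrt (q ^ 8 / (2 * m1)) \<and>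
    q ^ 40 + q ^ 42 * (lam * 2) \<le> q ^ 8 \<and>
    R \<le> 1 / q \<and>
    24 * m1 * (q ^ 6)\<^sup>2 / eps\<^sup>2 + (2 * q ^ 8 + q ^ 40 + q ^ 42 * C3 T) * C4 T R < q ^ 6 \<and>
    o2q q \<le> eps / 4 \<and> o1q q \<le> eps / 4 \<and> o1q q * (C3 T * C4 T R) \<le> eps / 4 \<and> q ^ 23 \<le> eps / 4 \<and>
    \<bar>k\<bar> * sqrt (2 * q ^ 6) \<le> eps / 4 \<and>
    2 * q ^ 8 * C4 T R < m0 * eps\<^sup>2 / 32 \<and> 2 * q ^ 8 * C4 T R \<le> eps / 4 \<and>
    (\<forall>s t x. 0 \<le> s \<longrightarrow> s \<le> t \<longrightarrow> t \<le> T + 1 \<longrightarrow> t - s \<le> q ^ 23 \<longrightarrow> \<bar>x\<bar> \<le> R \<longrightarrow> \<bar>Gs s x - Gs t x\<bar> \<le> eps / 4)"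

lemma eventually_less_at_right_0: "(f \<longlongrightarrow> 0) (at_right (0::real)) \<Longrightarrow> 0 < c \<Longrightarrow> eventually (\<lambda>q. f q < (c::real)) (at_right 0)"
  by (rule order_tendstoD(2))

lemma eventually_pos_less_at_right_0: "eventually (\<lambda>q. 0 < q \<and> q < c) (at_right (0::real))" if "0 < c" for c
  unfolding eventually_at_right_field using that by (intro exI[of _ c]) auto

lemma exp_dominates:
  obtains x0 :: real where "\<And>x. x0 \<le> x \<Longrightarrow> 1 \<le> x \<and> 3 * x * (1 + 3 * x)\<^sup>2 * x * x ^ 8 \<le> exp (2 * x) \<and> 2 * x ^ 3 * x ^ 8 \<le> exp (2 * x)"
proof -
  have "eventually (\<lambda>x::real. 1 \<le> x \<and> 3 * x * (1 + 3 * x)\<^sup>2 * x * x ^ 8 \<le> exp (2 * x) \<and> 2 * x ^ 3 * x ^ 8 \<le> exp (2 * x)) at_top"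
    by (intro eventually_conj; real_asymp)
  then show ?thesis using that unfolding eventually_at_top_linorder by blast
qed

lemma eventually_params:
  assumes T: "0 < T" and eps: "0 < eps" and R: "0 \<le> R"
  shows "eventually (params T eps R) (at_right 0)"
proof -
  obtain x0 :: real where x0: "\<And>x. x0 \<le> x \<Longrightarrow> 1 \<le> x \<and> 3 * x * (1 + 3 * x)\<^sup>2 * x * x ^ 8 \<le> exp (2 * x) \<and> 2 * x ^ 3 * x ^ 8 \<le> exp (2 * x)"
    using exp_dominates by blast
  \<comment> \<open>Once \<open>q < 1 / x1\<close>, the cutoff \<open>1 / q\<close> exceeds all
    these thresholds at once.\<close>
  define x1 where "x1 = Max {1, x0, m1, yb T + 1, R}"
  have x1: "1 \<le> x1" "x0 \<le> x1" "m1 \<le> x1" "yb T + 1 \<le> x1" "R \<le> x1"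
    unfolding x1_def by (intro Max_ge; simp)+
  have out: "eventually (\<lambda>q. 0 < q \<and> q < 1 / x1) (at_right 0)" by (rule eventually_pos_less_at_right_0) (use x1 in simp)
  obtain d where d: "0 < d" "\<And>s t x. 0 \<le> s \<Longrightarrow> s \<le> t \<Longrightarrow> t \<le> T + 1 \<Longrightarrow> t - s < d \<Longrightarrow> \<bar>x\<bar> \<le> R \<Longrightarrow> \<bar>Gs s x - Gs t x\<bar> \<le> eps / 4"
  proof -
    have "uniformly_continuous_on ({0..T + 1} \<times> {- R..R}) (\<lambda>(t, x). Gs t x)"
      by (intro compact_uniformly_continuous continuous_on_subset[OF continuous_on_Gs] compact_Times) auto
    then obtain d where d: "0 < d" "\<And>p p'. p \<in> {0..T + 1} \<times> {- R..R} \<Longrightarrow> p' \<in> {0..T + 1} \<times> {- R..R} \<Longrightarrow> dist p' p < d \<Longrightarrow>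
        dist ((\<lambda>(t, x). Gs t x) p') ((\<lambda>(t, x). Gs t x) p) < eps / 4"
      unfolding uniformly_continuous_on_def using eps by (metis divide_pos_pos zero_less_numeral)
    show ?thesis
    proof (rule that[OF d(1)])
      fix s t x :: real assume *: "0 \<le> s" "s \<le> t" "t \<le> T + 1" "t - s < d" "\<bar>x\<bar> \<le> R"
      have "- R \<le> x \<and> x \<le> R" using *(5) by linarith
      with * show "\<bar>Gs s x - Gs t x\<bar> \<le> eps / 4"
        using d(2)[of "(t, x)" "(s, x)"] by (auto simp: dist_Pair_Pair dist_real_def)
    qed
  qed
  have m1p: "0 < m1" by (rule m1_pos)
  \<comment> \<open>Where a condition of \<open>params\<close> has a power of \<open>q\<close> on
    the right, this power is divided out; positive powers of \<open>q\<close> remain on the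
    left.\<close>
  have e: "eventually (\<lambda>q. (T + 1) * (q ^ 9 + q ^ 11 * C3 T + 3 * m1\<^sup>2 * q ^ 7) < 1) (at_right 0)"
    "eventually (\<lambda>q. 4 * C3 T * (q ^ 3 + 4 * q\<^sup>2) < 1) (at_right 0)"
    "eventually (\<lambda>q. k\<^sup>2 * q ^ 15 * (2 * m1) < 1) (at_right 0)"
    "eventually (\<lambda>q. q ^ 32 + q ^ 34 * (lam * 2) < 1) (at_right 0)"
    "eventually (\<lambda>q. 24 * m1 * q ^ 6 / eps\<^sup>2 + (2 * q\<^sup>2 + q ^ 34 + q ^ 36 * C3 T) * C4 T R < 1) (at_right 0)"
    "eventually (\<lambda>q. 2 * q\<^sup>2 + 8 * q < eps / 4) (at_right 0)"
    "eventually (\<lambda>q. 2 * q ^ 11 + 8 * q ^ 10 < eps / 4) (at_right 0)"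
    "eventually (\<lambda>q. (2 * q ^ 11 + 8 * q ^ 10) * (C3 T * C4 T R) < eps / 4) (at_right 0)"
    "eventually (\<lambda>q. q ^ 23 < eps / 4) (at_right 0)"
    "eventually (\<lambda>q. \<bar>k\<bar> * sqrt (2 * q ^ 6) < eps / 4) (at_right 0)"
    "eventually (\<lambda>q. 2 * q ^ 8 * C4 T R < m0 * eps\<^sup>2 / 32) (at_right 0)"
    "eventually (\<lambda>q. 2 * q ^ 8 * C4 T R < eps / 4) (at_right 0)"
    "eventually (\<lambda>q. q ^ 23 < d) (at_right 0)"
    "eventually (\<lambda>q. 3 * q ^ 6 < 1) (at_right (0::real))"
    "eventually (\<lambda>q. 2 * q ^ 8 < 1) (at_right (0::real))"
    "eventually (\<lambda>q. 0 < q \<and> q < 1 / 2) (at_right (0::real))"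
    using eps d(1) m0_pos eventually_pos_less_at_right_0[of "1 / 2"] by (auto intro!: eventually_less_at_right_0 eventually_pos_less_at_right_0 tendsto_eq_intros)
  from e out show ?thesis
  proof eventually_elim
    case (elim q)
    have q: "0 < q" "q < 1 / x1" by (use elim in auto)
    have q0: "0 < q ^ n" for n using q by simp
    have x1q: "x1 < 1 / q" using q x1 by (simp add: field_simps)
    have o1: "o1q q = 2 * q ^ 11 + 8 * q ^ 10"
    proof -
      have "q ^ 11 * (1 / q) = q ^ 10" using q by (simp add: power_eq_if)
      then show ?thesis by (simp add: o1q_def algebra_simps)
    qed
    have o2: "o2q q = 2 * q\<^sup>2 + 8 * q" using q by (simp add: o2q_def algebra_simps power2_eq_square)
    have out1: "3 * x * (1 + 3 * x)\<^sup>2 * (1 / q) \<le> q ^ 8 * exp (2 * x) \<and> m1 * (x + yb T)\<^sup>2 / 2 \<le> q ^ 8 * exp (2 * x)"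
      if x: "1 / q < x" for x
    proof -
      have x': "x0 \<le> x" "m1 \<le> x" "yb T \<le> x" "1 \<le> x" using x x1q x1 by auto
      have "1 / x < q" using x q x' by (simp add: field_simps)
      \<comment> \<open>Beyond the cutoff, the factor \<open>q ^ 8\<close> is paid for by eight
        further powers of \<open>x\<close>, which the exponential still dominates.\<close>
      then have "(1 / x) ^ 8 \<le> q ^ 8" using x' by (intro power_mono) auto
      then have q8: "exp (2 * x) / x ^ 8 \<le> q ^ 8 * exp (2 * x)"
        using mult_right_mono[of "(1 / x) ^ 8" "q ^ 8" "exp (2 * x)"] by (simp add: power_one_over)
      have x8: "0 < x ^ 8" using x' by simp
      have "3 * x * (1 + 3 * x)\<^sup>2 * (1 / q) \<le> 3 * x * (1 + 3 * x)\<^sup>2 * x"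
        using x x' by (intro mult_left_mono) auto
      also have "\<dots> \<le> exp (2 * x) / x ^ 8" using x0[OF x'(1)] x8 by (simp add: pos_le_divide_eq)
      finally have 1: "3 * x * (1 + 3 * x)\<^sup>2 * (1 / q) \<le> exp (2 * x) / x ^ 8" .
      have yb0: "0 \<le> yb T" unfolding yb_def using T by simp
      have "m1 * (x + yb T)\<^sup>2 \<le> x * (2 * x)\<^sup>2" using x' m1p yb0 by (intro mult_mono power_mono) auto
      then have "m1 * (x + yb T)\<^sup>2 / 2 \<le> 2 * x ^ 3" by (simp add: power2_eq_square power3_eq_cube)
      also have "\<dots> \<le> exp (2 * x) / x ^ 8" using x0[OF x'(1)] x8 by (simp add: pos_le_divide_eq)
      finally show ?thesis using 1 q8 by linarith
    qed
    have s31: "q ^ 8 * q ^ 23 = q ^ 31" by (simp flip: power_add)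
    have c1: "(T + 1) * (q ^ 40 + q ^ 42 * C3 T + 3 * m1\<^sup>2 * (q ^ 23)\<^sup>2 / q ^ 8) \<le> q ^ 8 * q ^ 23"
    proof -
      have "(q ^ 23)\<^sup>2 / q ^ 8 = q ^ 38" using q by (simp add: power_mult[symmetric] power_diff[symmetric])
      then have a: "3 * m1\<^sup>2 * (q ^ 23)\<^sup>2 / q ^ 8 = 3 * m1\<^sup>2 * q ^ 38" by (metis times_divide_eq_right)
      have "q ^ 40 = q ^ 31 * q ^ 9" "q ^ 42 = q ^ 31 * q ^ 11" "q ^ 38 = q ^ 31 * q ^ 7" by (simp_all flip: power_add)
      then have "(T + 1) * (q ^ 40 + q ^ 42 * C3 T + 3 * m1\<^sup>2 * q ^ 38) = q ^ 31 * ((T + 1) * (q ^ 9 + q ^ 11 * C3 T + 3 * m1\<^sup>2 * q ^ 7))"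
        by (simp only: distrib_left mult_ac)
      also have "\<dots> \<le> q ^ 31 * 1" using elim(1) q0[of 31] by (intro mult_left_mono) auto
      finally show ?thesis unfolding a s31 by simp
    qed
    have c2: "2 * C3 T * o1q q \<le> q ^ 8"
    proof -
      have "q ^ 11 = q ^ 8 * q ^ 3" "q ^ 10 = q ^ 8 * q\<^sup>2" by (simp_all flip: power_add)
      then have "2 * C3 T * o1q q = q ^ 8 * (4 * C3 T * (q ^ 3 + 4 * q\<^sup>2))" unfolding o1 by (simp add: algebra_simps)
      also have "\<dots> \<le> q ^ 8 * 1" using elim(2) q0[of 8] by (intro mult_left_mono) auto
      finally show ?thesis by simp
    qed
    have c3: "\<bar>k\<bar> * sqrt (q ^ 23) \<le> sqrt (q ^ 8 / (2 * m1))"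
    proof -
      have "k\<^sup>2 * q ^ 23 = q ^ 8 * (k\<^sup>2 * q ^ 15)" by (simp flip: power_add)
      also have "\<dots> \<le> q ^ 8 * (1 / (2 * m1))"
        using elim(3) q0[of 8] m1p by (intro mult_left_mono) (auto simp: pos_le_divide_eq)
      finally have "k\<^sup>2 * q ^ 23 \<le> q ^ 8 / (2 * m1)" by simp
      then have "sqrt (k\<^sup>2 * q ^ 23) \<le> sqrt (q ^ 8 / (2 * m1))" by (rule real_sqrt_le_mono)
      then show ?thesis by (simp add: real_sqrt_mult)
    qed
    have c4: "q ^ 40 + q ^ 42 * (lam * 2) \<le> q ^ 8"
    proof -
      have "q ^ 40 = q ^ 8 * q ^ 32" "q ^ 42 = q ^ 8 * q ^ 34" by (simp_all flip: power_add)
      then have "q ^ 40 + q ^ 42 * (lam * 2) = q ^ 8 * (q ^ 32 + q ^ 34 * (lam * 2))" by (simp only: distrib_left mult_ac)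
      also have "\<dots> \<le> q ^ 8 * 1" using elim(4) q0[of 8] by (intro mult_left_mono) auto
      finally show ?thesis by simp
    qed
    have c5: "24 * m1 * (q ^ 6)\<^sup>2 / eps\<^sup>2 + (2 * q ^ 8 + q ^ 40 + q ^ 42 * C3 T) * C4 T R < q ^ 6"
    proof -
      have "q ^ 40 = q ^ 6 * q ^ 34" "q ^ 42 = q ^ 6 * q ^ 36" "q ^ 8 = q ^ 6 * q\<^sup>2" "(q ^ 6)\<^sup>2 = q ^ 6 * q ^ 6"
        by (simp_all flip: power_add power_mult)
      then have "24 * m1 * (q ^ 6)\<^sup>2 / eps\<^sup>2 + (2 * q ^ 8 + q ^ 40 + q ^ 42 * C3 T) * C4 T R
          = q ^ 6 * (24 * m1 * q ^ 6 / eps\<^sup>2 + (2 * q\<^sup>2 + q ^ 34 + q ^ 36 * C3 T) * C4 T R)"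
        by (simp add: algebra_simps)
      also have "\<dots> < q ^ 6 * 1" using elim(5) q0[of 6] by (intro mult_strict_left_mono) auto
      finally show ?thesis by simp
    qed
    have f1: "0 < q" "q \<le> 1 / 2" "3 * q ^ 6 \<le> 1" "2 * q ^ 8 \<le> 1" using elim by linarith+
    have f2: "\<forall>x>1 / q. 3 * x * (1 + 3 * x)\<^sup>2 * (1 / q) \<le> q ^ 8 * exp (2 * x)"
      "\<forall>x>1 / q. m1 * (x + yb T)\<^sup>2 / 2 \<le> q ^ 8 * exp (2 * x)"
      by (intro allI impI; use out1 in blast)+
    have f3: "yb T + 1 \<le> 1 / q" "R \<le> 1 / q" using x1 x1q by linarith+
    have f4: "o2q q \<le> eps / 4" "o1q q \<le> eps / 4" "o1q q * (C3 T * C4 T R) \<le> eps / 4" "q ^ 23 \<le> eps / 4"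
      "\<bar>k\<bar> * sqrt (2 * q ^ 6) \<le> eps / 4" "2 * q ^ 8 * C4 T R < m0 * eps\<^sup>2 / 32" "2 * q ^ 8 * C4 T R \<le> eps / 4"
      unfolding o1 o2 by (rule less_imp_le, rule elim | rule elim)+
    have f5: "\<forall>s t x. 0 \<le> s \<longrightarrow> s \<le> t \<longrightarrow> t \<le> T + 1 \<longrightarrow> t - s \<le> q ^ 23 \<longrightarrow> \<bar>x\<bar> \<le> R \<longrightarrow> \<bar>Gs s x - Gs t x\<bar> \<le> eps / 4"
    proof (intro allI impI)
      fix s t x :: real assume "0 \<le> s" "s \<le> t" "t \<le> T + 1" "t - s \<le> q ^ 23" "\<bar>x\<bar> \<le> R"
      then show "\<bar>Gs s x - Gs t x\<bar> \<le> eps / 4" using elim(13) by (intro d(2)) linarith+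
    qed
    show ?case
      unfolding params_def by (intro conjI f1 f2 f3 f4 f5 c1 c2 c3 c4 c5)
  qed
qed

end

section \<open>From the good event to the deterministic assumptions\<close>

context scaled_q begin

text \<open>The only passage from probability to the pathwise argument: off \<open>bad\<close>, a
  single path satisfies every assumption of the comparison, each component of \<open>bad\<close>
  supplying one of them.\<close>

lemma good_event:
  assumes st: "stefan lam k" and par: "stefan.params lam k T eps R q" and eps: "0 < eps" "eps \<le> 1" and R: "0 \<le> R"
    and \<omega>: "\<omega> \<in> space M" "\<omega> \<notin> bad"
    and path: "particle_path b (\<lambda>i t. X i t \<omega>) (\<lambda>i t. W i t \<omega>) (\<lambda>i t. X i t \<omega> - X i 0 \<omega> - W i t \<omega>)"
    and cont: "\<And>i. continuous_on {0..} (\<lambda>t. W i t \<omega>)" and fin: "\<And>y. finite {i. X i 0 \<omega> \<le> y}"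
  shows "good_path_eps b (\<lambda>i t. X i t \<omega>) (\<lambda>i t. W i t \<omega>) (\<lambda>i t. X i t \<omega> - X i 0 \<omega> - W i t \<omega>) T (1 / q) (1 / q) lam k
    (q ^ 23) (q ^ 8) (q ^ 6) (q ^ 40) (q ^ 42) (stefan.o1q q) (stefan.o2q q) eps R (stefan.C4 k T R)"
proof -
  interpret st: stefan lam k by (rule st)
  interpret pp: particle_path b "\<lambda>i t. X i t \<omega>" "\<lambda>i t. W i t \<omega>" "\<lambda>i t. X i t \<omega> - X i 0 \<omega> - W i t \<omega>" by (rule path)
  note P = par[unfolded st.params_def]
  have X0: "0 \<le> X i 0 \<omega>" for i using pp.X0_nonneg .
  have W0: "W i 0 \<omega> = 0" for i using pp.A_0[of i] by simp
  have T0: "0 < T" by (rule T)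
  have ranged: "ranged_path b (\<lambda>i t. X i t \<omega>) (\<lambda>i t. W i t \<omega>) (\<lambda>i t. X i t \<omega> - X i 0 \<omega> - W i t \<omega>) T (1 / q) (1 / q)"
  proof (unfold_locales)
    show "0 < T" by (rule T)
    show "2 \<le> 1 / q" using P by (simp add: field_simps)
    fix i u assume u: "0 \<le> u" "u \<le> T + 1"
    have "\<omega> \<notin> osc_bad 0 (T + 1) (1 / 2) (1 / q)" using \<omega>(2) by (simp add: bad_def)
    from osc_good[OF \<omega>(1) this cont X0, of u i] u T q
    show "\<bar>W i u \<omega>\<bar> \<le> (1 / q + X i 0 \<omega>) / 2" by (simp add: W0)
  next
    have "\<omega> \<notin> S_bad (1 / q)" using \<omega>(2) by (simp add: bad_def)
    from S_good[OF \<omega>(1) this X0] q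
    show "summable (\<lambda>i. 1 / (1 + X i 0 \<omega>)\<^sup>2)" "b * (\<Sum>i. 1 / (1 + X i 0 \<omega>)\<^sup>2) \<le> 1 / q" by auto
  qed
  interpret rp: ranged_path b "\<lambda>i t. X i t \<omega>" "\<lambda>i t. W i t \<omega>" "\<lambda>i t. X i t \<omega> - X i 0 \<omega> - W i t \<omega>" T "1 / q" "1 / q"
    by (rule ranged)
  have qn: "0 < q ^ n" "q ^ n \<le> 1" for n using q by (auto intro: power_le_one)
  have osc: "\<bar>W i u \<omega> - W i v \<omega>\<bar> \<le> 2 * c * (1 + 4 / q)"
    \<comment> \<open>Both times are compared with the start of the window, and the threshold is
      evaluated at the largest admissible starting point.\<close>
    if "\<omega> \<notin> osc_bad (n * q ^ 23) tau c 1" "0 < tau" "0 \<le> c" "X i 0 \<omega> \<le> 4 * (1 / q)"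
      "n * q ^ 23 \<le> u" "u \<le> n * q ^ 23 + tau" "n * q ^ 23 \<le> v" "v \<le> n * q ^ 23 + tau" for n :: nat and i u v tau c
  proof -
    have s: "0 \<le> real n * q ^ 23" using q by simp
    have "\<bar>W i u \<omega> - W i (n * q ^ 23) \<omega>\<bar> \<le> c * (1 + X i 0 \<omega>)" "\<bar>W i v \<omega> - W i (n * q ^ 23) \<omega>\<bar> \<le> c * (1 + X i 0 \<omega>)"
      using osc_good[OF \<omega>(1) that(1) cont X0 s that(2,3), of _ i] that by auto
    moreover have "c * (1 + X i 0 \<omega>) \<le> c * (1 + 4 / q)" using that by (intro mult_left_mono) auto
    ultimately show ?thesis by linarith
  qed
  have noise: "\<bar>pp.Ghat (n * q ^ 23) (n * q ^ 23 + d) (q ^ 42 * j) - heat d (pp.G (n * q ^ 23)) (q ^ 42 * j)\<bar> \<le> q ^ 40"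
    if nb: "\<omega> \<notin> noise_bad (n * q ^ 23) (n * q ^ 23 + d) (q ^ 42 * j) (q ^ 40)" and d: "0 < d" "d \<le> 1"
      and n: "real n * q ^ 23 \<le> T" for n :: nat and j :: int and d
  proof -
    have s: "0 \<le> real n * q ^ 23" "real n * q ^ 23 < n * q ^ 23 + d" "real n * q ^ 23 \<le> n * q ^ 23 + d" "n * q ^ 23 + d \<le> T + 1" "real n * q ^ 23 \<le> T + 1"
      using q d n by auto
    show ?thesis
    proof (rule noise_good[OF s(1,2) \<omega>(1) nb])
      have "(\<lambda>i. b * pos (q ^ 42 * j - (X i (n * q ^ 23) \<omega> + W i (n * q ^ 23 + d) \<omega> - W i (n * q ^ 23) \<omega>)) - b * heat d pos (q ^ 42 * j - X i (n * q ^ 23) \<omega>))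
        sums (pp.Ghat (n * q ^ 23) (n * q ^ 23 + d) (q ^ 42 * j) - heat d (pp.G (n * q ^ 23)) (q ^ 42 * j))"
        unfolding pp.Ghat_def
        by (intro sums_diff summable_sums rp.Ghat_summable[OF s(1,3,4)] rp.heat_G_sums s)
      then show "(\<lambda>i. b * xi (n * q ^ 23) (n * q ^ 23 + d) (q ^ 42 * j) i \<omega>)
        sums (pp.Ghat (n * q ^ 23) (n * q ^ 23 + d) (q ^ 42 * j) - heat d (pp.G (n * q ^ 23)) (q ^ 42 * j))"
        unfolding xi_def by (simp add: right_diff_distrib add_diff_eq)
    qed (use q in simp)
  qed
  have bad_n: "\<omega> \<notin> osc_bad (n * q ^ 23) (q ^ 23) (q ^ 11) 1" "\<omega> \<notin> osc_bad (n * q ^ 23) (3 * q ^ 6) (q\<^sup>2) 1"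
    if "real n * q ^ 23 \<le> T" for n :: nat
    using \<omega>(2) that unfolding Nh bad_def by auto
  have bad_nj: "\<omega> \<notin> noise_bad (n * q ^ 23) (n * q ^ 23 + q ^ 23) (q ^ 42 * j) (q ^ 40)"
    "\<omega> \<notin> noise_bad (n * q ^ 23) (n * q ^ 23 + q ^ 6) (q ^ 42 * j) (q ^ 40)"
    if "real n * q ^ 23 \<le> T" "\<bar>q ^ 42 * real_of_int j\<bar> \<le> 1 / q + 2" for n :: nat and j :: int
    using \<omega>(2) that unfolding Nh J0 bad_def by auto
  show ?thesis
  proof (unfold_locales)
    show "0 < q ^ 23" "q ^ 23 \<le> 1" "0 < q ^ 8" "0 < q ^ 42" "q ^ 42 \<le> 1" "0 \<le> q ^ 40" using q qn by (auto simp: less_imp_le)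
    show "q ^ 23 \<le> q ^ 6" using q by (intro power_decreasing) auto
    show "0 \<le> st.o1q q" unfolding st.o1q_def using q by simp
    show "\<bar>W i u \<omega> - W i v \<omega>\<bar> \<le> st.o1q q"
      if "real n * q ^ 23 \<le> T" "X i 0 \<omega> \<le> 4 * (1 / q)" "n * q ^ 23 \<le> u" "u \<le> n * q ^ 23 + q ^ 23"
        "n * q ^ 23 \<le> v" "v \<le> n * q ^ 23 + q ^ 23" for n :: nat and i u v
      unfolding st.o1q_def using that q qn by (intro osc[OF bad_n(1)]) auto
    show "\<bar>W i u \<omega> - W i v \<omega>\<bar> \<le> st.o2q q"
      if "real n * q ^ 23 \<le> T" "X i 0 \<omega> \<le> 4 * (1 / q)" "n * q ^ 23 \<le> u" "u \<le> n * q ^ 23 + 3 * q ^ 6"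
        "n * q ^ 23 \<le> v" "v \<le> n * q ^ 23 + 3 * q ^ 6" for n :: nat and i u v
      unfolding st.o2q_def using that q qn by (intro osc[OF bad_n(2)]) auto
    show "\<bar>pp.Ghat (n * q ^ 23) (n * q ^ 23 + q ^ 23) (q ^ 42 * real_of_int j) - heat (q ^ 23) (pp.G (n * q ^ 23)) (q ^ 42 * real_of_int j)\<bar> \<le> q ^ 40"
      if "real n * q ^ 23 \<le> T" "\<bar>q ^ 42 * real_of_int j\<bar> \<le> 1 / q + 2" for n :: nat and j :: int
      using that q qn by (intro noise bad_nj) auto
    show "\<bar>pp.Ghat (n * q ^ 23) (n * q ^ 23 + q ^ 6) (q ^ 42 * real_of_int j) - heat (q ^ 6) (pp.G (n * q ^ 23)) (q ^ 42 * real_of_int j)\<bar> \<le> q ^ 40"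
      if "real n * q ^ 23 \<le> T" "\<bar>q ^ 42 * real_of_int j\<bar> \<le> 1 / q + 2" for n :: nat and j :: int
      using that q qn by (intro noise bad_nj) auto
    show "\<bar>pp.G 0 (q ^ 42 * real_of_int j) - lam * (pos (q ^ 42 * real_of_int j))\<^sup>2 / 2\<bar> \<le> q ^ 40"
      if "\<bar>q ^ 42 * real_of_int j\<bar> \<le> 1 / q + 2" for j :: int
    proof (cases "0 \<le> j")
      case True
      have "j \<in> {0..J0}" using that True unfolding J0 by simp
      then have "\<omega> \<notin> init_bad (q ^ 42 * j) (q ^ 40)" using \<omega>(2) unfolding bad_def by auto
      from init_good[OF \<omega>(1) this X0 _ _ fin] show ?thesis using True q by (simp add: pp.G_def)
    next
      case False
      \<comment> \<open>Left of the origin there is nothing to estimate: no particle starts there,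
        and the limiting parabola vanishes.\<close>
      then have j: "q ^ 42 * real_of_int j \<le> 0" using qn by (simp add: mult_le_0_iff)
      then have "pos (q ^ 42 * real_of_int j - X i 0 \<omega>) = 0" for i using X0[of i] by simp
      then show ?thesis using j q by (simp add: pp.G_def less_imp_le max_absorb1)
    qed
    show "1 + exp (2 * (st.yb T + 1) + 2 * (T + 1)) \<le> st.C4 T R" "1 + exp (2 * R + 2 * (T + 1)) \<le> st.C4 T R"
      unfolding st.C4_def by (simp_all add: add_nonneg_nonneg)
  qed (use P eps R in \<open>simp_all add: power2_eq_square\<close>)
qed

end

section \<open>The Atlas model as a rescaled particle path\<close>

text \<open>Replaces the existential ranking by countably many order conditions on coordinates,
  which makes the times of leadership a measurable set.\<close>

lemma leftmost_iff:
  assumes "ranking x p"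
  shows "leftmost x i \<longleftrightarrow> (\<forall>j. x i \<le> x j) \<and> (\<forall>j<i. x i < x j)"
proof -
  have min: "(\<forall>j. x (r 0) \<le> x j) \<and> (\<forall>j<r 0. x (r 0) < x j)" if r: "ranking x r" for r
  proof -
    have "x (r 0) < x j \<or> x (r 0) = x j \<and> r 0 \<le> j" for j
    proof -
      obtain l where l: "j = r l" using r unfolding ranking_def by (meson bij_pointE)
      show ?thesis
      proof (cases "l = 0")
        case False
        then have "x (r 0) < x (r l) \<or> (x (r 0) = x (r l) \<and> r 0 < r l)" using r unfolding ranking_def by blast
        then show ?thesis using l by auto
      qed (use l in simp)
    qed
    then show ?thesis by (metis leD less_imp_le order_refl)
  qed
  show ?thesis
  proof
    assume "leftmost x i"
    then show "(\<forall>j. x i \<le> x j) \<and> (\<forall>j<i. x i < x j)" using min unfolding leftmost_def by blast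
  next
    assume i: "(\<forall>j. x i \<le> x j) \<and> (\<forall>j<i. x i < x j)"
    have "i = p 0"
      using i min[OF assms] by (metis leD linorder_neqE_nat)
    then show "leftmost x i" using assms unfolding leftmost_def by blast
  qed
qed

lemma leftmost_unique: "ranking x p \<Longrightarrow> leftmost x i \<Longrightarrow> leftmost x j \<Longrightarrow> i = j"
  unfolding leftmost_iff by (metis leD linorder_neqE_nat)

text \<open>The drift of particle \<open>i\<close> is the Lebesgue measure of the set
  \<open>Ls i\<close> of times at which it leads. These sets partition
  \<open>[0, \<infinity>)\<close>, which makes the drifts over \<open>(s, t]\<close> add up to
  \<open>t - s\<close>.\<close>

lemma particle_path_unscaled:
  fixes x w :: "nat \<Rightarrow> real \<Rightarrow> real"
  assumes cont: "\<And>i. continuous_on {0..} (x i)"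
    and rank: "\<And>t. 0 \<le> t \<Longrightarrow> \<exists>p. ranking (\<lambda>i. x i t) p"
    and eq: "\<And>i t. 0 \<le> t \<Longrightarrow> x i t = x i 0 + (LINT s:{0..t}|lborel. of_bool (leftmost (\<lambda>j. x j s) i)) + w i t"
    and w0: "\<And>i. w i 0 = 0" and x0: "\<And>i. 0 \<le> x i 0"
  shows "particle_path 1 x w (\<lambda>i t. x i t - x i 0 - w i t)"
proof -
  define Ls where "Ls i = {s. 0 \<le> s \<and> leftmost (\<lambda>j. x j s) i}" for i
  \<comment> \<open>Freezing the paths at time 0 for negative arguments turns continuity on the
    half-line into measurability on the whole line.\<close>
  have Ls_eq: "Ls i = {s. 0 \<le> s \<and> (\<forall>j. x i (max 0 s) \<le> x j (max 0 s)) \<and> (\<forall>j\<in>{..<i}. x i (max 0 s) < x j (max 0 s))}" for i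
  proof -
    have "leftmost (\<lambda>j. x j s) i \<longleftrightarrow> (\<forall>j. x i (max 0 s) \<le> x j (max 0 s)) \<and> (\<forall>j\<in>{..<i}. x i (max 0 s) < x j (max 0 s))" if s: "0 \<le> s" for s
    proof -
      obtain p where "ranking (\<lambda>i. x i s) p" using rank[OF s] by blast
      from leftmost_iff[OF this, of i] s show ?thesis by (simp add: lessThan_def)
    qed
    then show ?thesis unfolding Ls_def by auto
  qed
  have xm[measurable]: "(\<lambda>s. x i (max 0 s)) \<in> borel_measurable borel" for i
  proof (intro borel_measurable_continuous_onI continuous_on_compose2[OF cont])
    show "continuous_on UNIV (\<lambda>s. max 0 s :: real)" by (intro continuous_intros)
  qed auto
  have Ls[measurable]: "Ls i \<in> sets borel" for i unfolding Ls_eq by measurable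
  define a where "a i t = measure lborel (Ls i \<inter> {0..t})" for i t
  have int_a: "(LINT s:{0..t}|lborel. of_bool (leftmost (\<lambda>j. x j s) i)) = a i t" for i t
  proof -
    have "(LINT s:{0..t}|lborel. of_bool (leftmost (\<lambda>j. x j s) i)) = (LINT s|lborel. indicator (Ls i \<inter> {0..t}) s)"
      unfolding set_lebesgue_integral_def
      by (intro Bochner_Integration.integral_cong refl) (auto simp: Ls_def indicator_def)
    also have "\<dots> = a i t" by (simp add: a_def)
    finally show ?thesis .
  qed
  have A_eq: "x i t - x i 0 - w i t = a i t" if "0 \<le> t" for i t
    using eq[OF that, of i] unfolding int_a by simp
  have fin: "emeasure lborel (Ls i \<inter> {s..t}) < \<infinity>" for i s t
  proof -
    have "emeasure lborel (Ls i \<inter> {s..t}) \<le> emeasure lborel {s..t}" by (intro emeasure_mono) auto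
    also have "\<dots> < \<infinity>" by (simp add: emeasure_lborel_Icc_eq)
    finally show ?thesis .
  qed
  have a_diff: "a i t - a i s = measure lborel (Ls i \<inter> {s<..t})" if st: "0 \<le> s" "s \<le> t" for i s t
  proof -
    have "Ls i \<inter> {0..t} = (Ls i \<inter> {0..s}) \<union> (Ls i \<inter> {s<..t})" using st by auto
    moreover have "emeasure lborel (Ls i \<inter> {s<..t}) \<noteq> \<infinity>"
      using fin[of i s t] emeasure_mono[of "Ls i \<inter> {s<..t}" "Ls i \<inter> {s..t}" lborel] by (auto simp: top_unique subset_iff)
    moreover have "emeasure lborel (Ls i \<inter> {0..s}) \<noteq> \<infinity>" using fin[of i 0 s] by simp
    ultimately have "measure lborel (Ls i \<inter> {0..t}) = measure lborel (Ls i \<inter> {0..s}) + measure lborel (Ls i \<inter> {s<..t})"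
      by (simp only:) (rule measure_Union, auto)
    then show ?thesis by (simp add: a_def)
  qed
  have disj: "disjoint_family Ls"
  proof (unfold disjoint_family_on_def, intro ballI impI)
    fix i j :: nat assume "i \<noteq> j"
    then show "Ls i \<inter> Ls j = {}" unfolding Ls_def using rank leftmost_unique by blast
  qed
  have cover: "(\<Union>i. Ls i) = {0..}"
  proof
    show "{0..} \<subseteq> (\<Union>i. Ls i)"
    proof
      fix s :: real assume "s \<in> {0..}"
      then have s: "0 \<le> s" by simp
      then obtain p where "ranking (\<lambda>i. x i s) p" using rank by blast
      then have "leftmost (\<lambda>i. x i s) (p 0)" unfolding leftmost_def by blast
      then show "s \<in> (\<Union>i. Ls i)" using s unfolding Ls_def by blast
    qed
  qed (auto simp: Ls_def)
  have minimal: "x i s \<le> x j s" if "s \<in> Ls i" for i j s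
    using that unfolding Ls_eq by (auto simp: max_def split: if_splits)
  show ?thesis
  proof
    show "x i t = x i 0 + (x i t - x i 0 - w i t) + w i t" for i t by simp
    show "x i 0 - x i 0 - w i 0 = 0" for i by (simp add: w0)
    show "x i s - x i 0 - w i s \<le> x i t - x i 0 - w i t" if "0 \<le> s" "s \<le> t" for i s t
      using a_diff[OF that, of i] that unfolding A_eq[OF that(1)] A_eq[OF order_trans[OF that]]
      by (metis diff_ge_0_iff_ge measure_nonneg)
    show "(\<lambda>i. 1 * (x i t - x i 0 - w i t - (x i s - x i 0 - w i s))) sums (t - s)" if st: "0 \<le> s" "s \<le> t" for s t
    proof -
      have t0: "0 \<le> t" using st by simp
      have U: "(\<Union>i. Ls i \<inter> {s<..t}) = {s<..t}" using cover st by auto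
      have "(\<lambda>i. measure lborel (Ls i \<inter> {s<..t})) sums measure lborel (\<Union>i. Ls i \<inter> {s<..t})"
      proof (rule measure_UNION)
        show "disjoint_family (\<lambda>i. Ls i \<inter> {s<..t})" using disj unfolding disjoint_family_on_def by blast
        show "emeasure lborel (\<Union>i. Ls i \<inter> {s<..t}) \<noteq> \<infinity>" unfolding U using st by simp
      qed auto
      then show ?thesis unfolding U A_eq[OF t0] A_eq[OF st(1)] a_diff[OF st] using st by simp
    qed
    show "\<exists>u\<in>{s..t}. (\<forall>j. x i u \<le> x j u) \<and> x i t - x i 0 - w i t = x i u - x i 0 - w i u"
      if st: "0 \<le> s" "s \<le> t" and less: "x i s - x i 0 - w i s < x i t - x i 0 - w i t" for i s t
    proof -
      have t0: "0 \<le> t" using st by simp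
      have al: "a i s < a i t" using less unfolding A_eq[OF t0] A_eq[OF st(1)] .
      define V where "V = Ls i \<inter> {s..t}"
      have "V \<noteq> {}"
      proof
        assume "V = {}"
        then have "Ls i \<inter> {s<..t} = {}" unfolding V_def by auto
        then show False using a_diff[OF st, of i] al by simp
      qed
      \<comment> \<open>The supremum of the leading times need not be one of them, as ties may go to
        another index; it lies in their closure, so by continuity particle \<open>i\<close> is still
        a minimum at \<open>u\<close>, and it receives no drift afterwards.\<close>
      define u where "u = Sup V"
      have bdd: "bdd_above V" unfolding V_def by auto
      have u: "u \<in> closure V" unfolding u_def by (rule closure_contains_Sup[OF \<open>V \<noteq> {}\<close> bdd])
      have clo: "closure V \<subseteq> {s..t}" unfolding V_def by (rule closure_minimal) auto
      then have ust: "u \<in> {s..t}" using u by blast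
      have "x i u \<le> x j u" for j
      proof -
        obtain v where v: "\<And>n. v n \<in> V" "v \<longlonglongrightarrow> u" using u unfolding closure_sequential by blast
        have v0: "v n \<in> {0..}" for n using v(1)[of n] st unfolding V_def by auto
        have u0: "u \<in> {0..}" using ust st by auto
        have lim: "(\<lambda>n. x l (v n)) \<longlonglongrightarrow> x l u" for l
          using cont[of l] v0 u0 v(2) unfolding continuous_on_sequentially comp_def by blast
        show ?thesis
          by (rule LIMSEQ_le[OF lim lim]) (use v(1) minimal in \<open>auto simp: V_def\<close>)
      qed
      moreover have "a i t = a i u"
      proof -
        have "Ls i \<inter> {u<..t} = {}"
        proof (rule ccontr)
          assume "Ls i \<inter> {u<..t} \<noteq> {}"
          then obtain v where v: "v \<in> Ls i" "u < v" "v \<le> t" by auto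
          then have "v \<in> V" using ust unfolding V_def by auto
          then have "v \<le> u" unfolding u_def by (rule cSup_upper[OF _ bdd])
          then show False using v by simp
        qed
        then show ?thesis using a_diff[of u t i] ust st by auto
      qed
      moreover have "0 \<le> u" using ust st by auto
      ultimately show ?thesis using ust A_eq[OF t0, of i] A_eq[of u i] by (intro bexI[of _ u]) auto
    qed
    show "\<exists>i. \<forall>j. x i t \<le> x j t" if t: "0 \<le> t" for t
    proof -
      have "t \<in> (\<Union>i. Ls i)" using cover t by simp
      then show ?thesis using minimal by blast
    qed
  qed (use x0 in auto)
qed

text \<open>Diffusive scaling: drift accumulates over the longer time \<open>t / b^2\<close> but is
  multiplied by \<open>b\<close> in space and again by the mass \<open>b\<close> of a particle, so
  its total mass per unit time stays 1.\<close>

lemma particle_path_scale: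
  assumes pp: "particle_path 1 x w a" and b: "0 < b"
  shows "particle_path b (\<lambda>i t. b * x i (t / b\<^sup>2)) (\<lambda>i t. b * w i (t / b\<^sup>2)) (\<lambda>i t. b * a i (t / b\<^sup>2))"
proof -
  interpret p: particle_path 1 x w a by (rule pp)
  have d: "0 \<le> t / b\<^sup>2" if "0 \<le> t" for t using that b by simp
  have m: "s / b\<^sup>2 \<le> t / b\<^sup>2" if "s \<le> t" for s t using that b by (simp add: divide_right_mono)
  show ?thesis
  proof
    show "0 < b" by (rule b)
    show "b * x i (t / b\<^sup>2) = b * x i (0 / b\<^sup>2) + b * a i (t / b\<^sup>2) + b * w i (t / b\<^sup>2)" if "0 \<le> t" for i t
      using p.X_eq[OF d[OF that], of i] by (simp add: distrib_left[symmetric])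
    show "b * a i (0 / b\<^sup>2) = 0" for i using p.A_0 by simp
    show "b * a i (s / b\<^sup>2) \<le> b * a i (t / b\<^sup>2)" if "0 \<le> s" "s \<le> t" for i s t
      using p.A_mono[OF d[OF that(1)] m[OF that(2)]] b by simp
    show "(\<lambda>i. b * (b * a i (t / b\<^sup>2) - b * a i (s / b\<^sup>2))) sums (t - s)" if "0 \<le> s" "s \<le> t" for s t
    proof -
      have "(\<lambda>i. b\<^sup>2 * (1 * (a i (t / b\<^sup>2) - a i (s / b\<^sup>2)))) sums (b\<^sup>2 * (t / b\<^sup>2 - s / b\<^sup>2))"
        by (intro sums_mult p.A_sums d m that)
      moreover have "b\<^sup>2 * (t / b\<^sup>2 - s / b\<^sup>2) = t - s" using b by (simp add: right_diff_distrib)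
      ultimately show ?thesis by (simp add: power2_eq_square right_diff_distrib mult.assoc)
    qed
    show "\<exists>u\<in>{s..t}. (\<forall>j. b * x i (u / b\<^sup>2) \<le> b * x j (u / b\<^sup>2)) \<and> b * a i (t / b\<^sup>2) = b * a i (u / b\<^sup>2)"
      if "0 \<le> s" "s \<le> t" "b * a i (s / b\<^sup>2) < b * a i (t / b\<^sup>2)" for i s t
    proof -
      have "a i (s / b\<^sup>2) < a i (t / b\<^sup>2)" using that(3) b by simp
      from p.A_last[OF d[OF that(1)] m[OF that(2)] this]
      obtain v where v: "v \<in> {s / b\<^sup>2..t / b\<^sup>2}" "\<forall>j. x i v \<le> x j v" "a i (t / b\<^sup>2) = a i v" by blast
      have "v * b\<^sup>2 \<in> {s..t}" using v(1) b by (simp add: pos_divide_le_eq pos_le_divide_eq)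
      moreover have "v * b\<^sup>2 / b\<^sup>2 = v" using b by simp
      ultimately show ?thesis using v b by (intro bexI[of _ "v * b\<^sup>2"]) auto
    qed
    show "\<exists>i. \<forall>j. b * x i (t / b\<^sup>2) \<le> b * x j (t / b\<^sup>2)" if "0 \<le> t" for t
      using p.leader[OF d[OF that]] b by auto
    show "0 \<le> b * x i (0 / b\<^sup>2)" for i using p.X0_nonneg[of i] b by simp
  qed
qed

section \<open>Poisson moments\<close>

definition pois :: "real \<Rightarrow> nat \<Rightarrow> real" where "pois m k = m ^ k / fact k * exp (- m)"

lemma pois_nonneg: "0 \<le> m \<Longrightarrow> 0 \<le> pois m k" by (simp add: pois_def)

lemma pois_sums: "pois m sums 1"
proof -
  have "(\<lambda>k. m ^ k /\<^sub>R fact k * exp (- m)) sums (exp m * exp (- m))" by (intro sums_mult2 exp_converges)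
  then show ?thesis by (simp add: pois_def[abs_def] divide_inverse mult.commute exp_minus_inverse)
qed

lemma pois_Suc: "real (Suc k) * pois m (Suc k) = m * pois m k"
  by (simp add: pois_def fact_Suc del: of_nat_Suc)

lemma pois_mean: "(\<lambda>k. real k * pois m k) sums m"
proof -
  have "(\<lambda>k. real (Suc k) * pois m (Suc k)) sums (m * 1)" unfolding pois_Suc by (intro sums_mult pois_sums)
  from sums_Suc[OF this] show ?thesis by simp
qed

lemma pois_fact2: "(\<lambda>k. real k * (real k - 1) * pois m k) sums m\<^sup>2"
proof -
  have e: "real (Suc k) * (real (Suc k) - 1) * pois m (Suc k) = m * (real k * pois m k)" for k
  proof -
    have "real (Suc k) * (real (Suc k) - 1) * pois m (Suc k) = (real (Suc k) - 1) * (real (Suc k) * pois m (Suc k))"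
      by (simp only: mult_ac)
    then show ?thesis unfolding pois_Suc by simp
  qed
  have "(\<lambda>k. real (Suc k) * (real (Suc k) - 1) * pois m (Suc k)) sums (m * m)"
    unfolding e by (intro sums_mult pois_mean)
  from sums_Suc[OF this] show ?thesis by (simp add: power2_eq_square)
qed

lemma pois_var: "(\<lambda>k. (real k - m)\<^sup>2 * pois m k) sums m"
proof -
  have "(\<lambda>k. real k * (real k - 1) * pois m k + ((1 - 2 * m) * (real k * pois m k) + m\<^sup>2 * pois m k)) sums (m\<^sup>2 + ((1 - 2 * m) * m + m\<^sup>2 * 1))"
    by (intro sums_add sums_mult pois_fact2 pois_mean pois_sums)
  moreover have "m\<^sup>2 + ((1 - 2 * m) * m + m\<^sup>2 * 1) = m" by (simp add: power2_eq_square algebra_simps)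
  moreover have "real k * (real k - 1) * pois m k + ((1 - 2 * m) * (real k * pois m k) + m\<^sup>2 * pois m k) = (real k - m)\<^sup>2 * pois m k" for k
    by (simp add: power2_eq_square algebra_simps)
  ultimately show ?thesis by simp
qed

text \<open>The Cauchy-Schwarz bound by the standard deviation, in the form \<open>\<bar>k - m\<bar>
  \<le> (k - m)^2 / (2 * sqrt m) + sqrt m / 2\<close>.\<close>

lemma pois_abs:
  assumes "0 \<le> m" shows "summable (\<lambda>k. \<bar>real k - m\<bar> * pois m k)" "(\<Sum>k. \<bar>real k - m\<bar> * pois m k) \<le> sqrt m"
proof -
  have "summable (\<lambda>k. \<bar>real k - m\<bar> * pois m k) \<and> (\<Sum>k. \<bar>real k - m\<bar> * pois m k) \<le> sqrt m"
  proof (cases "m = 0")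
    case True
    then have "\<bar>real k - m\<bar> * pois m k = real k * pois m k" for k by simp
    then show ?thesis using pois_mean[of m] True by (simp add: sums_iff)
  next
    case False
    then have s: "0 < sqrt m" using assms by simp
    have le: "\<bar>real k - m\<bar> * pois m k \<le> ((real k - m)\<^sup>2 * pois m k) / (2 * sqrt m) + (sqrt m / 2) * pois m k" for k
    proof -
      have "2 * \<bar>real k - m\<bar> * sqrt m \<le> (real k - m)\<^sup>2 + (sqrt m)\<^sup>2"
        using sum_squares_bound[of "\<bar>real k - m\<bar>" "sqrt m"] by simp
      then have "\<bar>real k - m\<bar> \<le> ((real k - m)\<^sup>2 + (sqrt m)\<^sup>2) / (2 * sqrt m)"
        using s by (simp add: pos_le_divide_eq mult_ac)
      also have "\<dots> = (real k - m)\<^sup>2 / (2 * sqrt m) + sqrt m / 2"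
      proof -
        have "r * r / (2 * r) = r / 2" if "0 < r" for r :: real using that by simp
        from this[OF s] show ?thesis by (simp only: add_divide_distrib power2_eq_square)
      qed
      finally have "\<bar>real k - m\<bar> * pois m k \<le> ((real k - m)\<^sup>2 / (2 * sqrt m) + sqrt m / 2) * pois m k"
        using pois_nonneg[OF assms] by (rule mult_right_mono)
      then show ?thesis by (simp add: distrib_right)
    qed
    have S: "(\<lambda>k. ((real k - m)\<^sup>2 * pois m k) / (2 * sqrt m) + (sqrt m / 2) * pois m k) sums (m / (2 * sqrt m) + sqrt m / 2 * 1)"
      by (intro sums_add sums_mult pois_sums sums_divide pois_var)
    have e: "m / (2 * sqrt m) + sqrt m / 2 * 1 = sqrt m"
    proof -
      have "m / (2 * sqrt m) = (m / sqrt m) / 2" by simp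
      also have "m / sqrt m = sqrt m" by (rule real_div_sqrt[OF assms])
      finally show ?thesis by linarith
    qed
    have sm: "summable (\<lambda>k. \<bar>real k - m\<bar> * pois m k)"
      by (rule summable_comparison_test'[OF sums_summable[OF S]]) (use le pois_nonneg[OF assms] in auto)
    moreover have "(\<Sum>k. \<bar>real k - m\<bar> * pois m k) \<le> (\<Sum>k. ((real k - m)\<^sup>2 * pois m k) / (2 * sqrt m) + (sqrt m / 2) * pois m k)"
      by (intro suminf_le le sm sums_summable[OF S])
    ultimately show ?thesis using sums_unique[OF S] e by simp
  qed
  then show "summable (\<lambda>k. \<bar>real k - m\<bar> * pois m k)" "(\<Sum>k. \<bar>real k - m\<bar> * pois m k) \<le> sqrt m" by auto
qed

text \<open>\<open>PPP_plus\<close> prescribes the probabilities of the finite values of a count.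
  They sum to 1, so the count is almost surely a natural number, and expectations become
  series.\<close>

lemma (in prob_space) poisson_variable:
  assumes [measurable]: "N \<in> borel_measurable M" and m: "0 \<le> m"
    and N: "\<And>k::nat. measure M {\<omega> \<in> space M. N \<omega> = of_nat k} = pois m k"
  shows "AE \<omega> in M. \<exists>k. N \<omega> = of_nat k"
    "f \<in> borel_measurable borel \<Longrightarrow> (\<integral>\<^sup>+\<omega>. f (N \<omega> :: ennreal) \<partial>M) = (\<Sum>k. f (of_nat k) * ennreal (pois m k))"
proof -
  let ?E = "\<lambda>k::nat. {\<omega> \<in> space M. N \<omega> = of_nat k}"
  have E[measurable]: "?E k \<in> sets M" for k by measurable
  have disj: "disjoint_family ?E" unfolding disjoint_family_on_def by auto
  have "(\<lambda>k. prob (?E k)) sums prob (\<Union>k. ?E k)" by (rule finite_measure_UNION) (use disj in auto)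
  then have "prob (\<Union>k. ?E k) = 1" unfolding N using pois_sums sums_unique2 by blast
  then have ae: "AE \<omega> in M. \<omega> \<in> (\<Union>k. ?E k)" by (subst AE_in_set_eq_1) auto
  then show "AE \<omega> in M. \<exists>k. N \<omega> = of_nat k" by eventually_elim auto
  assume [measurable]: "f \<in> borel_measurable borel"
  have "(\<integral>\<^sup>+\<omega>. f (N \<omega>) \<partial>M) = (\<integral>\<^sup>+\<omega>. (\<Sum>k. f (of_nat k) * indicator (?E k) \<omega>) \<partial>M)"
  proof (rule nn_integral_cong_AE)
    show "AE \<omega> in M. f (N \<omega>) = (\<Sum>k. f (of_nat k) * indicator (?E k) \<omega>)"
      using ae
    proof eventually_elim
      case (elim \<omega>)
      then obtain k where k: "\<omega> \<in> ?E k" by blast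
      have "(\<Sum>l. f (of_nat l) * indicator (?E l) \<omega>) = (\<Sum>l\<in>{k}. f (of_nat l) * indicator (?E l) \<omega>)"
      proof (rule suminf_finite)
        fix l assume "l \<notin> {k}"
        then have "\<omega> \<notin> ?E l" using k by auto
        then have "indicator (?E l) \<omega> = (0::ennreal)" by (rule indicator_simps(2))
        then show "f (of_nat l) * indicator (?E l) \<omega> = 0" by (simp only: mult_zero_right)
      qed simp
      moreover have "N \<omega> = of_nat k" "\<omega> \<in> space M" using k by auto
      ultimately show ?case by simp
    qed
  qed
  also have "\<dots> = (\<Sum>k. f (of_nat k) * emeasure M (?E k))"
    by (subst nn_integral_suminf) (auto simp: nn_integral_cmult)
  also have "\<dots> = (\<Sum>k. f (of_nat k) * ennreal (pois m k))" unfolding emeasure_eq_measure N ..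
  finally show "(\<integral>\<^sup>+\<omega>. f (N \<omega>) \<partial>M) = (\<Sum>k. f (of_nat k) * ennreal (pois m k))" .
qed

section \<open>The Atlas model started from Poisson points\<close>

locale atlas_ppp = atlas_infinity M F W X
  for M :: "'a measure" and F :: "real \<Rightarrow> 'a measure" and W X :: "nat \<Rightarrow> real \<Rightarrow> 'a \<Rightarrow> real" +
  fixes lam :: real
  assumes lam_pos: "lam > 0" and ppp: "PPP_plus M lam (\<lambda>i. X i 0)"
begin

lemma X_meas: "0 \<le> t \<Longrightarrow> X i t \<in> borel_measurable M"
  using measurable_from_subalg[OF subalgebra_F X_adapted] .

lemma W_meas: "0 \<le> t \<Longrightarrow> W i t \<in> borel_measurable M"
  using W_brownian[of i] unfolding std_brownian_motion_def by blast

lemma W0: "AE \<omega> in M. \<forall>i. W i 0 \<omega> = 0"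
  unfolding AE_all_countable using W_brownian unfolding std_brownian_motion_def by blast

lemma W_cont: "AE \<omega> in M. \<forall>i. continuous_on {0..} (\<lambda>t. W i t \<omega>)"
  unfolding AE_all_countable using W_brownian unfolding std_brownian_motion_def by blast

lemma X0_nonneg: "AE \<omega> in M. \<forall>i. 0 \<le> X i 0 \<omega>"
proof -
  have "AE \<omega> in M. incseq (\<lambda>i. X i 0 \<omega>) \<and> (\<forall>i. 0 \<le> X i 0 \<omega>)"
    using ppp[unfolded PPP_plus_def, THEN conjunct2, THEN conjunct1] .
  then show ?thesis by eventually_elim simp
qed

lemma path: "AE \<omega> in M. particle_path 1 (\<lambda>i t. X i t \<omega>) (\<lambda>i t. W i t \<omega>) (\<lambda>i t. X i t \<omega> - X i 0 \<omega> - W i t \<omega>)"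
  using X_continuous X_ranked X_equation W0 X0_nonneg
proof eventually_elim
  case (elim \<omega>)
  show ?case
  proof (rule particle_path_unscaled)
    show "continuous_on {0..} (\<lambda>t. X i t \<omega>)" for i using elim(1) by (rule spec)
    show "\<exists>p. ranking (\<lambda>i. X i t \<omega>) p" if "0 \<le> t" for t using elim(2)[rule_format, OF that] .
    show "X i t \<omega> = X i 0 \<omega> + (LINT s:{0..t}|lborel. of_bool (leftmost (\<lambda>j. X j s \<omega>) i)) + W i t \<omega>"
      if "0 \<le> t" for i t using elim(3)[rule_format, OF that] .
    show "W i 0 \<omega> = 0" for i using elim(4) by (rule spec)
    show "0 \<le> X i 0 \<omega>" for i using elim(5) by (rule spec)
  qed
qed

lemma particle_path_scaled:
  assumes "particle_path 1 (\<lambda>i t. X i t \<omega>) (\<lambda>i t. W i t \<omega>) (\<lambda>i t. X i t \<omega> - X i 0 \<omega> - W i t \<omega>)" and b: "0 < b"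
  shows "particle_path b (\<lambda>i t. X_scaled X b i t \<omega>) (\<lambda>i t. X_scaled W b i t \<omega>)
    (\<lambda>i t. X_scaled X b i t \<omega> - X_scaled X b i 0 \<omega> - X_scaled W b i t \<omega>)"
  using particle_path_scale[OF assms] by (simp add: X_scaled_def right_diff_distrib)

lemma num_points_measurable[measurable]:
  assumes [measurable]: "A \<in> sets borel" shows "num_points (\<lambda>i. X i 0) A \<in> borel_measurable M"
proof -
  have [measurable]: "X i 0 \<in> borel_measurable M" for i by (rule X_meas) simp
  show ?thesis unfolding num_points_def[abs_def] by measurable
qed

lemma num_points_poisson:
  assumes "A \<in> sets borel" "A \<subseteq> {0..}" "emeasure lborel A < \<infinity>"
  shows "measure M {\<omega> \<in> space M. num_points (\<lambda>i. X i 0) A \<omega> = of_nat k} = pois (lam * measure lborel A) k"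
  using ppp[unfolded PPP_plus_def, THEN conjunct2, THEN conjunct2, THEN conjunct1, rule_format, OF assms]
  by (simp only: pois_def)

text \<open>Infinitely many points in \<open>[0, n]\<close> would make the count infinite, whereas
  it is almost surely a natural number, for all \<open>n\<close> simultaneously.\<close>

lemma AE_finite_below: "AE \<omega> in M. \<forall>y. finite {i. X i 0 \<omega> \<le> y}"
proof -
  have "AE \<omega> in M. \<forall>n::nat. \<exists>k. num_points (\<lambda>i. X i 0) {0..real n} \<omega> = of_nat k"
    unfolding AE_all_countable
  proof
    fix n :: nat
    show "AE \<omega> in M. \<exists>k. num_points (\<lambda>i. X i 0) {0..real n} \<omega> = of_nat k"
      by (rule poisson_variable(1)[OF num_points_measurable _ num_points_poisson]) (use lam_pos in auto)
  qed
  then show ?thesis using X0_nonneg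
  proof eventually_elim
    case (elim \<omega>)
    have fin: "finite {i. X i 0 \<omega> \<in> {0..real n}}" for n
    proof (rule ccontr)
      assume inf: "infinite {i. X i 0 \<omega> \<in> {0..real n}}"
      have "num_points (\<lambda>i. X i 0) {0..real n} \<omega> = (\<integral>\<^sup>+i. indicator {0..real n} (X i 0 \<omega>) \<partial>count_space UNIV)"
        unfolding num_points_def by (rule nn_integral_count_space_nat[symmetric])
      also have "\<dots> = (\<integral>\<^sup>+i. indicator {i. X i 0 \<omega> \<in> {0..real n}} i \<partial>count_space UNIV)"
        by (intro nn_integral_cong) (auto simp: indicator_def)
      also have "\<dots> = \<infinity>" using inf by (subst nn_integral_indicator) auto
      finally show False using elim(1) by (metis ennreal_of_nat_neq_top infinity_ennreal_def)
    qed
    show ?case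
    proof
      fix y
      obtain n :: nat where "y \<le> real n" using real_arch_simple by blast
      then have "{i. X i 0 \<omega> \<le> y} \<subseteq> {i. X i 0 \<omega> \<in> {0..real n}}" using elim(2) by auto
      then show "finite {i. X i 0 \<omega> \<le> y}" using fin finite_subset by blast
    qed
  qed
qed

text \<open>Brownian scaling, with the filtration run at speed \<open>1 / b^2\<close>. The count in
  \<open>[0, y / b]\<close> is Poisson with mean \<open>lam * y / b\<close>, so \<open>b\<close>
  times it has standard deviation \<open>sqrt (b * lam * y)\<close>.\<close>

lemma scaled_atlas:
  assumes b: "0 < b"
  shows "scaled_atlas M b lam (X_scaled X b) (X_scaled W b) (\<lambda>t. F (t / b\<^sup>2))"
proof
  have d: "0 \<le> t / b\<^sup>2" if "0 \<le> t" for t using that b by simp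
  have dl: "s / b\<^sup>2 < t / b\<^sup>2" if "s < t" for s t using that b by (simp add: divide_strict_right_mono)
  show "0 < b" "0 < lam" using b lam_pos by auto
  show "subalgebra M (F (t / b\<^sup>2))" for t by (rule subalgebra_F)
  show "X_scaled X b i t \<in> borel_measurable (F (t / b\<^sup>2))" if "0 \<le> t" for i t
    unfolding X_scaled_def[abs_def] using X_adapted[OF d[OF that], of i] by measurable
  show "X_scaled X b i 0 \<in> borel_measurable (F (t / b\<^sup>2))" if "0 \<le> t" for i t
  proof -
    have "X i 0 \<in> borel_measurable (F (t / b\<^sup>2))"
      using X_adapted[of 0 i] sets_F_mono[OF d[OF that]] space_F unfolding measurable_def by auto
    then show ?thesis unfolding X_scaled_def[abs_def] by simp
  qed
  show "X_scaled W b i t \<in> borel_measurable M" if "0 \<le> t" for i t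
    unfolding X_scaled_def[abs_def] using W_meas[OF d[OF that], of i] by measurable
  show "distributed M lborel (\<lambda>\<omega>. X_scaled W b i t \<omega> - X_scaled W b i s \<omega>) (\<lambda>x. ennreal (normal_density 0 (sqrt (t - s)) x))"
    if st: "0 \<le> s" "s < t" for i s t
  proof -
    have "distributed M lborel (\<lambda>\<omega>. W i (t / b\<^sup>2) \<omega> - W i (s / b\<^sup>2) \<omega>) (\<lambda>x. ennreal (normal_density 0 (sqrt (t / b\<^sup>2 - s / b\<^sup>2)) x))"
      using W_brownian[of i] d[OF st(1)] dl[OF st(2)] unfolding std_brownian_motion_def by blast
    from normal_density_affine[OF this, of b 0] b dl[OF st(2)]
    have "distributed M lborel (\<lambda>\<omega>. b * (W i (t / b\<^sup>2) \<omega> - W i (s / b\<^sup>2) \<omega>)) (\<lambda>x. ennreal (normal_density 0 (b * sqrt (t / b\<^sup>2 - s / b\<^sup>2)) x))"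
      by simp
    moreover have "b * sqrt (t / b\<^sup>2 - s / b\<^sup>2) = sqrt (t - s)"
      using b by (simp add: diff_divide_distrib[symmetric] real_sqrt_divide)
    ultimately show ?thesis by (simp add: X_scaled_def right_diff_distrib)
  qed
  show "indep_set (sets (F (s / b\<^sup>2))) (sets (vimage_algebra (space M) (\<lambda>\<omega> i. X_scaled W b i t \<omega> - X_scaled W b i s \<omega>) (PiM UNIV (\<lambda>_. borel))))"
    if st: "0 \<le> s" "s < t" for s t
  proof -
    let ?V = "vimage_algebra (space M) (\<lambda>\<omega> i. W i (t / b\<^sup>2) \<omega> - W i (s / b\<^sup>2) \<omega>) (PiM UNIV (\<lambda>_. borel))"
    have i: "(\<lambda>\<omega>. W i (t / b\<^sup>2) \<omega> - W i (s / b\<^sup>2) \<omega>) \<in> borel_measurable ?V" for i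
    proof -
      have "(\<lambda>\<omega> i. W i (t / b\<^sup>2) \<omega> - W i (s / b\<^sup>2) \<omega>) \<in> measurable ?V (PiM UNIV (\<lambda>_. borel))"
        by (rule measurable_vimage_algebra1) (auto simp: space_PiM)
      from measurable_compose[OF this measurable_component_singleton[of i UNIV]] show ?thesis by simp
    qed
    have "(\<lambda>\<omega> i. X_scaled W b i t \<omega> - X_scaled W b i s \<omega>) \<in> measurable ?V (PiM UNIV (\<lambda>_. borel))"
    proof (rule measurable_PiM_single')
      show "(\<lambda>\<omega>. X_scaled W b i t \<omega> - X_scaled W b i s \<omega>) \<in> borel_measurable ?V" for i
      proof -
        have "(\<lambda>\<omega>. b * (W i (t / b\<^sup>2) \<omega> - W i (s / b\<^sup>2) \<omega>)) \<in> borel_measurable ?V" using i[of i] by measurable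
        then show ?thesis by (simp add: X_scaled_def right_diff_distrib)
      qed
    qed auto
    from measurable_sets[OF this]
    have sub: "sets (vimage_algebra (space M) (\<lambda>\<omega> i. X_scaled W b i t \<omega> - X_scaled W b i s \<omega>) (PiM UNIV (\<lambda>_. borel))) \<subseteq> sets ?V"
      unfolding sets_vimage_algebra[of "space M" "\<lambda>\<omega> i. X_scaled W b i t \<omega> - X_scaled W b i s \<omega>"]
      using sets.sigma_sets_subset[of "{(\<lambda>\<omega> i. X_scaled W b i t \<omega> - X_scaled W b i s \<omega>) -` A \<inter> space M |A. A \<in> sets (PiM UNIV (\<lambda>_. borel))}" ?V]
      by auto
    show ?thesis
      using W_increments[OF d[OF st(1)] dl[OF st(2)]] sub unfolding indep_set_def
      by (elim indep_sets_mono_sets) (auto split: bool.split)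
  qed
  show "indep_var borel (\<lambda>\<omega>. X_scaled W b i t \<omega> - X_scaled W b i s \<omega>) borel (\<lambda>\<omega>. X_scaled W b j t \<omega> - X_scaled W b j s \<omega>)"
    if "i \<noteq> j" and st: "0 \<le> s" "s < t" for i j s t
  proof -
    \<comment> \<open>Independence is available for whole paths; the increment is a measurable
      functional of a path.\<close>
    let ?Y = "\<lambda>f. b * f (t / b\<^sup>2) - b * f (s / b\<^sup>2)"
    have t0: "0 \<le> t / b\<^sup>2" "0 \<le> s / b\<^sup>2" using st d[of s] d[of t] by auto
    have Ym: "?Y \<in> borel_measurable (PiM {0..} (\<lambda>_. borel))"
      using t0 by (intro borel_measurable_diff borel_measurable_times borel_measurable_const measurable_component_singleton) auto
    have "indep_vars (\<lambda>_. borel) (\<lambda>i \<omega>. ?Y (\<lambda>t\<in>{0..}. W i t \<omega>)) UNIV"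
      by (rule indep_vars_compose2[OF W_indep Ym])
    then have ind: "indep_vars (\<lambda>_. borel) (\<lambda>i \<omega>. X_scaled W b i t \<omega> - X_scaled W b i s \<omega>) UNIV"
      using t0 by (simp add: X_scaled_def)
    have "indep_var (PiM {i} (\<lambda>_. borel)) (\<lambda>\<omega>. restrict (\<lambda>i. X_scaled W b i t \<omega> - X_scaled W b i s \<omega>) {i})
       (PiM {j} (\<lambda>_. borel)) (\<lambda>\<omega>. restrict (\<lambda>i. X_scaled W b i t \<omega> - X_scaled W b i s \<omega>) {j})"
      using that by (intro indep_var_restrict[OF ind]) auto
    from indep_var_compose[OF this, of "\<lambda>f. f i" borel "\<lambda>f. f j" borel]
    show ?thesis by (simp add: comp_def)
  qed
  have path_b: "AE \<omega> in M. particle_path b (\<lambda>i t. X_scaled X b i t \<omega>) (\<lambda>i t. X_scaled W b i t \<omega>)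
    (\<lambda>i t. X_scaled X b i t \<omega> - X_scaled X b i 0 \<omega> - X_scaled W b i t \<omega>)"
    using path by eventually_elim (rule particle_path_scaled[OF _ b])
  show "AE \<omega> in M. \<forall>i. \<forall>t\<ge>0. X_scaled X b i 0 \<omega> + X_scaled W b i t \<omega> \<le> X_scaled X b i t \<omega>"
    using path_b
  proof (eventually_elim, intro allI impI)
    fix \<omega> i t assume p: "particle_path b (\<lambda>i t. X_scaled X b i t \<omega>) (\<lambda>i t. X_scaled W b i t \<omega>)
      (\<lambda>i t. X_scaled X b i t \<omega> - X_scaled X b i 0 \<omega> - X_scaled W b i t \<omega>)" and t: "0 \<le> (t::real)"
    show "X_scaled X b i 0 \<omega> + X_scaled W b i t \<omega> \<le> X_scaled X b i t \<omega>"
      using particle_path.A_mono[OF p, of 0 t i] particle_path.A_0[OF p, of i] t by simp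
  qed
  show "AE \<omega> in M. \<forall>i. X_scaled W b i 0 \<omega> = 0" using W0 by eventually_elim (simp add: X_scaled_def)
  show "AE \<omega> in M. \<forall>i. continuous_on {0..} (\<lambda>t. X_scaled W b i t \<omega>)"
    using W_cont
  proof (eventually_elim, intro allI)
    fix \<omega> i assume c: "\<forall>i. continuous_on {0..} (\<lambda>t. W i t \<omega>)"
    have "continuous_on {0..} (\<lambda>t. W i (t / b\<^sup>2) \<omega>)"
      by (rule continuous_on_compose2[OF c[rule_format]]) (use b in \<open>auto intro!: continuous_intros\<close>)
    then show "continuous_on {0..} (\<lambda>t. X_scaled W b i t \<omega>)" unfolding X_scaled_def by (intro continuous_intros)
  qed
  show "AE \<omega> in M. \<forall>i. 0 \<le> X_scaled X b i 0 \<omega>" using X0_nonneg by eventually_elim (use b in \<open>simp add: X_scaled_def\<close>)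
  show "(\<Sum>i. emeasure M {\<omega> \<in> space M. X_scaled X b i 0 \<omega> \<in> {u..<v}}) \<le> ennreal (lam * (v - u) / b)"
    if uv: "0 \<le> u" "u \<le> v" for u v
  proof -
    let ?A = "{u / b..<v / b}"
    have ub: "u / b \<le> v / b" using uv b by (simp add: divide_right_mono)
    have mA: "measure lborel ?A = (v - u) / b" using ub by (simp add: diff_divide_distrib)
    have X0[measurable]: "X i 0 \<in> borel_measurable M" for i by (rule X_meas) simp
    have "{\<omega> \<in> space M. X_scaled X b i 0 \<omega> \<in> {u..<v}} = {\<omega> \<in> space M. X i 0 \<omega> \<in> ?A}" for i
      using b by (auto simp: X_scaled_def pos_divide_le_eq pos_less_divide_eq mult.commute)
    then have "(\<Sum>i. emeasure M {\<omega> \<in> space M. X_scaled X b i 0 \<omega> \<in> {u..<v}}) = (\<Sum>i. \<integral>\<^sup>+\<omega>. indicator ?A (X i 0 \<omega>) \<partial>M)"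
    proof -
      have "emeasure M {\<omega> \<in> space M. X i 0 \<omega> \<in> ?A} = (\<integral>\<^sup>+\<omega>. indicator ?A (X i 0 \<omega>) \<partial>M)" for i
      proof -
        have "emeasure M {\<omega> \<in> space M. X i 0 \<omega> \<in> ?A} = (\<integral>\<^sup>+\<omega>. indicator {\<omega> \<in> space M. X i 0 \<omega> \<in> ?A} \<omega> \<partial>M)"
          by (rule nn_integral_indicator[symmetric]) measurable
        also have "\<dots> = (\<integral>\<^sup>+\<omega>. indicator ?A (X i 0 \<omega>) \<partial>M)"
          by (intro nn_integral_cong) (auto simp: indicator_def)
        finally show ?thesis .
      qed
      then show ?thesis using \<open>\<And>i. {\<omega> \<in> space M. X_scaled X b i 0 \<omega> \<in> {u..<v}} = {\<omega> \<in> space M. X i 0 \<omega> \<in> ?A}\<close> by simp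
    qed
    also have "\<dots> = (\<integral>\<^sup>+\<omega>. num_points (\<lambda>i. X i 0) ?A \<omega> \<partial>M)"
      unfolding num_points_def by (rule nn_integral_suminf[symmetric]) measurable
    also have "\<dots> = (\<Sum>k. of_nat k * ennreal (pois (lam * ((v - u) / b)) k))"
    proof (rule poisson_variable(2)[where f="\<lambda>x. x"])
      show "measure M {\<omega> \<in> space M. num_points (\<lambda>i. X i 0) ?A \<omega> = of_nat k} = pois (lam * ((v - u) / b)) k" for k
        unfolding mA[symmetric]
      proof (rule num_points_poisson)
        have "0 \<le> u / b" using uv b by simp
        then show "?A \<subseteq> {0..}" by auto
      qed (use ub in auto)
    qed (use lam_pos uv b in auto)
    also have "\<dots> = (\<Sum>k. ennreal (real k * pois (lam * ((v - u) / b)) k))"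
      using lam_pos uv b by (intro suminf_cong) (simp add: ennreal_mult pois_nonneg ennreal_of_nat_eq_real_of_nat)
    also have "\<dots> = ennreal (lam * ((v - u) / b))"
      using lam_pos uv b pois_mean[of "lam * ((v - u) / b)"]
      by (subst suminf_ennreal2) (auto simp: pois_nonneg sums_iff)
    finally show ?thesis by simp
  qed
  show "(\<integral>\<^sup>+\<omega>. ennreal \<bar>b * enn2real (\<Sum>i. indicator {..y} (X_scaled X b i 0 \<omega>)) - lam * y\<bar> \<partial>M) \<le> ennreal (sqrt (b * lam * y))"
    if y: "0 \<le> y" for y
  proof -
    let ?A = "{0..y / b}" and ?m = "lam * (y / b)"
    have yb: "0 \<le> y / b" using y b by simp
    have m: "0 \<le> ?m" using lam_pos yb by (intro mult_nonneg_nonneg) auto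
    have mA: "measure lborel ?A = y / b" using yb by simp
    have "(\<integral>\<^sup>+\<omega>. ennreal \<bar>b * enn2real (\<Sum>i. indicator {..y} (X_scaled X b i 0 \<omega>)) - lam * y\<bar> \<partial>M)
        = (\<integral>\<^sup>+\<omega>. ennreal \<bar>b * enn2real (num_points (\<lambda>i. X i 0) ?A \<omega>) - lam * y\<bar> \<partial>M)"
    proof (rule nn_integral_cong_AE)
      show "AE \<omega> in M. ennreal \<bar>b * enn2real (\<Sum>i. indicator {..y} (X_scaled X b i 0 \<omega>)) - lam * y\<bar>
        = ennreal \<bar>b * enn2real (num_points (\<lambda>i. X i 0) ?A \<omega>) - lam * y\<bar>"
        using X0_nonneg
      proof eventually_elim
        case (elim \<omega>)
        have "indicator {..y} (X_scaled X b i 0 \<omega>) = (indicator ?A (X i 0 \<omega>) :: ennreal)" for i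
          using elim b by (auto simp: indicator_def X_scaled_def pos_le_divide_eq mult.commute)
        then show ?case by (simp add: num_points_def)
      qed
    qed
    also have "\<dots> = (\<Sum>k. ennreal \<bar>b * enn2real (of_nat k) - lam * y\<bar> * ennreal (pois ?m k))"
    proof (rule poisson_variable(2)[where f="\<lambda>x. ennreal \<bar>b * enn2real x - lam * y\<bar>"])
      show "measure M {\<omega> \<in> space M. num_points (\<lambda>i. X i 0) ?A \<omega> = of_nat k} = pois ?m k" for k
      proof -
        have "measure M {\<omega> \<in> space M. num_points (\<lambda>i. X i 0) ?A \<omega> = of_nat k} = pois (lam * measure lborel ?A) k"
          by (intro num_points_poisson) (use yb in auto)
        then show ?thesis by (simp only: mA)
      qed
    qed (use m in auto)
    also have "\<dots> = (\<Sum>k. ennreal (b * (\<bar>real k - ?m\<bar> * pois ?m k)))"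
    proof (intro suminf_cong)
      fix k
      have "b * real k - lam * y = b * (real k - ?m)" using b by (simp add: right_diff_distrib)
      then have "\<bar>b * real k - lam * y\<bar> = b * \<bar>real k - ?m\<bar>" using b by (simp add: abs_mult)
      then show "ennreal \<bar>b * enn2real (of_nat k) - lam * y\<bar> * ennreal (pois ?m k) = ennreal (b * (\<bar>real k - ?m\<bar> * pois ?m k))"
        using m b by (simp add: ennreal_mult[symmetric] pois_nonneg mult.assoc)
    qed
    also have "\<dots> = ennreal (\<Sum>k. b * (\<bar>real k - ?m\<bar> * pois ?m k))"
      using pois_abs(1)[OF m] m b by (intro suminf_ennreal2 summable_mult) (auto simp: pois_nonneg)
    also have "\<dots> \<le> ennreal (b * sqrt ?m)"
      using pois_abs[OF m] b by (intro ennreal_leI) (simp add: suminf_mult)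
    also have "b * sqrt ?m = sqrt (b * lam * y)"
    proof -
      have "sqrt (b\<^sup>2 * ?m) = sqrt (b\<^sup>2) * sqrt ?m" by (rule real_sqrt_mult)
      also have "sqrt (b\<^sup>2) = b" using b by simp
      finally have "b * sqrt ?m = sqrt (b\<^sup>2 * ?m)" by (rule sym)
      moreover have "b\<^sup>2 * ?m = b * lam * y" using b by (simp add: power2_eq_square)
      ultimately show ?thesis by simp
    qed
    finally show ?thesis .
  qed
  show "AE \<omega> in M. \<forall>y. finite {i. X_scaled X b i 0 \<omega> \<le> y}"
    using AE_finite_below
  proof (eventually_elim, intro allI)
    fix \<omega> y assume f: "\<forall>y. finite {i. X i 0 \<omega> \<le> y}"
    have "{i. X_scaled X b i 0 \<omega> \<le> y} = {i. X i 0 \<omega> \<le> y / b}"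
      using b by (auto simp: X_scaled_def pos_le_divide_eq mult.commute)
    then show "finite {i. X_scaled X b i 0 \<omega> \<le> y}" using f by simp
  qed
qed

text \<open>Shows that only finitely many particles visit a left half-line in bounded time, outside
  one null set that serves all \<open>b\<close>. The oscillation estimate is applied at scale 1 with
  \<open>p = 3\<close>, and smallness comes from \<open>R\<close> tending to infinity.\<close>

lemma AE_locally_finite: "AE \<omega> in M. \<forall>(n::nat) r. finite {i. \<exists>t\<in>{0..real n}. X i t \<omega> \<le> r}"
proof -
  interpret s: scaled_atlas M 1 lam X W F
    using scaled_atlas[of 1] by (simp add: X_scaled_def[abs_def])
  have "AE \<omega> in M. \<forall>n::nat. \<exists>R::nat. \<omega> \<notin> s.osc_bad 0 (real n + 1) (1 / 2) (1 + real R)"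
    unfolding AE_all_countable
  proof
    fix n :: nat
    let ?O = "\<lambda>R::nat. s.osc_bad 0 (real n + 1) (1 / 2) (1 + real R)"
    let ?K = "2 * moment 3 * s.zeta2 * lam / 1 * (100 * (real n + 1) / (1 / 2)\<^sup>2) ^ 3"
    have le: "emeasure M (\<Inter>R. ?O R) \<le> ennreal (?K / (1 + real R) ^ (2 * 3 - 2))" for R
      by (rule order_trans[OF emeasure_mono s.emeasure_osc_bad]) (auto intro: s.osc_bad_sets)
    have "(\<lambda>R. ?K / (1 + real R) ^ (2 * 3 - 2)) \<longlonglongrightarrow> 0"
      by real_asymp
    then have "(\<lambda>R. ennreal (?K / (1 + real R) ^ (2 * 3 - 2))) \<longlonglongrightarrow> ennreal 0" by (intro tendsto_ennrealI)
    then have "emeasure M (\<Inter>R. ?O R) \<le> ennreal 0" by (rule LIMSEQ_le_const) (use le in blast)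
    then have "emeasure M (\<Inter>R. ?O R) = 0" by simp
    moreover have "(\<Inter>R. ?O R) \<in> sets M" by (intro sets.countable_INT) (auto intro: s.osc_bad_sets)
    ultimately have "(\<Inter>R. ?O R) \<in> null_sets M" by auto
    then have "AE \<omega> in M. \<omega> \<notin> (\<Inter>R. ?O R)" by (rule AE_not_in)
    then show "AE \<omega> in M. \<exists>R. \<omega> \<notin> ?O R" by eventually_elim auto
  qed
  then show ?thesis using AE_finite_below s.lower W_cont W0 X0_nonneg AE_space
  proof (eventually_elim, intro allI)
    fix \<omega> and n :: nat and r :: real
    assume 1: "\<forall>n::nat. \<exists>R::nat. \<omega> \<notin> s.osc_bad 0 (real n + 1) (1 / 2) (1 + real R)"
      and 2: "\<forall>y. finite {i. X i 0 \<omega> \<le> y}" and 3: "\<forall>i. \<forall>t\<ge>0. X i 0 \<omega> + W i t \<omega> \<le> X i t \<omega>"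
      and 4: "\<forall>i. continuous_on {0..} (\<lambda>t. W i t \<omega>)" and 5: "\<forall>i. W i 0 \<omega> = 0" and 6: "\<forall>i. 0 \<le> X i 0 \<omega>"
      and 7: "\<omega> \<in> space M"
    obtain R :: nat where R: "\<omega> \<notin> s.osc_bad 0 (real n + 1) (1 / 2) (1 + real R)" using 1 by blast
    \<comment> \<open>A particle that reaches \<open>r\<close> satisfies
      \<open>X i 0 - (1 + R + X i 0) / 2 \<le> r\<close>, which bounds its starting point.\<close>
    have "{i. \<exists>t\<in>{0..real n}. X i t \<omega> \<le> r} \<subseteq> {i. X i 0 \<omega> \<le> 2 * r + (1 + real R)}"
    proof safe
      fix i t assume t: "t \<in> {0..real n}" and x: "X i t \<omega> \<le> r"
      have "\<bar>W i t \<omega> - W i 0 \<omega>\<bar> \<le> 1 / 2 * ((1 + real R) + X i 0 \<omega>)"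
        by (rule s.osc_good[OF 7 R]) (use 4 6 t in auto)
      then have "- (1 / 2 * ((1 + real R) + X i 0 \<omega>)) \<le> W i t \<omega>"
        using 5[rule_format, of i] abs_ge_minus_self[of "W i t \<omega> - W i 0 \<omega>"] by linarith
      moreover have "X i 0 \<omega> + W i t \<omega> \<le> X i t \<omega>" using 3 t by simp
      moreover have "p \<le> 2 * r + c" if "- (1 / 2 * (c + p)) \<le> w" "p + w \<le> y" "y \<le> r" for p w y c :: real
        using that by (simp add: field_simps)
      ultimately show "X i 0 \<omega> \<le> 2 * r + (1 + real R)" using x by blast
    qed
    then show "finite {i. \<exists>t\<in>{0..real n}. X i t \<omega> \<le> r}" using 2 finite_subset by blast
  qed
qed

text \<open>Everything is expressed in \<open>q = root 180 b\<close>, which tends to 0 with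
  \<open>b\<close>. The exceptional set is \<open>bad\<close> together with the null set on which
  the paths are irregular.\<close>

lemma high_probability:
  assumes st: "stefan lam k" and T: "0 < T" and eps: "0 < eps" "eps \<le> 1" and R: "0 \<le> R" and e: "0 < e"
  shows "eventually (\<lambda>b. 0 < b \<and> (\<exists>B\<in>sets M. emeasure M B \<le> ennreal e \<and> (\<forall>\<omega>\<in>space M - B.
      (\<forall>i t. 0 \<le> t \<longrightarrow> t \<le> T \<longrightarrow> y_star k t - eps \<le> X_scaled X b i t \<omega>) \<and>
      (\<forall>t. 0 \<le> t \<longrightarrow> t \<le> T \<longrightarrow> (\<exists>i. X_scaled X b i t \<omega> \<le> y_star k t + eps)) \<and>
      (\<forall>t x. 0 \<le> t \<longrightarrow> t \<le> T \<longrightarrow> \<bar>x\<bar> \<le> R \<longrightarrow>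
        \<bar>(\<Sum>i. b * max 0 (x - X_scaled X b i t \<omega>)) - stefan.Gs lam k t x\<bar> \<le> eps)))) (at_right 0)"
proof -
  interpret st: stefan lam k by (rule st)
  have q_lim: "filterlim (\<lambda>b. root 180 b) (at_right 0) (at_right (0::real))"
    unfolding filterlim_at
  proof
    show "\<forall>\<^sub>F x in at_right 0. root 180 x \<in> {0<..} \<and> root 180 x \<noteq> (0::real)"
      by (rule eventually_mono[OF st.eventually_pos_less_at_right_0[of 1]]) auto
    have "((\<lambda>b. root 180 b) \<longlongrightarrow> root 180 0) (at_right (0::real))"
      by (intro tendsto_real_root tendsto_ident_at)
    then show "((\<lambda>b. root 180 b) \<longlongrightarrow> 0) (at_right (0::real))" by simp
  qed
  let ?C = "scaled_q.Cbad lam T"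
  have evC: "eventually (\<lambda>q. ?C * q < e) (at_right 0)"
    by (rule st.eventually_less_at_right_0) (auto intro!: tendsto_eq_intros e)
  have evq: "eventually (\<lambda>q. st.params T eps R q \<and> ?C * q < e) (at_right 0)"
    by (intro eventually_conj evC st.eventually_params T eps R)
  from eventually_compose_filterlim[OF evq q_lim] st.eventually_pos_less_at_right_0[of 1, OF zero_less_one]
  show ?thesis
  proof eventually_elim
    case (elim b)
    define q where "q = root 180 b"
    have b: "0 < b" using elim by simp
    have P: "st.params T eps R q" "?C * q < e" using elim by (auto simp: q_def)
    have q: "0 < q" "q \<le> 1" using P(1) unfolding st.params_def by auto
    have bq: "b = q ^ 180" unfolding q_def using b by simp
    interpret sa: scaled_atlas M b lam "X_scaled X b" "X_scaled W b" "\<lambda>t. F (t / b\<^sup>2)" by (rule scaled_atlas[OF b])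
    interpret sq: scaled_q M b lam "X_scaled X b" "X_scaled W b" "\<lambda>t. F (t / b\<^sup>2)" q T
      by unfold_locales (use q bq T in auto)
    have "AE \<omega> in M. particle_path 1 (\<lambda>i t. X i t \<omega>) (\<lambda>i t. W i t \<omega>) (\<lambda>i t. X i t \<omega> - X i 0 \<omega> - W i t \<omega>)
      \<and> (\<forall>i. continuous_on {0..} (\<lambda>t. X_scaled W b i t \<omega>)) \<and> (\<forall>y. finite {i. X_scaled X b i 0 \<omega> \<le> y})"
      using path sa.W_cont sa.finite_below by eventually_elim auto
    then obtain N where N: "{\<omega> \<in> space M. \<not> (particle_path 1 (\<lambda>i t. X i t \<omega>) (\<lambda>i t. W i t \<omega>) (\<lambda>i t. X i t \<omega> - X i 0 \<omega> - W i t \<omega>)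
      \<and> (\<forall>i. continuous_on {0..} (\<lambda>t. X_scaled W b i t \<omega>)) \<and> (\<forall>y. finite {i. X_scaled X b i 0 \<omega> \<le> y}))} \<subseteq> N"
      "emeasure M N = 0" "N \<in> sets M" by (rule AE_E)
    have "emeasure M (sq.bad \<union> N) \<le> emeasure M sq.bad + emeasure M N"
      using sq.bad_sets N by (intro emeasure_subadditive) auto
    also have "\<dots> \<le> ennreal (?C * q)" using sq.emeasure_bad N by simp
    also have "\<dots> \<le> ennreal e" using P(2) by (intro ennreal_leI) simp
    finally have 1: "emeasure M (sq.bad \<union> N) \<le> ennreal e" .
    show ?case
    proof (intro conjI b bexI[of _ "sq.bad \<union> N"] 1 ballI)
      show "sq.bad \<union> N \<in> sets M" using sq.bad_sets N by auto
      fix \<omega> assume \<omega>: "\<omega> \<in> space M - (sq.bad \<union> N)"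
      then have pp: "particle_path 1 (\<lambda>i t. X i t \<omega>) (\<lambda>i t. W i t \<omega>) (\<lambda>i t. X i t \<omega> - X i 0 \<omega> - W i t \<omega>)"
        and c: "\<And>i. continuous_on {0..} (\<lambda>t. X_scaled W b i t \<omega>)" and f: "\<And>y. finite {i. X_scaled X b i 0 \<omega> \<le> y}"
        using N(1) by auto
      interpret g: good_path_eps b "\<lambda>i t. X_scaled X b i t \<omega>" "\<lambda>i t. X_scaled W b i t \<omega>"
        "\<lambda>i t. X_scaled X b i t \<omega> - X_scaled X b i 0 \<omega> - X_scaled W b i t \<omega>" T "1 / q" "1 / q" lam k
        "q ^ 23" "q ^ 8" "q ^ 6" "q ^ 40" "q ^ 42" "stefan.o1q q" "stefan.o2q q" eps R "stefan.C4 k T R"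
        by (rule sq.good_event[OF st P(1) eps R _ _ particle_path_scaled[OF pp b] c f]) (use \<omega> in auto)
      show "\<forall>i t. 0 \<le> t \<longrightarrow> t \<le> T \<longrightarrow> y_star k t - eps \<le> X_scaled X b i t \<omega>" using g.leader_lower by blast
      show "\<forall>t. 0 \<le> t \<longrightarrow> t \<le> T \<longrightarrow> (\<exists>i. X_scaled X b i t \<omega> \<le> y_star k t + eps)" using g.leader_upper by blast
      show "\<forall>t x. 0 \<le> t \<longrightarrow> t \<le> T \<longrightarrow> \<bar>x\<bar> \<le> R \<longrightarrow>
        \<bar>(\<Sum>i. b * max 0 (x - X_scaled X b i t \<omega>)) - stefan.Gs lam k t x\<bar> \<le> eps"
        using g.G_close unfolding g.G_def by blast
    qed
  qed
qed

end

section \<open>The topology of the measure-valued paths\<close>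

lemma test_funI:
  assumes "K + L \<le> 1" "\<And>x. \<bar>f x\<bar> \<le> K" "L-lipschitz_on UNIV f" "\<And>x. r < x \<Longrightarrow> f x = 0"
  shows "f \<in> test_fun r"
proof -
  have "{x. f x \<noteq> 0} \<subseteq> {..r}" using assms(4) by (auto simp: not_less[symmetric])
  then have "closure {x. f x \<noteq> 0} \<subseteq> {..r}" by (rule closure_minimal) simp
  then show ?thesis unfolding test_fun_def using assms(1-3) by blast
qed

lemma test_fun_props:
  assumes "f \<in> test_fun r"
  shows test_fun_lipschitz: "\<bar>f x - f y\<bar> \<le> \<bar>x - y\<bar>"
    and test_fun_bound: "\<bar>f x\<bar> \<le> 1"
    and test_fun_vanish: "r < x \<Longrightarrow> f x = 0"
    and test_fun_measurable: "f \<in> borel_measurable borel"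
proof -
  obtain K L where KL: "K + L \<le> 1" "\<And>x. \<bar>f x\<bar> \<le> K" "L-lipschitz_on UNIV f" "closure {x. f x \<noteq> 0} \<subseteq> {..r}"
    using assms unfolding test_fun_def by blast
  have "0 \<le> K" using KL(2)[of 0] by linarith
  have "0 \<le> L" using KL(3) by (rule lipschitz_on_nonneg)
  have "\<bar>f x - f y\<bar> \<le> L * \<bar>x - y\<bar>" using lipschitz_onD[OF KL(3), of x y] by (simp add: dist_real_def)
  also have "\<dots> \<le> 1 * \<bar>x - y\<bar>" using KL(1) \<open>0 \<le> K\<close> by (intro mult_right_mono) auto
  finally show "\<bar>f x - f y\<bar> \<le> \<bar>x - y\<bar>" by simp
  show "\<bar>f x\<bar> \<le> 1" using KL(1) KL(2)[of x] \<open>0 \<le> L\<close> by linarith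
  show "f x = 0" if "r < x" using KL(4) closure_subset[of "{x. f x \<noteq> 0}"] that by fastforce
  show "f \<in> borel_measurable borel"
    using lipschitz_on_continuous_on[OF KL(3)] by (rule borel_measurable_continuous_onI)
qed

lemma test_fun_mono: "r \<le> s \<Longrightarrow> test_fun r \<subseteq> test_fun s"
  unfolding test_fun_def by (fastforce simp: subset_iff)

lemma zero_test_fun: "(\<lambda>x. 0) \<in> test_fun r"
  by (rule test_funI[where K = 0 and L = 0]) (auto simp: lipschitz_on_def)

lemma M_star_sets[measurable_cong]: "\<mu> \<in> M_star \<Longrightarrow> sets \<mu> = sets borel"
  by (simp add: M_star_def)

lemma M_star_space: "\<mu> \<in> M_star \<Longrightarrow> space \<mu> = UNIV"
  using sets_eq_imp_space_eq[OF M_star_sets] by simp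

lemma M_star_atMost_finite: "\<mu> \<in> M_star \<Longrightarrow> emeasure \<mu> {..r} < \<infinity>"
proof -
  assume mu: "\<mu> \<in> M_star"
  have "emeasure \<mu> {..r} \<le> emeasure \<mu> ({..<0} \<union> {0..r})"
    using M_star_sets[OF mu] by (intro emeasure_mono) auto
  also have "\<dots> \<le> emeasure \<mu> {..<0} + emeasure \<mu> {0..r}"
    using M_star_sets[OF mu] by (intro emeasure_subadditive) auto
  also have "\<dots> < \<infinity>" using mu by (simp add: M_star_def)
  finally show ?thesis .
qed

lemma M_starI:
  assumes "sets \<mu> = sets borel" "\<And>r. emeasure \<mu> {..r} < \<infinity>" shows "\<mu> \<in> M_star"
  unfolding M_star_def mem_Collect_eq
proof (intro conjI allI impI)
  show "emeasure \<mu> {..<0} < \<infinity>"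
    using assms(1) by (intro le_less_trans[OF emeasure_mono assms(2)[of 0]]) auto
  fix K :: "real set" assume "compact K"
  then obtain r where "\<And>x. x \<in> K \<Longrightarrow> \<bar>x\<bar> \<le> r" by (metis bounded_real compact_imp_bounded)
  then have "K \<subseteq> {..r}" by (force simp: abs_le_iff)
  then show "emeasure \<mu> K < \<infinity>"
    using assms(1) by (intro le_less_trans[OF emeasure_mono assms(2)[of r]]) auto
qed (rule assms(1))

lemma M_star_integrable:
  fixes f :: "real \<Rightarrow> real"
  assumes mu: "\<mu> \<in> M_star" and f: "f \<in> borel_measurable borel" "\<And>x. \<bar>f x\<bar> \<le> C" "\<And>x. r < x \<Longrightarrow> f x = 0"
  shows "integrable \<mu> f" "\<bar>\<integral>x. f x \<partial>\<mu>\<bar> \<le> C * measure \<mu> {..r}"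
proof -
  note [measurable_cong] = M_star_sets[OF mu]
  have C: "0 \<le> C" using f(2)[of 0] by linarith
  have int: "integrable \<mu> (\<lambda>x. C * indicator {..r} x)"
    using M_star_atMost_finite[OF mu, of r] by (intro integrable_mult_right) simp
  have le: "\<bar>f x\<bar> \<le> C * indicator {..r} x" for x
    using f(2)[of x] f(3)[of x] by (auto simp: indicator_def not_le)
  have fm: "f \<in> borel_measurable \<mu>"
    unfolding measurable_cong_sets[OF M_star_sets[OF mu] refl] by (rule f(1))
  show i: "integrable \<mu> f"
    by (rule Bochner_Integration.integrable_bound[OF int fm]) (use le C in \<open>auto simp: abs_mult\<close>)
  have "\<bar>\<integral>x. f x \<partial>\<mu>\<bar> \<le> (\<integral>x. \<bar>f x\<bar> \<partial>\<mu>)" by (rule integral_abs_bound)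
  also have "\<dots> \<le> (\<integral>x. C * indicator {..r} x \<partial>\<mu>)"
    by (rule integral_mono[OF integrable_abs[OF i] int le])
  finally show "\<bar>\<integral>x. f x \<partial>\<mu>\<bar> \<le> C * measure \<mu> {..r}" using M_star_space[OF mu] by simp
qed

lemma test_fun_integrable: "\<mu> \<in> M_star \<Longrightarrow> f \<in> test_fun r \<Longrightarrow> integrable \<mu> f"
  by (rule M_star_integrable(1)[where C = 1 and r = r]) (auto intro: test_fun_props)

lemma test_fun_integral_bound: "\<mu> \<in> M_star \<Longrightarrow> f \<in> test_fun r \<Longrightarrow> \<bar>\<integral>x. f x \<partial>\<mu>\<bar> \<le> measure \<mu> {..r}"
  using M_star_integrable(2)[of \<mu> f 1 r] by (auto intro: test_fun_props)

definition sup_dist :: "real \<Rightarrow> real measure \<Rightarrow> real measure \<Rightarrow> real" where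
  "sup_dist r \<mu> \<nu> = (SUP f\<in>test_fun r. \<bar>(\<integral>x. f x \<partial>\<mu>) - (\<integral>x. f x \<partial>\<nu>)\<bar>)"

lemma d_star_sup_dist:
  "\<mu> \<in> M_star \<Longrightarrow> \<nu> \<in> M_star \<Longrightarrow> d_star \<mu> \<nu> = (\<Sum>n. (1/2) ^ Suc n * min 1 (sup_dist (real (Suc n)) \<mu> \<nu>))"
  by (simp add: d_star_def sup_dist_def)

lemma sup_dist_upper:
  assumes "\<mu> \<in> M_star" "\<nu> \<in> M_star" "f \<in> test_fun r"
  shows "\<bar>(\<integral>x. f x \<partial>\<mu>) - (\<integral>x. f x \<partial>\<nu>)\<bar> \<le> sup_dist r \<mu> \<nu>"
  unfolding sup_dist_def
proof (rule cSUP_upper[OF assms(3)])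
  show "bdd_above ((\<lambda>f. \<bar>(\<integral>x. f x \<partial>\<mu>) - (\<integral>x. f x \<partial>\<nu>)\<bar>) ` test_fun r)"
  proof (rule bdd_aboveI2)
    fix f assume "f \<in> test_fun r"
    then show "\<bar>(\<integral>x. f x \<partial>\<mu>) - (\<integral>x. f x \<partial>\<nu>)\<bar> \<le> measure \<mu> {..r} + measure \<nu> {..r}"
      using test_fun_integral_bound[OF assms(1), of f r] test_fun_integral_bound[OF assms(2), of f r] by linarith
  qed
qed

lemma sup_dist_least:
  "(\<And>f. f \<in> test_fun r \<Longrightarrow> \<bar>(\<integral>x. f x \<partial>\<mu>) - (\<integral>x. f x \<partial>\<nu>)\<bar> \<le> c) \<Longrightarrow> sup_dist r \<mu> \<nu> \<le> c"
  unfolding sup_dist_def using zero_test_fun by (intro cSUP_least) auto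

lemma sup_dist_nonneg: "\<mu> \<in> M_star \<Longrightarrow> \<nu> \<in> M_star \<Longrightarrow> 0 \<le> sup_dist r \<mu> \<nu>"
  using sup_dist_upper[OF _ _ zero_test_fun, of \<mu> \<nu> r] by simp

lemma d_star_summable:
  "\<mu> \<in> M_star \<Longrightarrow> \<nu> \<in> M_star \<Longrightarrow> summable (\<lambda>n. (1/2) ^ Suc n * min 1 (sup_dist (real (Suc n)) \<mu> \<nu>))"
  by (rule summable_comparison_test'[OF sums_summable[OF power_half_series], of 0])
    (use sup_dist_nonneg in \<open>auto simp: abs_mult intro!: mult_left_le\<close>)

text \<open>Continuous ramps of slope \<open>m\<close> decrease to the indicator of
  \<open>{..a}\<close>; finiteness of the mass of \<open>{..a + 1}\<close> provides the dominating
  function.\<close>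

lemma M_star_integral_atMost_limit:
  assumes mu: "\<mu> \<in> M_star"
  shows "(\<lambda>m. \<integral>x. min 1 (max 0 (1 - real m * (x - a))) \<partial>\<mu>) \<longlonglongrightarrow> measure \<mu> {..a}"
proof -
  note [measurable_cong] = M_star_sets[OF mu]
  let ?g = "\<lambda>m x. min 1 (max 0 (1 - real m * (x - a)))"
  have "(\<lambda>m. \<integral>x. ?g (Suc m) x \<partial>\<mu>) \<longlonglongrightarrow> (\<integral>x. indicator {..a} x \<partial>\<mu>)"
  proof (rule integral_dominated_convergence)
    show "integrable \<mu> (\<lambda>x. indicator {..a + 1} x :: real)"
      using M_star_atMost_finite[OF mu, of "a + 1"] by simp
    show "AE x in \<mu>. norm (?g (Suc m) x) \<le> indicator {..a + 1} x" for m
    proof (rule AE_I2)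
      fix x
      have "1 - real (Suc m) * (x - a) \<le> 0" if "a + 1 < x"
      proof -
        have "0 \<le> real m * (x - a)" using that by simp
        then show ?thesis using that by (simp add: algebra_simps)
      qed
      then show "norm (?g (Suc m) x) \<le> indicator {..a + 1} x"
        by (cases "a + 1 < x") (auto simp: max_def min_def)
    qed
    show "AE x in \<mu>. (\<lambda>m. ?g (Suc m) x) \<longlonglongrightarrow> indicator {..a} x"
    proof (rule AE_I2)
      fix x
      show "(\<lambda>m. ?g (Suc m) x) \<longlonglongrightarrow> indicator {..a} x"
      proof (cases "x \<le> a")
        case True
        have "?g (Suc m) x = 1" for m
          using mult_nonneg_nonpos[of "real (Suc m)" "x - a"] True by (simp add: min_def max_def del: of_nat_Suc)
        then show ?thesis using True by simp
      next
        case False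
        obtain n where n: "1 < real n * (x - a)" using False ex_less_of_nat_mult[of "x - a" 1] by auto
        have "?g (Suc m) x = 0" if "n \<le> m" for m
        proof -
          have "real n * (x - a) \<le> real (Suc m) * (x - a)" using that False by (intro mult_right_mono) auto
          then show ?thesis using n by (simp add: min_def max_def)
        qed
        then show ?thesis using False
          by (intro tendsto_eventually eventually_sequentiallyI[of n]) auto
      qed
    qed
  qed (unfold measurable_cong_sets[OF M_star_sets[OF mu] refl], measurable)
  then have "(\<lambda>m. \<integral>x. ?g (Suc m) x \<partial>\<mu>) \<longlonglongrightarrow> measure \<mu> {..a}" using M_star_space[OF mu] by simp
  then show ?thesis by (rule LIMSEQ_imp_Suc)
qed

text \<open>Rescaled ramps are test functions, so the masses of all \<open>{..a}\<close> agree;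
  these sets generate the Borel sets and have finite mass.\<close>

lemma M_star_eqI:
  assumes mu: "\<mu> \<in> M_star" and nu: "\<nu> \<in> M_star"
    and eq: "\<And>n f. f \<in> test_fun (real (Suc n)) \<Longrightarrow> (\<integral>x. f x \<partial>\<mu>) = (\<integral>x. f x \<partial>\<nu>)"
  shows "\<mu> = \<nu>"
proof -
  have meas: "measure \<mu> {..a} = measure \<nu> {..a}" for a
  proof -
    let ?g = "\<lambda>m x. min 1 (max 0 (1 - real m * (x - a)))"
    obtain n :: nat where n: "a + 1 \<le> real n" using real_arch_simple by blast
    have "(\<integral>x. ?g (Suc m) x \<partial>\<mu>) = (\<integral>x. ?g (Suc m) x \<partial>\<nu>)" for m
    proof -
      \<comment> \<open>Chosen so that the supremum bound \<open>?c\<close> and the Lipschitz bound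
        \<open>?c * real (Suc m)\<close> add up to exactly 1.\<close>
      let ?c = "1 / (real (Suc m) + 1)"
      have "(\<lambda>x. ?c * ?g (Suc m) x) \<in> test_fun (real (Suc n))"
      proof (rule test_funI[where K = ?c and L = "?c * real (Suc m)"])
        show "?c + ?c * real (Suc m) \<le> 1" by (simp add: field_simps)
        show "\<bar>?c * ?g (Suc m) x\<bar> \<le> ?c" for x
          by (auto simp: abs_mult min_def max_def divide_right_mono)
        have lip: "\<bar>min 1 (max 0 u) - min 1 (max 0 v)\<bar> \<le> \<bar>u - v\<bar>" for u v :: real by (auto simp: min_def max_def)
        show "(?c * real (Suc m))-lipschitz_on UNIV (\<lambda>x. ?c * ?g (Suc m) x)"
        proof (rule lipschitz_onI)
          fix x y :: real
          have "\<bar>?g (Suc m) x - ?g (Suc m) y\<bar> \<le> \<bar>(1 - real (Suc m) * (x - a)) - (1 - real (Suc m) * (y - a))\<bar>" by (rule lip)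
          also have "\<dots> = real (Suc m) * \<bar>x - y\<bar>"
          proof -
            have "(1 - real (Suc m) * (x - a)) - (1 - real (Suc m) * (y - a)) = real (Suc m) * (y - x)"
              by (simp add: algebra_simps)
            then show ?thesis by (simp only: abs_mult abs_of_nat) (simp add: abs_minus_commute)
          qed
          finally have "?c * \<bar>?g (Suc m) x - ?g (Suc m) y\<bar> \<le> ?c * (real (Suc m) * \<bar>x - y\<bar>)"
            by (rule mult_left_mono) simp
          moreover have "dist (?c * ?g (Suc m) x) (?c * ?g (Suc m) y) = ?c * \<bar>?g (Suc m) x - ?g (Suc m) y\<bar>"
          proof -
            have "?c * ?g (Suc m) x - ?c * ?g (Suc m) y = ?c * (?g (Suc m) x - ?g (Suc m) y)"
              by (rule right_diff_distrib[symmetric])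
            then show ?thesis unfolding dist_real_def by (simp only: abs_mult) simp
          qed
          ultimately show "dist (?c * ?g (Suc m) x) (?c * ?g (Suc m) y) \<le> ?c * real (Suc m) * dist x y"
            by (simp only: dist_real_def mult.assoc)
        qed simp
        show "?c * ?g (Suc m) x = 0" if "real (Suc n) < x" for x
        proof -
          have "1 \<le> x - a" using that n by simp
          then have "1 * 1 \<le> real (Suc m) * (x - a)" by (intro mult_mono) auto
          then show ?thesis by (simp add: max_def)
        qed
      qed
      from eq[OF this] show ?thesis by (simp del: of_nat_Suc)
    qed
    moreover have "(\<lambda>m. \<integral>x. ?g (Suc m) x \<partial>\<mu>) \<longlonglongrightarrow> measure \<mu> {..a}"
      "(\<lambda>m. \<integral>x. ?g (Suc m) x \<partial>\<nu>) \<longlonglongrightarrow> measure \<nu> {..a}"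
      by (rule LIMSEQ_Suc[OF M_star_integral_atMost_limit] mu nu)+
    ultimately show ?thesis using LIMSEQ_unique by auto
  qed
  show ?thesis
  proof (rule measure_eqI_generator_eq[where \<Omega> = UNIV and E = "range atMost" and A = "\<lambda>n. {..real n}"])
    show "Int_stable (range (atMost :: real \<Rightarrow> _))" by (auto simp: Int_stable_def)
    show "emeasure \<mu> X = emeasure \<nu> X" if XX: "X \<in> range atMost" for X
    proof -
      obtain a where X: "X = {..a}" using XX by blast
      have "emeasure \<mu> {..a} = ennreal (measure \<mu> {..a})" "emeasure \<nu> {..a} = ennreal (measure \<nu> {..a})"
        using M_star_atMost_finite[OF mu, of a] M_star_atMost_finite[OF nu, of a]
        by (intro emeasure_eq_ennreal_measure; simp)+
      then show ?thesis unfolding X meas by simp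
    qed
    show "sets \<mu> = sigma_sets UNIV (range atMost)" "sets \<nu> = sigma_sets UNIV (range atMost)"
      using M_star_sets[OF mu] M_star_sets[OF nu] by (simp_all add: borel_eq_atMost)
    show "(\<Union>n::nat. {..real n}) = UNIV" using real_arch_simple by auto
    show "emeasure \<mu> {..real n} \<noteq> \<infinity>" for n using M_star_atMost_finite[OF mu, of "real n"] by simp
  qed auto
qed

lemma Metric_space_d_star: "Metric_space M_star d_star"
proof
  have nonneg: "0 \<le> (1/2) ^ Suc n * min 1 (sup_dist (real (Suc n)) \<mu> \<nu>)" if "\<mu> \<in> M_star" "\<nu> \<in> M_star" for n \<mu> \<nu>
    using sup_dist_nonneg[OF that] by simp
  show "0 \<le> d_star \<mu> \<nu>" for \<mu> \<nu>
  proof (cases "\<mu> \<in> M_star \<and> \<nu> \<in> M_star")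
    case True
    then show ?thesis using nonneg by (simp only: d_star_sup_dist) (blast intro: suminf_nonneg d_star_summable)
  qed (auto simp: d_star_def)
  show "d_star \<mu> \<nu> = d_star \<nu> \<mu>" for \<mu> \<nu>
    by (auto simp: d_star_def abs_minus_commute)
  show "d_star \<mu> \<nu> = 0 \<longleftrightarrow> \<mu> = \<nu>" if mu: "\<mu> \<in> M_star" and nu: "\<nu> \<in> M_star" for \<mu> \<nu>
  proof
    assume "d_star \<mu> \<nu> = 0"
    then have 0: "sup_dist (real (Suc n)) \<mu> \<nu> = 0" for n
      using suminf_eq_zero_iff[OF d_star_summable[OF mu nu] nonneg[OF mu nu]] sup_dist_nonneg[OF mu nu]
      unfolding d_star_sup_dist[OF mu nu] by (auto simp: min_def split: if_splits)
    show "\<mu> = \<nu>"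
    proof (rule M_star_eqI[OF mu nu])
      fix n f assume "f \<in> test_fun (real (Suc n))"
      from sup_dist_upper[OF mu nu this] show "(\<integral>x. f x \<partial>\<mu>) = (\<integral>x. f x \<partial>\<nu>)" unfolding 0 by simp
    qed
  next
    assume "\<mu> = \<nu>"
    moreover have "sup_dist r \<nu> \<nu> = 0" for r
      using sup_dist_least[of r \<nu> \<nu> 0] sup_dist_nonneg[OF nu nu, of r] by simp
    ultimately show "d_star \<mu> \<nu> = 0" by (simp add: d_star_sup_dist[OF nu nu])
  qed
  show "d_star \<mu> \<xi> \<le> d_star \<mu> \<nu> + d_star \<nu> \<xi>" if mu: "\<mu> \<in> M_star" and nu: "\<nu> \<in> M_star" and xi: "\<xi> \<in> M_star" for \<mu> \<nu> \<xi>
  proof -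
    have tri: "sup_dist r \<mu> \<xi> \<le> sup_dist r \<mu> \<nu> + sup_dist r \<nu> \<xi>" for r
      by (rule sup_dist_least) (use sup_dist_upper[OF mu nu] sup_dist_upper[OF nu xi] in \<open>smt (verit)\<close>)
    have le: "min 1 (sup_dist r \<mu> \<xi>) \<le> min 1 (sup_dist r \<mu> \<nu>) + min 1 (sup_dist r \<nu> \<xi>)" for r
      using tri[of r] sup_dist_nonneg[OF mu nu, of r] sup_dist_nonneg[OF nu xi, of r] by (auto simp: min_def)
    show ?thesis
      unfolding d_star_sup_dist[OF mu nu] d_star_sup_dist[OF nu xi] d_star_sup_dist[OF mu xi]
        suminf_add[OF d_star_summable[OF mu nu] d_star_summable[OF nu xi]]
    proof (rule suminf_le)
      show "(1/2) ^ Suc n * min 1 (sup_dist (real (Suc n)) \<mu> \<xi>)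
        \<le> (1/2) ^ Suc n * min 1 (sup_dist (real (Suc n)) \<mu> \<nu>) + (1/2) ^ Suc n * min 1 (sup_dist (real (Suc n)) \<nu> \<xi>)" for n
        unfolding distrib_left[symmetric] by (rule mult_left_mono[OF le]) simp
    qed (intro summable_add d_star_summable mu nu xi)+
  qed
qed

text \<open>The classes \<open>test_fun\<close> grow with the radius, so radius \<open>N\<close>
  covers the first \<open>N\<close> terms of the metric; the remaining weights add up to
  \<open>(1/2) ^ N\<close>.\<close>

lemma d_star_le:
  assumes mu: "\<mu> \<in> M_star" and nu: "\<nu> \<in> M_star" and eta: "0 \<le> \<eta>"
    and le: "\<And>f. f \<in> test_fun (real N) \<Longrightarrow> \<bar>(\<integral>x. f x \<partial>\<mu>) - (\<integral>x. f x \<partial>\<nu>)\<bar> \<le> \<eta>"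
  shows "d_star \<mu> \<nu> \<le> \<eta> + (1/2) ^ N"
proof -
  let ?h = "\<lambda>n. (1/2::real) ^ Suc n" and ?t = "\<lambda>n. if n < N then 0 else (1/2::real) ^ Suc n"
  have "(\<lambda>n. ?t (n + N)) = (\<lambda>n. (1/2) ^ N * ?h n)" by (auto simp: power_add)
  then have "(\<lambda>n. ?t (n + N)) sums ((1/2) ^ N * 1)" using sums_mult[OF power_half_series] by simp
  then have "?t sums ((1/2) ^ N * 1 + (\<Sum>n<N. ?t n))" by (rule iffD1[OF sums_iff_shift[of ?t N]])
  then have t: "?t sums ((1/2) ^ N)" by simp
  have h: "(\<lambda>n. \<eta> * ?h n) sums (\<eta> * 1)" by (rule sums_mult[OF power_half_series])
  have "d_star \<mu> \<nu> \<le> (\<Sum>n. \<eta> * ?h n + ?t n)"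
    unfolding d_star_sup_dist[OF mu nu]
  proof (rule suminf_le[OF _ d_star_summable[OF mu nu] sums_summable[OF sums_add[OF h t]]])
    fix n
    show "?h n * min 1 (sup_dist (real (Suc n)) \<mu> \<nu>) \<le> \<eta> * ?h n + ?t n"
    proof (cases "n < N")
      case True
      have "sup_dist (real (Suc n)) \<mu> \<nu> \<le> \<eta>"
        by (rule sup_dist_least[OF le]) (use test_fun_mono[of "real (Suc n)" "real N"] True in auto)
      then have "?h n * min 1 (sup_dist (real (Suc n)) \<mu> \<nu>) \<le> ?h n * \<eta>" by (intro mult_left_mono) auto
      then show ?thesis using True by (simp add: mult.commute)
    next
      case False
      have "?h n * min 1 (sup_dist (real (Suc n)) \<mu> \<nu>) \<le> ?h n * 1" by (intro mult_left_mono) auto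
      then show ?thesis using False eta by (simp add: add_increasing)
    qed
  qed
  also have "\<dots> = \<eta> + (1/2) ^ N" using sums_unique[OF sums_add[OF h t]] by simp
  finally show ?thesis .
qed

lemma half_power_less: "0 < (e::real) \<Longrightarrow> \<exists>N. (1/2) ^ N < e"
  by (rule real_arch_pow_inv) auto

text \<open>Turns continuity in the metric into continuity of integrals, uniform over the test
  functions of each single radius, by cutting the series of the metric at \<open>N\<close>.\<close>

lemma C_pathsI:
  assumes ext: "q \<in> extensional {0..}" and q: "\<And>t. 0 \<le> t \<Longrightarrow> q t \<in> M_star"
    and cont: "\<And>t N \<eta>. 0 \<le> t \<Longrightarrow> 0 < \<eta> \<Longrightarrow> \<exists>\<delta>>0. \<forall>s\<ge>0. \<bar>s - t\<bar> < \<delta> \<longrightarrow>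
      (\<forall>f\<in>test_fun (real N). \<bar>(\<integral>x. f x \<partial>q t) - (\<integral>x. f x \<partial>q s)\<bar> \<le> \<eta>)"
  shows "q \<in> C_paths"
proof -
  interpret Metric_space M_star d_star by (rule Metric_space_d_star)
  have "continuous_map (top_of_set {0..}) mtopology q"
    unfolding continuous_map_to_metric
  proof (intro ballI allI impI)
    fix t e :: real assume "t \<in> topspace (top_of_set {0..})" and e: "0 < e"
    then have t: "0 \<le> t" by simp
    obtain N where N: "(1/2) ^ N < e / 2" using half_power_less[of "e / 2"] e by auto
    obtain \<delta> where d: "0 < \<delta>"
      "\<forall>s\<ge>0. \<bar>s - t\<bar> < \<delta> \<longrightarrow> (\<forall>f\<in>test_fun (real N). \<bar>(\<integral>x. f x \<partial>q t) - (\<integral>x. f x \<partial>q s)\<bar> \<le> e / 2)"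
      using cont[OF t, of "e / 2" N] e by auto
    have "q s \<in> mball (q t) e" if "0 \<le> s" "\<bar>s - t\<bar> < \<delta>" for s
    proof -
      have "d_star (q t) (q s) \<le> e / 2 + (1/2) ^ N"
        using d that e by (intro d_star_le q t) auto
      then show ?thesis using N q[OF t] q[OF that(1)] by (simp add: mball_def)
    qed
    then show "\<exists>U. openin (top_of_set {0..}) U \<and> t \<in> U \<and> (\<forall>y\<in>U. q y \<in> mball (q t) e)"
      using t d(1) by (intro exI[of _ "{0..} \<inter> ball t \<delta>"]) (auto simp: dist_real_def abs_minus_commute)
  qed
  then show ?thesis using ext by (simp add: C_paths_def)
qed

lemma C_paths_M_star: "q \<in> C_paths \<Longrightarrow> 0 \<le> t \<Longrightarrow> q t \<in> M_star"
proof -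
  interpret Metric_space M_star d_star by (rule Metric_space_d_star)
  assume "q \<in> C_paths" "0 \<le> t"
  then show ?thesis unfolding C_paths_def continuous_map_def by auto
qed

section \<open>Rescaled point measures\<close>

definition point_measure_of :: "real \<Rightarrow> (nat \<Rightarrow> real) \<Rightarrow> real measure" where
  "point_measure_of b x = scale_measure (ennreal b) (distr (count_space UNIV) borel x)"

lemma sets_point_measure_of[simp]: "sets (point_measure_of b x) = sets borel"
  by (simp add: point_measure_of_def)

lemma emeasure_point_measure_of:
  "A \<in> sets borel \<Longrightarrow> emeasure (point_measure_of b x) A = ennreal b * emeasure (count_space UNIV) {i. x i \<in> A}"
  by (simp add: point_measure_of_def emeasure_distr vimage_def)

lemma scale_measure_density: "scale_measure (ennreal b) N = density N (\<lambda>_. ennreal b)"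
  by (rule measure_eqI) (simp_all add: emeasure_density nn_integral_cmult_indicator)

lemma integral_point_measure_of:
  assumes b: "0 \<le> b" and f[measurable]: "f \<in> borel_measurable borel"
    and A: "finite A" "\<And>i. i \<notin> A \<Longrightarrow> f (x i) = (0::real)"
  shows "(\<integral>z. f z \<partial>point_measure_of b x) = b * (\<Sum>i\<in>A. f (x i))"
proof -
  have "(\<integral>z. f z \<partial>point_measure_of b x) = (\<integral>z. b *\<^sub>R f z \<partial>distr (count_space UNIV) borel x)"
    unfolding point_measure_of_def scale_measure_density using b by (intro integral_density) auto
  also have "\<dots> = b * (\<integral>i. f (x i) \<partial>count_space UNIV)" by (simp add: integral_distr)
  also have "(\<integral>i. f (x i) \<partial>count_space UNIV) = (\<Sum>i | i \<in> UNIV \<and> f (x i) \<noteq> 0. f (x i))"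
    by (rule lebesgue_integral_count_space_finite_support) (use A in \<open>auto intro: finite_subset\<close>)
  also have "\<dots> = (\<Sum>i\<in>A. f (x i))"
    by (rule sum.mono_neutral_left) (use A in auto)
  finally show ?thesis .
qed

lemma point_measure_of_M_star:
  assumes b: "0 < b"
  shows "point_measure_of b x \<in> M_star \<longleftrightarrow> (\<forall>r. finite {i. x i \<le> r})"
proof
  assume M: "point_measure_of b x \<in> M_star"
  show "\<forall>r. finite {i. x i \<le> r}"
  proof
    fix r
    have "ennreal b * emeasure (count_space UNIV) {i. x i \<le> r} < \<infinity>"
      using M_star_atMost_finite[OF M, of r] by (simp add: emeasure_point_measure_of)
    then show "finite {i. x i \<le> r}"
      using b by (cases "finite {i. x i \<le> r}") (auto simp: ennreal_mult_top)
  qed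
next
  assume "\<forall>r. finite {i. x i \<le> r}"
  then show "point_measure_of b x \<in> M_star"
    by (intro M_starI) (auto simp: emeasure_point_measure_of ennreal_mult_less_top of_nat_less_top)
qed

text \<open>Identifies the integrated count of a configuration with an integral against its measure,
  the form in which it is compared with the limit.\<close>

lemma integral_pos_point_measure_of:
  assumes "0 \<le> b" "finite {i. x i \<le> r}"
  shows "(\<integral>z. max 0 (r - z) \<partial>point_measure_of b x) = (\<Sum>i. b * max 0 (r - x i))"
proof -
  have "(\<integral>z. max 0 (r - z) \<partial>point_measure_of b x) = b * (\<Sum>i | x i \<le> r. max 0 (r - x i))"
    using assms by (intro integral_point_measure_of) auto
  also have "\<dots> = (\<Sum>i. b * max 0 (r - x i))"
    unfolding sum_distrib_left by (rule suminf_finite[symmetric]) (use assms in auto)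
  finally show ?thesis .
qed

lemma AE_ge_point_measure_of:
  assumes "\<And>i. c \<le> x i" shows "AE z in point_measure_of b x. c \<le> z"
proof (rule AE_I'[of "{..<c}"])
  have "{i. x i \<in> {..<c}} = {}" using assms by (auto simp: not_less)
  then show "{..<c} \<in> null_sets (point_measure_of b x)"
    by (simp only: null_sets_def mem_Collect_eq) (simp add: emeasure_point_measure_of)
qed auto

section \<open>From integrated counts to measures\<close>

lemma M_star_pos_integrable:
  assumes mu: "\<mu> \<in> M_star" and AE: "AE z in \<mu>. - R \<le> z"
  shows "integrable \<mu> (\<lambda>z. max 0 (x - z))"
proof (rule Bochner_Integration.integrable_bound)
  show "integrable \<mu> (\<lambda>z. (\<bar>x\<bar> + \<bar>R\<bar>) * indicator {..x} z)"
    using M_star_atMost_finite[OF mu, of x] M_star_sets[OF mu] by (intro integrable_mult_right) simp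
  show "(\<lambda>z. max 0 (x - z)) \<in> borel_measurable \<mu>"
    unfolding measurable_cong_sets[OF M_star_sets[OF mu] refl] by measurable
  show "AE z in \<mu>. norm (max 0 (x - z)) \<le> norm ((\<bar>x\<bar> + \<bar>R\<bar>) * indicator {..x} z)"
    using AE by eventually_elim (auto simp: indicator_def)
qed

lemma tent_function:
  fixes h :: real assumes "0 < h"
  shows "0 \<le> max 0 (y + h - z) - 2 * max 0 (y - z) + max 0 (y - h - z)"
    "h \<le> \<bar>z - y\<bar> \<Longrightarrow> max 0 (y + h - z) - 2 * max 0 (y - z) + max 0 (y - h - z) = 0"
  using assms by (auto simp: max_def)

lemma sum_second_difference:
  fixes p :: "nat \<Rightarrow> real"
  shows "(\<Sum>j<n. p (Suc (Suc j)) - 2 * p (Suc j) + p j) = (p (Suc n) - p n) - (p (Suc 0) - p 0)"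
  by (induction n) auto

text \<open>A Lipschitz function is within \<open>h\<close> of its interpolation by tents on a grid of mesh \<open>h\<close>, and tents are
  second differences of the functions \<open>z \<mapsto> max 0 (x - z)\<close>.\<close>

lemma tent_approximation:
  fixes f :: "real \<Rightarrow> real"
  assumes mu: "\<mu> \<in> M_star" and AE: "AE z in \<mu>. - R \<le> z" and f: "f \<in> test_fun r"
    and h: "0 < h" "h \<le> 1" and x: "\<And>j. x j = - R - 1 + h * real j" and N: "r + 1 \<le> x N"
  shows "\<bar>(\<integral>z. f z \<partial>\<mu>) - (\<Sum>j<N. f (x (Suc j)) / h * ((\<integral>z. max 0 (x (Suc (Suc j)) - z) \<partial>\<mu>)
      - 2 * (\<integral>z. max 0 (x (Suc j) - z) \<partial>\<mu>) + (\<integral>z. max 0 (x j - z) \<partial>\<mu>)))\<bar>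
    \<le> h * (\<integral>z. max 0 (r + 2 - z) \<partial>\<mu>)"
proof -
  let ?D = "\<lambda>j z. max 0 (x (Suc (Suc j)) - z) - 2 * max 0 (x (Suc j) - z) + max 0 (x j - z)"
  let ?F = "\<lambda>z. \<Sum>j<N. f (x (Suc j)) / h * ?D j z"
  note int = M_star_pos_integrable[OF mu AE]
  have intD: "integrable \<mu> (?D j)" for j
    by (intro Bochner_Integration.integrable_add Bochner_Integration.integrable_diff integrable_mult_right int)
  have intF: "integrable \<mu> ?F" by (intro Bochner_Integration.integrable_sum integrable_mult_right intD)
  have "(\<integral>z. ?D j z \<partial>\<mu>) = (\<integral>z. max 0 (x (Suc (Suc j)) - z) \<partial>\<mu>)
      - 2 * (\<integral>z. max 0 (x (Suc j) - z) \<partial>\<mu>) + (\<integral>z. max 0 (x j - z) \<partial>\<mu>)" for j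
    using int by simp
  then have F: "(\<Sum>j<N. f (x (Suc j)) / h * ((\<integral>z. max 0 (x (Suc (Suc j)) - z) \<partial>\<mu>)
      - 2 * (\<integral>z. max 0 (x (Suc j) - z) \<partial>\<mu>) + (\<integral>z. max 0 (x j - z) \<partial>\<mu>))) = (\<integral>z. ?F z \<partial>\<mu>)"
    using intD by (subst Bochner_Integration.integral_sum) (auto simp del: Bochner_Integration.integral_diff Bochner_Integration.integral_add)
  have D: "0 \<le> ?D j z" "h \<le> \<bar>z - x (Suc j)\<bar> \<Longrightarrow> ?D j z = 0" for j z
  proof -
    have "x (Suc (Suc j)) = x (Suc j) + h" "x j = x (Suc j) - h" by (simp_all add: x algebra_simps)
    then show "0 \<le> ?D j z" "h \<le> \<bar>z - x (Suc j)\<bar> \<Longrightarrow> ?D j z = 0"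
      using tent_function[OF h(1), where y = "x (Suc j)" and z = z] by (simp_all only:)
  qed
  have le: "\<bar>f z - ?F z\<bar> \<le> h * max 0 (r + 2 - z)" if z: "- R \<le> z" for z
  proof (cases "z \<le> r + 1")
    case True
    have "x N \<le> x (Suc N)" "x (Suc N) - x N = h" "x (Suc 0) \<le> z" "x 0 \<le> z"
      using h z by (auto simp: x algebra_simps)
    \<comment> \<open>The tents form a partition of unity up to the factor \<open>h\<close>: the sum
      telescopes to a difference of slopes, and \<open>z\<close> has at least two grid points to its
      left and lies at or left of \<open>x N\<close>.\<close>
    then have "(\<Sum>j<N. ?D j z) = h"
      unfolding sum_second_difference[of "\<lambda>j. max 0 (x j - z)"] using N True by (simp add: max_def)
    then have "f z = (\<Sum>j<N. f z / h * ?D j z)" unfolding sum_distrib_left[symmetric] using h by simp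
    then have eq: "f z - ?F z = (\<Sum>j<N. (f z - f (x (Suc j))) / h * ?D j z)"
      by (simp only: diff_divide_distrib left_diff_distrib sum_subtractf)
    have "\<bar>f z - ?F z\<bar> \<le> (\<Sum>j<N. ?D j z)"
      unfolding eq
    proof (rule order_trans[OF sum_abs sum_mono])
      fix j
      show "\<bar>(f z - f (x (Suc j))) / h * ?D j z\<bar> \<le> ?D j z"
      proof (cases "h \<le> \<bar>z - x (Suc j)\<bar>")
        case True then show ?thesis using D(2)[of z j] by simp
      next
        case False
        \<comment> \<open>Only tents centred within \<open>h\<close> of \<open>z\<close> are nonzero
          there, and \<open>f\<close> is 1-Lipschitz, as its two bounds sum to at most 1.\<close>
        then have "\<bar>f z - f (x (Suc j))\<bar> \<le> h" using test_fun_lipschitz[OF f, of z "x (Suc j)"] by linarith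
        then have "\<bar>(f z - f (x (Suc j))) / h\<bar> \<le> 1" using h by simp
        then have "\<bar>(f z - f (x (Suc j))) / h\<bar> * ?D j z \<le> 1 * ?D j z" by (rule mult_right_mono[OF _ D(1)])
        then show ?thesis using D(1)[of j z] by (simp only: abs_mult abs_of_nonneg mult_1)
      qed
    qed
    also have "\<dots> = h * 1" by (simp add: \<open>(\<Sum>j<N. ?D j z) = h\<close>)
    also have "\<dots> \<le> h * max 0 (r + 2 - z)" using True h by (intro mult_left_mono) auto
    finally show ?thesis .
  next
    case False
    have "f (x (Suc j)) / h * ?D j z = 0" for j
    proof (cases "r < x (Suc j)")
      case True then show ?thesis using test_fun_vanish[OF f True] by simp
    next
      case rx: False
      then have "h \<le> \<bar>z - x (Suc j)\<bar>" using False h by linarith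
      then show ?thesis using D(2)[of z j] by simp
    qed
    then have "?F z = 0" by (intro sum.neutral) blast
    moreover have "f z = 0" using False by (intro test_fun_vanish[OF f]) simp
    ultimately show ?thesis using h by simp
  qed
  have intf: "integrable \<mu> f" by (rule test_fun_integrable[OF mu f])
  have "\<bar>(\<integral>z. f z \<partial>\<mu>) - (\<integral>z. ?F z \<partial>\<mu>)\<bar> = \<bar>\<integral>z. f z - ?F z \<partial>\<mu>\<bar>"
    by (simp only: Bochner_Integration.integral_diff[OF intf intF])
  also have "\<dots> \<le> (\<integral>z. \<bar>f z - ?F z\<bar> \<partial>\<mu>)" by (rule integral_abs_bound)
  also have "\<dots> \<le> (\<integral>z. h * max 0 (r + 2 - z) \<partial>\<mu>)"
  proof (rule integral_mono_AE)
    show "integrable \<mu> (\<lambda>z. \<bar>f z - ?F z\<bar>)"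
      by (intro integrable_abs Bochner_Integration.integrable_diff intf intF)
    show "AE z in \<mu>. \<bar>f z - ?F z\<bar> \<le> h * max 0 (r + 2 - z)" using AE by eventually_elim (rule le)
  qed (intro integrable_mult_right int)
  finally show ?thesis unfolding F by simp
qed

text \<open>Uniformity is the point: \<open>\<epsilon>\<close> and \<open>R'\<close> depend on the
  bounds \<open>R\<close>, \<open>r\<close>, \<open>C\<close> and on \<open>\<eta>\<close> alone, so
  one statement serves all test functions of radius \<open>r\<close>, all times and all paths.
  Interpolation by finitely many tents reduces the claim to the integrated counts at finitely many
  points.\<close>

lemma close_test_functions:
  fixes R r C \<eta> :: real
  assumes R: "0 \<le> R" and r: "0 \<le> r" and C: "0 \<le> C" and eta: "0 < \<eta>"
  obtains \<epsilon> R' where "0 < \<epsilon>" "\<epsilon> \<le> 1" "0 \<le> R'"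
    "\<And>\<mu> \<nu> f. \<mu> \<in> M_star \<Longrightarrow> \<nu> \<in> M_star \<Longrightarrow> (AE z in \<mu>. - R \<le> z) \<Longrightarrow> (AE z in \<nu>. - R \<le> z) \<Longrightarrow>
      (\<integral>z. max 0 (r + 2 - z) \<partial>\<nu>) \<le> C \<Longrightarrow>
      (\<And>x. \<bar>x\<bar> \<le> R' \<Longrightarrow> \<bar>(\<integral>z. max 0 (x - z) \<partial>\<mu>) - (\<integral>z. max 0 (x - z) \<partial>\<nu>)\<bar> \<le> \<epsilon>) \<Longrightarrow>
      f \<in> test_fun r \<Longrightarrow> \<bar>(\<integral>z. f z \<partial>\<mu>) - (\<integral>z. f z \<partial>\<nu>)\<bar> \<le> \<eta>"
proof -
  \<comment> \<open>The interpolation errors of the two measures are \<open>h * (C + 1)\<close> and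
    \<open>h * C\<close>; the additional 1 accounts for an integrated count known up to
    \<open>\<epsilon> \<le> 1\<close>.\<close>
  define h where "h = min 1 (\<eta> / (2 * (2 * C + 1)))"
  have h: "0 < h" "h \<le> 1" using C eta by (auto simp: h_def)
  have hC: "h * (2 * C + 1) \<le> \<eta> / 2"
  proof -
    have "h * (2 * C + 1) \<le> \<eta> / (2 * (2 * C + 1)) * (2 * C + 1)"
      using C by (intro mult_right_mono) (auto simp: h_def)
    also have "\<dots> = \<eta> / 2" using C by (simp add: field_simps)
    finally show ?thesis .
  qed
  define x where "x = (\<lambda>j. - R - 1 + h * real j)"
  have x_alt: "x j = - R - 1 + h * real j" for j by (simp add: x_def)
  obtain N where N: "(r + R + 2) / h \<le> real N" using real_arch_simple by blast
  then have N': "r + 1 \<le> x N" using h by (simp add: x_def field_simps)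
  \<comment> \<open>Each of the \<open>N\<close> second differences is off by at most
    \<open>4 * \<epsilon>\<close> and is divided by \<open>h\<close>.\<close>
  define \<epsilon> where "\<epsilon> = min 1 (\<eta> * h / (8 * (real N + 1)))"
  have e: "0 < \<epsilon>" "\<epsilon> \<le> 1" using eta h by (auto simp: \<epsilon>_def)
  have eN: "real N * (4 * \<epsilon> / h) \<le> \<eta> / 2"
  proof -
    have "\<epsilon> \<le> \<eta> * h / (8 * (real N + 1))" by (simp add: \<epsilon>_def)
    then have "8 * (real N + 1) * \<epsilon> \<le> \<eta> * h" by (simp add: field_simps)
    then have "8 * real N * \<epsilon> \<le> \<eta> * h" using e by (simp add: algebra_simps)
    then show ?thesis using h by (simp add: field_simps)
  qed
  define R' where "R' = R + r + 3 + h * (real N + 1)"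
  have "0 \<le> R'" using R r h by (simp add: R'_def)
  have xR: "\<bar>x j\<bar> \<le> R'" if "j \<le> Suc N" for j
  proof -
    have "0 \<le> h * real j" "h * real j \<le> h * (real N + 1)" using h that by (auto intro!: mult_left_mono)
    then show ?thesis using R r unfolding x_def R'_def by linarith
  qed
  show thesis
  proof (rule that[OF e \<open>0 \<le> R'\<close>])
    fix \<mu> \<nu> f
    assume mu: "\<mu> \<in> M_star" and nu: "\<nu> \<in> M_star" and AE: "AE z in \<mu>. - R \<le> z" "AE z in \<nu>. - R \<le> z"
      and GC: "(\<integral>z. max 0 (r + 2 - z) \<partial>\<nu>) \<le> C"
      and G: "\<And>x. \<bar>x\<bar> \<le> R' \<Longrightarrow> \<bar>(\<integral>z. max 0 (x - z) \<partial>\<mu>) - (\<integral>z. max 0 (x - z) \<partial>\<nu>)\<bar> \<le> \<epsilon>"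
      and f: "f \<in> test_fun r"
    define Gm where "Gm = (\<lambda>x. \<integral>z. max 0 (x - z) \<partial>\<mu>)"
    define Gn where "Gn = (\<lambda>x. \<integral>z. max 0 (x - z) \<partial>\<nu>)"
    define Im where "Im = (\<Sum>j<N. f (x (Suc j)) / h * (Gm (x (Suc (Suc j))) - 2 * Gm (x (Suc j)) + Gm (x j)))"
    define In where "In = (\<Sum>j<N. f (x (Suc j)) / h * (Gn (x (Suc (Suc j))) - 2 * Gn (x (Suc j)) + Gn (x j)))"
    have "\<bar>r + 2\<bar> \<le> R'" using R r h by (simp add: R'_def)
    from G[OF this] have "Gm (r + 2) \<le> C + 1" using GC e by (simp add: Gm_def)
    then have "h * Gm (r + 2) \<le> h * (C + 1)" "h * Gn (r + 2) \<le> h * C" using h GC by (auto simp: Gn_def)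
    moreover have "\<bar>(\<integral>z. f z \<partial>\<mu>) - Im\<bar> \<le> h * Gm (r + 2)"
      unfolding Im_def Gm_def by (rule tent_approximation[OF mu AE(1) f h x_alt N'])
    moreover have "\<bar>(\<integral>z. f z \<partial>\<nu>) - In\<bar> \<le> h * Gn (r + 2)"
      unfolding In_def Gn_def by (rule tent_approximation[OF nu AE(2) f h x_alt N'])
    moreover have "\<bar>Im - In\<bar> \<le> real N * (4 * \<epsilon> / h)"
    proof -
      let ?d = "\<lambda>j. Gm (x j) - Gn (x j)"
      have d: "\<bar>?d j\<bar> \<le> \<epsilon>" if "j \<le> Suc N" for j using G[OF xR[OF that]] by (simp add: Gm_def Gn_def)
      have eq: "Im - In = (\<Sum>j<N. f (x (Suc j)) * ((?d (Suc (Suc j)) - 2 * ?d (Suc j) + ?d j) / h))"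
        unfolding Im_def In_def sum_subtractf[symmetric]
        by (rule sum.cong[OF refl]) (use h in \<open>simp add: field_simps\<close>)
      have "\<bar>Im - In\<bar> \<le> (\<Sum>j<N. 4 * \<epsilon> / h)"
        unfolding eq
      proof (rule order_trans[OF sum_abs sum_mono])
        fix j assume "j \<in> {..<N}"
        then have "\<bar>?d (Suc (Suc j))\<bar> \<le> \<epsilon>" "\<bar>?d (Suc j)\<bar> \<le> \<epsilon>" "\<bar>?d j\<bar> \<le> \<epsilon>" by (intro d; simp)+
        then have "\<bar>?d (Suc (Suc j)) - 2 * ?d (Suc j) + ?d j\<bar> \<le> 4 * \<epsilon>"
        proof -
          have "\<bar>a - 2 * b + c\<bar> \<le> 4 * \<epsilon>" if "\<bar>a\<bar> \<le> \<epsilon>" "\<bar>b\<bar> \<le> \<epsilon>" "\<bar>c\<bar> \<le> \<epsilon>" for a b c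
            using that by linarith
          then show ?thesis using \<open>\<bar>?d (Suc (Suc j))\<bar> \<le> \<epsilon>\<close> \<open>\<bar>?d (Suc j)\<bar> \<le> \<epsilon>\<close> \<open>\<bar>?d j\<bar> \<le> \<epsilon>\<close> .
        qed
        then have "\<bar>(?d (Suc (Suc j)) - 2 * ?d (Suc j) + ?d j) / h\<bar> \<le> 4 * \<epsilon> / h"
          using h by (simp add: divide_right_mono)
        then have "\<bar>f (x (Suc j))\<bar> * \<bar>(?d (Suc (Suc j)) - 2 * ?d (Suc j) + ?d j) / h\<bar> \<le> 1 * (4 * \<epsilon> / h)"
          by (intro mult_mono test_fun_bound[OF f]) auto
        then show "\<bar>f (x (Suc j)) * ((?d (Suc (Suc j)) - 2 * ?d (Suc j) + ?d j) / h)\<bar> \<le> 4 * \<epsilon> / h"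
          by (simp only: abs_mult mult_1)
      qed
      then show ?thesis by simp
    qed
    moreover have "h * (C + 1) + h * C = h * (2 * C + 1)" by (simp add: algebra_simps)
    ultimately show "\<bar>(\<integral>z. f z \<partial>\<mu>) - (\<integral>z. f z \<partial>\<nu>)\<bar> \<le> \<eta>" using hC eN by linarith
  qed
qed

section \<open>The limit path of measures\<close>

context stefan begin

lemma u_star_nonneg: "0 \<le> u_star lam k t x"
  using prof_bounds(1)[of "x / sqrt t"] m0_pos lam_pos by (auto simp: u_star_def prof_def indicator_def)

lemma u_star_le: "u_star lam k t x \<le> m1 * indicator {ys t..} x"
  using prof_bounds(2)[of "x / sqrt t"] m1_pos
  by (auto simp: u_star_def prof_def indicator_def y_star_def m1_def)

lemma u_star_measurable[measurable]: "u_star lam k t \<in> borel_measurable borel"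
  unfolding u_star_def[abs_def] by (cases "t = 0") simp_all

lemma Q_star_M_star: "0 \<le> t \<Longrightarrow> Q_star lam k t \<in> M_star"
proof (rule M_starI)
  assume t: "0 \<le> t"
  then show "sets (Q_star lam k t) = sets borel" by (simp add: Q_star_def)
  fix r
  have "emeasure (Q_star lam k t) {..r} = (\<integral>\<^sup>+ x. ennreal (u_star lam k t x) * indicator {..r} x \<partial>lborel)"
    using t by (simp add: Q_star_def emeasure_density)
  also have "\<dots> \<le> (\<integral>\<^sup>+ x. ennreal m1 * indicator {ys t..r} x \<partial>lborel)"
  proof (rule nn_integral_mono)
    fix x
    show "ennreal (u_star lam k t x) * indicator {..r} x \<le> ennreal m1 * indicator {ys t..r} x"
      using u_star_le[of t x] by (auto simp: indicator_def ennreal_leI ennreal_eq_0_iff split: if_splits)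
  qed
  also have "\<dots> < \<infinity>" by (simp add: nn_integral_cmult_indicator ennreal_mult_less_top emeasure_lborel_Icc_eq)
  finally show "emeasure (Q_star lam k t) {..r} < \<infinity>" .
qed

lemma AE_Q_star: "0 \<le> t \<Longrightarrow> AE z in Q_star lam k t. ys t \<le> z"
proof -
  assume t: "0 \<le> t"
  have "ys t \<le> z" if "0 < u_star lam k t z" for z
    using u_star_le[of t z] that by (cases "ys t \<le> z") auto
  then have "AE z in lborel. 0 < ennreal (u_star lam k t z) \<longrightarrow> ys t \<le> z" by auto
  then have "AE z in density lborel (\<lambda>x. ennreal (u_star lam k t x)). ys t \<le> z" by (subst AE_density) auto
  moreover have "Q_star lam k t = density lborel (\<lambda>x. ennreal (u_star lam k t x))" using t by (simp add: Q_star_def)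
  ultimately show ?thesis by (simp only:)
qed

text \<open>Confirms that \<open>Gs\<close>, built from the profile, is the integrated count of the
  limit density, via an explicit primitive of \<open>u_star lam k t z * (x - z)\<close> right of the
  boundary.\<close>

lemma integral_pos_Q_star:
  assumes t: "0 \<le> t" shows "(\<integral>z. max 0 (x - z) \<partial>Q_star lam k t) = Gs t x"
proof -
  obtain F w where Fw: "\<And>z. (F has_real_derivative w z * (x - z)) (at z)" "\<And>z. isCont w z"
    "\<And>z. u_star lam k t z = w z * indicator {ys t<..} z" "ys t < x \<Longrightarrow> F x - F (ys t) = G0 t x"
  proof (cases "t = 0")
    case True
    show ?thesis
    proof (rule that[of "\<lambda>z. lam * (x * z - z\<^sup>2 / 2)" "\<lambda>_. lam"])
      show "((\<lambda>z. lam * (x * z - z\<^sup>2 / 2)) has_real_derivative lam * (x - z)) (at z)" for z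
        by (auto intro!: derivative_eq_intros)
    qed (auto simp: True u_star_def y_star_def G0_0 power2_eq_square algebra_simps)
  next
    case False
    then have t: "0 < t" using t by simp
    show ?thesis
    \<comment> \<open>Integration by parts in disguise: differentiating, the two \<open>Gam'\<close>
      terms cancel. At \<open>z = x\<close> it equals \<open>G0 t x\<close>, and at the boundary it
      vanishes because \<open>k\<close> is a double zero of \<open>Gam\<close>.\<close>
    proof (rule that[of "\<lambda>z. t * Gam (z / sqrt t) + (x - z) * (sqrt t * Gam' (z / sqrt t))" "\<lambda>z. prof (z / sqrt t)"])
      show "((\<lambda>z. t * Gam (z / sqrt t) + (x - z) * (sqrt t * Gam' (z / sqrt t))) has_real_derivative
        prof (z / sqrt t) * (x - z)) (at z)" for z
        using t by (auto intro!: derivative_eq_intros DERIV_chain2[OF Gam_deriv] DERIV_chain2[OF Gam'_deriv] simp: field_simps)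
          (use t in \<open>simp add: mult.assoc[symmetric]\<close>)?
      show "isCont (\<lambda>z. prof (z / sqrt t)) z" for z
        unfolding prof_def using t by (intro continuous_intros isCont_o2[OF _ DERIV_isCont[OF Phi_deriv]]) auto
      show "u_star lam k t z = prof (z / sqrt t) * indicator {ys t<..} z" for z
        using t by (simp add: u_star_def prof_def)
      show "t * Gam (x / sqrt t) + (x - x) * (sqrt t * Gam' (x / sqrt t)) -
          (t * Gam (ys t / sqrt t) + (x - ys t) * (sqrt t * Gam' (ys t / sqrt t))) = G0 t x"
        using t by (simp add: G0_pos_time y_star_def Gam_k Gam'_k)
    qed
  qed
  have "(\<integral>z. max 0 (x - z) \<partial>Q_star lam k t) = (\<integral>z. u_star lam k t z * max 0 (x - z) \<partial>lborel)"
    unfolding Q_star_def using t u_star_nonneg by (simp add: integral_density)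
  also have "\<dots> = Gs t x"
  proof (cases "ys t < x")
    case False
    then have 0: "u_star lam k t z * max 0 (x - z) = 0" for z by (auto simp: Fw(3) indicator_def)
    show ?thesis unfolding 0 using False by (simp add: Gs_def)
  next
    case True
    have "(\<integral>z. u_star lam k t z * max 0 (x - z) \<partial>lborel) = (\<integral>z. (w z * (x - z)) * indicator {ys t..x} z \<partial>lborel)"
    proof (rule integral_cong_AE)
      show "AE z in lborel. u_star lam k t z * max 0 (x - z) = (w z * (x - z)) * indicator {ys t..x} z"
        using AE_lborel_singleton[of "ys t"] by eventually_elim (auto simp: Fw(3) indicator_def)
      have [measurable]: "w \<in> borel_measurable borel"
        using Fw(2) by (intro borel_measurable_continuous_onI) (simp add: continuous_on_eq_continuous_at)
      show "(\<lambda>z. (w z * (x - z)) * indicator {ys t..x} z) \<in> borel_measurable lborel" by simp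
    qed simp
    also have "\<dots> = F x - F (ys t)"
      using True Fw(1,2) by (intro integral_FTC_Icc_real) (auto intro!: continuous_intros)
    finally show ?thesis using Fw(4)[OF True] True by (simp add: Gs_def)
  qed
  finally show ?thesis .
qed

lemma Gs_bound:
  assumes "0 \<le> t" "t \<le> T + 1" shows "Gs t x \<le> m1 * (\<bar>x\<bar> + yb T)\<^sup>2 / 2"
proof -
  have "(max 0 (x - ys t))\<^sup>2 \<le> (\<bar>x\<bar> + yb T)\<^sup>2"
    using ys_le_yb[OF assms] by (intro power_mono) auto
  then have "m1 * (max 0 (x - ys t))\<^sup>2 / 2 \<le> m1 * (\<bar>x\<bar> + yb T)\<^sup>2 / 2" using m1_pos by simp
  then show ?thesis using Gs_upper[OF assms(1), of x] by linarith
qed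

text \<open>Uniform continuity of \<open>Gs\<close> on compact sets is transferred to the measures
  by \<open>close_test_functions\<close>; the free boundary requires no separate treatment.\<close>

lemma Q_star_C_paths: "Q_star lam k \<in> C_paths"
proof (rule C_pathsI[OF _ Q_star_M_star])
  show "Q_star lam k \<in> extensional {0..}" by (simp add: Q_star_def)
  fix t \<eta> :: real and N assume t: "0 \<le> t" and eta: "0 < \<eta>"
  have yb: "0 \<le> yb t" using ys_le_yb[of 0 t] t by (simp add: y_star_def)
  obtain \<epsilon> R' where e: "0 < \<epsilon>" "0 \<le> R'" and close:
    "\<And>\<mu> \<nu> f. \<mu> \<in> M_star \<Longrightarrow> \<nu> \<in> M_star \<Longrightarrow> (AE z in \<mu>. - yb t \<le> z) \<Longrightarrow> (AE z in \<nu>. - yb t \<le> z) \<Longrightarrow>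
      (\<integral>z. max 0 (real N + 2 - z) \<partial>\<nu>) \<le> m1 * (\<bar>real N + 2\<bar> + yb t)\<^sup>2 / 2 \<Longrightarrow>
      (\<And>x. \<bar>x\<bar> \<le> R' \<Longrightarrow> \<bar>(\<integral>z. max 0 (x - z) \<partial>\<mu>) - (\<integral>z. max 0 (x - z) \<partial>\<nu>)\<bar> \<le> \<epsilon>) \<Longrightarrow>
      f \<in> test_fun (real N) \<Longrightarrow> \<bar>(\<integral>z. f z \<partial>\<mu>) - (\<integral>z. f z \<partial>\<nu>)\<bar> \<le> \<eta>"
    by (rule close_test_functions[OF yb, of "real N" "m1 * (\<bar>real N + 2\<bar> + yb t)\<^sup>2 / 2" \<eta>])
      (use m1_pos eta in auto)
  let ?S = "{0..t+1} \<times> {-R'..R'}"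
  have "uniformly_continuous_on ?S (\<lambda>(t, x). Gs t x)"
    by (rule compact_uniformly_continuous[OF continuous_on_subset[OF continuous_on_Gs]])
      (auto intro: compact_Times)
  then obtain d where d: "0 < d" "\<And>p q. p \<in> ?S \<Longrightarrow> q \<in> ?S \<Longrightarrow> dist q p < d \<Longrightarrow>
      dist (case q of (t, x) \<Rightarrow> Gs t x) (case p of (t, x) \<Rightarrow> Gs t x) < \<epsilon>"
    unfolding uniformly_continuous_on_def using e(1) by metis
  show "\<exists>\<delta>>0. \<forall>s\<ge>0. \<bar>s - t\<bar> < \<delta> \<longrightarrow> (\<forall>f\<in>test_fun (real N).
      \<bar>(\<integral>x. f x \<partial>Q_star lam k t) - (\<integral>x. f x \<partial>Q_star lam k s)\<bar> \<le> \<eta>)"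
  proof (intro exI[of _ "min d 1"] conjI allI impI ballI)
    show "0 < min d 1" using d(1) by simp
    fix s f assume s: "0 \<le> s" "\<bar>s - t\<bar> < min d 1" and f: "f \<in> test_fun (real N)"
    have AE: "AE z in Q_star lam k s. - yb t \<le> z" if "0 \<le> s" "s \<le> t + 1" for s
      using AE_Q_star[OF that(1)] by eventually_elim (use ys_le_yb[OF that] in linarith)
    show "\<bar>(\<integral>x. f x \<partial>Q_star lam k t) - (\<integral>x. f x \<partial>Q_star lam k s)\<bar> \<le> \<eta>"
    proof (rule close[OF Q_star_M_star[OF t] Q_star_M_star[OF s(1)] AE AE _ _ f])
      show "(\<integral>z. max 0 (real N + 2 - z) \<partial>Q_star lam k s) \<le> m1 * (\<bar>real N + 2\<bar> + yb t)\<^sup>2 / 2"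
        unfolding integral_pos_Q_star[OF s(1)] using s by (intro Gs_bound) auto
      fix x assume x: "\<bar>x\<bar> \<le> R'"
      have "- R' \<le> x" "x \<le> R'" "s \<le> t + 1" "\<bar>t - s\<bar> < d" using x s(2) by linarith+
      then have "dist (Gs t x) (Gs s x) < \<epsilon>"
        using d(2)[of "(s, x)" "(t, x)"] s t by (auto simp: dist_Pair_Pair dist_real_def)
      then show "\<bar>(\<integral>z. max 0 (x - z) \<partial>Q_star lam k t) - (\<integral>z. max 0 (x - z) \<partial>Q_star lam k s)\<bar> \<le> \<epsilon>"
        unfolding integral_pos_Q_star[OF s(1)] integral_pos_Q_star[OF t] by (simp add: dist_real_def)
    qed (use s t in auto)
  qed
qed

end

section \<open>Convergence\<close>

lemma Q_scaled_point_measure: "0 \<le> t \<Longrightarrow> Q_scaled X b \<omega> t = point_measure_of b (\<lambda>i. X_scaled X b i t \<omega>)"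
  by (simp add: Q_scaled_def point_measure_of_def)

text \<open>On a bounded time interval one finite set of particles carries all integrals of test
  functions of a given radius. These integrals are finite sums of 1-Lipschitz functions of
  continuous paths, hence continuous uniformly in the test function.\<close>

lemma Q_scaled_C_paths:
  assumes b: "0 < b" and fin: "\<And>(n::nat) r. finite {i. \<exists>t\<in>{0..real n}. X i t \<omega> \<le> r}"
    and cont: "\<And>i. continuous_on {0..} (\<lambda>t. X i t \<omega>)"
  shows "Q_scaled X b \<omega> \<in> C_paths"
proof -
  have fin': "finite {i. \<exists>t\<in>{0..T}. X_scaled X b i t \<omega> \<le> r}" for T r
  proof -
    obtain n :: nat where n: "T / b\<^sup>2 \<le> real n" using real_arch_simple by blast
    show ?thesis
    proof (rule finite_subset[OF _ fin[of n "r / b"]], safe)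
      fix i t assume t: "t \<in> {0..T}" and le: "X_scaled X b i t \<omega> \<le> r"
      have "t / b\<^sup>2 \<le> T / b\<^sup>2" using t by (intro divide_right_mono) auto
      then have "t / b\<^sup>2 \<in> {0..real n}" using t n by auto
      moreover have "X i (t / b\<^sup>2) \<omega> \<le> r / b" using le b by (simp add: X_scaled_def field_simps)
      ultimately show "\<exists>t\<in>{0..real n}. X i t \<omega> \<le> r / b" by blast
    qed
  qed
  have contX: "continuous_on {0..} (\<lambda>t. X_scaled X b i t \<omega>)" for i
  proof -
    have "continuous_on {0..} (\<lambda>t. X i (t / b\<^sup>2) \<omega>)"
      by (rule continuous_on_compose2[OF cont]) (auto intro!: continuous_intros simp: b[THEN less_imp_neq, symmetric])
    then show ?thesis unfolding X_scaled_def by (intro continuous_intros)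
  qed
  have M: "Q_scaled X b \<omega> t \<in> M_star" if "0 \<le> t" for t
    unfolding Q_scaled_point_measure[OF that] point_measure_of_M_star[OF b]
    by (intro allI finite_subset[OF _ fin'[of t]]) (use that in auto)
  show ?thesis
  proof (rule C_pathsI[OF _ M])
    show "Q_scaled X b \<omega> \<in> extensional {0..}" by (simp add: Q_scaled_def)
    fix t \<eta> :: real and N assume t: "0 \<le> t" and eta: "0 < \<eta>"
    define A where "A = {i. \<exists>s\<in>{0..t+1}. X_scaled X b i s \<omega> \<le> real N}"
    have A: "finite A" unfolding A_def by (rule fin')
    let ?S = "\<lambda>s. \<Sum>i\<in>A. \<bar>X_scaled X b i t \<omega> - X_scaled X b i s \<omega>\<bar>"
    have "continuous_on {0..} ?S" by (intro continuous_intros contX)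
    then have "\<exists>d>0. \<forall>s\<in>{0..}. dist s t < d \<longrightarrow> dist (?S s) (?S t) < \<eta> / b"
      by (rule continuous_on_iff[THEN iffD1, rule_format]) (use t eta b in auto)
    then obtain d where d: "0 < d" "\<And>s. s \<in> {0..} \<Longrightarrow> dist s t < d \<Longrightarrow> dist (?S s) (?S t) < \<eta> / b" by blast
    show "\<exists>\<delta>>0. \<forall>s\<ge>0. \<bar>s - t\<bar> < \<delta> \<longrightarrow> (\<forall>f\<in>test_fun (real N).
        \<bar>(\<integral>x. f x \<partial>Q_scaled X b \<omega> t) - (\<integral>x. f x \<partial>Q_scaled X b \<omega> s)\<bar> \<le> \<eta>)"
    proof (intro exI[of _ "min d 1"] conjI allI impI ballI)
      show "0 < min d 1" using d(1) by simp
      fix s f assume s: "0 \<le> s" "\<bar>s - t\<bar> < min d 1" and f: "f \<in> test_fun (real N)"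
      have int: "(\<integral>x. f x \<partial>Q_scaled X b \<omega> u) = b * (\<Sum>i\<in>A. f (X_scaled X b i u \<omega>))" if "0 \<le> u" "u \<le> t + 1" for u
        unfolding Q_scaled_point_measure[OF that(1)]
      proof (rule integral_point_measure_of[OF _ test_fun_measurable[OF f] A])
        show "f (X_scaled X b i u \<omega>) = 0" if "i \<notin> A" for i
          using that \<open>0 \<le> u\<close> \<open>u \<le> t + 1\<close> by (intro test_fun_vanish[OF f]) (auto simp: A_def not_le)
      qed (use b in simp)
      have "\<bar>(\<integral>x. f x \<partial>Q_scaled X b \<omega> t) - (\<integral>x. f x \<partial>Q_scaled X b \<omega> s)\<bar>
        = b * \<bar>\<Sum>i\<in>A. f (X_scaled X b i t \<omega>) - f (X_scaled X b i s \<omega>)\<bar>"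
      proof -
        have eq: "(\<integral>x. f x \<partial>Q_scaled X b \<omega> t) - (\<integral>x. f x \<partial>Q_scaled X b \<omega> s)
          = b * (\<Sum>i\<in>A. f (X_scaled X b i t \<omega>) - f (X_scaled X b i s \<omega>))"
        proof -
          have "s \<le> t + 1" using s(2) by linarith
          from int[OF s(1) this] int[OF t] show ?thesis by (simp add: sum_subtractf right_diff_distrib)
        qed
        show ?thesis unfolding eq abs_mult using b by simp
      qed
      also have "\<dots> \<le> b * ?S s"
        using b by (intro mult_left_mono order_trans[OF sum_abs sum_mono] test_fun_lipschitz[OF f]) auto
      also have "\<dots> \<le> b * (\<eta> / b)"
        using d(2)[of s] s b by (intro mult_left_mono) (auto simp: dist_real_def)
      finally show "\<bar>(\<integral>x. f x \<partial>Q_scaled X b \<omega> t) - (\<integral>x. f x \<partial>Q_scaled X b \<omega> s)\<bar> \<le> \<eta>" using b by simp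
    qed
  qed
qed

text \<open>The metric on paths is arbitrary apart from its topology: its balls are open for uniform
  convergence on compacts, so they contain a uniform neighbourhood over some
  \<open>[0, T]\<close>.\<close>

lemma uc_open_ball:
  assumes "Metric_space C_paths dd" "Metric_space.mtopology C_paths dd = uc_topology" "q \<in> C_paths" "0 < e"
  obtains T e' where "0 < T" "0 < e'"
    "\<And>q'. q' \<in> C_paths \<Longrightarrow> (\<And>t. 0 \<le> t \<Longrightarrow> t \<le> T \<Longrightarrow> d_star (q t) (q' t) < e') \<Longrightarrow> dd q' q \<le> e"
proof -
  interpret C: Metric_space C_paths dd by (rule assms(1))
  have "uc_open (C.mball q e)"
    using C.openin_mball[of q e] unfolding assms(2) openin_uc_topology .
  moreover have "q \<in> C.mball q e" using assms(3,4) by simp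
  ultimately have "\<exists>K e'. compact K \<and> K \<subseteq> {0..} \<and> e' > 0 \<and>
        {q' \<in> C_paths. \<forall>t\<in>K. d_star (q t) (q' t) < e'} \<subseteq> C.mball q e"
    unfolding uc_open_def by blast
  then obtain K e' where K: "compact K" "K \<subseteq> {0..}" "0 < e'"
    "{q' \<in> C_paths. \<forall>t\<in>K. d_star (q t) (q' t) < e'} \<subseteq> C.mball q e"
    by blast
  obtain T where T: "\<And>t. t \<in> K \<Longrightarrow> \<bar>t\<bar> \<le> T" using compact_imp_bounded[OF K(1)] by (auto simp: bounded_real)
  show thesis
  proof (rule that[of "max 1 T" e'])
    fix q' assume q': "q' \<in> C_paths" "\<And>t. 0 \<le> t \<Longrightarrow> t \<le> max 1 T \<Longrightarrow> d_star (q t) (q' t) < e'"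
    have "d_star (q t) (q' t) < e'" if "t \<in> K" for t
      using T[OF that] K(2) that by (intro q'(2)) auto
    then have "q' \<in> C.mball q e" using K(4) q'(1) by blast
    then show "dd q' q \<le> e" by (simp add: C.commute)
  qed (use K in auto)
qed

text \<open>The deviation sets need not be measurable; measurable supersets of small mass suffice
  for the outer measure.\<close>

lemma tendsto_outer_measure_0:
  assumes "\<And>e. 0 < e \<Longrightarrow> eventually (\<lambda>b. \<exists>B\<in>sets M. emeasure M B \<le> ennreal e \<and> A b \<subseteq> B) F"
  shows "((\<lambda>b. outer_measure_of M (A b)) \<longlongrightarrow> 0) F"
proof (rule order_tendstoI)
  fix a :: ennreal assume "0 < a"
  then obtain y where y: "0 < y" "y < a" using dense by blast
  then have "y \<noteq> \<top>" by auto
  then obtain e where e: "0 \<le> e" "y = ennreal e" by (cases y) auto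
  then have "0 < e" using y(1) by simp
  from assms[OF this] show "eventually (\<lambda>b. outer_measure_of M (A b) < a) F"
  proof eventually_elim
    case (elim b)
    then obtain B where "B \<in> sets M" "emeasure M B \<le> ennreal e" "A b \<subseteq> B" by blast
    then have "outer_measure_of M (A b) \<le> ennreal e"
      using INF_lower[of B "{B \<in> sets M. A b \<subseteq> B}" "emeasure M"]
      unfolding outer_measure_of_def by (force intro: order_trans)
    then show ?case using y e by simp
  qed
qed simp

context atlas_ppp begin

lemma AE_Q_scaled_C_paths: "AE \<omega> in M. \<forall>b>0. Q_scaled X b \<omega> \<in> C_paths"
  using AE_locally_finite X_continuous
  by eventually_elim (intro allI impI Q_scaled_C_paths, auto)

text \<open>The tolerances are resolved from the outside in: a ball of paths contains a uniform
  \<open>d_star\<close> ball on \<open>[0, T]\<close>, which asks for test functions of radius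
  \<open>N\<close>, which ask for integrated counts on \<open>[- R, R]\<close>. The leader bound
  confines all measures to the right of \<open>- (yb T + 1)\<close>, as the tents require.\<close>

lemma Q_scaled_deviation:
  assumes st: "stefan lam k"
    and dd: "Metric_space C_paths dd" "Metric_space.mtopology C_paths dd = uc_topology"
    and a: "0 < a" and e: "0 < e"
  shows "eventually (\<lambda>b. \<exists>B\<in>sets M. emeasure M B \<le> ennreal e \<and>
    {\<omega> \<in> space M. Q_scaled X b \<omega> \<in> C_paths \<and> dd (Q_scaled X b \<omega>) (Q_star lam k) > a} \<subseteq> B) (at_right 0)"
proof -
  interpret st: stefan lam k by (rule st)
  obtain T e' where T: "0 < T" and e': "0 < e'" and ball: "\<And>q'. q' \<in> C_paths \<Longrightarrow>
      (\<And>t. 0 \<le> t \<Longrightarrow> t \<le> T \<Longrightarrow> d_star (Q_star lam k t) (q' t) < e') \<Longrightarrow> dd q' (Q_star lam k) \<le> a"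
    using uc_open_ball[OF dd st.Q_star_C_paths a] by metis
  obtain N where N: "(1/2) ^ N < e' / 2" using half_power_less[of "e' / 2"] e' by auto
  have yb: "0 \<le> st.yb T" using st.ys_le_yb[of 0 T] T by (simp add: y_star_def)
  let ?C = "st.m1 * (\<bar>real N + 2\<bar> + st.yb T)\<^sup>2 / 2"
  obtain \<epsilon> R where eps: "0 < \<epsilon>" "\<epsilon> \<le> 1" and R: "0 \<le> R" and close:
    "\<And>\<mu> \<nu> f. \<mu> \<in> M_star \<Longrightarrow> \<nu> \<in> M_star \<Longrightarrow> (AE z in \<mu>. - (st.yb T + 1) \<le> z) \<Longrightarrow> (AE z in \<nu>. - (st.yb T + 1) \<le> z) \<Longrightarrow>
      (\<integral>z. max 0 (real N + 2 - z) \<partial>\<nu>) \<le> ?C \<Longrightarrow>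
      (\<And>x. \<bar>x\<bar> \<le> R \<Longrightarrow> \<bar>(\<integral>z. max 0 (x - z) \<partial>\<mu>) - (\<integral>z. max 0 (x - z) \<partial>\<nu>)\<bar> \<le> \<epsilon>) \<Longrightarrow>
      f \<in> test_fun (real N) \<Longrightarrow> \<bar>(\<integral>z. f z \<partial>\<mu>) - (\<integral>z. f z \<partial>\<nu>)\<bar> \<le> e' / 2"
    by (rule close_test_functions[of "st.yb T + 1" "real N" ?C "e' / 2"])
      (use st.m1_pos e' yb in auto)
  have "eventually (\<lambda>b. 0 < b \<and> (\<exists>B\<in>sets M. emeasure M B \<le> ennreal e \<and> (\<forall>\<omega>\<in>space M - B.
      (\<forall>i t. 0 \<le> t \<longrightarrow> t \<le> T \<longrightarrow> y_star k t - \<epsilon> \<le> X_scaled X b i t \<omega>) \<and>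
      (\<forall>t. 0 \<le> t \<longrightarrow> t \<le> T \<longrightarrow> (\<exists>i. X_scaled X b i t \<omega> \<le> y_star k t + \<epsilon>)) \<and>
      (\<forall>t x. 0 \<le> t \<longrightarrow> t \<le> T \<longrightarrow> \<bar>x\<bar> \<le> R \<longrightarrow>
        \<bar>(\<Sum>i. b * max 0 (x - X_scaled X b i t \<omega>)) - stefan.Gs lam k t x\<bar> \<le> \<epsilon>)))) (at_right 0)"
    by (rule high_probability[OF st T eps R e])
  then show ?thesis
  proof eventually_elim
    case (elim b)
    then obtain B where b: "0 < b" and B: "B \<in> sets M" "emeasure M B \<le> ennreal e" and
      lo: "\<And>\<omega> i t. \<omega> \<in> space M - B \<Longrightarrow> 0 \<le> t \<Longrightarrow> t \<le> T \<Longrightarrow> y_star k t - \<epsilon> \<le> X_scaled X b i t \<omega>" and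
      G: "\<And>\<omega> t x. \<omega> \<in> space M - B \<Longrightarrow> 0 \<le> t \<Longrightarrow> t \<le> T \<Longrightarrow> \<bar>x\<bar> \<le> R \<Longrightarrow>
        \<bar>(\<Sum>i. b * max 0 (x - X_scaled X b i t \<omega>)) - st.Gs t x\<bar> \<le> \<epsilon>"
      by metis
    show ?case
    proof (intro bexI[OF _ B(1)] conjI B(2) subsetI)
      fix \<omega> assume "\<omega> \<in> {\<omega> \<in> space M. Q_scaled X b \<omega> \<in> C_paths \<and> dd (Q_scaled X b \<omega>) (Q_star lam k) > a}"
      then have \<omega>: "\<omega> \<in> space M" and Q: "Q_scaled X b \<omega> \<in> C_paths" and far: "dd (Q_scaled X b \<omega>) (Q_star lam k) > a" by auto
      show "\<omega> \<in> B"
      proof (rule ccontr)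
        assume "\<omega> \<notin> B"
        then have \<omega>': "\<omega> \<in> space M - B" using \<omega> by simp
        have "dd (Q_scaled X b \<omega>) (Q_star lam k) \<le> a"
        proof (rule ball[OF Q])
          fix t assume t: "0 \<le> t" "t \<le> T"
          let ?x = "\<lambda>i. X_scaled X b i t \<omega>"
          have Qt: "Q_scaled X b \<omega> t = point_measure_of b ?x" by (rule Q_scaled_point_measure[OF t(1)])
          have M: "point_measure_of b ?x \<in> M_star" using C_paths_M_star[OF Q t(1)] unfolding Qt .
          have fin: "finite {i. ?x i \<le> r}" for r using M point_measure_of_M_star[OF b, of ?x] by blast
          have yt: "\<bar>st.ys t\<bar> \<le> st.yb T" using st.ys_le_yb[OF t(1)] t(2) by simp
          have "d_star (point_measure_of b ?x) (Q_star lam k t) \<le> e' / 2 + (1/2) ^ N"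
          proof (rule d_star_le[OF M st.Q_star_M_star[OF t(1)]])
            fix f assume f: "f \<in> test_fun (real N)"
            show "\<bar>(\<integral>x. f x \<partial>point_measure_of b ?x) - (\<integral>x. f x \<partial>Q_star lam k t)\<bar> \<le> e' / 2"
            proof (rule close[OF M st.Q_star_M_star[OF t(1)] _ _ _ _ f])
              have "- (st.yb T + 1) \<le> ?x i" for i using lo[OF \<omega>' t, of i] yt eps(2) by linarith
              then show "AE z in point_measure_of b ?x. - (st.yb T + 1) \<le> z" by (rule AE_ge_point_measure_of)
              show "AE z in Q_star lam k t. - (st.yb T + 1) \<le> z"
                using st.AE_Q_star[OF t(1)] by eventually_elim (use yt in linarith)
              show "(\<integral>z. max 0 (real N + 2 - z) \<partial>Q_star lam k t) \<le> ?C"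
                unfolding st.integral_pos_Q_star[OF t(1)] using t by (intro st.Gs_bound) auto
              fix x assume "\<bar>x\<bar> \<le> R"
              from G[OF \<omega>' t this]
              show "\<bar>(\<integral>z. max 0 (x - z) \<partial>point_measure_of b ?x) - (\<integral>z. max 0 (x - z) \<partial>Q_star lam k t)\<bar> \<le> \<epsilon>"
                using integral_pos_point_measure_of[OF less_imp_le[OF b] fin[of x]]
                by (simp only: st.integral_pos_Q_star[OF t(1)])
            qed
          qed (use e' in simp)
          also have "\<dots> < e'" using N by simp
          finally show "d_star (Q_star lam k t) (Q_scaled X b \<omega> t) < e'"
            unfolding Qt by (simp only: Metric_space.commute[OF Metric_space_d_star])
        qed
        then show False using far by simp
      qed
    qed
  qed
qed

lemma Y_scaled_deviation:
  assumes st: "stefan lam k" and K: "compact K" "K \<subseteq> {0..}" and a: "0 < a" and e: "0 < e"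
  shows "eventually (\<lambda>b. \<exists>B\<in>sets M. emeasure M B \<le> ennreal e \<and>
    {\<omega> \<in> space M. \<exists>t\<in>K. \<bar>Y_scaled X b t \<omega> - y_star k t\<bar> > a} \<subseteq> B) (at_right 0)"
proof -
  obtain T' where T': "\<And>t. t \<in> K \<Longrightarrow> \<bar>t\<bar> \<le> T'" using compact_imp_bounded[OF K(1)] by (auto simp: bounded_real)
  define T where "T = max 1 T'"
  define \<epsilon> where "\<epsilon> = min 1 a"
  have T: "0 < T" by (simp add: T_def)
  have eps: "0 < \<epsilon>" "\<epsilon> \<le> 1" "\<epsilon> \<le> a" using a by (auto simp: \<epsilon>_def)
  have "eventually (\<lambda>b. 0 < b \<and> (\<exists>B\<in>sets M. emeasure M B \<le> ennreal e \<and> (\<forall>\<omega>\<in>space M - B.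
      (\<forall>i t. 0 \<le> t \<longrightarrow> t \<le> T \<longrightarrow> y_star k t - \<epsilon> \<le> X_scaled X b i t \<omega>) \<and>
      (\<forall>t. 0 \<le> t \<longrightarrow> t \<le> T \<longrightarrow> (\<exists>i. X_scaled X b i t \<omega> \<le> y_star k t + \<epsilon>)) \<and>
      (\<forall>t x. 0 \<le> t \<longrightarrow> t \<le> T \<longrightarrow> \<bar>x\<bar> \<le> 0 \<longrightarrow>
        \<bar>(\<Sum>i. b * max 0 (x - X_scaled X b i t \<omega>)) - stefan.Gs lam k t x\<bar> \<le> \<epsilon>)))) (at_right 0)"
    by (rule high_probability[OF st T eps(1,2) _ e]) simp
  then show ?thesis
  proof eventually_elim
    case (elim b)
    then obtain B where b: "0 < b" and B: "B \<in> sets M" "emeasure M B \<le> ennreal e" and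
      lo: "\<And>\<omega> i t. \<omega> \<in> space M - B \<Longrightarrow> 0 \<le> t \<Longrightarrow> t \<le> T \<Longrightarrow> y_star k t - \<epsilon> \<le> X_scaled X b i t \<omega>" and
      up: "\<And>\<omega> t. \<omega> \<in> space M - B \<Longrightarrow> 0 \<le> t \<Longrightarrow> t \<le> T \<Longrightarrow> \<exists>i. X_scaled X b i t \<omega> \<le> y_star k t + \<epsilon>"
      by metis
    have "\<bar>Y_scaled X b t \<omega> - y_star k t\<bar> \<le> a" if \<omega>: "\<omega> \<in> space M - B" and "t \<in> K" for \<omega> t
    proof -
      have t: "0 \<le> t" "t \<le> T" using T'[OF \<open>t \<in> K\<close>] K(2) \<open>t \<in> K\<close> by (auto simp: T_def)
      \<comment> \<open>The lower bound on all particles also supplies the boundedness below that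
        the real infimum needs.\<close>
      have "y_star k t - \<epsilon> \<le> Y_scaled X b t \<omega>"
        unfolding Y_scaled_def by (rule cINF_greatest) (auto intro: lo[OF \<omega> t])
      moreover obtain i where i: "X_scaled X b i t \<omega> \<le> y_star k t + \<epsilon>" using up[OF \<omega> t] by blast
      have "Y_scaled X b t \<omega> \<le> X_scaled X b i t \<omega>"
        unfolding Y_scaled_def by (rule cINF_lower[OF bdd_belowI2]) (auto intro: lo[OF \<omega> t])
      ultimately show ?thesis using i eps(3) by linarith
    qed
    then show ?case by (intro bexI[OF _ B(1)] conjI B(2)) (force simp: not_less[symmetric])
  qed
qed

end

theorem theorem1p2:
  fixes M :: "'a measure"
    and F :: "real \<Rightarrow> 'a measure"
    and W X :: "nat \<Rightarrow> real \<Rightarrow> 'a \<Rightarrow> real"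
    and lam :: real
  assumes "lam > 0"
    and "atlas_infinity M F W X"
    and "PPP_plus M lam (\<lambda>i. X i 0)"
  shows "(\<exists>!\<kappa>. g_fun \<kappa> = 1 - lam / 2) \<and>
    (\<forall>\<kappa>. g_fun \<kappa> = 1 - lam / 2 \<longrightarrow>
       (\<forall>dd. Metric_space C_paths dd \<and> Metric_space.mtopology C_paths dd = uc_topology \<longrightarrow>
          tends_in_probability M C_paths dd (Q_scaled X) (Q_star lam \<kappa>)) \<and>
       (\<forall>K e. compact K \<and> K \<subseteq> {0..} \<and> e > 0 \<longrightarrow>
          ((\<lambda>b. outer_measure_of M
              {\<omega> \<in> space M. \<exists>t\<in>K. \<bar>Y_scaled X b t \<omega> - y_star \<kappa> t\<bar> > e}) \<longlongrightarrow> 0) (at_right 0)))"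
proof (intro conjI allI impI)
  interpret atlas_ppp M F W X lam
    using assms by (simp add: atlas_ppp_def atlas_ppp_axioms_def)
  show "\<exists>!\<kappa>. g_fun \<kappa> = 1 - lam / 2" by (rule ex1_kappa[OF assms(1)])
  fix \<kappa> assume "g_fun \<kappa> = 1 - lam / 2"
  then have st: "stefan lam \<kappa>" using assms(1) by unfold_locales
  show "tends_in_probability M C_paths dd (Q_scaled X) (Q_star lam \<kappa>)"
    if "Metric_space C_paths dd \<and> Metric_space.mtopology C_paths dd = uc_topology" for dd
    unfolding tends_in_probability_def
  proof (intro conjI allI impI)
    show "Q_star lam \<kappa> \<in> C_paths" by (rule stefan.Q_star_C_paths[OF st])
    show "AE \<omega> in M. Q_scaled X b \<omega> \<in> C_paths" if "0 < b" for b
      using AE_Q_scaled_C_paths by eventually_elim (use that in blast)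
    show "((\<lambda>b. outer_measure_of M {\<omega> \<in> space M. Q_scaled X b \<omega> \<in> C_paths \<and> a < dd (Q_scaled X b \<omega>) (Q_star lam \<kappa>)})
        \<longlongrightarrow> 0) (at_right 0)" if "0 < a" for a
      using \<open>Metric_space C_paths dd \<and> _\<close> that by (intro tendsto_outer_measure_0 Q_scaled_deviation[OF st]) auto
  qed
  show "((\<lambda>b. outer_measure_of M {\<omega> \<in> space M. \<exists>t\<in>K. \<bar>Y_scaled X b t \<omega> - y_star \<kappa> t\<bar> > e}) \<longlongrightarrow> 0) (at_right 0)"
    if "compact K \<and> K \<subseteq> {0..} \<and> e > 0" for K e
    using that by (intro tendsto_outer_measure_0 Y_scaled_deviation[OF st]) auto
qed

end
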